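(* The following hold. (a) $\mathcal{P}\subset\{\text{inner functions satisfying the SIP}\}\subset\mathcal{M}$. (b) Let $\Theta$ be an inner function satisfying the Weak Embedding Property (WEP). Then $\Theta\in\mathcal{M}$ if and only if $\Theta$ satisfies the SIP. (c) The class $\mathcal{P}$ consists of the Carleson--Newman Blaschke products satisfying the SIP, i.e. $\mathcal{P}$ equals the set of Carleson--Newman Blaschke products that satisfy the SIP.
   Context: $\mathbb{D}$ is the open unit disc; $H^\infty$ is the algebra of bounded analytic functions on $\mathbb{D}$ with the sup norm $\|\cdot\|_\infty$. $\Theta\in H^\infty$ is inner if it has radial limits of modulus $1$ at almost every point of $\partial\mathbb{D}$. $\mathcal{Z}(\Theta)$ is the zero set of $\Theta$ in $\mathbb{D}$; $H^\infty/\Theta H^\infty$ has the norm $\|[f]\|=\inf\{\|f+g\Theta\|_\infty:g\in H^\infty\}$. Infima over the empty set are $+\infty$. SIP (Sharp Invertibility Property): for every $\varepsilon>0$ there exists $\delta>0$ such that for every $f\in H^\infty$, the conditions $\|[f]\|\le1$ and $\inf_{\mathcal{Z}(\Theta)}|f|\ge1-\delta$ imply that $[f]$ is invertible in $H^\infty/\Theta H^\infty$ and $\|[f]^{-1}\|\le1+\varepsilon$. WEP (Weak Embedding Property): for every $f\in H^\infty$, $\inf_{\mathcal{Z}(\Theta)}|f|>0$ implies that $[f]$ is invertible in $H^\infty/\Theta H^\infty$. (A known theorem of Gorkin, Mortini and Nikolski: WEP holds iff $\inf\{|\Theta(z)|:\rho(z,\mathcal{Z}(\Theta))\ge t\}>0$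 for every $t\in(0,1)$, where $\rho(z,w)=|z-w|/|1-\bar wz|$.) A Blaschke product with zeros $\{a_j\}$ (listed with multiplicity) is Carleson--Newman, written $\in(CN)$, if $\mu=\sum_j(1-|a_j|)\delta_{a_j}$ is a Carleson measure, i.e. there is $C>0$ with $\mu(Q(I))\le C|I|$ for every arc $I\subset\partial\mathbb{D}$, where $Q(I)=\{z\in\mathbb{D}: z/|z|\in I,\ 1-|z|\le|I|\}$. For $a\in\mathbb{D}$, $\varphi_a(w)=\frac{a-w}{1-\bar a w}$. $\mathcal{M}$ is the set of inner functions $\Theta$ with $\varphi_a\circ\Theta\in(CN)$ for every $a\in\mathbb{D}\setminus\{0\}$, and $\mathcal{P}=(CN)\cap\mathcal{M}$. Blaschke products are understood up to unimodular constants. *)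

theory Defs
  imports "HOL-Analysis.Analysis"
begin

text \<open>
  Functions on the open unit disc are represented by total functions \<^typ>\<open>complex \<Rightarrow> complex\<close>;
  every notion below depends only on their values on \<^term>\<open>ball (0::complex) 1\<close>.
\<close>

definition Hinf :: "(complex \<Rightarrow> complex) set" where
  "Hinf = {f. f holomorphic_on ball 0 1 \<and> bounded (f ` ball 0 1)}"

definition sup_norm :: "(complex \<Rightarrow> complex) \<Rightarrow> real" where
  "sup_norm f = (SUP z\<in>ball 0 1. cmod (f z))"

definition inner_function :: "(complex \<Rightarrow> complex) \<Rightarrow> bool" where
  "inner_function \<Theta> \<longleftrightarrow> \<Theta> \<in> Hinf \<and>
     (AE t in lebesgue_on {0..2 * pi}.
        \<exists>L. cmod L = 1 \<and> ((\<lambda>r. \<Theta> (complex_of_real r * cis t)) \<longlongrightarrow> L) (at_left 1))"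

definition zero_set :: "(complex \<Rightarrow> complex) \<Rightarrow> complex set" where
  "zero_set \<Theta> = {z \<in> ball 0 1. \<Theta> z = 0}"

text \<open>
  Elements of the quotient of \<^term>\<open>Hinf\<close> by the ideal generated by \<open>\<Theta>\<close> are handled
  through representatives: \<open>quot_eq \<Theta> f g\<close> says \<open>[f] = [g]\<close>, and \<open>quot_inverse \<Theta> f g\<close> says
  \<open>[f] [g] = [1]\<close>, i.e. \<open>[g]\<close> is the (necessarily unique) inverse of \<open>[f]\<close>.
\<close>

definition quot_eq :: "(complex \<Rightarrow> complex) \<Rightarrow> (complex \<Rightarrow> complex) \<Rightarrow> (complex \<Rightarrow> complex) \<Rightarrow> bool" where
  "quot_eq \<Theta> f g \<longleftrightarrow> (\<exists>h\<in>Hinf. \<forall>z\<in>ball 0 1. f z - g z = h z * \<Theta> z)"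

definition quot_norm :: "(complex \<Rightarrow> complex) \<Rightarrow> (complex \<Rightarrow> complex) \<Rightarrow> real" where
  "quot_norm \<Theta> f = (INF g\<in>Hinf. sup_norm (\<lambda>z. f z + g z * \<Theta> z))"

definition quot_inverse :: "(complex \<Rightarrow> complex) \<Rightarrow> (complex \<Rightarrow> complex) \<Rightarrow> (complex \<Rightarrow> complex) \<Rightarrow> bool" where
  "quot_inverse \<Theta> f g \<longleftrightarrow> g \<in> Hinf \<and> quot_eq \<Theta> (\<lambda>z. f z * g z) (\<lambda>z. 1)"

text \<open>The infima are taken in \<^typ>\<open>ereal\<close>, so that the infimum over an empty zero set is \<open>\<infinity>\<close>.\<close>

definition SIP :: "(complex \<Rightarrow> complex) \<Rightarrow> bool" where
  "SIP \<Theta> \<longleftrightarrow> (\<forall>\<epsilon>>0. \<exists>\<delta>>0. \<forall>f\<in>Hinf.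
     quot_norm \<Theta> f \<le> 1 \<longrightarrow> (INF z\<in>zero_set \<Theta>. ereal (cmod (f z))) \<ge> ereal (1 - \<delta>) \<longrightarrow>
     (\<exists>g. quot_inverse \<Theta> f g \<and> quot_norm \<Theta> g \<le> 1 + \<epsilon>))"

definition WEP :: "(complex \<Rightarrow> complex) \<Rightarrow> bool" where
  "WEP \<Theta> \<longleftrightarrow> (\<forall>f\<in>Hinf.
     (INF z\<in>zero_set \<Theta>. ereal (cmod (f z))) > 0 \<longrightarrow> (\<exists>g. quot_inverse \<Theta> f g))"

definition disc_aut :: "complex \<Rightarrow> complex \<Rightarrow> complex" where
  "disc_aut a w = (a - w) / (1 - cnj a * w)"

definition blaschke_factor :: "complex \<Rightarrow> complex \<Rightarrow> complex" where
  "blaschke_factor a z = (if a = 0 then z else complex_of_real (cmod a) / a * disc_aut a z)"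

text \<open>
  A Blaschke sequence is a family \<open>a\<close> indexed by an arbitrary (possibly finite or empty) set
  \<open>J\<close> of naturals; a zero of multiplicity \<open>m\<close> is the value of \<open>a\<close> at \<open>m\<close> indices.
\<close>

definition blaschke_sequence :: "nat set \<Rightarrow> (nat \<Rightarrow> complex) \<Rightarrow> bool" where
  "blaschke_sequence J a \<longleftrightarrow> a ` J \<subseteq> ball 0 1 \<and> (\<lambda>j. 1 - cmod (a j)) summable_on J"

text \<open>The constant \<open>c\<close> reflects that Blaschke products are taken up to unimodular constants.\<close>

definition blaschke_product :: "nat set \<Rightarrow> (nat \<Rightarrow> complex) \<Rightarrow> (complex \<Rightarrow> complex) \<Rightarrow> bool" where
  "blaschke_product J a B \<longleftrightarrow> blaschke_sequence J a \<and>
     (\<exists>c. cmod c = 1 \<and> (\<forall>z\<in>ball 0 1. \<exists>p.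
        (\<lambda>j. if j \<in> J then blaschke_factor (a j) z else 1) has_prod p \<and> B z = c * p))"

text \<open>
  The set \<open>Q(I)\<close> for the closed arc \<open>I\<close> of length \<open>\<beta> - \<alpha>\<close> from \<^term>\<open>cis \<alpha>\<close> to \<^term>\<open>cis \<beta>\<close>.
  An arc without some of its endpoints has the same length and a smaller \<open>Q(I)\<close>, so in the
  Carleson condition closed arcs suffice.
\<close>

definition carleson_box :: "real \<Rightarrow> real \<Rightarrow> complex set" where
  "carleson_box \<alpha> \<beta> =
     {z \<in> ball 0 1. z / complex_of_real (cmod z) \<in> cis ` {\<alpha>..\<beta>} \<and> 1 - cmod z \<le> \<beta> - \<alpha>}"

definition carleson_measure :: "complex measure \<Rightarrow> bool" where
  "carleson_measure \<mu> \<longleftrightarrow> (\<exists>C>0. \<forall>\<alpha> \<beta>. \<alpha> < \<beta> \<and> \<beta> \<le> \<alpha> + 2 * pi \<longrightarrow>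
     emeasure \<mu> (carleson_box \<alpha> \<beta>) \<le> ennreal (C * (\<beta> - \<alpha>)))"

text \<open>The sum over \<open>j \<in> J\<close> of the point masses \<open>1 - \<bar>a j\<bar>\<close> at \<open>a j\<close>.\<close>

definition zeros_measure :: "nat set \<Rightarrow> (nat \<Rightarrow> complex) \<Rightarrow> complex measure" where
  "zeros_measure J a = distr (density (count_space J) (\<lambda>j. ennreal (1 - cmod (a j)))) borel a"

lemma emeasure_zeros_measure:
  assumes "A \<in> sets borel"
  shows "emeasure (zeros_measure J a) A =
           (\<integral>\<^sup>+ j. ennreal (1 - cmod (a j)) \<partial>count_space {j \<in> J. a j \<in> A})"
proof -
  let ?w = "\<lambda>j. ennreal (1 - cmod (a j))" and ?K = "{j \<in> J. a j \<in> A}"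
  have "emeasure (zeros_measure J a) A = emeasure (density (count_space J) ?w) ?K"
    unfolding zeros_measure_def using assms
    by (subst emeasure_distr) (auto intro!: arg_cong2[where f = emeasure])
  also have "\<dots> = (\<integral>\<^sup>+ j. ?w j * indicator ?K j \<partial>count_space J)"
    by (subst emeasure_density) auto
  also have "\<dots> = (\<integral>\<^sup>+ j. ?w j * indicator ?K j * indicator J j \<partial>count_space UNIV)"
    by (rule nn_integral_count_space_indicator) simp
  also have "\<dots> = (\<integral>\<^sup>+ j. ?w j * indicator ?K j \<partial>count_space UNIV)"
    by (rule nn_integral_cong) (simp split: split_indicator)
  also have "\<dots> = (\<integral>\<^sup>+ j. ?w j \<partial>count_space ?K)"
    by (rule nn_integral_count_space_indicator[symmetric]) simp
  finally show ?thesis .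
qed

lemma carleson_box_borel: "carleson_box \<alpha> \<beta> \<in> sets borel"
proof -
  have "compact (cis ` {\<alpha>..\<beta>})"
    by (intro compact_continuous_image continuous_intros) auto
  then have [measurable]: "cis ` {\<alpha>..\<beta>} \<in> sets borel"
    by (simp add: borel_closed compact_imp_closed)
  show ?thesis
    unfolding carleson_box_def by measurable
qed

definition CN :: "(complex \<Rightarrow> complex) set" where
  "CN = {B. \<exists>J a. blaschke_product J a B \<and> carleson_measure (zeros_measure J a)}"

definition class_M :: "(complex \<Rightarrow> complex) set" where
  "class_M = {\<Theta>. inner_function \<Theta> \<and> (\<forall>a\<in>ball 0 1 - {0}. disc_aut a \<circ> \<Theta> \<in> CN)}"

definition class_P :: "(complex \<Rightarrow> complex) set" where
  "class_P = CN \<inter> class_M"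

end

theory Submission
  imports Defs "HOL-Complex_Analysis.Complex_Analysis" "HOL-Real_Asymp.Real_Asymp"
begin

text \<open>
  All three inclusions pass through one condition on an inner function \<open>\<Theta>\<close>: \<open>\<bar>\<Theta>\<bar>\<close> is uniformly close
  to 1 at points pseudohyperbolically far from the zeros of \<open>\<Theta>\<close>.

  SIP implies the condition: apply SIP to a disc automorphism vanishing at such a point \<open>z\<close>; its
  inverse modulo \<open>\<Theta>\<close> has norm at least \<open>1 / \<bar>\<Theta> z\<bar>\<close>. The condition implies \<open>\<Theta> \<in> \<M>\<close>: every disc of a
  fixed hyperbolic radius contains a point where \<open>\<phi>\<^sub>a \<circ> \<Theta>\<close> is bounded below, and an inner function with
  this property is a Carleson--Newman Blaschke product.

  Conversely, let \<open>\<Theta> \<in> \<M>\<close> be bounded below far from its zeros, as is the case under WEP and in \<open>CN\<close>. If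
  the infimum \<open>m\<close> of \<open>\<bar>\<Theta>\<bar>\<close> far from the zeros stayed in \<open>(0, 1)\<close>, Harnack's inequality would make \<open>\<Theta>\<close>
  almost equal to a constant \<open>a\<close> with \<open>\<bar>a\<bar> = m\<close> on large discs, so that \<open>\<phi>\<^sub>a \<circ> \<Theta>\<close> could not be in \<open>CN\<close>.
  Hence the condition holds, and under it the hypothesis of SIP says that \<open>max \<bar>f\<bar> \<bar>\<Theta>\<bar>\<close> is close to 1 on
  the disc. A Bezout equation \<open>f G = 1 + h \<Theta>\<close> with \<open>G\<close> of norm close to 1 then follows by approximating
  \<open>f\<close> and \<open>\<Theta>\<close> by finite Blaschke products and solving a Nevanlinna--Pick problem. Its Pick matrix is
  estimated by Green's formula with a logarithmic weight, which shows that the model spaces of two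
  inner functions are almost orthogonal when at each point one of them is close to 1 in modulus.
\<close>

text \<open>The logarithmic weight of an inner \<open>b\<close> is
  \<open>- ln (1 - r^2 * |b|^2)\<close> with \<open>r < 1\<close>. It ranges from 0 to
  \<open>L = - ln (1 - r^2)\<close> and is at least \<open>L - 1\<close> where |b| \<ge> r. For
  general x, its Green integral against |x'|^2 is only bounded by L times the squared norm; for x in
  the model space of \<open>b\<close> it is O(sqrt L) times that norm. So such an x has little
  energy where |b| is near 1, and the relative error O(1 / sqrt L) becomes small as r tends to 1.
  The Pick matrix for the values s / f, with s = 1 / (1 + \<epsilon>), at the zeros of a finite
  Blaschke product T is congruent to (1 - s^2) times the Gram matrix of the Szego kernels minus the
  Gram matrix of their projections to the model space of f. The kernels lie in the model space of T,
  so near orthogonality yields positivity. All bounds depend on \<epsilon> only and survive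
  normal-family limits. As \<Theta> may have a singular factor, membership in \<M> is used a second
  time: \<Theta> is replaced by the Blaschke products \<phi>_a o \<Theta> with small a \<noteq> 0.
  Finally, radial limits are not part of the definition of a Blaschke product, and their existence
  is proved by a maximal estimate.\<close>

section \<open>The pseudohyperbolic distance\<close>

text \<open>One minus the squared pseudohyperbolic distance (\<open>cmod_disc_aut_sq\<close>). It is
  carried through in place of the distance because sums of it over the zeros express the Carleson
  condition in conformally invariant form.\<close>

definition prox :: "complex \<Rightarrow> complex \<Rightarrow> real" where
  "prox z w = (1 - (cmod z)\<^sup>2) * (1 - (cmod w)\<^sup>2) / (cmod (1 - cnj z * w))\<^sup>2"

lemma one_minus_cnj_mult_nonzero:
  assumes "cmod z < 1" "cmod w \<le> 1"
  shows "1 - cnj z * w \<noteq> 0"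
proof
  assume "1 - cnj z * w = 0"
  then have "cmod z * cmod w = 1"
    by (metis complex_mod_cnj eq_iff_diff_eq_0 norm_mult norm_one)
  moreover have "cmod z * cmod w \<le> cmod z * 1"
    using assms by (intro mult_left_mono) auto
  ultimately show False using assms by simp
qed

lemma cmod_one_minus_cnj_mult_ge:
  assumes "cmod w \<le> 1"
  shows "cmod (1 - cnj z * w) \<ge> 1 - cmod z"
proof -
  have "cmod (1 - cnj z * w) \<ge> 1 - cmod z * cmod w"
    using norm_triangle_ineq2[of 1 "cnj z * w"] by (simp add: norm_mult)
  moreover have "cmod z * cmod w \<le> cmod z * 1"
    using assms by (intro mult_left_mono) auto
  ultimately show ?thesis by simp
qed

lemma cmod_one_minus_cnj_identity:
  "(cmod (1 - cnj z * w))\<^sup>2 - (cmod (z - w))\<^sup>2 = (1 - (cmod z)\<^sup>2) * (1 - (cmod w)\<^sup>2)"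
  unfolding cmod_power2 by (simp add: algebra_simps power2_eq_square)

lemma cmod_disc_aut_sq:
  assumes "1 - cnj z * w \<noteq> 0"
  shows "(cmod (disc_aut z w))\<^sup>2 = 1 - prox z w"
proof -
  have "(cmod (1 - cnj z * w))\<^sup>2 \<noteq> 0" using assms by simp
  moreover have "(cmod (z - w))\<^sup>2 = (cmod (1 - cnj z * w))\<^sup>2 - (1 - (cmod z)\<^sup>2) * (1 - (cmod w)\<^sup>2)"
    using cmod_one_minus_cnj_identity[of z w] by linarith
  ultimately show ?thesis
    unfolding disc_aut_def prox_def norm_divide power_divide by (simp add: diff_divide_distrib)
qed

lemma prox_pos:
  assumes "cmod z < 1" "cmod w < 1" shows "prox z w > 0"
  using assms one_minus_cnj_mult_nonzero[of z w]
  unfolding prox_def by (auto intro!: divide_pos_pos mult_pos_pos simp: power_less_one_iff abs_square_less_1)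

lemma cmod_one_minus_cnj_commute: "cmod (1 - cnj z * w) = cmod (1 - cnj w * z)"
proof -
  have "cmod (1 - cnj z * w) = cmod (cnj (1 - cnj z * w))" by (simp only: complex_mod_cnj)
  then show ?thesis by (simp add: mult.commute)
qed

lemma prox_commute: "prox z w = prox w z"
  unfolding prox_def using cmod_one_minus_cnj_commute[of z w] by (simp add: mult.commute)

lemma cmod_disc_aut_commute: "cmod (disc_aut z w) = cmod (disc_aut w z)"
  unfolding disc_aut_def norm_divide using cmod_one_minus_cnj_commute[of z w]
  by (simp add: norm_minus_commute)

lemma disc_aut_0_right [simp]: "disc_aut a 0 = a" and disc_aut_0_left [simp]: "disc_aut 0 z = - z"
  and disc_aut_self [simp]: "disc_aut a a = 0"
  by (auto simp: disc_aut_def)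

lemma cmod_disc_aut_less_1:
  assumes "cmod a < 1" "cmod z < 1" shows "cmod (disc_aut a z) < 1"
proof -
  have "(cmod (disc_aut a z))\<^sup>2 < 1"
    using cmod_disc_aut_sq[OF one_minus_cnj_mult_nonzero[of a z]] prox_pos[OF assms] assms by simp
  then show ?thesis by (simp add: abs_square_less_1)
qed

lemma cmod_disc_aut_eq_1:
  assumes "cmod a < 1" "cmod z = 1" shows "cmod (disc_aut a z) = 1"
proof -
  have "(cmod (disc_aut a z))\<^sup>2 = 1\<^sup>2"
    using cmod_disc_aut_sq[OF one_minus_cnj_mult_nonzero[of a z]] assms by (simp add: prox_def)
  then show ?thesis by (metis norm_ge_zero one_power2 power2_eq_iff_nonneg zero_le_one)
qed

lemma cmod_disc_aut_le_1:
  assumes "cmod a < 1" "cmod z \<le> 1" shows "cmod (disc_aut a z) \<le> 1"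
  using cmod_disc_aut_less_1[of a z] cmod_disc_aut_eq_1[of a z] assms by fastforce

lemma disc_aut_eq_0_iff:
  assumes "cmod a < 1" "cmod z \<le> 1" shows "disc_aut a z = 0 \<longleftrightarrow> z = a"
  using one_minus_cnj_mult_nonzero[OF assms] by (auto simp: disc_aut_def)

lemma disc_aut_disc_aut:
  assumes "cmod a < 1" "cmod z \<le> 1" shows "disc_aut a (disc_aut a z) = z"
proof -
  have 1: "1 - cnj a * z \<noteq> 0" and 2: "1 - cnj a * a \<noteq> 0"
    using one_minus_cnj_mult_nonzero[of a z] one_minus_cnj_mult_nonzero[of a a] assms by auto
  have n: "a - disc_aut a z = z * (1 - cnj a * a) / (1 - cnj a * z)"
    using 1 by (simp add: disc_aut_def field_simps)
  have d: "1 - cnj a * disc_aut a z = (1 - cnj a * a) / (1 - cnj a * z)"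
    using 1 by (simp add: disc_aut_def field_simps)
  show ?thesis
    unfolding disc_aut_def[of a "disc_aut a z"] n d using 1 2 by simp
qed

lemma disc_aut_holomorphic [holomorphic_intros]:
  assumes "f holomorphic_on U" "\<And>z. z \<in> U \<Longrightarrow> 1 - cnj a * f z \<noteq> 0"
  shows "(\<lambda>z. disc_aut a (f z)) holomorphic_on U"
  using assms unfolding disc_aut_def by (auto intro!: holomorphic_intros)

lemma disc_aut_holomorphic_ball [holomorphic_intros]:
  assumes "f holomorphic_on U" "cmod a < 1" "\<And>z. z \<in> U \<Longrightarrow> cmod (f z) \<le> 1"
  shows "(\<lambda>z. disc_aut a (f z)) holomorphic_on U"
  using assms one_minus_cnj_mult_nonzero by (auto intro!: disc_aut_holomorphic)

lemma disc_aut_holomorphic_on_ball: "cmod a < 1 \<Longrightarrow> disc_aut a holomorphic_on ball 0 1"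
  using disc_aut_holomorphic_ball[OF holomorphic_on_ident, of a "ball 0 1"] by (simp add: less_imp_le)

lemma disc_aut_continuous_on_cball:
  assumes "cmod a < 1" shows "continuous_on (cball 0 1) (disc_aut a)"
  unfolding disc_aut_def using assms one_minus_cnj_mult_nonzero
  by (intro continuous_intros) auto

lemma cmod_disc_aut_invariant:
  assumes "cmod a < 1" "cmod z < 1" "cmod w < 1"
  shows "cmod (disc_aut (disc_aut a z) (disc_aut a w)) = cmod (disc_aut z w)"
proof -
  define A where "A = 1 - cnj a * z"
  define B where "B = 1 - cnj a * w"
  have nz: "A \<noteq> 0" "B \<noteq> 0" "1 - cnj a * a \<noteq> 0" "1 - cnj z * w \<noteq> 0"
    using one_minus_cnj_mult_nonzero assms unfolding A_def B_def by auto
  have cA: "cnj A \<noteq> 0" using nz by simp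
  have n: "disc_aut a z - disc_aut a w = (w - z) * (1 - cnj a * a) / (A * B)"
    using nz unfolding disc_aut_def A_def B_def by (simp add: divide_simps) (simp add: algebra_simps)
  have d: "1 - cnj (disc_aut a z) * disc_aut a w = (1 - cnj z * w) * (1 - cnj a * a) / (cnj A * B)"
    using nz cA unfolding disc_aut_def A_def B_def by (simp add: divide_simps) (simp add: algebra_simps)
  have "disc_aut (disc_aut a z) (disc_aut a w) = - disc_aut z w * (cnj A / A)"
    unfolding disc_aut_def[of "disc_aut a z"] n d using nz cA
    by (simp add: disc_aut_def divide_simps)  (simp add: algebra_simps)
  moreover have "cmod (cnj A / A) = 1" using nz by (simp add: norm_divide)
  ultimately show ?thesis by (simp only: norm_mult norm_minus_cancel mult_1_right)
qed

lemma prox_invariant: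
  assumes "cmod a < 1" "cmod z < 1" "cmod w < 1"
  shows "prox (disc_aut a z) (disc_aut a w) = prox z w"
  using cmod_disc_aut_invariant[OF assms] assms cmod_disc_aut_less_1
    cmod_disc_aut_sq[OF one_minus_cnj_mult_nonzero[of z w]]
    cmod_disc_aut_sq[OF one_minus_cnj_mult_nonzero[of "disc_aut a z" "disc_aut a w"]]
  by (simp add: less_imp_le)

lemma prox_le:
  assumes "cmod z < 1" "cmod w < 1"
  shows "prox z w \<le> (1 - (cmod w)\<^sup>2) / (1 - cmod z)\<^sup>2"
proof -
  have "(1 - cmod z)\<^sup>2 \<le> (cmod (1 - cnj z * w))\<^sup>2"
    using cmod_one_minus_cnj_mult_ge[of w z] assms by (intro power_mono) auto
  moreover have "(1 - (cmod z)\<^sup>2) * (1 - (cmod w)\<^sup>2) \<le> 1 * (1 - (cmod w)\<^sup>2)"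
    using assms by (intro mult_right_mono) (auto simp: power_le_one)
  ultimately show ?thesis
    unfolding prox_def using assms
    by (intro frac_le) (auto simp: power_le_one)
qed

text \<open>Moving \<open>w\<close> to the origin turns \<open>prox w a\<close> into
  \<open>1 - |a'|^2\<close>, and \<open>prox z' a'\<close> exceeds this by at most the factor
  \<open>1 / (1 - |z'|)^2\<close>. Bounds on sums over zeros can thus be transferred between points
  at bounded hyperbolic distance.\<close>

lemma prox_quasi_invariant:
  assumes "cmod z < 1" "cmod w < 1" "cmod a < 1" "cmod (disc_aut z w) \<le> R" "R < 1"
  shows "prox z a \<le> prox w a / (1 - R)\<^sup>2"
proof -
  define z' where "z' = disc_aut w z"
  define a' where "a' = disc_aut w a"
  have z': "cmod z' < 1" "cmod z' \<le> R" and a': "cmod a' < 1"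
    using assms cmod_disc_aut_commute[of z w] unfolding z'_def a'_def
    by (auto intro!: cmod_disc_aut_less_1)
  have "prox z a = prox z' a'"
    unfolding z'_def a'_def using prox_invariant assms by simp
  also have "\<dots> \<le> (1 - (cmod a')\<^sup>2) / (1 - cmod z')\<^sup>2"
    using prox_le z' a' by simp
  also have "\<dots> \<le> (1 - (cmod a')\<^sup>2) / (1 - R)\<^sup>2"
    using z' a' assms by (intro divide_left_mono power_mono mult_pos_pos) (auto simp: power_le_one)
  also have "1 - (cmod a')\<^sup>2 = prox w a"
    unfolding a'_def using cmod_disc_aut_sq one_minus_cnj_mult_nonzero[of w a] assms by simp
  finally show ?thesis .
qed

section \<open>Bounded analytic functions on the disc\<close>

text \<open>A maximum principle for functions without boundary values: the hypothesis controls
  \<open>g\<close> only asymptotically near the circle. It serves for quotients by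
  \<open>disc_aut a\<close> or by \<open>z^n\<close>, whose moduli tend to 1 there.\<close>

lemma max_modulus_limit:
  assumes hol: "g holomorphic_on ball 0 1"
    and lim: "\<And>e. e > 0 \<Longrightarrow> \<exists>r0<1. \<forall>w. r0 \<le> cmod w \<and> cmod w < 1 \<longrightarrow> cmod (g w) \<le> M + e"
    and z: "cmod z < 1"
  shows "cmod (g z) \<le> M"
proof (rule field_le_epsilon)
  fix e :: real assume "e > 0"
  then obtain r0 where r0: "r0 < 1" "\<And>w. r0 \<le> cmod w \<Longrightarrow> cmod w < 1 \<Longrightarrow> cmod (g w) \<le> M + e"
    using lim by blast
  define r where "r = (1 + max r0 (cmod z)) / 2"
  have "max r0 (cmod z) < 1" "max r0 (cmod z) \<ge> r0" "max r0 (cmod z) \<ge> cmod z" "cmod z \<ge> 0"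
    using r0(1) z by auto
  then have r: "r < 1" "r > r0" "r > cmod z" unfolding r_def by (simp_all add: max_def split: if_splits)
  then have "r > 0" using norm_ge_zero[of z] by linarith
  show "cmod (g z) \<le> M + e"
  proof (rule maximum_modulus_frontier[where S = "ball 0 r" and f = g])
    show "g holomorphic_on interior (ball 0 r)"
      using hol r by (auto elim!: holomorphic_on_subset)
    show "continuous_on (closure (ball 0 r)) g"
      using hol r \<open>r > 0\<close> by (auto intro!: holomorphic_on_imp_continuous_on elim!: holomorphic_on_subset)
  qed (use r r0 \<open>r > 0\<close> in \<open>auto simp: frontier_ball\<close>)
qed

lemma divide_zero:
  assumes hol: "f holomorphic_on S" and S: "open S" and a: "a \<in> S" "f a = 0"
  obtains g where "g holomorphic_on S" "\<And>z. z \<in> S \<Longrightarrow> f z = (z - a) * g z"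
proof
  show "(\<lambda>z. if z = a then deriv f a else (f z - f a) / (z - a)) holomorphic_on S"
    using pole_lemma[OF hol, of a] S a by (simp add: interior_open)
qed (use a in auto)

lemma cmod_disc_aut_ge_boundary:
  assumes "cmod a < 1" "e > 0"
  shows "\<exists>r0<1. \<forall>w. r0 \<le> cmod w \<and> cmod w \<le> 1 \<longrightarrow> cmod (disc_aut a w) \<ge> 1 - e"
proof -
  have "uniformly_continuous_on (cball 0 1) (disc_aut a)"
    by (intro compact_uniformly_continuous disc_aut_continuous_on_cball assms) auto
  then obtain d where d: "d > 0" "\<And>x y. x \<in> cball 0 1 \<Longrightarrow> y \<in> cball 0 1 \<Longrightarrow> dist y x < d \<Longrightarrow>
      dist (disc_aut a y) (disc_aut a x) < e"
    using assms unfolding uniformly_continuous_on_def by meson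
  have "cmod (disc_aut a w) \<ge> 1 - e" if w: "max (1 - d / 2) (1/2) \<le> cmod w" "cmod w \<le> 1" for w
  proof -
    define v where "v = w / of_real (cmod w)"
    have w0: "cmod w > 0" using w by auto
    have v: "cmod v = 1" using w0 by (simp add: v_def norm_divide)
    have "w = of_real (cmod w) * v" using w0 by (auto simp: v_def)
    then have "w - v = of_real (cmod w - 1) * v" by (simp add: algebra_simps)
    then have "dist w v = 1 - cmod w" using v w
      by (simp add: dist_norm norm_mult del: of_real_diff)
    then have "dist (disc_aut a w) (disc_aut a v) < e"
      using d(1) d(2)[of v w] v w by auto
    moreover have "cmod (disc_aut a v) = 1" using cmod_disc_aut_eq_1 assms v by blast
    ultimately show ?thesis
      using norm_triangle_ineq2[of "disc_aut a v" "disc_aut a w"] by (simp add: dist_norm norm_minus_commute)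
  qed
  then show ?thesis using d(1) by (intro exI[of _ "max (1 - d / 2) (1/2)"]) auto
qed

lemma schwarz_division:
  assumes hol: "f holomorphic_on ball 0 1" and bd: "\<And>z. cmod z < 1 \<Longrightarrow> cmod (f z) \<le> M"
    and a: "cmod a < 1" "f a = 0"
  obtains g where "g holomorphic_on ball 0 1" "\<And>z. cmod z < 1 \<Longrightarrow> f z = disc_aut a z * g z"
    "\<And>z. cmod z < 1 \<Longrightarrow> cmod (g z) \<le> M"
proof -
  obtain q where q: "q holomorphic_on ball 0 1" "\<And>z. z \<in> ball 0 1 \<Longrightarrow> f z = (z - a) * q z"
    using divide_zero[OF hol, of a] a by auto
  define g where "g z = - (1 - cnj a * z) * q z" for z
  have hg: "g holomorphic_on ball 0 1" unfolding g_def by (intro holomorphic_intros q)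
  have eq: "f z = disc_aut a z * g z" if "cmod z < 1" for z
  proof -
    have "disc_aut a z * g z = (z - a) * q z * ((1 - cnj a * z) / (1 - cnj a * z))"
      unfolding disc_aut_def g_def times_divide_eq_right times_divide_eq_left
      by (rule arg_cong2[where f = divide]) (simp_all add: algebra_simps)
    then show ?thesis using q(2)[of z] that one_minus_cnj_mult_nonzero[of a z] a by simp
  qed
  have M0: "M \<ge> 0" using bd[OF a(1)] a(2) by simp
  have "cmod (g z) \<le> M" if z: "cmod z < 1" for z
  proof (rule max_modulus_limit[OF hg _ z])
    fix e :: real assume e: "e > 0"
    \<comment> \<open>Chosen so that \<open>(1 - d) * (M + e) = M\<close>. Halving it to
      \<open>d'\<close> keeps \<open>1 - d'\<close> positive even when \<open>M = 0\<close>, where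
      \<open>d = 1\<close>.\<close>
    define d where "d = e / (M + e)"
    have d: "d > 0" "d \<le> 1" using e M0 by (auto simp: d_def)
    have Md: "M = (1 - d) * (M + e)"
      using e M0 by (simp add: d_def field_simps add_nonneg_pos)
    define d' where "d' = d / 2"
    obtain r0 where r0: "r0 < 1" "\<And>w. r0 \<le> cmod w \<Longrightarrow> cmod w \<le> 1 \<Longrightarrow> cmod (disc_aut a w) \<ge> 1 - d'"
      using cmod_disc_aut_ge_boundary[OF a(1), of d'] d by (auto simp: d'_def)
    have "cmod (g w) \<le> M + e" if w: "r0 \<le> cmod w" "cmod w < 1" for w
    proof -
      have "(1 - d') * cmod (g w) \<le> cmod (disc_aut a w) * cmod (g w)"
        using r0(2)[of w] w by (intro mult_right_mono) auto
      also have "\<dots> \<le> M" using bd[of w] eq[of w] w by (simp add: norm_mult)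
      also have "M = (1 - d) * (M + e)" by (rule Md)
      also have "\<dots> \<le> (1 - d') * (M + e)"
        by (rule mult_right_mono) (use M0 d e in \<open>auto simp: d'_def\<close>)
      finally show ?thesis using d by (simp add: d'_def)
    qed
    then show "\<exists>r0<1. \<forall>w. r0 \<le> cmod w \<and> cmod w < 1 \<longrightarrow> cmod (g w) \<le> M + e"
      using r0(1) by blast
  qed
  then show thesis using that hg eq by blast
qed

text \<open>A form of Harnack's inequality that controls the full value and not only the real part:
  the Cayley transform of \<open>g\<close> about \<open>g 0\<close> satisfies the Schwarz lemma.
  Adding \<open>e\<close> makes the real part strictly positive, so that the transform has no pole;
  \<open>e\<close> is removed at the end.\<close>

lemma positive_real_part_oscillation:
  assumes hol: "g holomorphic_on ball 0 R" and pos: "\<And>z. cmod z < R \<Longrightarrow> Re (g z) \<ge> 0"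
    and R: "R > 0" and rho: "\<rho> < 1" and z: "cmod z \<le> \<rho> * R"
  shows "cmod (g z - g 0) \<le> 2 * \<rho> / (1 - \<rho>) * Re (g 0)"
proof -
  have rho0: "\<rho> \<ge> 0" using z R by (smt (verit) norm_ge_zero mult_neg_pos)
  have main: "cmod (g z - g 0) \<le> 2 * \<rho> / (1 - \<rho>) * (Re (g 0) + e)" if e: "e > 0" for e
  proof -
    define p where "p w = g (of_real R * w) + of_real e" for w
    define h where "h w = (p w - p 0) / (p w + cnj (p 0))" for w
    have Rp: "Re (p w) > 0" if "cmod w < 1" for w
      using pos[of "of_real R * w"] that e R by (simp add: p_def norm_mult)
    have nz: "p w + cnj (p 0) \<noteq> 0" if "cmod w < 1" for w
      using Rp[OF that] Rp[of 0] by (auto simp: complex_eq_iff)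
    have hp: "p holomorphic_on ball 0 1"
      unfolding p_def using R
      by (intro holomorphic_intros holomorphic_on_compose_gen[OF _ hol, unfolded o_def])
        (auto simp: norm_mult)
    have hh: "h holomorphic_on ball 0 1"
      unfolding h_def using nz by (intro holomorphic_intros hp) auto
    have h1: "cmod (h w) < 1" if w: "cmod w < 1" for w
    proof -
      have "(cmod (p w + cnj (p 0)))\<^sup>2 - (cmod (p w - p 0))\<^sup>2 = 4 * Re (p w) * Re (p 0)"
        unfolding cmod_power2 by (simp add: algebra_simps power2_eq_square)
      also have "\<dots> > 0" using Rp[OF w] Rp[of 0] by simp
      finally have "cmod (p w - p 0) < cmod (p w + cnj (p 0))"
        by (meson diff_gt_0_iff_gt norm_ge_zero power_less_imp_less_base)
      then show ?thesis using nz[OF w] by (simp add: h_def norm_divide divide_less_eq)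
    qed
    define v where "v = z / of_real R"
    have v: "cmod v \<le> \<rho>" using z R by (simp add: v_def norm_divide divide_le_eq)
    then have v1: "cmod v < 1" using rho by simp
    have hv: "cmod (h v) \<le> \<rho>"
      using Schwarz_Lemma(1)[OF hh _ h1, of v] v v1 by (force simp: h_def)
    define x where "x = cmod (p v - p 0)"
    have "x = cmod (h v) * cmod (p v + cnj (p 0))"
      using nz[of v] v1 unfolding x_def h_def by (simp add: norm_divide)
    also have "\<dots> \<le> \<rho> * cmod (p v + cnj (p 0))"
      using hv by (intro mult_right_mono) auto
    finally have x_le: "x \<le> \<rho> * cmod (p v + cnj (p 0))" .
    have "cmod (p v + cnj (p 0)) \<le> x + 2 * Re (p 0)"
    proof -
      have eq: "p v + cnj (p 0) = (p v - p 0) + of_real (2 * Re (p 0))"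
        by (simp add: complex_eq_iff)
      have "cmod (of_real (2 * Re (p 0))) = 2 * Re (p 0)"
        using Rp[of 0] unfolding norm_of_real by simp
      then show ?thesis
        unfolding x_def by (subst eq) (metis norm_triangle_ineq)
    qed
    then have le: "\<rho> * cmod (p v + cnj (p 0)) \<le> \<rho> * (x + 2 * Re (p 0))"
      using rho0 by (intro mult_left_mono)
    have "x * (1 - \<rho>) \<le> 2 * \<rho> * Re (p 0)"
      using order_trans[OF x_le le] by (simp add: algebra_simps)
    then have "x \<le> 2 * \<rho> / (1 - \<rho>) * Re (p 0)"
      using rho by (simp add: field_simps)
    then show ?thesis using R unfolding x_def p_def v_def by simp
  qed
  have c: "2 * \<rho> / (1 - \<rho>) \<ge> 0" using rho rho0 by simp
  show ?thesis
  proof (rule field_le_epsilon)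
    fix e :: real assume e: "e > 0"
    define e' where "e' = e / (2 * \<rho> / (1 - \<rho>) + 1)"
    have e': "e' > 0" using e c unfolding e'_def by (intro divide_pos_pos) auto
    have "2 * \<rho> / (1 - \<rho>) * e' \<le> (2 * \<rho> / (1 - \<rho>) + 1) * e'" using e' by (intro mult_right_mono) auto
    also have "\<dots> = e" using c unfolding e'_def by (smt (verit) nonzero_mult_div_cancel_left times_divide_eq_right)
    finally have "2 * \<rho> / (1 - \<rho>) * e' \<le> e" .
    with main[OF e'] show "cmod (g z - g 0) \<le> 2 * \<rho> / (1 - \<rho>) * Re (g 0) + e"
      by (smt (verit) distrib_left)
  qed
qed

lemma positive_real_part_oscillation_disc:
  assumes hol: "g holomorphic_on ball 0 1" and pos: "\<And>z. cmod z < 1 \<Longrightarrow> Re (g z) \<ge> 0"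
    and w: "cmod w < 1" and z: "cmod z < 1" "cmod (disc_aut w z) \<le> \<rho>" and rho: "\<rho> < 1"
  shows "cmod (g z - g w) \<le> 2 * \<rho> / (1 - \<rho>) * Re (g w)"
proof -
  have "(\<lambda>x. g (disc_aut w x)) holomorphic_on ball 0 1"
    by (rule holomorphic_on_compose_gen[OF _ hol, unfolded o_def])
      (use w cmod_disc_aut_less_1 disc_aut_holomorphic_on_ball[OF w] in auto)
  from positive_real_part_oscillation[OF this _ _ rho, of "disc_aut w z"]
  show ?thesis using pos cmod_disc_aut_less_1[OF w] z w by (simp add: disc_aut_disc_aut)
qed

section \<open>Means over circles\<close>

definition cmean :: "real \<Rightarrow> (complex \<Rightarrow> 'a::banach) \<Rightarrow> 'a" where
  "cmean r F = (1 / (2 * pi)) *\<^sub>R integral {0..2 * pi} (\<lambda>t. F (of_real r * cis t))"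

lemma continuous_on_circle:
  assumes "continuous_on (sphere 0 r) F" "r \<ge> 0"
  shows "continuous_on A (\<lambda>t. F (of_real r * cis t))"
  by (rule continuous_on_compose2[OF assms(1)]) (use assms in \<open>auto simp: norm_mult intro!: continuous_intros\<close>)

lemma circle_integrable:
  fixes F :: "complex \<Rightarrow> 'a::banach"
  assumes "continuous_on (sphere 0 r) F" "r \<ge> 0"
  shows "(\<lambda>t. F (of_real r * cis t)) integrable_on {0..2 * pi}"
  by (rule integrable_continuous_real) (rule continuous_on_circle[OF assms])

lemma cmean_add:
  assumes "continuous_on (sphere 0 r) F" "continuous_on (sphere 0 r) G" "r \<ge> 0"
  shows "cmean r (\<lambda>z. F z + G z) = cmean r F + cmean r G"
  unfolding cmean_def using assms
  by (subst Henstock_Kurzweil_Integration.integral_add) (auto intro!: circle_integrable simp: scaleR_add_right)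

lemma cmean_diff:
  assumes "continuous_on (sphere 0 r) F" "continuous_on (sphere 0 r) G" "r \<ge> 0"
  shows "cmean r (\<lambda>z. F z - G z) = cmean r F - cmean r G"
  unfolding cmean_def using assms
  by (subst Henstock_Kurzweil_Integration.integral_diff) (auto intro!: circle_integrable simp: scaleR_diff_right)

lemma cmean_mult_right:
  fixes c :: "'a::{real_normed_field,banach}"
  shows "cmean r (\<lambda>z. c * F z) = c * cmean r F"
  unfolding cmean_def by simp

lemma cmean_scaleR: "cmean r (\<lambda>z. c *\<^sub>R F z) = c *\<^sub>R cmean r F"
  unfolding cmean_def by simp

lemma cmean_cong:
  assumes "\<And>z. cmod z = r \<Longrightarrow> F z = G z" "r \<ge> 0" shows "cmean r F = cmean r G"
  unfolding cmean_def using assms by (auto intro!: arg_cong[where f = "(*\<^sub>R) _"] integral_cong simp: norm_mult)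

lemma cmean_const: "cmean r (\<lambda>z. c) = c"
  unfolding cmean_def by simp

lemma cmean_0: "cmean 0 F = F 0"
  unfolding cmean_def by simp

lemma cmean_mono:
  fixes F G :: "complex \<Rightarrow> real"
  assumes "continuous_on (sphere 0 r) F" "continuous_on (sphere 0 r) G" "r \<ge> 0"
    and "\<And>z. cmod z = r \<Longrightarrow> F z \<le> G z"
  shows "cmean r F \<le> cmean r G"
  unfolding cmean_def real_scaleR_def using assms
  by (intro mult_left_mono integral_le) (auto intro!: circle_integrable simp: norm_mult)

lemma norm_cmean_le:
  fixes F :: "complex \<Rightarrow> 'a::banach"
  assumes "continuous_on (sphere 0 r) F" "r \<ge> 0"
  shows "norm (cmean r F) \<le> cmean r (\<lambda>z. norm (F z))"
proof -
  have "norm (integral {0..2 * pi} (\<lambda>t. F (of_real r * cis t)))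
      \<le> integral {0..2 * pi} (\<lambda>t. norm (F (of_real r * cis t)))"
    by (rule integral_norm_bound_integral)
      (use assms in \<open>auto intro!: circle_integrable continuous_intros\<close>)
  then show ?thesis by (simp add: cmean_def divide_right_mono)
qed

lemma cmean_bounded_linear:
  fixes F :: "complex \<Rightarrow> 'a::banach" and h :: "'a \<Rightarrow> 'b::banach"
  assumes "continuous_on (sphere 0 r) F" "r \<ge> 0" "bounded_linear h"
  shows "cmean r (\<lambda>z. h (F z)) = h (cmean r F)"
proof -
  have "integral {0..2 * pi} (h \<circ> (\<lambda>t. F (of_real r * cis t))) = h (integral {0..2 * pi} (\<lambda>t. F (of_real r * cis t)))"
    by (rule integral_linear) (use assms in \<open>auto intro!: circle_integrable\<close>)
  then show ?thesis
    unfolding cmean_def o_def using linear_cmul[OF bounded_linear.linear[OF assms(3)]] by simp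
qed

lemma cmean_of_real:
  assumes "continuous_on (sphere 0 r) F" "r \<ge> 0"
  shows "cmean r (\<lambda>z. complex_of_real (F z)) = of_real (cmean r F)"
  by (rule cmean_bounded_linear[OF assms bounded_linear_of_real])

lemma cmean_Re:
  assumes "continuous_on (sphere 0 r) F" "r \<ge> 0"
  shows "cmean r (\<lambda>z. Re (F z)) = Re (cmean r F)"
  by (rule cmean_bounded_linear[OF assms bounded_linear_Re])

lemma cmean_cnj:
  assumes "continuous_on (sphere 0 r) F" "r \<ge> 0"
  shows "cmean r (\<lambda>z. cnj (F z)) = cnj (cmean r F)"
  by (rule cmean_bounded_linear[OF assms bounded_linear_cnj])

lemma cmean_cauchy:
  assumes cont: "continuous_on (cball 0 r) f" and hol: "f holomorphic_on ball 0 r" and z: "cmod z < r"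
  shows "cmean r (\<lambda>w. w * f w / (w - z)) = f z"
proof -
  have "((\<lambda>u. f u / (u - z)) has_contour_integral (2 * of_real pi * \<i> * f z)) (part_circlepath 0 r 0 (2 * pi))"
    using Cauchy_integral_circlepath[OF cont hol, of z] z by (simp add: circlepath_def)
  then have "((\<lambda>t. f (0 + of_real r * cis t) / (0 + of_real r * cis t - z) * of_real r * \<i> * cis t)
      has_integral (2 * of_real pi * \<i> * f z)) {0..2 * pi}"
    by (subst (asm) has_contour_integral_part_circlepath_iff) auto
  from has_integral_mult_right[OF this, of "1 / (2 * of_real pi * \<i>)"]
  have "((\<lambda>t. (1 / (2 * pi)) *\<^sub>R (of_real r * cis t * f (of_real r * cis t) / (of_real r * cis t - z)))
      has_integral f z) {0..2 * pi}"
    by (simp add: mult_ac scaleR_conv_of_real)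
  from integral_unique[OF this] show ?thesis
    unfolding cmean_def by (subst (asm) integral_cmul)
qed

lemma cmean_holomorphic:
  assumes cont: "continuous_on (cball 0 r) f" and hol: "f holomorphic_on ball 0 r" and "r > 0"
  shows "cmean r f = f 0"
proof -
  have "cmean r f = cmean r (\<lambda>w. w * f w / (w - 0))"
    by (rule cmean_cong) (use assms in auto)
  then show ?thesis using cmean_cauchy[OF cont hol, of 0] assms by simp
qed

section \<open>The Poisson kernel of a disc of radius r\<close>

definition poisson :: "real \<Rightarrow> complex \<Rightarrow> complex \<Rightarrow> real" where
  "poisson r z w = (r\<^sup>2 - (cmod z)\<^sup>2) / (cmod (w - z))\<^sup>2"

lemma poisson_continuous:
  assumes "cmod z < r" shows "continuous_on (sphere 0 r) (poisson r z)"
  unfolding poisson_def using assms by (auto intro!: continuous_intros)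

lemma poisson_bounds:
  assumes "cmod z < r" "cmod w = r"
  shows "poisson r z w > 0" "poisson r z w \<le> (r + cmod z) / (r - cmod z)"
proof -
  have r: "r > 0" using assms(1) norm_ge_zero[of z] by linarith
  have sq: "(cmod z)\<^sup>2 < r\<^sup>2" using assms r by (intro power_strict_mono) auto
  have d: "cmod (w - z) \<ge> r - cmod z" using norm_triangle_ineq2[of w z] assms by simp
  then have "cmod (w - z) > 0" using assms by linarith
  then show "poisson r z w > 0" using sq unfolding poisson_def by simp
  have "(r - cmod z)\<^sup>2 \<le> (cmod (w - z))\<^sup>2" using d assms by (intro power_mono) auto
  then have "poisson r z w \<le> (r\<^sup>2 - (cmod z)\<^sup>2) / (r - cmod z)\<^sup>2"
    unfolding poisson_def using sq assms by (intro divide_left_mono) (auto intro!: mult_pos_pos \<open>cmod (w - z) > 0\<close>)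
  also have "\<dots> = (r + cmod z) / (r - cmod z)"
    using assms by (simp add: divide_simps power2_eq_square) (simp add: algebra_simps)
  finally show "poisson r z w \<le> (r + cmod z) / (r - cmod z)" .
qed

text \<open>Cauchy's formula for \<open>f\<close> times the factor \<open>(r\<^sup>2 - \<bar>z\<bar>\<^sup>2) / (r\<^sup>2 - cnj z * w)\<close>, which is 1 at \<open>w = z\<close>.\<close>

lemma poisson_formula:
  assumes hol: "f holomorphic_on ball 0 r" and cont: "continuous_on (cball 0 r) f" and z: "cmod z < r"
  shows "cmean r (\<lambda>w. of_real (poisson r z w) * f w) = f z"
proof -
  have r: "r > 0" using z norm_ge_zero[of z] by linarith
  define g where "g w = f w * of_real (r\<^sup>2 - (cmod z)\<^sup>2) / (of_real (r\<^sup>2) - cnj z * w)" for w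
  have nz: "of_real (r\<^sup>2) - cnj z * w \<noteq> 0" if "cmod w \<le> r" for w
  proof
    assume "of_real (r\<^sup>2) - cnj z * w = 0"
    then have "cmod (of_real (r\<^sup>2)) = cmod (cnj z * w)" by simp
    then have eq: "r\<^sup>2 = cmod z * cmod w" unfolding norm_of_real norm_mult by simp
    have "cmod z * cmod w \<le> cmod z * r" using that by (intro mult_left_mono) auto
    also have "\<dots> < r * r" using z r by simp
    finally show False using eq by (simp add: power2_eq_square)
  qed
  have "g holomorphic_on ball 0 r" unfolding g_def using nz by (intro holomorphic_intros hol) auto
  moreover have "continuous_on (cball 0 r) g" unfolding g_def using nz by (intro continuous_intros cont) auto
  ultimately have "cmean r (\<lambda>w. w * g w / (w - z)) = g z" using cmean_cauchy z by blast
  moreover have "g z = f z"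
  proof -
    have "of_real (r\<^sup>2) - cnj z * z = (of_real (r\<^sup>2 - (cmod z)\<^sup>2) :: complex)"
      using complex_norm_square[of z] by (simp add: mult.commute)
    then show ?thesis using nz[of z] z unfolding g_def by simp
  qed
  moreover have "cmean r (\<lambda>w. of_real (poisson r z w) * f w) = cmean r (\<lambda>w. w * g w / (w - z))"
  proof (rule cmean_cong)
    fix w assume w: "cmod w = r"
    have ww: "of_real (r\<^sup>2) = w * cnj w" using complex_norm_square[of w] w by simp
    have w0: "w \<noteq> 0" "w - z \<noteq> 0" "cnj w - cnj z \<noteq> 0" using w z r by auto
    have sq: "of_real ((cmod (w - z))\<^sup>2) = (w - z) * (cnj w - cnj z)"
      using complex_norm_square[of "w - z"] by simp
    have "w * g w / (w - z) = f w * of_real (r\<^sup>2 - (cmod z)\<^sup>2) * (w / (w * (cnj w - cnj z) * (w - z)))"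
      unfolding g_def ww by (simp add: algebra_simps)
    also have "w / (w * (cnj w - cnj z) * (w - z)) = 1 / ((w - z) * (cnj w - cnj z))"
      using w0 by simp
    also have "f w * of_real (r\<^sup>2 - (cmod z)\<^sup>2) * \<dots> = of_real (poisson r z w) * f w"
      unfolding poisson_def of_real_divide sq by simp
    finally show "of_real (poisson r z w) * f w = w * g w / (w - z)" by simp
  qed (use r in simp)
  ultimately show ?thesis by simp
qed

lemma poisson_mean_1: "cmod z < r \<Longrightarrow> cmean r (poisson r z) = 1"
proof -
  assume z: "cmod z < r"
  then have r: "r \<ge> 0" using norm_ge_zero[of z] by linarith
  have "cmean r (\<lambda>w. of_real (poisson r z w) * 1) = (1::complex)"
    using poisson_formula[of "\<lambda>_. 1" r z] z by (auto simp: holomorphic_on_const)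
  then have "of_real (cmean r (poisson r z)) = (1::complex)"
    using cmean_of_real[OF poisson_continuous[OF z] r] by simp
  then show ?thesis using of_real_eq_1_iff by blast
qed

section \<open>Green's formula on the disc\<close>

text \<open>\<open>Fz\<close> and \<open>Fb\<close> are the derivatives with respect to z and its
  conjugate. Carrying them as data lets the rules below compute mixed second derivatives
  mechanically, and their continuity provides the regularity that Green's formula asks for.\<close>

definition wirtinger ::
    "complex set \<Rightarrow> (complex \<Rightarrow> complex) \<Rightarrow> (complex \<Rightarrow> complex) \<Rightarrow> (complex \<Rightarrow> complex) \<Rightarrow> bool" where
  "wirtinger U F Fz Fb \<longleftrightarrow>
     (\<forall>z\<in>U. (F has_derivative (\<lambda>h. Fz z * h + Fb z * cnj h)) (at z)) \<and> continuous_on U Fz \<and> continuous_on U Fb"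

lemma wirtinger_imp_continuous: "wirtinger U F Fz Fb \<Longrightarrow> continuous_on U F"
  unfolding wirtinger_def
  by (meson continuous_at_imp_continuous_on has_derivative_continuous)

lemma wirtinger_holomorphic:
  assumes "f holomorphic_on U" "open U"
  shows "wirtinger U f (deriv f) (\<lambda>_. 0)"
  using assms holomorphic_derivI[OF assms] holomorphic_deriv[OF assms]
  unfolding wirtinger_def
  by (auto simp: has_field_derivative_def mult.commute[of _ "deriv f _"] intro: holomorphic_on_imp_continuous_on)

lemma wirtinger_add:
  assumes "wirtinger U F Fz Fb" "wirtinger U G Gz Gb"
  shows "wirtinger U (\<lambda>z. F z + G z) (\<lambda>z. Fz z + Gz z) (\<lambda>z. Fb z + Gb z)"
  using assms unfolding wirtinger_def
  by (auto intro!: continuous_intros derivative_eq_intros simp: algebra_simps fun_eq_iff)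

lemma wirtinger_diff:
  assumes "wirtinger U F Fz Fb" "wirtinger U G Gz Gb"
  shows "wirtinger U (\<lambda>z. F z - G z) (\<lambda>z. Fz z - Gz z) (\<lambda>z. Fb z - Gb z)"
  using assms unfolding wirtinger_def
  by (auto intro!: continuous_intros derivative_eq_intros simp: algebra_simps fun_eq_iff)

lemma wirtinger_mult:
  assumes "wirtinger U F Fz Fb" "wirtinger U G Gz Gb"
  shows "wirtinger U (\<lambda>z. F z * G z) (\<lambda>z. Fz z * G z + F z * Gz z) (\<lambda>z. Fb z * G z + F z * Gb z)"
  using assms wirtinger_imp_continuous[OF assms(1)] wirtinger_imp_continuous[OF assms(2)] unfolding wirtinger_def
  by (auto intro!: continuous_intros derivative_eq_intros simp: algebra_simps fun_eq_iff)

lemma wirtinger_cnj: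
  assumes "wirtinger U F Fz Fb"
  shows "wirtinger U (\<lambda>z. cnj (F z)) (\<lambda>z. cnj (Fb z)) (\<lambda>z. cnj (Fz z))"
  using assms unfolding wirtinger_def
  by (auto intro!: continuous_intros derivative_eq_intros simp: algebra_simps fun_eq_iff)

lemma wirtinger_compose:
  assumes F: "wirtinger U F Fz Fb" and g: "g holomorphic_on V" "open V" "\<And>z. z \<in> U \<Longrightarrow> F z \<in> V"
  shows "wirtinger U (\<lambda>z. g (F z)) (\<lambda>z. deriv g (F z) * Fz z) (\<lambda>z. deriv g (F z) * Fb z)"
proof -
  have "((\<lambda>z. g (F z)) has_derivative (\<lambda>h. deriv g (F z) * Fz z * h + deriv g (F z) * Fb z * cnj h)) (at z)"
    if z: "z \<in> U" for z
  proof -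
    have "(g has_derivative (*) (deriv g (F z))) (at (F z))"
      using holomorphic_derivI[OF g(1,2) g(3)[OF z]] by (simp add: has_field_derivative_def)
    moreover have "(F has_derivative (\<lambda>h. Fz z * h + Fb z * cnj h)) (at z)"
      using F z by (simp add: wirtinger_def)
    ultimately show ?thesis
      using has_derivative_compose[of F "\<lambda>h. Fz z * h + Fb z * cnj h" z UNIV g "(*) (deriv g (F z))"]
      by (simp add: distrib_left mult.assoc)
  qed
  moreover have "continuous_on U (\<lambda>z. deriv g (F z))"
    by (rule continuous_on_compose2[OF holomorphic_on_imp_continuous_on[OF holomorphic_deriv[OF g(1,2)]]
          wirtinger_imp_continuous[OF F]]) (use g in auto)
  ultimately show ?thesis
    using F unfolding wirtinger_def by (auto intro!: continuous_intros)
qed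

lemma wirtinger_cong:
  assumes "wirtinger U F Fz Fb" "open U" "\<And>z. z \<in> U \<Longrightarrow> F z = F' z" "\<And>z. z \<in> U \<Longrightarrow> Fz z = Fz' z"
    "\<And>z. z \<in> U \<Longrightarrow> Fb z = Fb' z"
  shows "wirtinger U F' Fz' Fb'"
proof -
  have "(F' has_derivative (\<lambda>h. Fz' z * h + Fb' z * cnj h)) (at z)" if "z \<in> U" for z
  proof -
    have "(F has_derivative (\<lambda>h. Fz' z * h + Fb' z * cnj h)) (at z)"
      using assms that by (simp add: wirtinger_def)
    then show ?thesis
      by (rule has_derivative_transform_within_open[OF _ assms(2) that]) (use assms in auto)
  qed
  then show ?thesis using assms unfolding wirtinger_def by (auto cong: continuous_on_cong)
qed

lemma has_derivative_real_line:
  fixes F :: "complex \<Rightarrow> complex"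
  assumes "(F has_derivative (\<lambda>h. a * h + b * cnj h)) (at (p x))" "(p has_vector_derivative q) (at x)"
  shows "((\<lambda>x. F (p x)) has_vector_derivative (a * q + b * cnj q)) (at x)"
proof -
  have "((\<lambda>x. F (p x)) has_derivative (\<lambda>h. a * (h *\<^sub>R q) + b * cnj (h *\<^sub>R q))) (at x)"
    using has_derivative_compose[OF assms(2)[unfolded has_vector_derivative_def] assms(1)] .
  then show ?thesis unfolding has_vector_derivative_def by (simp add: algebra_simps)
qed

text \<open>Up to a factor \<open>\<i>\<close> the difference of the two integrands is the angular
  derivative of \<open>F\<close>, whose integral over a full circle vanishes. Hence the radial
  derivative of a circle mean can be written with either derivative alone.\<close>

lemma cmean_wirtinger_rotation:
  assumes W: "wirtinger U F Fz Fb" and U: "sphere 0 r \<subseteq> U" and r: "r \<ge> 0"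
  shows "cmean r (\<lambda>z. z * Fz z) = cmean r (\<lambda>z. cnj z * Fb z)"
proof -
  let ?p = "\<lambda>t. of_real r * cis t"
  have p: "(?p has_vector_derivative (\<i> * ?p t)) (at t)" for t
    by (auto intro!: derivative_eq_intros simp: has_vector_derivative_def has_derivative_cis scaleR_conv_of_real)
  have pU: "?p t \<in> U" for t using U r by (auto simp: norm_mult)
  have "((\<lambda>t. F (?p t)) has_vector_derivative (Fz (?p t) * (\<i> * ?p t) + Fb (?p t) * cnj (\<i> * ?p t))) (at t)" for t
    using has_derivative_real_line[OF _ p] W pU unfolding wirtinger_def by blast
  then have "((\<lambda>t. Fz (?p t) * (\<i> * ?p t) + Fb (?p t) * cnj (\<i> * ?p t)) has_integral (F (?p (2 * pi)) - F (?p 0))) {0..2 * pi}"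
    by (intro fundamental_theorem_of_calculus) (auto intro: has_vector_derivative_at_within)
  from integral_unique[OF this]
  have "cmean r (\<lambda>z. Fz z * (\<i> * z) + Fb z * cnj (\<i> * z)) = 0"
    unfolding cmean_def by simp
  also have "cmean r (\<lambda>z. Fz z * (\<i> * z) + Fb z * cnj (\<i> * z)) = cmean r (\<lambda>z. \<i> * (z * Fz z - cnj z * Fb z))"
    by (rule cmean_cong) (use r in \<open>auto simp: algebra_simps\<close>)
  also have "\<dots> = \<i> * (cmean r (\<lambda>z. z * Fz z) - cmean r (\<lambda>z. cnj z * Fb z))"
    unfolding cmean_mult_right using W U r continuous_on_subset[OF _ U]
    by (subst cmean_diff) (auto intro!: continuous_intros simp: wirtinger_def)
  finally show ?thesis by simp
qed

lemma continuous_on_cmean_param: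
  fixes H :: "real \<Rightarrow> real \<Rightarrow> 'a::banach"
  assumes "continuous_on ({0..1} \<times> {0..2 * pi}) (\<lambda>(r, t). H r t)"
  shows "continuous_on {0..1} (\<lambda>r. integral {0..2 * pi} (H r))"
  using integral_continuous_on_param[of "{0..1}" 0 "2 * pi" H] assms by simp

lemma continuous_on_polar:
  assumes "continuous_on (cball 0 1) H"
  shows "continuous_on ({0..1} \<times> {0..2 * pi}) (\<lambda>(r, t). H (of_real r * cis t))"
  unfolding case_prod_beta
  by (rule continuous_on_compose2[OF assms]) (auto intro!: continuous_intros simp: norm_mult)

lemma continuous_on_cmean:
  fixes H :: "complex \<Rightarrow> 'a::banach"
  assumes "continuous_on (cball 0 1) H"
  shows "continuous_on {0..1} (\<lambda>r. cmean r H)"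
  unfolding cmean_def
  by (intro continuous_intros continuous_on_cmean_param continuous_on_polar assms)

lemma has_vector_derivative_cmean:
  assumes W: "wirtinger U F Fz Fb" and U: "cball 0 1 \<subseteq> U" and r: "0 < r" "r < 1"
  shows "((\<lambda>r. cmean r F) has_vector_derivative (2 / r) *\<^sub>R cmean r (\<lambda>z. cnj z * Fb z)) (at r)"
    and "((\<lambda>r. cmean r F) has_vector_derivative (2 / r) *\<^sub>R cmean r (\<lambda>z. z * Fz z)) (at r)"
proof -
  let ?D = "\<lambda>r t. Fz (of_real r * cis t) * cis t + Fb (of_real r * cis t) * cnj (cis t)"
  have cF: "continuous_on (cball 0 1) F" "continuous_on (cball 0 1) Fz" "continuous_on (cball 0 1) Fb"
    using W U wirtinger_imp_continuous[OF W] continuous_on_subset unfolding wirtinger_def by blast+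
  have sph: "sphere 0 s \<subseteq> cball 0 1" if "s \<le> 1" for s :: real using that by auto
  have "((\<lambda>r. integral (cbox 0 (2 * pi)) (\<lambda>t. F (of_real r * cis t))) has_vector_derivative
      integral (cbox 0 (2 * pi)) (?D r)) (at r within {0..1})"
  proof (rule leibniz_rule_vector_derivative)
    fix s t :: real assume s: "s \<in> {0..1}"
    have "((\<lambda>s. of_real s * cis t) has_vector_derivative cis t) (at s)"
      by (auto intro!: derivative_eq_intros simp: has_vector_derivative_def scaleR_conv_of_real)
    moreover have "of_real s * cis t \<in> U" using U s by (auto simp: norm_mult)
    ultimately show "((\<lambda>s. F (of_real s * cis t)) has_vector_derivative ?D s t) (at s within {0..1})"
      using has_derivative_real_line W unfolding wirtinger_def
      by (blast intro: has_vector_derivative_at_within)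
  next
    fix s :: real assume "s \<in> {0..1}"
    then show "(\<lambda>t. F (of_real s * cis t)) integrable_on cbox 0 (2 * pi)"
      using circle_integrable[OF continuous_on_subset[OF cF(1) sph]] by simp
  next
    show "continuous_on ({0..1} \<times> cbox 0 (2 * pi)) (\<lambda>(r, t). ?D r t)"
      using continuous_on_polar[OF cF(2)] continuous_on_polar[OF cF(3)]
      by (auto intro!: continuous_intros simp: case_prod_beta)
  qed (use r in auto)
  then have "((\<lambda>r. integral {0..2 * pi} (\<lambda>t. F (of_real r * cis t))) has_vector_derivative
      integral {0..2 * pi} (?D r)) (at r)"
    using at_within_interior[of r "{0..1}"] r by (simp add: interior_atLeastAtMost_real)
  from has_vector_derivative_scaleR[OF DERIV_const this, of "1 / (2 * pi)"]
  have D: "((\<lambda>r. cmean r F) has_vector_derivative (1 / (2 * pi)) *\<^sub>R integral {0..2 * pi} (?D r)) (at r)"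
    unfolding cmean_def by simp
  have "(1 / (2 * pi)) *\<^sub>R integral {0..2 * pi} (?D r) = cmean r (\<lambda>z. (1 / r) *\<^sub>R (z * Fz z + cnj z * Fb z))"
    unfolding cmean_def using r
    by (intro arg_cong[where f = "(*\<^sub>R) _"] integral_cong) (simp add: scaleR_conv_of_real field_simps)
  also have "\<dots> = (1 / r) *\<^sub>R (cmean r (\<lambda>z. z * Fz z) + cmean r (\<lambda>z. cnj z * Fb z))"
    unfolding cmean_scaleR using r continuous_on_subset[OF cF(2) sph] continuous_on_subset[OF cF(3) sph]
    by (subst cmean_add) (auto intro!: continuous_intros)
  finally have e: "(1 / (2 * pi)) *\<^sub>R integral {0..2 * pi} (?D r) = \<dots>" .
  have rot: "cmean r (\<lambda>z. z * Fz z) = cmean r (\<lambda>z. cnj z * Fb z)"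
    by (rule cmean_wirtinger_rotation[OF W]) (use sph[of r] U r in auto)
  show "((\<lambda>r. cmean r F) has_vector_derivative (2 / r) *\<^sub>R cmean r (\<lambda>z. cnj z * Fb z)) (at r)"
    using D unfolding e rot by (simp add: scaleR_2[symmetric])
  then show "((\<lambda>r. cmean r F) has_vector_derivative (2 / r) *\<^sub>R cmean r (\<lambda>z. z * Fz z)) (at r)"
    unfolding rot .
qed

lemma continuous_on_x_ln_x: "continuous_on {0..1} (\<lambda>r::real. r * ln r)"
proof -
  have "isCont (\<lambda>r::real. r * ln r) r" if "r > 0" for r
    using that by (intro continuous_intros) auto
  moreover have "((\<lambda>r::real. r * ln r) \<longlongrightarrow> 0 * ln 0) (at 0 within {0..1})"
  proof -
    have "((\<lambda>r::real. r * ln r) \<longlongrightarrow> 0) (at_right 0)" by real_asymp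
    then show ?thesis
      using at_within_Icc_at_right[of 0 "1::real"] by simp
  qed
  ultimately show ?thesis
    unfolding continuous_on_eq_continuous_within
    by (metis atLeastAtMost_iff continuous_at_imp_continuous_at_within continuous_within less_eq_real_def)
qed

text \<open>In polar coordinates this is \<open>2 / pi\<close> times the area integral of
  \<open>H z * ln (1 / |z|)\<close>, the potential of \<open>H\<close> at 0 for the Green function
  of the disc. Since \<open>r * ln r\<close> extends continuously to 0, the integrand is continuous
  for continuous \<open>H\<close>.\<close>

definition green_int :: "(complex \<Rightarrow> 'a::banach) \<Rightarrow> 'a" where
  "green_int H = integral {0..1} (\<lambda>r. (- 4 * (r * ln r)) *\<^sub>R cmean r H)"

lemma continuous_on_green_integrand:
  fixes H :: "complex \<Rightarrow> 'a::banach"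
  assumes "continuous_on (cball 0 1) H"
  shows "continuous_on {0..1} (\<lambda>r. (- 4 * (r * ln r)) *\<^sub>R cmean r H)"
  by (intro continuous_intros continuous_on_cmean continuous_on_x_ln_x assms)

text \<open>The correction term in \<open>\<Phi>\<close> is chosen so that the two terms
  \<open>(2 / r) * k r\<close> in its derivative cancel, which leaves the integrand of
  \<open>green_int\<close>. \<open>Fbz\<close> is the mixed derivative, a quarter of the
  Laplacian.\<close>

theorem green_formula:
  assumes W: "wirtinger U F Fz Fb" and W2: "wirtinger U Fb Fbz Fbb" and U: "open U" "cball 0 1 \<subseteq> U"
  shows "cmean 1 F = F 0 + green_int Fbz"
proof -
  define k where "k r = cmean r (\<lambda>z. cnj z * Fb z)" for r
  define m where "m r = (1 / (2 * pi)) *\<^sub>R integral {0..2 * pi} (\<lambda>t. cnj (cis t) * Fb (of_real r * cis t))" for r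
  have cF: "continuous_on (cball 0 1) F" "continuous_on (cball 0 1) Fb" "continuous_on (cball 0 1) Fbz"
    using W W2 U wirtinger_imp_continuous[OF W] continuous_on_subset unfolding wirtinger_def by blast+
  \<comment> \<open>Splitting off one factor \<open>r\<close> from \<open>k\<close> turns
    \<open>ln r * k r\<close> into \<open>(r * ln r) * m r\<close>, which is continuous at 0 and
    vanishes there.\<close>
  have km: "k r = r *\<^sub>R m r" for r
    unfolding k_def m_def cmean_def
    by (simp add: scaleR_conv_of_real mult.assoc)
  have cm: "continuous_on {0..1} m"
    unfolding m_def using continuous_on_polar[OF cF(2)]
    by (intro continuous_intros continuous_on_cmean_param) (auto intro!: continuous_intros simp: case_prod_beta)
  define \<Phi> where "\<Phi> r = cmean r F - (2 * (r * ln r)) *\<^sub>R m r" for r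
  have Phi: "\<Phi> r = cmean r F - (2 * ln r) *\<^sub>R k r" for r by (simp add: \<Phi>_def km mult_ac)
  have c\<Phi>: "continuous_on {0..1} \<Phi>"
    unfolding \<Phi>_def by (intro continuous_intros continuous_on_cmean cF cm continuous_on_x_ln_x)
  have WH: "wirtinger U (\<lambda>z. cnj z * Fb z) (\<lambda>z. cnj z * Fbz z) (\<lambda>z. Fb z + cnj z * Fbb z)"
    by (rule wirtinger_cong[OF wirtinger_mult[OF wirtinger_cnj[OF wirtinger_holomorphic[OF holomorphic_on_ident U(1)]] W2] U(1)])
      auto
  have D\<Phi>: "(\<Phi> has_vector_derivative ((- 4 * (r * ln r)) *\<^sub>R cmean r Fbz)) (at r)" if r: "r \<in> {0<..<1}" for r
  proof -
    have r': "0 < r" "r < 1" using r by auto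
    have dk: "(k has_vector_derivative (2 * r) *\<^sub>R cmean r Fbz) (at r)"
    proof -
      have "cmean r (\<lambda>z. z * (cnj z * Fbz z)) = cmean r (\<lambda>z. of_real (r\<^sup>2) * Fbz z)"
        by (rule cmean_cong) (use r' complex_norm_square in \<open>auto simp: mult.assoc[symmetric]\<close>)
      then have "(2 / r) *\<^sub>R cmean r (\<lambda>z. z * (cnj z * Fbz z)) = (2 * r) *\<^sub>R cmean r Fbz"
        using r' by (simp add: cmean_mult_right scaleR_conv_of_real power2_eq_square)
      then show ?thesis
        using has_vector_derivative_cmean(2)[OF WH U(2) r'] unfolding k_def by simp
    qed
    have dl: "((\<lambda>r. 2 * ln r) has_field_derivative (2 / r)) (at r)"
      using r' by (auto intro!: derivative_eq_intros)
    have "((\<lambda>r. cmean r F - (2 * ln r) *\<^sub>R k r) has_vector_derivative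
        ((2 / r) *\<^sub>R k r - ((2 * ln r) *\<^sub>R ((2 * r) *\<^sub>R cmean r Fbz) + (2 / r) *\<^sub>R k r))) (at r)"
      using has_vector_derivative_diff[OF has_vector_derivative_cmean(1)[OF W U(2) r'] has_vector_derivative_scaleR[OF dl dk]]
      unfolding k_def .
    then show ?thesis unfolding Phi[abs_def] by (simp add: mult.commute)
  qed
  have "((\<lambda>r. (- 4 * (r * ln r)) *\<^sub>R cmean r Fbz) has_integral (\<Phi> 1 - \<Phi> 0)) {0..1}"
    by (rule fundamental_theorem_of_calculus_interior[OF _ c\<Phi> D\<Phi>]) auto
  then have "green_int Fbz = \<Phi> 1 - \<Phi> 0" unfolding green_int_def by (rule integral_unique)
  then show ?thesis by (simp add: \<Phi>_def cmean_0)
qed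

section \<open>The Green integral as a positive functional\<close>

lemma green_int_add:
  fixes F G :: "complex \<Rightarrow> 'a::banach"
  assumes "continuous_on (cball 0 1) F" "continuous_on (cball 0 1) G"
  shows "green_int (\<lambda>z. F z + G z) = green_int F + green_int G"
proof -
  have s: "sphere 0 r \<subseteq> cball 0 1" if "r \<in> {0..1}" for r :: real using that by auto
  have "green_int (\<lambda>z. F z + G z) = integral {0..1} (\<lambda>r. (- 4 * (r * ln r)) *\<^sub>R cmean r F + (- 4 * (r * ln r)) *\<^sub>R cmean r G)"
    unfolding green_int_def
    by (rule integral_cong) (use cmean_add[OF continuous_on_subset[OF assms(1) s] continuous_on_subset[OF assms(2) s]] in
        \<open>simp add: scaleR_add_right\<close>)
  also have "\<dots> = green_int F + green_int G"
    unfolding green_int_def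
    by (rule Henstock_Kurzweil_Integration.integral_add)
      (intro integrable_continuous_real continuous_on_green_integrand assms)+
  finally show ?thesis .
qed

lemma green_int_cmult:
  fixes c :: real
  shows "green_int (\<lambda>z. c * F z) = c * green_int F"
  unfolding green_int_def cmean_mult_right real_scaleR_def
  by (simp add: mult.left_commute integral_mult_right[symmetric] del: integral_mult_right)

lemma green_int_cong:
  assumes "\<And>z. cmod z \<le> 1 \<Longrightarrow> F z = G z" shows "green_int F = green_int G"
  unfolding green_int_def
  by (rule integral_cong) (use assms in \<open>auto intro!: arg_cong[where f = "(*) _"] arg_cong[where f = "(*\<^sub>R) _"] cmean_cong\<close>)

lemma green_int_mono:
  fixes F G :: "complex \<Rightarrow> real"
  assumes "continuous_on (cball 0 1) F" "continuous_on (cball 0 1) G"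
    and le: "\<And>z. cmod z \<le> 1 \<Longrightarrow> F z \<le> G z"
  shows "green_int F \<le> green_int G"
  unfolding green_int_def
proof (rule integral_le)
  fix r :: real assume r: "r \<in> {0..1}"
  then have s: "sphere 0 r \<subseteq> cball (0::complex) 1" by auto
  have "r * ln r \<le> 0" using r by (cases "r = 0") (auto intro!: mult_nonneg_nonpos)
  then show "(- 4 * (r * ln r)) *\<^sub>R cmean r F \<le> (- 4 * (r * ln r)) *\<^sub>R cmean r G"
    using cmean_mono[OF continuous_on_subset[OF assms(1) s] continuous_on_subset[OF assms(2) s]] le r
    unfolding real_scaleR_def by (intro mult_left_mono) auto
qed (intro integrable_continuous_real continuous_on_green_integrand assms)+

lemma green_int_nonneg:
  fixes F :: "complex \<Rightarrow> real"
  assumes "continuous_on (cball 0 1) F" "\<And>z. cmod z \<le> 1 \<Longrightarrow> 0 \<le> F z"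
  shows "green_int F \<ge> 0"
proof -
  have "green_int (\<lambda>_. 0 :: real) = 0" unfolding green_int_def by (simp add: cmean_const)
  then show ?thesis using green_int_mono[of "\<lambda>_. 0" F] assms by simp
qed

lemma green_int_Re:
  assumes "continuous_on (cball 0 1) F"
  shows "green_int (\<lambda>z. Re (F z)) = Re (green_int F)"
proof -
  have s: "sphere 0 r \<subseteq> cball 0 1" if "r \<in> {0..1}" for r :: real using that by auto
  have "Re (green_int F) = integral {0..1} (Re \<circ> (\<lambda>r. (- 4 * (r * ln r)) *\<^sub>R cmean r F))"
    unfolding green_int_def
    by (rule integral_linear[symmetric])
      (intro integrable_continuous_real continuous_on_green_integrand assms bounded_linear_Re)+
  also have "\<dots> = green_int (\<lambda>z. Re (F z))"
    unfolding green_int_def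
    by (rule integral_cong) (use cmean_Re[OF continuous_on_subset[OF assms s]] in simp)
  finally show ?thesis by simp
qed

text \<open>The inequality \<open>2 * f * g \<le> s * f^2 + g^2 / s\<close> is integrated and
  \<open>s = sqrt (B / A)\<close> is taken. If \<open>A\<close> or \<open>B\<close> is 0, extreme
  values of \<open>s\<close> force \<open>C \<le> 0\<close>.\<close>

lemma green_int_cauchy_schwarz:
  fixes f g :: "complex \<Rightarrow> real"
  assumes cf: "continuous_on (cball 0 1) f" and cg: "continuous_on (cball 0 1) g"
  shows "green_int (\<lambda>z. f z * g z) \<le> sqrt (green_int (\<lambda>z. (f z)\<^sup>2)) * sqrt (green_int (\<lambda>z. (g z)\<^sup>2))"
proof -
  define A where "A = green_int (\<lambda>z. (f z)\<^sup>2)"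
  define B where "B = green_int (\<lambda>z. (g z)\<^sup>2)"
  define C where "C = green_int (\<lambda>z. f z * g z)"
  have A: "A \<ge> 0" and B: "B \<ge> 0"
    unfolding A_def B_def by (auto intro!: green_int_nonneg continuous_intros assms)
  have am: "2 * C \<le> s * A + (1 / s) * B" if s: "s > 0" for s
  proof -
    have "2 * C = green_int (\<lambda>z. 2 * (f z * g z))" unfolding C_def green_int_cmult ..
    also have "\<dots> \<le> green_int (\<lambda>z. s * (f z)\<^sup>2 + (1 / s) * (g z)\<^sup>2)"
    proof (rule green_int_mono)
      fix z
      have "0 \<le> (s * f z - g z)\<^sup>2 / s" using s by simp
      also have "(s * f z - g z)\<^sup>2 / s = s * (f z)\<^sup>2 + (1 / s) * (g z)\<^sup>2 - 2 * (f z * g z)"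
        using s by (simp add: power2_eq_square field_simps)
      finally show "2 * (f z * g z) \<le> s * (f z)\<^sup>2 + (1 / s) * (g z)\<^sup>2" by simp
    qed (use s in \<open>auto intro!: continuous_intros assms\<close>)
    also have "\<dots> = s * A + (1 / s) * B"
      unfolding A_def B_def
      using s by (subst green_int_add) (auto intro!: continuous_intros assms simp: green_int_cmult green_int_cmult[of "1 / s", simplified])
    finally show ?thesis .
  qed
  show ?thesis
  proof (cases "A > 0 \<and> B > 0")
    case True
    have "2 * C \<le> sqrt (B / A) * A + (1 / sqrt (B / A)) * B" using True by (intro am) auto
    also have "sqrt (B / A) * A = sqrt A * sqrt B"
      using True by (simp add: real_sqrt_divide real_div_sqrt field_simps)
    also have "(1 / sqrt (B / A)) * B = sqrt A * sqrt B"
      using True by (simp add: real_sqrt_divide real_div_sqrt field_simps)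
    finally show ?thesis unfolding A_def B_def C_def by simp
  next
    case False
    then have 0: "A = 0 \<or> B = 0" using A B by auto
    have "C \<le> 0"
    proof (rule ccontr)
      assume "\<not> C \<le> 0"
      then have C: "C > 0" by simp
      show False
      proof (cases "A = 0")
        case True
        have "2 * C \<le> (1 / ((B + 1) / C)) * B" using am[of "(B + 1) / C"] True B C by simp
        also have "\<dots> \<le> C" using B C by (simp add: field_simps)
        finally show False using C by simp
      next
        case False
        then have "B = 0" using 0 by simp
        then have "2 * C \<le> (C / (A + 1)) * A" using am[of "C / (A + 1)"] A C by simp
        also have "\<dots> \<le> C" using A C by (simp add: field_simps)
        finally show False using C by simp
      qed
    qed
    then show ?thesis using 0 unfolding A_def B_def C_def by auto
  qed
qed

section \<open>Littlewood-Paley estimates\<close>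

lemma deriv_cont_cball:
  assumes "f holomorphic_on U" "open U" "cball 0 1 \<subseteq> U"
  shows "continuous_on (cball 0 1) f" "continuous_on (cball 0 1) (deriv f)"
  using assms by (meson continuous_on_subset holomorphic_deriv holomorphic_on_imp_continuous_on)+

text \<open>Green's formula for \<open>f * cnj g\<close>, whose mixed derivative is
  \<open>f' * cnj g'\<close>. It turns inner products over the circle into area integrals, where
  pointwise information from inside the disc can be used.\<close>

lemma littlewood_paley_polar:
  assumes f: "f holomorphic_on U" and g: "g holomorphic_on U" and U: "open U" "cball 0 1 \<subseteq> U"
  shows "cmean 1 (\<lambda>z. f z * cnj (g z)) = f 0 * cnj (g 0) + green_int (\<lambda>z. deriv f z * cnj (deriv g z))"
proof (rule green_formula)
  have W: "wirtinger U (\<lambda>z. cnj (g z)) (\<lambda>z. 0) (\<lambda>z. cnj (deriv g z))"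
    using wirtinger_cnj[OF wirtinger_holomorphic[OF g U(1)]] by simp
  have W': "wirtinger U (\<lambda>z. cnj (deriv g z)) (\<lambda>z. 0) (\<lambda>z. cnj (deriv (deriv g) z))"
    using wirtinger_cnj[OF wirtinger_holomorphic[OF holomorphic_deriv[OF g U(1)] U(1)]] by simp
  show "wirtinger U (\<lambda>z. f z * cnj (g z)) (\<lambda>z. deriv f z * cnj (g z)) (\<lambda>z. f z * cnj (deriv g z))"
    by (rule wirtinger_cong[OF wirtinger_mult[OF wirtinger_holomorphic[OF f U(1)] W] U(1)]) auto
  show "wirtinger U (\<lambda>z. f z * cnj (deriv g z)) (\<lambda>z. deriv f z * cnj (deriv g z)) (\<lambda>z. f z * cnj (deriv (deriv g) z))"
    by (rule wirtinger_cong[OF wirtinger_mult[OF wirtinger_holomorphic[OF f U(1)] W'] U(1)]) auto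
qed (use U in auto)

lemma cmean_norm_sq:
  assumes "continuous_on (sphere 0 1) f"
  shows "cmean 1 (\<lambda>z. f z * cnj (f z)) = of_real (cmean 1 (\<lambda>z. (cmod (f z))\<^sup>2))"
  unfolding complex_norm_square[symmetric]
  by (rule cmean_of_real) (auto intro!: continuous_intros assms)

lemma littlewood_paley:
  assumes f: "f holomorphic_on U" and U: "open U" "cball 0 1 \<subseteq> U"
  shows "cmean 1 (\<lambda>z. (cmod (f z))\<^sup>2) = (cmod (f 0))\<^sup>2 + green_int (\<lambda>z. (cmod (deriv f z))\<^sup>2)"
proof -
  note c = deriv_cont_cball[OF f U]
  have "of_real (cmean 1 (\<lambda>z. (cmod (f z))\<^sup>2)) = f 0 * cnj (f 0) + green_int (\<lambda>z. deriv f z * cnj (deriv f z))"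
    unfolding littlewood_paley_polar[OF f f U, symmetric]
    by (rule cmean_norm_sq[symmetric]) (rule continuous_on_subset[OF c(1)], auto)
  from arg_cong[OF this, of Re]
  have "cmean 1 (\<lambda>z. (cmod (f z))\<^sup>2) = Re (f 0 * cnj (f 0)) + Re (green_int (\<lambda>z. deriv f z * cnj (deriv f z)))"
    by (simp del: complex_mult_cnj)
  also have "Re (green_int (\<lambda>z. deriv f z * cnj (deriv f z))) = green_int (\<lambda>z. Re (deriv f z * cnj (deriv f z)))"
    by (rule green_int_Re[symmetric]) (intro continuous_intros c)
  finally show ?thesis unfolding complex_norm_square[symmetric] by simp
qed

lemma green_int_deriv_sq_le:
  assumes f: "f holomorphic_on U" and U: "open U" "cball 0 1 \<subseteq> U"
  shows "green_int (\<lambda>z. (cmod (deriv f z))\<^sup>2) \<le> cmean 1 (\<lambda>z. (cmod (f z))\<^sup>2)"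
  using littlewood_paley[OF assms] by simp

lemma cmean_nonneg:
  fixes F :: "complex \<Rightarrow> real"
  assumes "continuous_on (sphere 0 r) F" "r \<ge> 0" "\<And>z. cmod z = r \<Longrightarrow> 0 \<le> F z"
  shows "cmean r F \<ge> 0"
  using cmean_mono[of r "\<lambda>_. 0" F] assms by (simp add: cmean_const)

text \<open>In the application \<open>\<theta> = r * b\<close> with \<open>b\<close> inner. The
  factor \<open>r < 1\<close> keeps \<open>u = 1 - |\<theta>|^2\<close> away from 0 on the closed
  disc, so \<open>ln u\<close> and \<open>1 / u\<close> are smooth up to the circle, where
  \<open>- ln u\<close> has the constant value \<open>L\<close>.\<close>

locale contraction =
  fixes U :: "complex set" and \<theta> :: "complex \<Rightarrow> complex" and r :: real
  assumes U: "open U" "cball 0 1 \<subseteq> U" and th: "\<theta> holomorphic_on U"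
    and th_less: "\<And>z. z \<in> U \<Longrightarrow> cmod (\<theta> z) < 1"
    and th_bd: "\<And>z. cmod z = 1 \<Longrightarrow> cmod (\<theta> z) = r" and r: "0 < r" "r < 1"
begin

definition "u z = 1 - (cmod (\<theta> z))\<^sup>2"
definition "L = - ln (1 - r\<^sup>2)"
abbreviation "u' z \<equiv> complex_of_real (u z)"

lemma u_eq: "u' z = 1 - \<theta> z * cnj (\<theta> z)"
  unfolding u_def using complex_norm_square[of "\<theta> z"] by simp

lemma u_pos: "z \<in> U \<Longrightarrow> u z > 0" and u_le: "u z \<le> 1"
  using th_less[of z] by (auto simp: u_def abs_square_less_1)

lemma u_bd: "cmod z = 1 \<Longrightarrow> u z = 1 - r\<^sup>2"
  by (simp add: u_def th_bd)

lemma mem_U: "cmod z \<le> 1 \<Longrightarrow> z \<in> U"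
  using U(2) by auto

lemmas cont_th = deriv_cont_cball[OF th U]

lemma cont_u: "continuous_on (cball 0 1) u"
  unfolding u_def by (intro continuous_intros cont_th)

lemma cont_ln_u: "continuous_on (cball 0 1) (\<lambda>z. ln (u z))"
  using u_pos mem_U by (intro continuous_intros cont_u) fastforce

lemma cont_inv_u: "continuous_on (cball 0 1) f \<Longrightarrow> continuous_on (cball 0 1) (\<lambda>z. f z / u z)"
  using u_pos mem_U by (intro continuous_intros cont_u) fastforce+

lemmas W_th = wirtinger_holomorphic[OF th U(1)]

lemma W_cth: "wirtinger U (\<lambda>z. cnj (\<theta> z)) (\<lambda>z. 0) (\<lambda>z. cnj (deriv \<theta> z))"
  using wirtinger_cnj[OF W_th] by simp

lemma W_cth': "wirtinger U (\<lambda>z. cnj (deriv \<theta> z)) (\<lambda>z. 0) (\<lambda>z. cnj (deriv (deriv \<theta>) z))"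
  using wirtinger_cnj[OF wirtinger_holomorphic[OF holomorphic_deriv[OF th U(1)] U(1)]] by simp

lemma W_u: "wirtinger U u' (\<lambda>z. - deriv \<theta> z * cnj (\<theta> z)) (\<lambda>z. - \<theta> z * cnj (deriv \<theta> z))"
  using wirtinger_diff[OF wirtinger_holomorphic[OF holomorphic_on_const[of 1] U(1)] wirtinger_mult[OF W_th W_cth]]
  by (rule wirtinger_cong[OF _ U(1)]) (auto simp: u_eq)

lemma W_inv_u: "wirtinger U (\<lambda>z. 1 / u' z) (\<lambda>z. deriv \<theta> z * cnj (\<theta> z) / (u' z)\<^sup>2) (\<lambda>z. \<theta> z * cnj (deriv \<theta> z) / (u' z)\<^sup>2)"
proof (rule wirtinger_cong[OF wirtinger_compose[OF W_u, of "\<lambda>w. 1 / w" "- {0}"] U(1)])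
  have d: "deriv (\<lambda>w. 1 / w) w = - 1 / w\<^sup>2" if "w \<noteq> 0" for w :: complex
    by (rule DERIV_imp_deriv) (use that in \<open>auto intro!: derivative_eq_intros simp: power2_eq_square\<close>)
  fix z assume "z \<in> U"
  then have "u z \<noteq> 0" using u_pos[of z] by simp
  then show "deriv (\<lambda>w. 1 / w) (u' z) * (- deriv \<theta> z * cnj (\<theta> z)) = deriv \<theta> z * cnj (\<theta> z) / (u' z)\<^sup>2"
    "deriv (\<lambda>w. 1 / w) (u' z) * (- \<theta> z * cnj (deriv \<theta> z)) = \<theta> z * cnj (deriv \<theta> z) / (u' z)\<^sup>2"
    by (auto simp: d)
next
  fix z assume "z \<in> U" then show "u' z \<in> - {0}" using u_pos[of z] by simp
qed (auto intro!: holomorphic_intros)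

lemma W_ln_u: "wirtinger U (\<lambda>z. complex_of_real (ln (u z))) (\<lambda>z. - deriv \<theta> z * cnj (\<theta> z) / u' z) (\<lambda>z. - \<theta> z * cnj (deriv \<theta> z) / u' z)"
proof (rule wirtinger_cong[OF wirtinger_compose[OF W_u, of Ln "- \<real>\<^sub>\<le>\<^sub>0"] U(1)])
  fix z assume "z \<in> U"
  then have u: "u z > 0" using u_pos[of z] by simp
  then have d: "deriv Ln (u' z) = 1 / u' z"
    by (intro DERIV_imp_deriv) (auto intro!: derivative_eq_intros simp: complex_nonpos_Reals_iff inverse_eq_divide)
  show "Ln (u' z) = complex_of_real (ln (u z))" using u by (simp add: Ln_of_real)
  show "deriv Ln (u' z) * (- deriv \<theta> z * cnj (\<theta> z)) = - deriv \<theta> z * cnj (\<theta> z) / u' z"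
    "deriv Ln (u' z) * (- \<theta> z * cnj (deriv \<theta> z)) = - \<theta> z * cnj (deriv \<theta> z) / u' z"
    by (auto simp: d)
next
  fix z assume "z \<in> U" then show "u' z \<in> - \<real>\<^sub>\<le>\<^sub>0" using u_pos[of z] by (simp add: complex_nonpos_Reals_iff)
qed (auto intro!: holomorphic_intros)

text \<open>The derivative of \<open>- ln u\<close> with respect to the conjugate variable. Its
  z-derivative, computed in \<open>W_w\<close>, is \<open>|\<theta>'|^2 / u^2 \<ge> 0\<close>, so
  \<open>- ln u\<close> is subharmonic.\<close>

definition "w z = \<theta> z * cnj (deriv \<theta> z) / u' z"

lemma W_w: "\<exists>w2. wirtinger U w (\<lambda>z. deriv \<theta> z * cnj (deriv \<theta> z) / (u' z)\<^sup>2) w2"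
proof (rule exI, rule wirtinger_cong[OF wirtinger_mult[OF wirtinger_mult[OF W_th W_cth'] W_inv_u] U(1) _ _ refl])
  fix z assume z: "z \<in> U"
  then have u: "u' z \<noteq> 0" using u_pos[of z] by simp
  have "deriv \<theta> z * cnj (deriv \<theta> z) * u' z + \<theta> z * cnj (deriv \<theta> z) * (deriv \<theta> z * cnj (\<theta> z))
     = deriv \<theta> z * cnj (deriv \<theta> z)"
    unfolding u_eq by (simp add: algebra_simps)
  then show "(deriv \<theta> z * cnj (deriv \<theta> z) + \<theta> z * 0) * (1 / u' z) +
      \<theta> z * cnj (deriv \<theta> z) * (deriv \<theta> z * cnj (\<theta> z) / (u' z)\<^sup>2) = deriv \<theta> z * cnj (deriv \<theta> z) / (u' z)\<^sup>2"
    using u by (simp add: field_simps power2_eq_square)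
qed (simp add: w_def)

lemma cmod_w_le: "z \<in> U \<Longrightarrow> cmod (w z) \<le> cmod (deriv \<theta> z) / u z"
proof -
  assume z: "z \<in> U"
  have "cmod (\<theta> z) * cmod (deriv \<theta> z) / u z \<le> 1 * cmod (deriv \<theta> z) / u z"
    using th_less[OF z] u_pos[OF z] by (intro divide_right_mono mult_right_mono) auto
  then show ?thesis using u_pos[OF z] by (simp add: w_def norm_mult norm_divide)
qed

text \<open>A Carleson embedding whose constant grows only linearly in \<open>L\<close>. Green's
  formula is applied to \<open>(L + ln u) * |x|^2\<close>, which vanishes on the circle. The mixed
  derivative contains \<open>- |\<theta>'|^2 * |x|^2 / u^2\<close>, half of which survives after the
  cross terms have been absorbed.\<close>

lemma carleson_log:
  assumes x: "x holomorphic_on U"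
  shows "green_int (\<lambda>z. (cmod (deriv \<theta> z) * cmod (x z) / u z)\<^sup>2) \<le> 2 * (L + 2) * cmean 1 (\<lambda>z. (cmod (x z))\<^sup>2)"
proof -
  define F where "F z = (of_real (L + ln (u z))) * (x z * cnj (x z))" for z
  define Fb where "Fb z = - w z * (x z * cnj (x z)) + of_real (L + ln (u z)) * (x z * cnj (deriv x z))" for z
  define Fbz where "Fbz z = - (deriv \<theta> z * cnj (deriv \<theta> z) / (u' z)\<^sup>2) * (x z * cnj (x z)) - w z * (deriv x z * cnj (x z))
      - cnj (w z) * (x z * cnj (deriv x z)) + of_real (L + ln (u z)) * (deriv x z * cnj (deriv x z))" for z
  note Wx = wirtinger_holomorphic[OF x U(1)]
  have Wcx: "wirtinger U (\<lambda>z. cnj (x z)) (\<lambda>z. 0) (\<lambda>z. cnj (deriv x z))"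
    using wirtinger_cnj[OF Wx] by simp
  have Wcx': "wirtinger U (\<lambda>z. cnj (deriv x z)) (\<lambda>z. 0) (\<lambda>z. cnj (deriv (deriv x) z))"
    using wirtinger_cnj[OF wirtinger_holomorphic[OF holomorphic_deriv[OF x U(1)] U(1)]] by simp
  have WL: "wirtinger U (\<lambda>z. of_real (L + ln (u z))) (\<lambda>z. - cnj (w z)) (\<lambda>z. - w z)"
    by (rule wirtinger_cong[OF wirtinger_add[OF wirtinger_holomorphic[OF holomorphic_on_const[of "of_real L"] U(1)] W_ln_u] U(1)])
      (auto simp: w_def)
  obtain w2 where Ww: "wirtinger U w (\<lambda>z. deriv \<theta> z * cnj (deriv \<theta> z) / (u' z)\<^sup>2) w2" using W_w by blast
  have 1: "wirtinger U F (\<lambda>z. - cnj (w z) * (x z * cnj (x z)) + of_real (L + ln (u z)) * (deriv x z * cnj (x z))) Fb"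
    by (rule wirtinger_cong[OF wirtinger_mult[OF WL wirtinger_mult[OF Wx Wcx]] U(1)])
      (auto simp: F_def Fb_def)
  have 2: "\<exists>Fbb. wirtinger U Fb Fbz Fbb"
    by (rule exI, rule wirtinger_cong[OF wirtinger_diff[OF wirtinger_mult[OF WL wirtinger_mult[OF Wx Wcx']]
            wirtinger_mult[OF Ww wirtinger_mult[OF Wx Wcx]]] U(1) _ _ refl])
      (auto simp: Fb_def Fbz_def algebra_simps)
  have g: "cmean 1 F = F 0 + green_int Fbz" using green_formula[OF 1 _ U] 2 by blast
  note cx = deriv_cont_cball[OF x U]
  have cF: "continuous_on (cball 0 1) Fbz"
    using 2 U(2) unfolding wirtinger_def by (auto intro: continuous_on_subset)
  define A where "A z = (cmod (deriv \<theta> z) * cmod (x z) / u z)\<^sup>2" for z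
  have cA: "continuous_on (cball 0 1) A"
    unfolding A_def by (intro continuous_intros cont_inv_u cont_th cx)
  have "cmean 1 F = cmean 1 (\<lambda>z. 0)"
    by (rule cmean_cong) (auto simp: F_def u_bd L_def)
  then have "0 = Re (F 0) + green_int (\<lambda>z. Re (Fbz z))"
    using arg_cong[OF g, of Re] green_int_Re[OF cF] by (simp add: cmean_const)
  also have "green_int (\<lambda>z. Re (Fbz z)) \<le> green_int (\<lambda>z. (- 1 / 2) * A z + (L + 2) * (cmod (deriv x z))\<^sup>2)"
  proof (rule green_int_mono)
    fix z :: complex assume "cmod z \<le> 1"
    then have zU: "z \<in> U" by (rule mem_U)
    define a where "a = cmod (deriv \<theta> z) * cmod (x z) / u z"
    define b where "b = cmod (deriv x z)"
    have u: "u z > 0" by (rule u_pos[OF zU])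
    have b1: "cmod (w z * (deriv x z * cnj (x z))) \<le> a * b"
      using mult_right_mono[OF cmod_w_le[OF zU], of "b * cmod (x z)"]
      by (simp add: norm_mult a_def b_def mult_ac)
    have b2: "cmod (cnj (w z) * (x z * cnj (deriv x z))) \<le> a * b"
      using b1 by (simp add: norm_mult mult_ac)
    have "Re (Fbz z) = - a\<^sup>2 - Re (w z * (deriv x z * cnj (x z))) - Re (cnj (w z) * (x z * cnj (deriv x z))) + (L + ln (u z)) * b\<^sup>2"
    proof -
      have "deriv \<theta> z * cnj (deriv \<theta> z) / (u' z)\<^sup>2 * (x z * cnj (x z)) = of_real (a\<^sup>2)"
        unfolding a_def complex_norm_square[symmetric] by (simp add: power_mult_distrib power_divide)
      moreover have "of_real (L + ln (u z)) * (deriv x z * cnj (deriv x z)) = of_real ((L + ln (u z)) * b\<^sup>2)"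
        unfolding b_def complex_norm_square[symmetric] by simp
      ultimately show ?thesis unfolding Fbz_def by (simp del: of_real_mult of_real_power complex_mult_cnj)
    qed
    also have "\<dots> \<le> - a\<^sup>2 + 2 * (a * b) + L * b\<^sup>2"
    proof -
      have "(L + ln (u z)) * b\<^sup>2 \<le> L * b\<^sup>2"
        using u u_le[of z] by (intro mult_right_mono) auto
      then show ?thesis
        using b1 b2 abs_Re_le_cmod[of "w z * (deriv x z * cnj (x z))"] abs_Re_le_cmod[of "cnj (w z) * (x z * cnj (deriv x z))"]
        by linarith
    qed
    also have "\<dots> \<le> (- 1 / 2) * a\<^sup>2 + (L + 2) * b\<^sup>2"
    proof -
      have "0 \<le> (a / 2 - b)\<^sup>2" by simp
      then show ?thesis by (simp add: power2_eq_square algebra_simps)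
    qed
    finally show "Re (Fbz z) \<le> (- 1 / 2) * A z + (L + 2) * (cmod (deriv x z))\<^sup>2"
      unfolding A_def a_def b_def .
  qed (auto intro!: continuous_intros cF cA cx)
  also have "green_int (\<lambda>z. (- 1 / 2) * A z + (L + 2) * (cmod (deriv x z))\<^sup>2)
      = (- 1 / 2) * green_int A + (L + 2) * green_int (\<lambda>z. (cmod (deriv x z))\<^sup>2)"
    by (subst green_int_add) (auto intro!: continuous_intros cA cx simp: green_int_cmult[of "-1/2", simplified] green_int_cmult)
  also have "Re (F 0) \<le> (L + 2) * (cmod (x 0))\<^sup>2"
  proof -
    have "Re (F 0) = (L + ln (u 0)) * (cmod (x 0))\<^sup>2"
      unfolding F_def complex_norm_square[symmetric] by simp
    also have "\<dots> \<le> (L + 2) * (cmod (x 0))\<^sup>2"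
      using u_pos[of 0] u_le[of 0] mem_U[of 0] by (intro mult_right_mono) (auto intro: order_trans[of _ 0])
    finally show ?thesis .
  qed
  finally have "green_int A \<le> 2 * ((L + 2) * ((cmod (x 0))\<^sup>2 + green_int (\<lambda>z. (cmod (deriv x z))\<^sup>2)))"
    by (simp add: algebra_simps)
  then show ?thesis unfolding A_def littlewood_paley[OF x U] by (simp only: mult.assoc)
qed

end

text \<open>A pair \<open>x\<close>, \<open>Y\<close> as below is what membership of \<open>x\<close> in the model space of \<open>\<theta> / r\<close> amounts to.\<close>

locale model_pair = contraction +
  fixes x Y :: "complex \<Rightarrow> complex"
  assumes x: "x holomorphic_on U" and Y: "Y holomorphic_on U"
    and bd: "\<And>z. cmod z = 1 \<Longrightarrow> of_real r * Y z = \<theta> z * cnj (x z)" and Y0: "Y 0 = 0"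
begin

definition "n = cmean 1 (\<lambda>z. (cmod (x z))\<^sup>2)"

lemmas cont_x = deriv_cont_cball[OF x U] and cont_Y = deriv_cont_cball[OF Y U]

lemma bd': assumes "cmod z = 1"
  shows "cmod (Y z) = cmod (x z)" "\<theta> z * cnj (Y z) = of_real r * x z" "Y z * cnj (\<theta> z) = of_real r * cnj (x z)"
proof -
  have "r * cmod (Y z) = r * cmod (x z)"
    using arg_cong[OF bd[OF assms], of cmod] th_bd[OF assms] r by (simp add: norm_mult)
  then show "cmod (Y z) = cmod (x z)" using r by simp
  have tt: "\<theta> z * cnj (\<theta> z) = (of_real r)\<^sup>2"
    using complex_norm_square[of "\<theta> z"] th_bd[OF assms] by simp
  have "of_real r * (Y z * cnj (\<theta> z)) = (\<theta> z * cnj (\<theta> z)) * cnj (x z)"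
    using bd[OF assms] by (simp add: mult_ac)
  also have "\<dots> = of_real r * (of_real r * cnj (x z))" unfolding tt by (simp add: power2_eq_square)
  finally show *: "Y z * cnj (\<theta> z) = of_real r * cnj (x z)" using r by simp
  show "\<theta> z * cnj (Y z) = of_real r * x z" using arg_cong[OF *, of cnj] by (simp add: mult.commute)
qed

lemma n_Y: "cmean 1 (\<lambda>z. (cmod (Y z))\<^sup>2) = n"
  unfolding n_def by (rule cmean_cong) (auto simp: bd')

lemma n_nonneg: "n \<ge> 0"
  unfolding n_def
  by (rule cmean_nonneg) (auto intro!: continuous_intros continuous_on_subset[OF cont_x(1)])

lemma green_x: "green_int (\<lambda>z. (cmod (deriv x z))\<^sup>2) \<le> n" and green_Y: "green_int (\<lambda>z. (cmod (deriv Y z))\<^sup>2) \<le> n"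
  using green_int_deriv_sq_le[OF x U] green_int_deriv_sq_le[OF Y U] n_Y by (simp_all add: n_def)

text \<open>\<open>\<theta>' * Y = (\<theta> * Y)' - \<theta> * Y'\<close>, and
  \<open>\<theta> * Y\<close> and \<open>Y\<close> both have squared norm at most \<open>n\<close>.
  In contrast to \<open>carleson_log\<close> no \<open>L\<close> appears, because there is no
  division by \<open>u\<close>.\<close>

lemma green_theta_Y: "green_int (\<lambda>z. (cmod (deriv \<theta> z) * cmod (Y z))\<^sup>2) \<le> 4 * n"
proof -
  have h: "(\<lambda>z. \<theta> z * Y z) holomorphic_on U" by (intro holomorphic_intros th Y)
  have d: "deriv (\<lambda>z. \<theta> z * Y z) z = deriv \<theta> z * Y z + \<theta> z * deriv Y z" if "z \<in> U" for z
    using holomorphic_derivI[OF th U(1) that] holomorphic_derivI[OF Y U(1) that]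
    by (intro DERIV_imp_deriv) (auto intro!: derivative_eq_intros)
  have "green_int (\<lambda>z. (cmod (deriv \<theta> z) * cmod (Y z))\<^sup>2)
      \<le> green_int (\<lambda>z. 2 * (cmod (deriv (\<lambda>z. \<theta> z * Y z) z))\<^sup>2 + 2 * (cmod (deriv Y z))\<^sup>2)"
  proof (rule green_int_mono)
    fix z :: complex assume "cmod z \<le> 1"
    then have zU: "z \<in> U" by (rule mem_U)
    define a where "a = cmod (deriv (\<lambda>z. \<theta> z * Y z) z)"
    define b where "b = cmod (deriv Y z)"
    have "cmod (deriv \<theta> z) * cmod (Y z) = cmod (deriv (\<lambda>z. \<theta> z * Y z) z - \<theta> z * deriv Y z)"
      unfolding d[OF zU] by (simp add: norm_mult)
    also have "\<dots> \<le> a + cmod (\<theta> z) * b"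
      unfolding a_def b_def norm_mult[symmetric] by (rule norm_triangle_ineq4)
    also have "\<dots> \<le> a + 1 * b"
      using th_less[OF zU] by (intro add_left_mono mult_right_mono) (auto simp: b_def)
    finally have "(cmod (deriv \<theta> z) * cmod (Y z))\<^sup>2 \<le> (a + b)\<^sup>2"
      by (intro power_mono) auto
    also have "\<dots> \<le> 2 * a\<^sup>2 + 2 * b\<^sup>2"
      using zero_le_power2[of "a - b"] by (simp add: power2_eq_square algebra_simps)
    finally show "(cmod (deriv \<theta> z) * cmod (Y z))\<^sup>2 \<le> 2 * (cmod (deriv (\<lambda>z. \<theta> z * Y z) z))\<^sup>2 + 2 * (cmod (deriv Y z))\<^sup>2"
      unfolding a_def b_def .
  qed (intro continuous_intros cont_th cont_Y deriv_cont_cball(2)[OF h U])+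
  also have "\<dots> = 2 * green_int (\<lambda>z. (cmod (deriv (\<lambda>z. \<theta> z * Y z) z))\<^sup>2) + 2 * green_int (\<lambda>z. (cmod (deriv Y z))\<^sup>2)"
    by (subst green_int_add) (auto intro!: continuous_intros cont_Y deriv_cont_cball(2)[OF h U] simp: green_int_cmult)
  also have "green_int (\<lambda>z. (cmod (deriv (\<lambda>z. \<theta> z * Y z) z))\<^sup>2) \<le> cmean 1 (\<lambda>z. (cmod (\<theta> z * Y z))\<^sup>2)"
    by (rule green_int_deriv_sq_le[OF h U])
  also have "\<dots> \<le> cmean 1 (\<lambda>z. (cmod (Y z))\<^sup>2)"
  proof (rule cmean_mono)
    fix z :: complex assume z: "cmod z = 1"
    then have "cmod (\<theta> z) * cmod (Y z) \<le> 1 * cmod (Y z)" using th_bd r by (intro mult_right_mono) auto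
    then show "(cmod (\<theta> z * Y z))\<^sup>2 \<le> (cmod (Y z))\<^sup>2" by (auto simp: norm_mult intro!: power_mono)
  qed (auto intro!: continuous_intros continuous_on_subset[OF cont_Y(1)] continuous_on_subset[OF cont_th(1)])
  finally show ?thesis using green_Y n_Y by simp
qed

text \<open>\<open>(p, q)\<close> solves \<open>x = p + \<theta> * q\<close>,
  \<open>cnj Y = q + cnj \<theta> * p\<close>. On the circle it equals
  \<open>(x, cnj Y) / (1 + r)\<close>, so the division by \<open>u\<close> does no harm there
  although \<open>u\<close> is small.\<close>

definition "p z = (x z - \<theta> z * cnj (Y z)) / u' z"
definition "q z = (cnj (Y z) - cnj (\<theta> z) * x z) / u' z"

lemmas W_x = wirtinger_holomorphic[OF x U(1)] and W_Y = wirtinger_holomorphic[OF Y U(1)]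

lemma W_cx: "wirtinger U (\<lambda>z. cnj (x z)) (\<lambda>z. 0) (\<lambda>z. cnj (deriv x z))"
  and W_cY: "wirtinger U (\<lambda>z. cnj (Y z)) (\<lambda>z. 0) (\<lambda>z. cnj (deriv Y z))"
  using wirtinger_cnj[OF W_x] wirtinger_cnj[OF W_Y] by simp_all

lemma W_cx': "wirtinger U (\<lambda>z. cnj (deriv x z)) (\<lambda>z. 0) (\<lambda>z. cnj (deriv (deriv x) z))"
  and W_cY': "wirtinger U (\<lambda>z. cnj (deriv Y z)) (\<lambda>z. 0) (\<lambda>z. cnj (deriv (deriv Y) z))"
  using wirtinger_cnj[OF wirtinger_holomorphic[OF holomorphic_deriv[OF x U(1)] U(1)]]
    wirtinger_cnj[OF wirtinger_holomorphic[OF holomorphic_deriv[OF Y U(1)] U(1)]] by simp_all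

lemma u'_nz: "z \<in> U \<Longrightarrow> u' z \<noteq> 0" using u_pos[of z] by simp

lemma xp: "z \<in> U \<Longrightarrow> x z = p z + \<theta> z * q z" and yq: "z \<in> U \<Longrightarrow> cnj (Y z) = q z + cnj (\<theta> z) * p z"
proof -
  assume z: "z \<in> U"
  have "p z + \<theta> z * q z = (x z * (1 - \<theta> z * cnj (\<theta> z))) / u' z"
    unfolding p_def q_def by (simp add: add_divide_distrib[symmetric] algebra_simps)
  then show "x z = p z + \<theta> z * q z" using u'_nz[OF z] unfolding u_eq[symmetric] by simp
  have "q z + cnj (\<theta> z) * p z = (cnj (Y z) * (1 - \<theta> z * cnj (\<theta> z))) / u' z"
    unfolding p_def q_def by (simp add: add_divide_distrib[symmetric] algebra_simps)
  then show "cnj (Y z) = q z + cnj (\<theta> z) * p z" using u'_nz[OF z] unfolding u_eq[symmetric] by simp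
qed

text \<open>The derivatives of \<open>x\<close> and of \<open>cnj Y\<close> with the contributions
  of \<open>\<theta>'\<close> removed; by \<open>W_p\<close> and \<open>W_q\<close> all first
  derivatives of \<open>p\<close> and \<open>q\<close> are \<open>A / u\<close> and
  \<open>B / u\<close>, possibly times \<open>- \<theta>\<close> or
  \<open>- cnj \<theta>\<close>.\<close>

definition "A z = deriv x z - deriv \<theta> z * q z"
definition "B z = cnj (deriv Y z) - cnj (deriv \<theta> z) * p z"

lemma W_p: "wirtinger U p (\<lambda>z. A z / u' z) (\<lambda>z. - \<theta> z * B z / u' z)"
proof (rule wirtinger_cong[OF wirtinger_mult[OF wirtinger_diff[OF W_x wirtinger_mult[OF W_th W_cY]] W_inv_u] U(1)])
  fix z assume z: "z \<in> U"
  show "(x z - \<theta> z * cnj (Y z)) * (1 / u' z) = p z" by (simp add: p_def)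
  have e: "x z - \<theta> z * cnj (Y z) = p z * u' z" using u'_nz[OF z] by (simp add: p_def)
  show "(deriv x z - (deriv \<theta> z * cnj (Y z) + \<theta> z * 0)) * (1 / u' z) +
     (x z - \<theta> z * cnj (Y z)) * (deriv \<theta> z * cnj (\<theta> z) / (u' z)\<^sup>2) = A z / u' z"
    unfolding e unfolding A_def yq[OF z] using u'_nz[OF z] by (simp add: field_simps power2_eq_square)
  show "(0 - (0 * cnj (Y z) + \<theta> z * cnj (deriv Y z))) * (1 / u' z) +
     (x z - \<theta> z * cnj (Y z)) * (\<theta> z * cnj (deriv \<theta> z) / (u' z)\<^sup>2) = - \<theta> z * B z / u' z"
    unfolding e B_def using u'_nz[OF z] by (simp add: field_simps power2_eq_square)
qed

lemma W_q: "wirtinger U q (\<lambda>z. - cnj (\<theta> z) * A z / u' z) (\<lambda>z. B z / u' z)"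
proof (rule wirtinger_cong[OF wirtinger_mult[OF wirtinger_diff[OF W_cY wirtinger_mult[OF W_cth W_x]] W_inv_u] U(1)])
  fix z assume z: "z \<in> U"
  show "(cnj (Y z) - cnj (\<theta> z) * x z) * (1 / u' z) = q z" by (simp add: q_def)
  have e: "cnj (Y z) - cnj (\<theta> z) * x z = q z * u' z" using u'_nz[OF z] by (simp add: q_def)
  show "(0 - (0 * x z + cnj (\<theta> z) * deriv x z)) * (1 / u' z) +
     (cnj (Y z) - cnj (\<theta> z) * x z) * (deriv \<theta> z * cnj (\<theta> z) / (u' z)\<^sup>2) = - cnj (\<theta> z) * A z / u' z"
    unfolding e A_def using u'_nz[OF z] by (simp add: field_simps power2_eq_square)
  show "(cnj (deriv Y z) - (cnj (deriv \<theta> z) * x z + cnj (\<theta> z) * 0)) * (1 / u' z) +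
     (cnj (Y z) - cnj (\<theta> z) * x z) * (\<theta> z * cnj (deriv \<theta> z) / (u' z)\<^sup>2) = B z / u' z"
    unfolding e unfolding B_def xp[OF z] using u'_nz[OF z] by (simp add: field_simps power2_eq_square)
qed

lemma cont_p: "continuous_on (cball 0 1) p" and cont_q: "continuous_on (cball 0 1) q"
  using W_p W_q wirtinger_imp_continuous U(2) continuous_on_subset by blast+

text \<open>
  \<open>E = cnj x * p + Y * q\<close> is the squared norm of \<open>(x, cnj Y)\<close> for the inverse of the matrix
  with rows \<open>(1, \<theta>)\<close> and \<open>(cnj \<theta>, 1)\<close>; it is subharmonic.
\<close>

lemma green_B: "green_int (\<lambda>z. (cmod (B z))\<^sup>2) \<le> 2 * n"
proof -
  define E where "E z = cnj (x z) * p z + Y z * q z" for z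
  define Eb where "Eb z = cnj (deriv x z) * p z + cnj (q z) * B z" for z
  \<comment> \<open>The mixed derivative of \<open>E\<close> is nonnegative and, since
    \<open>u \<le> 1\<close>, at least \<open>|B|^2\<close>. Its Green integral is at most the
    boundary mean of \<open>E\<close>, because \<open>E 0\<close> is nonnegative.\<close>
  define Ebz where "Ebz z = complex_of_real (((cmod (A z))\<^sup>2 + (cmod (B z))\<^sup>2) / u z)" for z
  have WB: "wirtinger U B (\<lambda>z. - cnj (deriv \<theta> z) * (A z / u' z))
      (\<lambda>z. cnj (deriv (deriv Y) z) - (cnj (deriv (deriv \<theta>) z) * p z + cnj (deriv \<theta> z) * (- \<theta> z * B z / u' z)))"
    by (rule wirtinger_cong[OF wirtinger_diff[OF W_cY' wirtinger_mult[OF W_cth' W_p]] U(1)]) (auto simp: B_def)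
  have cq: "cnj (q z) * u' z = Y z - \<theta> z * cnj (x z)" if "z \<in> U" for z
    using u'_nz[OF that] by (simp add: q_def)
  have 1: "wirtinger U E (\<lambda>z. cnj (x z) * (A z / u' z) + (deriv Y z * q z + Y z * (- cnj (\<theta> z) * A z / u' z))) Eb"
  proof (rule wirtinger_cong[OF wirtinger_add[OF wirtinger_mult[OF W_cx W_p] wirtinger_mult[OF W_Y W_q]] U(1)])
    fix z assume z: "z \<in> U"
    have "cnj (x z) * (- \<theta> z * B z / u' z) + Y z * (B z / u' z) = (Y z - \<theta> z * cnj (x z)) * B z / u' z"
      by (simp add: algebra_simps add_divide_distrib diff_divide_distrib)
    also have "\<dots> = cnj (q z) * B z" unfolding cq[OF z, symmetric] using u'_nz[OF z] by simp
    finally show "cnj (deriv x z) * p z + cnj (x z) * (- \<theta> z * B z / u' z) + (0 * q z + Y z * (B z / u' z)) = Eb z"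
      unfolding Eb_def by (simp add: add.assoc)
  qed (auto simp: E_def)
  have 2: "\<exists>Ebb. wirtinger U Eb Ebz Ebb"
  proof (rule exI, rule wirtinger_cong[OF wirtinger_add[OF wirtinger_mult[OF W_cx' W_p] wirtinger_mult[OF wirtinger_cnj[OF W_q] WB]] U(1) _ _ refl])
    fix z assume z: "z \<in> U"
    have "Ebz z = (A z * cnj (A z) + B z * cnj (B z)) / u' z"
      unfolding Ebz_def by (simp only: of_real_divide of_real_add complex_norm_square)
    also have "\<dots> = A z * (cnj (deriv x z) - cnj (deriv \<theta> z) * cnj (q z)) / u' z + B z * cnj (B z) / u' z"
      by (simp add: A_def add_divide_distrib)
    finally show "0 * p z + cnj (deriv x z) * (A z / u' z) + (cnj (B z / u' z) * B z + cnj (q z) * (- cnj (deriv \<theta> z) * (A z / u' z))) = Ebz z"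
      using u'_nz[OF z] by (simp add: field_simps)
  qed (auto simp: Eb_def)
  have g: "cmean 1 E = E 0 + green_int Ebz" using green_formula[OF 1 _ U] 2 by blast
  have cE: "continuous_on (cball 0 1) Ebz"
    using 2 U(2) unfolding wirtinger_def by (auto intro: continuous_on_subset)
  have cB: "continuous_on (cball 0 1) B"
    using WB wirtinger_imp_continuous U(2) continuous_on_subset by blast
  have r2: "1 - r\<^sup>2 = (1 - r) * (1 + r)" by (simp add: power2_eq_square algebra_simps)
  have "cmean 1 E = cmean 1 (\<lambda>z. of_real ((2 / (1 + r)) * (cmod (x z))\<^sup>2))"
  proof (rule cmean_cong)
    fix z :: complex assume z: "cmod z = 1"
    have uz: "u' z = of_real ((1 - r) * (1 + r))" using u_bd[OF z] r2 by simp
    have pz: "p z = x z / of_real (1 + r)"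
    proof -
      have "p z = of_real (1 - r) * x z / of_real ((1 - r) * (1 + r))"
        unfolding p_def bd'[OF z] uz by (simp add: algebra_simps)
      then show ?thesis using r by simp
    qed
    have qz: "q z = cnj (Y z) / of_real (1 + r)"
    proof -
      have *: "cnj (\<theta> z) * x z = of_real r * cnj (Y z)"
        using arg_cong[OF bd[OF z], of cnj] by simp
      have "q z = of_real (1 - r) * cnj (Y z) / of_real ((1 - r) * (1 + r))"
        unfolding q_def * uz by (simp add: algebra_simps)
      then show ?thesis using r by simp
    qed
    have "E z = (x z * cnj (x z) + Y z * cnj (Y z)) / of_real (1 + r)"
      unfolding E_def pz qz by (simp add: add_divide_distrib mult_ac)
    also have "\<dots> = of_real (((cmod (x z))\<^sup>2 + (cmod (Y z))\<^sup>2) / (1 + r))"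
      unfolding complex_norm_square[symmetric] by simp
    finally show "E z = of_real ((2 / (1 + r)) * (cmod (x z))\<^sup>2)"
      unfolding bd'(1)[OF z] by simp
  qed simp
  also have "\<dots> = of_real (cmean 1 (\<lambda>z. (2 / (1 + r)) * (cmod (x z))\<^sup>2))"
    using r by (intro cmean_of_real) (auto intro!: continuous_intros continuous_on_subset[OF cont_x(1)] simp: sphere_def)
  also have "cmean 1 (\<lambda>z. (2 / (1 + r)) * (cmod (x z))\<^sup>2) = 2 / (1 + r) * n"
    unfolding n_def by (rule cmean_mult_right)
  finally have "2 / (1 + r) * n = Re (E 0) + green_int (\<lambda>z. Re (Ebz z))"
    using arg_cong[OF g, of Re] green_int_Re[OF cE] by simp
  moreover have "Re (E 0) \<ge> 0"
  proof -
    have "E 0 = of_real ((cmod (x 0))\<^sup>2 / u 0)"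
      unfolding E_def p_def using complex_norm_square[of "x 0"] by (simp add: Y0 mult.commute)
    then show ?thesis using u_pos[of 0] mem_U[of 0] by simp
  qed
  moreover have "green_int (\<lambda>z. (cmod (B z))\<^sup>2) \<le> green_int (\<lambda>z. Re (Ebz z))"
  proof (rule green_int_mono)
    fix z :: complex assume "cmod z \<le> 1"
    then have uz: "u z > 0" "u z \<le> 1" using u_pos mem_U u_le by auto
    have "(cmod (B z))\<^sup>2 * u z \<le> ((cmod (A z))\<^sup>2 + (cmod (B z))\<^sup>2) * 1"
      using uz by (intro mult_mono) auto
    then show "(cmod (B z))\<^sup>2 \<le> Re (Ebz z)" using uz unfolding Ebz_def by (simp add: field_simps)
  qed (intro continuous_intros cB cE)+
  moreover have "2 / (1 + r) * n \<le> 2 * n"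
    using n_nonneg r by (intro mult_right_mono) (auto simp: field_simps)
  ultimately show ?thesis by linarith
qed

lemma green_theta_p: "green_int (\<lambda>z. (cmod (deriv \<theta> z) * cmod (p z))\<^sup>2) \<le> 6 * n"
proof -
  have cB: "continuous_on (cball 0 1) B"
    unfolding B_def by (intro continuous_intros cont_Y cont_th cont_p)
  have "green_int (\<lambda>z. (cmod (deriv \<theta> z) * cmod (p z))\<^sup>2)
      \<le> green_int (\<lambda>z. 2 * (cmod (deriv Y z))\<^sup>2 + 2 * (cmod (B z))\<^sup>2)"
  proof (rule green_int_mono)
    fix z :: complex
    have "cmod (deriv \<theta> z) * cmod (p z) = cmod (cnj (deriv Y z) - B z)"
      unfolding B_def by (simp add: norm_mult)
    also have "\<dots> \<le> cmod (deriv Y z) + cmod (B z)"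
      using norm_triangle_ineq4[of "cnj (deriv Y z)" "B z"] by simp
    finally have "(cmod (deriv \<theta> z) * cmod (p z))\<^sup>2 \<le> (cmod (deriv Y z) + cmod (B z))\<^sup>2"
      by (intro power_mono) auto
    also have "\<dots> \<le> 2 * (cmod (deriv Y z))\<^sup>2 + 2 * (cmod (B z))\<^sup>2"
      using zero_le_power2[of "cmod (deriv Y z) - cmod (B z)"] by (simp add: power2_eq_square algebra_simps)
    finally show "(cmod (deriv \<theta> z) * cmod (p z))\<^sup>2 \<le> 2 * (cmod (deriv Y z))\<^sup>2 + 2 * (cmod (B z))\<^sup>2" .
  qed (intro continuous_intros cont_th cont_p cont_Y cB)+
  also have "\<dots> = 2 * green_int (\<lambda>z. (cmod (deriv Y z))\<^sup>2) + 2 * green_int (\<lambda>z. (cmod (B z))\<^sup>2)"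
    by (subst green_int_add) (auto intro!: continuous_intros cont_Y cB simp: green_int_cmult)
  finally show ?thesis using green_Y green_B by simp
qed

text \<open>Green's formula for \<open>- ln u * x * d\<close>, where \<open>d\<close> stands in for
  \<open>cnj x\<close>. On the circle \<open>d = (1 - r) * cnj x\<close>, so the boundary term is
  \<open>L * (1 - r) * n\<close> rather than the useless \<open>L * n\<close>, while the mixed
  derivative keeps the leading term \<open>- ln u * |x'|^2\<close>. Every remaining term is a
  product in which one factor costs \<open>sqrt (2 * (L + 2) * n)\<close> by
  \<open>carleson_log\<close> and the other only O(sqrt n).\<close>

theorem log_weighted_energy:
  "- ln (u 0) * (cmod (x 0))\<^sup>2 + green_int (\<lambda>z. - ln (u z) * (cmod (deriv x z))\<^sup>2)
    \<le> (L * (1 - r) + 11 * sqrt (2 * (L + 2))) * n"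
proof -
  define d where "d z = cnj (x z) - cnj (\<theta> z) * Y z" for z
  define K where "K z = of_real (- ln (u z)) * (x z * d z)" for z
  define Kb where "Kb z = w z * (x z * d z) + of_real (- ln (u z)) * (x z * (cnj (deriv x z) - cnj (deriv \<theta> z) * Y z))" for z
  define R where "R z = deriv \<theta> z * cnj (deriv \<theta> z) / (u' z)\<^sup>2 * (x z * d z)
      + w z * (deriv x z * d z - x z * (cnj (\<theta> z) * deriv Y z))
      + cnj (w z) * (x z * (cnj (deriv x z) - cnj (deriv \<theta> z) * Y z))
      - of_real (- ln (u z)) * (cnj (deriv \<theta> z) * (deriv x z * Y z + x z * deriv Y z))" for z
  define Kbz where "Kbz z = of_real (- ln (u z)) * (deriv x z * cnj (deriv x z)) + R z" for z
  obtain w2 where Ww: "wirtinger U w (\<lambda>z. deriv \<theta> z * cnj (deriv \<theta> z) / (u' z)\<^sup>2) w2" using W_w by blast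
  have Wd: "wirtinger U d (\<lambda>z. - cnj (\<theta> z) * deriv Y z) (\<lambda>z. cnj (deriv x z) - cnj (deriv \<theta> z) * Y z)"
    by (rule wirtinger_cong[OF wirtinger_diff[OF W_cx wirtinger_mult[OF W_cth W_Y]] U(1)]) (auto simp: d_def)
  have Wl: "wirtinger U (\<lambda>z. of_real (- ln (u z))) (\<lambda>z. cnj (w z)) w"
    by (rule wirtinger_cong[OF wirtinger_diff[OF wirtinger_holomorphic[OF holomorphic_on_const[of 0] U(1)] W_ln_u] U(1)])
      (auto simp: w_def)
  have Wd2: "wirtinger U (\<lambda>z. cnj (deriv x z) - cnj (deriv \<theta> z) * Y z) (\<lambda>z. - cnj (deriv \<theta> z) * deriv Y z)
      (\<lambda>z. cnj (deriv (deriv x) z) - cnj (deriv (deriv \<theta>) z) * Y z)"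
    by (rule wirtinger_cong[OF wirtinger_diff[OF W_cx' wirtinger_mult[OF W_cth' W_Y]] U(1)]) auto
  have 1: "wirtinger U K (\<lambda>z. cnj (w z) * (x z * d z) + of_real (- ln (u z)) * (deriv x z * d z + x z * (- cnj (\<theta> z) * deriv Y z))) Kb"
    by (rule wirtinger_cong[OF wirtinger_mult[OF Wl wirtinger_mult[OF W_x Wd]] U(1)]) (auto simp: K_def Kb_def)
  have 2: "\<exists>Kbb. wirtinger U Kb Kbz Kbb"
    by (rule exI, rule wirtinger_cong[OF wirtinger_add[OF wirtinger_mult[OF Ww wirtinger_mult[OF W_x Wd]]
            wirtinger_mult[OF Wl wirtinger_mult[OF W_x Wd2]]] U(1) _ _ refl])
      (auto simp: Kb_def Kbz_def R_def algebra_simps)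
  have g: "cmean 1 K = K 0 + green_int Kbz" using green_formula[OF 1 _ U] 2 by blast
  have cK: "continuous_on (cball 0 1) Kbz"
    using 2 U(2) unfolding wirtinger_def by (auto intro: continuous_on_subset)
  have cu: "continuous_on (cball 0 1) (\<lambda>z. complex_of_real (ln (u z)))"
    by (intro continuous_on_of_real cont_ln_u)
  have cR: "continuous_on (cball 0 1) R"
  proof -
    have "R = (\<lambda>z. Kbz z + of_real (ln (u z)) * (deriv x z * cnj (deriv x z)))"
      by (auto simp: Kbz_def)
    then show ?thesis by (auto intro!: continuous_intros cK cu cont_x)
  qed
  have "cmean 1 K = cmean 1 (\<lambda>z. of_real ((L * (1 - r)) * (cmod (x z))\<^sup>2))"
  proof (rule cmean_cong)
    fix z :: complex assume z: "cmod z = 1"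
    have dz: "d z = of_real (1 - r) * cnj (x z)"
      unfolding d_def using bd'(3)[OF z] by (simp add: algebra_simps)
    have "K z = of_real L * of_real (1 - r) * (x z * cnj (x z))"
      unfolding K_def u_bd[OF z] dz L_def by (simp add: mult_ac)
    then show "K z = of_real ((L * (1 - r)) * (cmod (x z))\<^sup>2)"
      unfolding complex_norm_square[symmetric] by simp
  qed simp
  also have "\<dots> = of_real (cmean 1 (\<lambda>z. (L * (1 - r)) * (cmod (x z))\<^sup>2))"
    by (rule cmean_of_real) (auto intro!: continuous_intros continuous_on_subset[OF cont_x(1)] simp: sphere_def)
  also have "cmean 1 (\<lambda>z. (L * (1 - r)) * (cmod (x z))\<^sup>2) = L * (1 - r) * n"
    unfolding n_def by (rule cmean_mult_right)
  finally have id: "L * (1 - r) * n = Re (K 0) + green_int (\<lambda>z. Re (Kbz z))"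
    using arg_cong[OF g, of Re] green_int_Re[OF cK] by simp
  have K0: "Re (K 0) = - ln (u 0) * (cmod (x 0))\<^sup>2"
  proof -
    have "K 0 = of_real (- ln (u 0) * (cmod (x 0))\<^sup>2)"
      unfolding K_def d_def of_real_mult complex_norm_square by (simp add: Y0)
    then show ?thesis by simp
  qed
  have "green_int (\<lambda>z. Re (Kbz z)) = green_int (\<lambda>z. - ln (u z) * (cmod (deriv x z))\<^sup>2 + Re (R z))"
  proof (rule green_int_cong)
    fix z
    have "of_real (- ln (u z)) * (deriv x z * cnj (deriv x z)) = complex_of_real (- ln (u z) * (cmod (deriv x z))\<^sup>2)"
      unfolding of_real_mult complex_norm_square ..
    then show "Re (Kbz z) = - ln (u z) * (cmod (deriv x z))\<^sup>2 + Re (R z)"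
      unfolding Kbz_def by (simp only: plus_complex.sel Re_complex_of_real)
  qed
  also have "\<dots> = green_int (\<lambda>z. - ln (u z) * (cmod (deriv x z))\<^sup>2) + green_int (\<lambda>z. Re (R z))"
    by (rule green_int_add) (intro continuous_intros cont_ln_u cont_x cR)+
  finally have id2: "- ln (u 0) * (cmod (x 0))\<^sup>2 + green_int (\<lambda>z. - ln (u z) * (cmod (deriv x z))\<^sup>2)
      = L * (1 - r) * n + (- 1) * green_int (\<lambda>z. Re (R z))" using id K0 by simp
  define a where "a z = cmod (deriv \<theta> z) * cmod (x z) / u z" for z
  define b where "b z = cmod (deriv \<theta> z) * cmod (Y z) / u z" for z
  define P where "P z = cmod (deriv \<theta> z) * cmod (p z)" for z
  define Q where "Q z = cmod (deriv \<theta> z) * cmod (Y z)" for z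
  define X' where "X' z = cmod (deriv x z)" for z
  define Y' where "Y' z = cmod (deriv Y z)" for z
  have ca: "continuous_on (cball 0 1) a" and cb: "continuous_on (cball 0 1) b"
    unfolding a_def b_def by (intro cont_inv_u continuous_intros cont_th cont_x cont_Y)+
  have cP: "continuous_on (cball 0 1) P" and cQ: "continuous_on (cball 0 1) Q"
    and cX': "continuous_on (cball 0 1) X'" and cY': "continuous_on (cball 0 1) Y'"
    unfolding P_def Q_def X'_def Y'_def by (intro continuous_intros cont_th cont_x cont_Y cont_p)+
  have "(- 1) * green_int (\<lambda>z. Re (R z)) = green_int (\<lambda>z. (- 1) * Re (R z))" unfolding green_int_cmult ..
  also have "\<dots> \<le> green_int (\<lambda>z. a z * P z + (a z * Q z + (2 * (a z * X' z) + (2 * (b z * X' z) + 2 * (a z * Y' z)))))"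
  proof (rule green_int_mono)
    fix z :: complex assume "cmod z \<le> 1"
    then have zU: "z \<in> U" by (rule mem_U)
    have u: "u z > 0" "u z \<le> 1" using u_pos[OF zU] u_le by auto
    have t1: "cmod (\<theta> z) \<le> 1" using th_less[OF zU] by simp
    have l: "- ln (u z) \<ge> 0" "- ln (u z) \<le> 1 / u z"
    proof -
      show "- ln (u z) \<ge> 0" using u by simp
      have "ln (1 / u z) \<le> 1 / u z - 1" using u by (intro ln_le_minus_one) auto
      then show "- ln (u z) \<le> 1 / u z" using u by (simp add: ln_div)
    qed
    define wz where "wz = cmod (deriv \<theta> z) / u z"
    have wz: "cmod (w z) \<le> wz" "wz \<ge> 0" using cmod_w_le[OF zU] u by (auto simp: wz_def)
    \<comment> \<open>\<open>d\<close> is \<open>u\<close> times the conjugate of \<open>p\<close>.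
      This removes one of the two powers of \<open>u\<close> from the denominator of the worst term
      and leaves \<open>a * P\<close>.\<close>
    have pd: "cmod (d z) = u z * cmod (p z)"
    proof -
      have "cnj (d z) = p z * u' z" using u'_nz[OF zU] unfolding d_def p_def by simp
      then have "cmod (cnj (d z)) = cmod (p z * u' z)" by simp
      then show ?thesis using u by (simp add: norm_mult mult.commute)
    qed
    have dd: "cmod (d z) \<le> cmod (x z) + cmod (Y z)"
    proof -
      have "cmod (\<theta> z) * cmod (Y z) \<le> 1 * cmod (Y z)" using t1 by (intro mult_right_mono) auto
      then show ?thesis unfolding d_def using norm_triangle_ineq4[of "cnj (x z)" "cnj (\<theta> z) * Y z"] by (simp add: norm_mult)
    qed
    have T1: "cmod (deriv \<theta> z * cnj (deriv \<theta> z) / (u' z)\<^sup>2 * (x z * d z)) = a z * P z"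
      using u pd by (simp add: a_def P_def norm_mult norm_divide norm_power power2_eq_square field_simps)
    have T2: "cmod (w z * (deriv x z * d z - x z * (cnj (\<theta> z) * deriv Y z))) \<le> a z * X' z + b z * X' z + a z * Y' z"
    proof -
      have "cmod (deriv x z * d z - x z * (cnj (\<theta> z) * deriv Y z))
          \<le> cmod (deriv x z) * cmod (d z) + cmod (x z) * (cmod (\<theta> z) * cmod (deriv Y z))"
        using norm_triangle_ineq4[of "deriv x z * d z" "x z * (cnj (\<theta> z) * deriv Y z)"] by (simp add: norm_mult)
      also have "\<dots> \<le> X' z * (cmod (x z) + cmod (Y z)) + cmod (x z) * (1 * Y' z)"
        unfolding X'_def Y'_def using dd t1 by (intro add_mono mult_left_mono mult_right_mono) auto
      finally have "cmod (w z) * cmod (deriv x z * d z - x z * (cnj (\<theta> z) * deriv Y z))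
          \<le> wz * (X' z * (cmod (x z) + cmod (Y z)) + cmod (x z) * (1 * Y' z))"
        using wz by (intro mult_mono) auto
      then show ?thesis unfolding norm_mult a_def b_def wz_def by (simp add: algebra_simps add_divide_distrib)
    qed
    have T3: "cmod (cnj (w z) * (x z * (cnj (deriv x z) - cnj (deriv \<theta> z) * Y z))) \<le> a z * X' z + a z * Q z"
    proof -
      have "cmod (cnj (deriv x z) - cnj (deriv \<theta> z) * Y z) \<le> X' z + Q z"
        unfolding X'_def Q_def using norm_triangle_ineq4[of "cnj (deriv x z)" "cnj (deriv \<theta> z) * Y z"] by (simp add: norm_mult)
      then have "cmod (w z) * (cmod (x z) * cmod (cnj (deriv x z) - cnj (deriv \<theta> z) * Y z)) \<le> wz * (cmod (x z) * (X' z + Q z))"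
        using wz by (intro mult_mono mult_left_mono) auto
      then show ?thesis unfolding norm_mult a_def wz_def by (simp add: algebra_simps add_divide_distrib)
    qed
    have T4: "cmod (of_real (- ln (u z)) * (cnj (deriv \<theta> z) * (deriv x z * Y z + x z * deriv Y z))) \<le> b z * X' z + a z * Y' z"
    proof -
      have "cmod (deriv x z * Y z + x z * deriv Y z) \<le> X' z * cmod (Y z) + cmod (x z) * Y' z"
        unfolding X'_def Y'_def using norm_triangle_ineq[of "deriv x z * Y z" "x z * deriv Y z"] by (simp add: norm_mult)
      then have "(- ln (u z)) * (cmod (deriv \<theta> z) * cmod (deriv x z * Y z + x z * deriv Y z))
          \<le> (1 / u z) * (cmod (deriv \<theta> z) * (X' z * cmod (Y z) + cmod (x z) * Y' z))"
        using l u by (intro mult_mono mult_left_mono) auto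
      moreover have "cmod (of_real (- ln (u z))) = - ln (u z)" using l unfolding norm_of_real by simp
      ultimately show ?thesis unfolding norm_mult a_def b_def
        by (simp add: algebra_simps add_divide_distrib norm_mult del: of_real_minus)
    qed
    have "cmod (R z) \<le> a z * P z + (a z * X' z + b z * X' z + a z * Y' z) + (a z * X' z + a z * Q z) + (b z * X' z + a z * Y' z)"
      unfolding R_def
      by (intro order_trans[OF norm_triangle_ineq4] order_trans[OF norm_triangle_ineq] add_mono order_refl T2 T3 T4 eq_refl[OF T1])
    then show "(- 1) * Re (R z) \<le> a z * P z + (a z * Q z + (2 * (a z * X' z) + (2 * (b z * X' z) + 2 * (a z * Y' z))))"
      using abs_Re_le_cmod[of "R z"] by linarith
  qed (intro continuous_intros cR ca cb cP cQ cX' cY')+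
  also have "\<dots> = green_int (\<lambda>z. a z * P z) + (green_int (\<lambda>z. a z * Q z) + (2 * green_int (\<lambda>z. a z * X' z)
      + (2 * green_int (\<lambda>z. b z * X' z) + 2 * green_int (\<lambda>z. a z * Y' z))))"
    unfolding green_int_cmult[symmetric]
    by (subst green_int_add, ((intro continuous_intros ca cb cP cQ cX' cY')+)[2])+ simp
  \<comment> \<open>The bound \<open>6 * n\<close> for \<open>P\<close> is relaxed to
    \<open>9 * n\<close>, so that the square roots add up to 3 + 2 + 2 + 2 + 2 = 11.\<close>
  also have "\<dots> \<le> sqrt (2 * (L + 2) * n) * sqrt (9 * n) + (sqrt (2 * (L + 2) * n) * sqrt (4 * n)
      + (2 * (sqrt (2 * (L + 2) * n) * sqrt n) + (2 * (sqrt (2 * (L + 2) * n) * sqrt n) + 2 * (sqrt (2 * (L + 2) * n) * sqrt n))))"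
  proof -
    have A: "green_int (\<lambda>z. (a z)\<^sup>2) \<le> 2 * (L + 2) * n" and Bb: "green_int (\<lambda>z. (b z)\<^sup>2) \<le> 2 * (L + 2) * n"
      unfolding a_def b_def using carleson_log[OF x] carleson_log[OF Y] n_Y by (simp_all add: n_def)
    have cs: "green_int (\<lambda>z. f z * h z) \<le> sqrt (2 * (L + 2) * n) * sqrt m"
      if "continuous_on (cball 0 1) f" "continuous_on (cball 0 1) h" "green_int (\<lambda>z. (f z)\<^sup>2) \<le> 2 * (L + 2) * n"
        "green_int (\<lambda>z. (h z)\<^sup>2) \<le> m" for f h m
    proof -
      have "green_int (\<lambda>z. (f z)\<^sup>2) \<ge> 0" "green_int (\<lambda>z. (h z)\<^sup>2) \<ge> 0"
        by (auto intro!: green_int_nonneg continuous_intros that)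
      then show ?thesis
        using green_int_cauchy_schwarz[OF that(1,2)] that(3,4)
        by (elim order_trans) (intro mult_mono, auto)
    qed
    show ?thesis
      using green_theta_p green_theta_Y green_x green_Y n_nonneg
      by (intro add_mono mult_left_mono cs ca cb cP cQ cX' cY' A Bb)
        (auto simp: P_def Q_def X'_def Y'_def)
  qed
  also have "\<dots> = 11 * sqrt (2 * (L + 2)) * n"
  proof -
    have "sqrt (9 * n) = 3 * sqrt n" "sqrt (4 * n) = 2 * sqrt n" unfolding real_sqrt_mult by simp_all
    moreover have "sqrt (2 * (L + 2) * n) * sqrt n = sqrt (2 * (L + 2)) * n"
      using n_nonneg unfolding real_sqrt_mult[of "2 * (L + 2)" n] by (simp add: mult.assoc)
    ultimately show ?thesis by (simp add: algebra_simps)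
  qed
  finally show ?thesis unfolding id2 by (simp add: algebra_simps)
qed

end

section \<open>The Pick matrix estimate\<close>

text \<open>Up to unimodular constants these are the finite Blaschke products; describing them by
  holomorphic extension across the circle avoids factoring them.\<close>

definition smooth_inner :: "(complex \<Rightarrow> complex) \<Rightarrow> bool" where
  "smooth_inner b \<longleftrightarrow> (\<exists>U. open U \<and> cball 0 1 \<subseteq> U \<and> b holomorphic_on U) \<and> (\<forall>z. cmod z = 1 \<longrightarrow> cmod (b z) = 1)"

lemma smooth_innerE:
  assumes "smooth_inner b"
  obtains U where "open U" "cball 0 1 \<subseteq> U" "b holomorphic_on U" "\<And>z. cmod z = 1 \<Longrightarrow> cmod (b z) = 1"
  using assms unfolding smooth_inner_def by blast

lemma smooth_inner_le_1:
  assumes "smooth_inner b" "cmod z \<le> 1"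
  shows "cmod (b z) \<le> 1"
proof -
  obtain U where U: "open U" "cball 0 1 \<subseteq> U" "b holomorphic_on U" "\<And>z. cmod z = 1 \<Longrightarrow> cmod (b z) = 1"
    using smooth_innerE[OF assms(1)] by blast
  show ?thesis
  proof (cases "cmod z = 1")
    case False
    show ?thesis
    proof (rule maximum_modulus_frontier[where S = "ball 0 1" and f = b])
      show "b holomorphic_on interior (ball 0 1)"
        using U(2,3) by (auto elim!: holomorphic_on_subset)
      show "continuous_on (closure (ball 0 1)) b"
        using U(2,3) by (auto intro: continuous_on_subset holomorphic_on_imp_continuous_on)
    qed (use U False assms in \<open>auto simp: frontier_ball\<close>)
  qed (use U(4) in auto)
qed

lemma cmean_sum:
  fixes F :: "'b \<Rightarrow> complex \<Rightarrow> 'a::banach"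
  assumes "\<And>i. i \<in> I \<Longrightarrow> continuous_on (sphere 0 r) (F i)" "r \<ge> 0"
  shows "cmean r (\<lambda>z. \<Sum>i\<in>I. F i z) = (\<Sum>i\<in>I. cmean r (F i))"
  using assms
proof (induction I rule: infinite_finite_induct)
  case (insert i I)
  then show ?case by (simp add: cmean_add continuous_on_sum)
qed (simp_all add: cmean_const)

text \<open>A linear combination of the reproducing kernels of the model space of \<open>b\<close>
  at the points of \<open>A\<close>. If \<open>b\<close> vanishes on \<open>A\<close>, the kernels
  are plain Szego kernels.\<close>

definition model_vec :: "complex set \<Rightarrow> (complex \<Rightarrow> complex) \<Rightarrow> (complex \<Rightarrow> complex) \<Rightarrow> complex \<Rightarrow> complex" where
  "model_vec A d b z = (\<Sum>i\<in>A. d i * (1 - cnj (b i) * b z) / (1 - cnj i * z))"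

text \<open>On the circle this is \<open>b * cnj (model_vec A d b)\<close>
  (\<open>model_vec_conj_bd\<close>), the partner \<open>Y\<close> that \<open>model_pair\<close>
  asks for. The factor \<open>z\<close> makes it vanish at 0.\<close>

definition model_vec_conj :: "complex set \<Rightarrow> (complex \<Rightarrow> complex) \<Rightarrow> (complex \<Rightarrow> complex) \<Rightarrow> complex \<Rightarrow> complex" where
  "model_vec_conj A d b z = z * (\<Sum>i\<in>A. cnj (d i) * (if z = i then deriv b i else (b z - b i) / (z - i)))"

lemma model_vec_conj_bd:
  assumes A: "A \<subseteq> ball 0 1" and z: "cmod z = 1" and b: "cmod (b z) = 1"
  shows "model_vec_conj A d b z = b z * cnj (model_vec A d b z)"
proof -
  have "z * (cnj (d i) * (if z = i then deriv b i else (b z - b i) / (z - i)))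
      = b z * cnj (d i * (1 - cnj (b i) * b z) / (1 - cnj i * z))" if i: "i \<in> A" for i
  proof -
    have zi: "z \<noteq> i" "z \<noteq> 0" using A i z by auto
    have zz: "cnj z = 1 / z" using complex_norm_square[of z] z zi by (simp add: field_simps)
    have bb: "b z * cnj (b z) = 1" using complex_norm_square[of "b z"] b by simp
    have "b z * cnj (d i * (1 - cnj (b i) * b z) / (1 - cnj i * z))
        = cnj (d i) * (b z - b i * (b z * cnj (b z))) / (1 - i * cnj z)"
      by (simp add: algebra_simps)
    also have "\<dots> = cnj (d i) * (b z - b i) / ((z - i) / z)"
      unfolding bb zz using zi by (simp add: field_simps)
    finally show ?thesis using zi by (simp add: mult_ac)
  qed
  then show ?thesis
    unfolding model_vec_conj_def model_vec_def cnj_sum sum_distrib_left by (intro sum.cong) auto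
qed

text \<open>\<open>|b|\<close> may exceed 1 outside the closed disc, so the common domain has to be
  cut down until \<open>|r * b| < 1\<close> holds on it.\<close>

lemma model_vec_domain:
  assumes b: "smooth_inner b" and A: "A \<subseteq> ball 0 1" "finite A" and r: "0 < r" "r < 1"
  obtains U where "open U" "cball 0 1 \<subseteq> U" "b holomorphic_on U" "model_vec A d b holomorphic_on U"
    "model_vec_conj A d b holomorphic_on U" "\<And>z. z \<in> U \<Longrightarrow> cmod (of_real r * b z) < 1"
    "\<And>z i. z \<in> U \<Longrightarrow> i \<in> A \<Longrightarrow> 1 - cnj i * z \<noteq> 0"
proof -
  obtain W where W: "open W" "cball 0 1 \<subseteq> W" "b holomorphic_on W" "\<And>z. cmod z = 1 \<Longrightarrow> cmod (b z) = 1"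
    using smooth_innerE[OF b] by blast
  have cb: "continuous_on W b" using W(3) by (rule holomorphic_on_imp_continuous_on)
  define U where "U = (W \<inter> (\<lambda>z. of_real r * b z) -` ball 0 1) \<inter> (\<Inter>i\<in>A. {z. 1 - cnj i * z \<noteq> 0})"
  have "open (W \<inter> (\<lambda>z. of_real r * b z) -` ball 0 1)"
    by (rule continuous_open_preimage) (auto intro!: continuous_intros cb W)
  moreover have "open {z. 1 - cnj i * z \<noteq> 0}" for i
    by (intro open_Collect_neq continuous_intros)
  ultimately have oU: "open U"
    unfolding U_def using A(2) by (metis (no_types, lifting) open_INT open_Int)
  have cU: "cball 0 1 \<subseteq> U"
  proof
    fix z :: complex assume z: "z \<in> cball 0 1"
    have "r * cmod (b z) \<le> r * 1" using smooth_inner_le_1[OF b] z r by (intro mult_left_mono) auto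
    then have "r * cmod (b z) < 1" using r by linarith
    then show "z \<in> U" unfolding U_def using W(2) z r one_minus_cnj_mult_nonzero[of _ z] A
      by (auto simp: norm_mult)
  qed
  have hU: "b holomorphic_on U" using W(3) by (rule holomorphic_on_subset) (auto simp: U_def)
  have nz: "1 - cnj i * z \<noteq> 0" if "z \<in> U" "i \<in> A" for z i using that by (auto simp: U_def)
  show thesis
  proof
    show "model_vec A d b holomorphic_on U"
      unfolding model_vec_def[abs_def] using nz by (intro holomorphic_intros hU) auto
    show "model_vec_conj A d b holomorphic_on U"
      unfolding model_vec_conj_def[abs_def]
      by (intro holomorphic_intros pole_lemma hU)
        (use A order_trans[OF ball_subset_cball cU] oU in \<open>auto simp: interior_open\<close>)
  qed (use oU cU hU nz in \<open>auto simp: U_def\<close>)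
qed

text \<open>The Szego combination \<open>X\<close> splits as \<open>v + b * g\<close>, with
  \<open>v\<close> its projection to the model space of \<open>b\<close>. The cross term is the mean
  of \<open>cnj (V * g)\<close>, which vanishes because \<open>V 0 = 0\<close>; so the inner product
  of \<open>v\<close> and \<open>X\<close> is the squared norm of \<open>v\<close>, and Cauchy's
  formula evaluates it at the nodes.\<close>

lemma model_vec_mean:
  assumes b: "smooth_inner b" and A: "A \<subseteq> ball 0 1" "finite A"
  shows "cmean 1 (\<lambda>z. model_vec A d b z * cnj (\<Sum>i\<in>A. d i / (1 - cnj i * z))) = (\<Sum>j\<in>A. cnj (d j) * model_vec A d b j)"
    and "of_real (cmean 1 (\<lambda>z. (cmod (model_vec A d b z))\<^sup>2)) = (\<Sum>j\<in>A. cnj (d j) * model_vec A d b j)"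
proof -
  define v where "v = model_vec A d b"
  define V where "V = model_vec_conj A d b"
  define X where "X z = (\<Sum>i\<in>A. d i / (1 - cnj i * z))" for z
  obtain U where U: "open U" "cball 0 1 \<subseteq> U" "b holomorphic_on U" "v holomorphic_on U" "V holomorphic_on U"
    "\<And>z i. z \<in> U \<Longrightarrow> i \<in> A \<Longrightarrow> 1 - cnj i * z \<noteq> 0"
  proof -
    have h: "0 < (1/2::real)" "(1/2::real) < 1" by auto
    show thesis
      by (rule model_vec_domain[OF b A h, of d]) (rule that; simp add: v_def V_def)
  qed
  have S: "sphere 0 1 \<subseteq> U" and BB: "ball 0 1 \<subseteq> U" using U(2) by auto
  have cv: "continuous_on T v" "continuous_on T V" "continuous_on T b" if "T \<subseteq> U" for T
    using U that by (auto intro: continuous_on_subset holomorphic_on_imp_continuous_on)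
  have ci: "continuous_on T (\<lambda>z. 1 / (1 - cnj i * z))" if "i \<in> A" "T \<subseteq> U" for T i
    using U(6) that by (intro continuous_intros) auto
  have cX: "continuous_on T X" if "T \<subseteq> U" for T
    unfolding X_def using U(6) that by (intro continuous_intros) auto
  have bb: "b z * cnj (b z) = 1" if "cmod z = 1" for z
    using complex_norm_square[of "b z"] that b by (simp add: smooth_inner_def)
  have each: "cmean 1 (\<lambda>z. cnj (d j) * (v z * cnj (1 / (1 - cnj j * z)))) = cnj (d j) * v j" if j: "j \<in> A" for j
  proof -
    have "cmean 1 (\<lambda>z. v z * cnj (1 / (1 - cnj j * z))) = cmean 1 (\<lambda>z. z * v z / (z - j))"
    proof (rule cmean_cong)
      fix z :: complex assume z: "cmod z = 1"
      then have nz: "z \<noteq> 0" "z \<noteq> j" using A(1) j by auto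
      then have zz: "cnj z = 1 / z" using complex_norm_square[of z] z by (simp add: field_simps)
      have "cnj (1 / (1 - cnj j * z)) = 1 / (1 - j * cnj z)" by simp
      also have "1 - j * cnj z = (z - j) / z" unfolding zz using nz by (simp add: field_simps)
      finally show "v z * cnj (1 / (1 - cnj j * z)) = z * v z / (z - j)" by simp
    qed simp
    also have "\<dots> = v j" using j A
      by (intro cmean_cauchy cv U(2) holomorphic_on_subset[OF U(4) BB]) auto
    finally show ?thesis unfolding cmean_mult_right by simp
  qed
  have "cmean 1 (\<lambda>z. v z * cnj (X z)) = cmean 1 (\<lambda>z. \<Sum>j\<in>A. cnj (d j) * (v z * cnj (1 / (1 - cnj j * z))))"
    by (rule cmean_cong) (auto simp: X_def sum_distrib_left mult_ac)
  also have "\<dots> = (\<Sum>j\<in>A. cmean 1 (\<lambda>z. cnj (d j) * (v z * cnj (1 / (1 - cnj j * z)))))"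
    by (rule cmean_sum) (intro continuous_on_mult continuous_on_const continuous_on_cnj cv(1)[OF S] ci[OF _ S], simp_all)
  also have "\<dots> = (\<Sum>j\<in>A. cnj (d j) * v j)" by (rule sum.cong[OF refl each])
  finally have 1: "cmean 1 (\<lambda>z. v z * cnj (X z)) = (\<Sum>j\<in>A. cnj (d j) * v j)" .
  define g where "g z = (\<Sum>i\<in>A. d i * cnj (b i) / (1 - cnj i * z))" for z
  have hg: "g holomorphic_on U" unfolding g_def using U(6) by (intro holomorphic_intros) auto
  have cg: "continuous_on T g" if "T \<subseteq> U" for T
    using holomorphic_on_imp_continuous_on[OF hg] that by (rule continuous_on_subset)
  have cVg: "continuous_on (sphere 0 1) (\<lambda>z. V z * g z)" by (intro continuous_on_mult cv(2)[OF S] cg[OF S])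
  have Xv: "X z = v z + b z * g z" for z
    unfolding X_def v_def model_vec_def g_def sum_distrib_left sum.distrib[symmetric]
    by (rule sum.cong) (auto simp: add_divide_distrib[symmetric] algebra_simps)
  have "cmean 1 (\<lambda>z. v z * cnj (X z)) = cmean 1 (\<lambda>z. v z * cnj (v z) + cnj (V z * g z))"
  proof (rule cmean_cong)
    fix z :: complex assume z: "cmod z = 1"
    have "V z = b z * cnj (v z)"
      unfolding V_def v_def using model_vec_conj_bd A z b by (simp add: smooth_inner_def)
    then show "v z * cnj (X z) = v z * cnj (v z) + cnj (V z * g z)"
      unfolding Xv by (simp add: algebra_simps)
  qed simp
  also have "\<dots> = cmean 1 (\<lambda>z. v z * cnj (v z)) + cmean 1 (\<lambda>z. cnj (V z * g z))"
    by (rule cmean_add) (intro continuous_on_mult continuous_on_cnj cv S cVg | simp)+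
  also have "cmean 1 (\<lambda>z. cnj (V z * g z)) = cnj (cmean 1 (\<lambda>z. V z * g z))"
    by (rule cmean_cnj[OF cVg]) simp
  also have "cmean 1 (\<lambda>z. V z * g z) = V 0 * g 0"
    by (rule cmean_holomorphic)
      (auto intro!: continuous_on_mult cv(2)[OF U(2)] cg[OF U(2)] holomorphic_on_mult
        holomorphic_on_subset[OF U(5) BB] holomorphic_on_subset[OF hg BB])
  also have "V 0 = 0" by (simp add: V_def model_vec_conj_def)
  also have "cmean 1 (\<lambda>z. v z * cnj (v z)) = of_real (cmean 1 (\<lambda>z. (cmod (v z))\<^sup>2))"
    by (rule cmean_norm_sq[OF cv(1)[OF S]])
  finally have 2: "cmean 1 (\<lambda>z. v z * cnj (X z)) = of_real (cmean 1 (\<lambda>z. (cmod (v z))\<^sup>2))" by simp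
  show "cmean 1 (\<lambda>z. model_vec A d b z * cnj (\<Sum>i\<in>A. d i / (1 - cnj i * z))) = (\<Sum>j\<in>A. cnj (d j) * model_vec A d b j)"
    using 1 unfolding v_def X_def .
  show "of_real (cmean 1 (\<lambda>z. (cmod (model_vec A d b z))\<^sup>2)) = (\<Sum>j\<in>A. cnj (d j) * model_vec A d b j)"
    using 1 2 unfolding v_def by simp
qed

definition log_level :: "real \<Rightarrow> real" where "log_level r = - ln (1 - r\<^sup>2)"

text \<open>The constant of \<open>log_weighted_energy\<close>. As \<open>r\<close> tends to 1 its
  first summand tends to 0 and the second grows like \<open>sqrt (log_level r)\<close>, hence
  \<open>energy_bound r / log_level r\<close> tends to 0.\<close>

definition energy_bound :: "real \<Rightarrow> real" where
  "energy_bound r = log_level r * (1 - r) + 11 * sqrt (2 * (log_level r + 2))"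

definition log_weight :: "real \<Rightarrow> (complex \<Rightarrow> complex) \<Rightarrow> complex \<Rightarrow> real" where
  "log_weight r b z = - ln (1 - r\<^sup>2 * (cmod (b z))\<^sup>2)"

lemma model_vec_energy:
  assumes b: "smooth_inner b" and A: "A \<subseteq> ball 0 1" "finite A" and r: "0 < r" "r < 1"
  shows "log_weight r b 0 * (cmod (model_vec A d b 0))\<^sup>2
      + green_int (\<lambda>z. log_weight r b z * (cmod (deriv (model_vec A d b) z))\<^sup>2)
    \<le> energy_bound r * cmean 1 (\<lambda>z. (cmod (model_vec A d b z))\<^sup>2)"
proof -
  obtain U where U: "open U" "cball 0 1 \<subseteq> U" "b holomorphic_on U" "model_vec A d b holomorphic_on U"
    "model_vec_conj A d b holomorphic_on U" "\<And>z. z \<in> U \<Longrightarrow> cmod (of_real r * b z) < 1"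
    by (rule model_vec_domain[OF b A r, of d]) (rule that; simp)
  interpret model_pair U "\<lambda>z. of_real r * b z" r "model_vec A d b" "model_vec_conj A d b"
  proof
    show "(\<lambda>z. of_real r * b z) holomorphic_on U" by (intro holomorphic_intros U)
    fix z :: complex assume z: "cmod z = 1"
    then have bz: "cmod (b z) = 1" using b by (simp add: smooth_inner_def)
    then show "cmod (of_real r * b z) = r" using r by (simp add: norm_mult)
    show "of_real r * model_vec_conj A d b z = of_real r * b z * cnj (model_vec A d b z)"
      using model_vec_conj_bd[of A z b d, OF A(1) z bz] by simp
  qed (use U r in \<open>auto simp: model_vec_conj_def\<close>)
  show ?thesis
    using log_weighted_energy
    unfolding u_def L_def n_def energy_bound_def log_level_def log_weight_def
    by (simp add: norm_mult power_mult_distrib)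
qed

text \<open>For the last claim, \<open>1 - r^4 = (1 - r^2) * (1 + r^2)\<close> and
  \<open>1 + r^2 \<le> exp 1\<close>: lowering the modulus from 1 to \<open>r\<close> costs at most
  1 in the logarithm.\<close>

lemma log_weight_bounds:
  assumes b: "smooth_inner b" and r: "0 < r" "r < 1" and z: "cmod z \<le> 1"
  shows "0 \<le> log_weight r b z" "log_weight r b z \<le> log_level r"
    and "cmod (b z) \<ge> r \<Longrightarrow> log_weight r b z \<ge> log_level r - 1"
proof -
  have r2: "r\<^sup>2 < 1" "r\<^sup>2 > 0" using r by (auto simp: power_less_one_iff abs_square_less_1)
  have b2: "(cmod (b z))\<^sup>2 \<le> 1" using smooth_inner_le_1[OF b z] by (simp add: power_le_one)
  then have le: "r\<^sup>2 * (cmod (b z))\<^sup>2 \<le> r\<^sup>2" using mult_left_mono[of "(cmod (b z))\<^sup>2" 1 "r\<^sup>2"] by simp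
  have "ln (1 - r\<^sup>2 * (cmod (b z))\<^sup>2) \<le> 1 - r\<^sup>2 * (cmod (b z))\<^sup>2 - 1"
    using le r2 by (intro ln_le_minus_one) linarith
  then show "0 \<le> log_weight r b z" unfolding log_weight_def
    using mult_nonneg_nonneg[of "r\<^sup>2" "(cmod (b z))\<^sup>2"] by (simp del: mult_nonneg_nonneg)
  show "log_weight r b z \<le> log_level r" unfolding log_weight_def log_level_def 
    by (subst neg_le_iff_le, subst ln_le_cancel_iff) (use le r2 in linarith)+
  assume br: "cmod (b z) \<ge> r"
  have "r\<^sup>2 \<le> (cmod (b z))\<^sup>2" using br r by (intro power_mono) auto
  then have "r\<^sup>2 * r\<^sup>2 \<le> r\<^sup>2 * (cmod (b z))\<^sup>2" by (intro mult_left_mono) auto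
  then have "1 - r\<^sup>2 * (cmod (b z))\<^sup>2 \<le> (1 - r\<^sup>2) * (1 + r\<^sup>2)" by (simp add: algebra_simps)
  also have "\<dots> \<le> (1 - r\<^sup>2) * exp 1"
    using r2 exp_ge_add_one_self[of 1] by (intro mult_left_mono) auto
  finally have "ln (1 - r\<^sup>2 * (cmod (b z))\<^sup>2) \<le> ln ((1 - r\<^sup>2) * exp 1)"
    by (subst ln_le_cancel_iff) (use le r2 in \<open>linarith | simp\<close>)+
  also have "\<dots> = ln (1 - r\<^sup>2) + 1" using r2 by (simp add: ln_mult)
  finally show "log_weight r b z \<ge> log_level r - 1" unfolding log_weight_def log_level_def by simp
qed

lemma log_weight_continuous:
  assumes b: "smooth_inner b" and r: "0 < r" "r < 1"
  shows "continuous_on (cball 0 1) (log_weight r b)"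
proof -
  obtain U where U: "open U" "cball 0 1 \<subseteq> U" "b holomorphic_on U" using smooth_innerE[OF b] by metis
  have "1 - r\<^sup>2 * (cmod (b z))\<^sup>2 \<noteq> 0" if "cmod z \<le> 1" for z
  proof -
    have "(cmod (b z))\<^sup>2 \<le> 1" using smooth_inner_le_1[OF b that] by (simp add: power_le_one)
    then have "r\<^sup>2 * (cmod (b z))\<^sup>2 \<le> r\<^sup>2 * 1" by (intro mult_left_mono) auto
    moreover have "r\<^sup>2 < 1" using r by (simp add: power_less_one_iff abs_square_less_1)
    ultimately show ?thesis by linarith
  qed
  then show ?thesis unfolding log_weight_def[abs_def]
    by (intro continuous_intros deriv_cont_cball(1)[OF U(3,1,2)]) auto
qed

lemma log_level_facts:
  assumes "0 < r" "r < 1" shows "log_level r > 0" "energy_bound r > 0"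
proof -
  show "log_level r > 0" using assms unfolding log_level_def by (simp add: power_less_one_iff abs_square_less_1)
  then show "energy_bound r > 0" unfolding energy_bound_def using assms by (intro add_pos_pos mult_pos_pos) auto
qed

text \<open>The model spaces of two inner functions are almost orthogonal if at each point one of them is
  close to 1 in modulus.\<close>

lemma pick_form_estimate:
  assumes f: "smooth_inner f" and T: "smooth_inner T" and A: "A \<subseteq> ball 0 1" "finite A"
    and T0: "\<And>z. z \<in> A \<Longrightarrow> T z = 0"
    and max: "\<And>z. cmod z \<le> 1 \<Longrightarrow> cmod (f z) \<ge> r \<or> cmod (T z) \<ge> r"
    and r: "0 < r" "r < 1" and L2: "log_level r \<ge> 2" and k: "sqrt (energy_bound r / log_level r) \<le> 1 / 4"
  shows "Re (\<Sum>j\<in>A. \<Sum>i\<in>A. d i * cnj (d j) * ((1 - cnj (f i) * f j) / (1 - cnj i * j)))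
    \<le> 4 * sqrt (energy_bound r / log_level r) * Re (\<Sum>j\<in>A. \<Sum>i\<in>A. d i * cnj (d j) / (1 - cnj i * j))"
proof -
  define v where "v = model_vec A d f"
  define X where "X = model_vec A d T"
  define L where "L = log_level r"
  define e where "e = energy_bound r"
  note Le = log_level_facts[OF r, folded L_def e_def]
  \<comment> \<open>As \<open>T\<close> vanishes on \<open>A\<close>, the Szego combination with
    coefficients \<open>d\<close> lies in the model space of \<open>T\<close>, while
    \<open>v\<close> is its projection to the model space of \<open>f\<close>.\<close>
  have X_eq: "X z = (\<Sum>i\<in>A. d i / (1 - cnj i * z))" for z
    unfolding X_def model_vec_def by (rule sum.cong) (auto simp: T0)
  define nv where "nv = cmean 1 (\<lambda>z. (cmod (v z))\<^sup>2)"
  define nX where "nX = cmean 1 (\<lambda>z. (cmod (X z))\<^sup>2)"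
  obtain U1 where U1: "open U1" "cball 0 1 \<subseteq> U1" "v holomorphic_on U1"
    by (rule model_vec_domain[OF f A r, of d]) (rule that; simp add: v_def)
  obtain U2 where U2: "open U2" "cball 0 1 \<subseteq> U2" "X holomorphic_on U2"
    by (rule model_vec_domain[OF T A r, of d]) (rule that; simp add: X_def)
  note cv = deriv_cont_cball[OF U1(3,1,2)] and cX = deriv_cont_cball[OF U2(3,1,2)]
  note cw = log_weight_continuous[OF f r] log_weight_continuous[OF T r]
  have nn: "nv \<ge> 0" "nX \<ge> 0" unfolding nv_def nX_def
    by (auto intro!: cmean_nonneg continuous_intros continuous_on_subset[OF cv(1)] continuous_on_subset[OF cX(1)])
  have nv: "of_real nv = (\<Sum>j\<in>A. \<Sum>i\<in>A. d i * cnj (d j) * ((1 - cnj (f i) * f j) / (1 - cnj i * j)))"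
    unfolding nv_def v_def model_vec_mean(2)[OF f A] unfolding model_vec_def sum_distrib_left
    by (intro sum.cong) auto
  have nX: "of_real nX = (\<Sum>j\<in>A. \<Sum>i\<in>A. d i * cnj (d j) / (1 - cnj i * j))"
    unfolding nX_def X_def model_vec_mean(2)[OF T A] unfolding X_eq[unfolded X_def] sum_distrib_left
    by (intro sum.cong) auto
  have mean: "of_real nv = cmean 1 (\<lambda>z. v z * cnj (X z))"
    unfolding nv_def v_def X_eq using model_vec_mean[OF f A, of d] by simp
  have "of_real nv = v 0 * cnj (X 0) + green_int (\<lambda>z. deriv v z * cnj (deriv X z))"
    unfolding mean
    by (rule littlewood_paley_polar[where U = "U1 \<inter> U2"]) (use U1 U2 in \<open>auto elim!: holomorphic_on_subset\<close>)
  from arg_cong[OF this, of Re]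
  have "nv = Re (v 0 * cnj (X 0)) + green_int (\<lambda>z. Re (deriv v z * cnj (deriv X z)))"
    by (subst green_int_Re) (auto intro!: continuous_intros cv cX)
  also have "\<dots> \<le> cmod (v 0) * cmod (X 0) + green_int (\<lambda>z. cmod (deriv v z) * cmod (deriv X z))"
  proof (intro add_mono green_int_mono)
    show "Re (v 0 * cnj (X 0)) \<le> cmod (v 0) * cmod (X 0)"
      using complex_Re_le_cmod[of "v 0 * cnj (X 0)"] by (simp add: norm_mult)
    show "Re (deriv v z * cnj (deriv X z)) \<le> cmod (deriv v z) * cmod (deriv X z)" for z
      using complex_Re_le_cmod[of "deriv v z * cnj (deriv X z)"] by (simp add: norm_mult)
  qed (intro continuous_intros cv cX)+
  finally have nv1: "nv \<le> \<dots>" .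
  \<comment> \<open>The value that minimises \<open>s * e / L + 1 / s\<close>, the factor that
    appears at the end.\<close>
  define s where "s = sqrt (L / e)"
  have s: "s > 0" using Le by (simp add: s_def)
  define wf where "wf = log_weight r f"
  define wT where "wT = log_weight r T"
  define H where "H z a b = (s * (wT z * b\<^sup>2 + wf z * a\<^sup>2) + (L / s) * (a\<^sup>2 + b\<^sup>2)) / L" for z and a b :: real
  have key: "a * b \<le> H z a b" if z: "cmod z \<le> 1" and ab: "a \<ge> 0" "b \<ge> 0" for z a b
  proof -
    note w = log_weight_bounds[OF f r z, folded wf_def L_def] log_weight_bounds[OF T r z, folded wT_def L_def]
    \<comment> \<open>One of the two weights is at least \<open>L - 1\<close>, and
      \<open>L - 1 \<ge> L / 2\<close> since \<open>L \<ge> 2\<close>. This is where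
      \<open>max\<close> enters.\<close>
    have "L / 2 \<le> wf z + wT z" using max[OF z] w L2 unfolding L_def[symmetric] by (smt (verit) field_sum_of_halves)
    then have "(L / 2) * (a * b) \<le> (wf z + wT z) * (a * b)" using ab by (intro mult_right_mono) auto
    moreover have am: "2 * (a * b) \<le> s * c\<^sup>2 + (1 / s) * c'\<^sup>2" if "c * c' = a * b" for c c'
    proof -
      have "0 \<le> (s * c - c')\<^sup>2 / s" using s by simp
      also have "\<dots> = s * c\<^sup>2 + (1 / s) * c'\<^sup>2 - 2 * (a * b)"
        unfolding that[symmetric] using s by (simp add: power2_eq_square field_simps)
      finally show ?thesis by simp
    qed
    have "2 * (wT z * (a * b)) \<le> s * (wT z * b\<^sup>2) + (L / s) * a\<^sup>2"
    proof -
      have "wT z * (2 * (a * b)) \<le> wT z * (s * b\<^sup>2 + (1 / s) * a\<^sup>2)" using am[of b a] w(4) by (intro mult_left_mono) auto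
      moreover have "wT z * ((1 / s) * a\<^sup>2) \<le> L * ((1 / s) * a\<^sup>2)" using w(5) s by (intro mult_right_mono) auto
      ultimately show ?thesis by (simp add: algebra_simps)
    qed
    moreover have "2 * (wf z * (a * b)) \<le> s * (wf z * a\<^sup>2) + (L / s) * b\<^sup>2"
    proof -
      have "wf z * (2 * (a * b)) \<le> wf z * (s * a\<^sup>2 + (1 / s) * b\<^sup>2)" using am[of a b] w(1) by (intro mult_left_mono) auto
      moreover have "wf z * ((1 / s) * b\<^sup>2) \<le> L * ((1 / s) * b\<^sup>2)" using w(2) s by (intro mult_right_mono) auto
      ultimately show ?thesis by (simp add: algebra_simps)
    qed
    ultimately have "L * (a * b) \<le> s * (wT z * b\<^sup>2 + wf z * a\<^sup>2) + (L / s) * (a\<^sup>2 + b\<^sup>2)"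
      by (simp add: algebra_simps)
    then show ?thesis unfolding H_def using Le by (simp add: field_simps)
  qed
  have "cmod (v 0) * cmod (X 0) + green_int (\<lambda>z. cmod (deriv v z) * cmod (deriv X z))
      \<le> H 0 (cmod (v 0)) (cmod (X 0)) + green_int (\<lambda>z. H z (cmod (deriv v z)) (cmod (deriv X z)))"
    using cw Le s unfolding wf_def[symmetric] wT_def[symmetric]
    by (intro add_mono green_int_mono key) (auto simp: H_def intro!: continuous_intros cv cX)
  also have "green_int (\<lambda>z. H z (cmod (deriv v z)) (cmod (deriv X z)))
      = (s / L) * green_int (\<lambda>z. wT z * (cmod (deriv X z))\<^sup>2) + ((s / L) * green_int (\<lambda>z. wf z * (cmod (deriv v z))\<^sup>2)
        + ((1 / s) * green_int (\<lambda>z. (cmod (deriv v z))\<^sup>2) + (1 / s) * green_int (\<lambda>z. (cmod (deriv X z))\<^sup>2)))"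
  proof -
    have *: "H z (cmod (deriv v z)) (cmod (deriv X z)) = (s / L) * (wT z * (cmod (deriv X z))\<^sup>2) + ((s / L) * (wf z * (cmod (deriv v z))\<^sup>2)
        + ((1 / s) * (cmod (deriv v z))\<^sup>2 + (1 / s) * (cmod (deriv X z))\<^sup>2))" for z
      unfolding H_def using Le s by (simp add: field_simps)
    show ?thesis
      unfolding * green_int_cmult[symmetric]
      by (subst green_int_add, ((intro continuous_intros cv cX cw[folded wf_def wT_def])+)[2])+ simp
  qed
  also have "H 0 (cmod (v 0)) (cmod (X 0)) = (s / L) * (wT 0 * (cmod (X 0))\<^sup>2) + (s / L) * (wf 0 * (cmod (v 0))\<^sup>2)
      + (1 / s) * (cmod (v 0))\<^sup>2 + (1 / s) * (cmod (X 0))\<^sup>2"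
    unfolding H_def using Le s by (simp add: field_simps)
  finally have "nv \<le> (s / L) * (wT 0 * (cmod (X 0))\<^sup>2 + green_int (\<lambda>z. wT z * (cmod (deriv X z))\<^sup>2))
      + (s / L) * (wf 0 * (cmod (v 0))\<^sup>2 + green_int (\<lambda>z. wf z * (cmod (deriv v z))\<^sup>2))
      + (1 / s) * ((cmod (v 0))\<^sup>2 + green_int (\<lambda>z. (cmod (deriv v z))\<^sup>2))
      + (1 / s) * ((cmod (X 0))\<^sup>2 + green_int (\<lambda>z. (cmod (deriv X z))\<^sup>2))"
    using nv1 by (simp add: distrib_left)
  also have "\<dots> \<le> (s / L) * (e * nX) + (s / L) * (e * nv) + (1 / s) * nv + (1 / s) * nX"
  proof (intro add_mono mult_left_mono)
    show "wT 0 * (cmod (X 0))\<^sup>2 + green_int (\<lambda>z. wT z * (cmod (deriv X z))\<^sup>2) \<le> e * nX"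
      unfolding wT_def e_def nX_def X_def by (rule model_vec_energy[OF T A r])
    show "wf 0 * (cmod (v 0))\<^sup>2 + green_int (\<lambda>z. wf z * (cmod (deriv v z))\<^sup>2) \<le> e * nv"
      unfolding wf_def e_def nv_def v_def by (rule model_vec_energy[OF f A r])
  qed (use s Le littlewood_paley[OF U1(3,1,2)] littlewood_paley[OF U2(3,1,2)] in \<open>auto simp: nv_def nX_def\<close>)
  also have "\<dots> = (s * e / L + 1 / s) * (nv + nX)" by (simp add: algebra_simps add_divide_distrib)
  also have "s * e / L + 1 / s = 2 * sqrt (e / L)"
    using Le unfolding s_def by (simp add: real_sqrt_divide field_simps)
  finally have fin: "nv \<le> 2 * sqrt (e / L) * (nv + nX)" .
  \<comment> \<open>Hypothesis \<open>k\<close> allows the term with \<open>nv\<close> on the right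
    to be absorbed, which doubles the constant from 2 to 4.\<close>
  have "2 * sqrt (e / L) * nv \<le> (1 / 2) * nv" using k nn unfolding e_def L_def by (intro mult_right_mono) auto
  then have "nv \<le> 4 * sqrt (e / L) * nX" using fin by (simp add: distrib_left)
  then show ?thesis
    unfolding nv[symmetric] nX[symmetric] by (simp add: e_def L_def)
qed

lemma energy_ratio_small:
  assumes "k > 0"
  obtains r where "0 < r" "r < 1" "log_level r \<ge> 2" "4 * sqrt (energy_bound r / log_level r) \<le> k"
proof -
  have "((\<lambda>r. 4 * sqrt (energy_bound r / log_level r)) \<longlongrightarrow> 0) (at_left 1)"
    unfolding energy_bound_def log_level_def by real_asymp
  then have "eventually (\<lambda>r. 4 * sqrt (energy_bound r / log_level r) < k) (at_left 1)"
    using assms by (rule order_tendstoD)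
  moreover have "filterlim log_level at_top (at_left 1)"
    unfolding log_level_def by real_asymp
  then have "eventually (\<lambda>r. log_level r \<ge> 2) (at_left 1)"
    by (simp add: filterlim_at_top)
  moreover have "eventually (\<lambda>r. r \<in> {0<..<1}) (at_left (1::real))"
    by (rule eventually_at_leftI[of 0]) auto
  ultimately have "eventually (\<lambda>r. 4 * sqrt (energy_bound r / log_level r) < k \<and> log_level r \<ge> 2 \<and> r \<in> {0<..<1}) (at_left 1)"
    by (intro eventually_conj)
  then obtain r where "4 * sqrt (energy_bound r / log_level r) < k \<and> log_level r \<ge> 2 \<and> r \<in> {0<..<1}"
    using eventually_happens trivial_limit_at_left_real by blast
  then show thesis using that[of r] by auto
qed

section \<open>Nevanlinna-Pick interpolation\<close>

definition pick_form :: "complex set \<Rightarrow> (complex \<Rightarrow> complex \<Rightarrow> complex) \<Rightarrow> (complex \<Rightarrow> complex) \<Rightarrow> complex" where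
  "pick_form A K c = (\<Sum>j\<in>A. \<Sum>i\<in>A. c i * cnj (c j) * K i j)"

abbreviation pick_kernel :: "(complex \<Rightarrow> complex) \<Rightarrow> complex \<Rightarrow> complex \<Rightarrow> complex" where
  "pick_kernel w i j \<equiv> (1 - cnj (w i) * w j) / (1 - cnj i * j)"

lemma pick_form_scale:
  assumes "\<And>i j. i \<in> A \<Longrightarrow> j \<in> A \<Longrightarrow> K' i j = s i * cnj (s j) * K i j"
  shows "pick_form A K' c = pick_form A K (\<lambda>i. c i * s i)"
  unfolding pick_form_def using assms by (intro sum.cong) (auto simp: mult_ac)

lemma pick_form_subset:
  assumes "finite B" "A \<subseteq> B" "\<And>i. i \<in> B - A \<Longrightarrow> c i = 0"
  shows "pick_form B K c = pick_form A K c"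
proof -
  have "pick_form B K c = (\<Sum>j\<in>A. \<Sum>i\<in>B. c i * cnj (c j) * K i j)"
    unfolding pick_form_def using assms by (intro sum.mono_neutral_right) auto
  also have "\<dots> = pick_form A K c"
    unfolding pick_form_def using assms by (intro sum.cong refl sum.mono_neutral_right) auto
  finally show ?thesis .
qed

lemma pick_form_insert:
  assumes "finite A" "a \<notin> A"
  shows "pick_form (insert a A) K c = c a * cnj (c a) * K a a + (\<Sum>i\<in>A. c i * cnj (c a) * K i a)
     + (\<Sum>j\<in>A. c a * cnj (c j) * K a j) + pick_form A K c"
  unfolding pick_form_def using assms by (simp add: sum.distrib add_ac)

text \<open>Under an automorphism the kernel \<open>1 - cnj x * y\<close> changes only by a constant
  and by one factor each in \<open>x\<close> and in \<open>y\<close>. Pick matrices therefore change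
  by a diagonal congruence.\<close>

lemma disc_aut_kernel:
  assumes "1 - cnj a * x \<noteq> 0" "1 - cnj a * y \<noteq> 0"
  shows "1 - cnj (disc_aut a x) * disc_aut a y = (1 - cnj a * a) * (1 - cnj x * y) / ((1 - a * cnj x) * (1 - cnj a * y))"
proof -
  have "1 - a * cnj x \<noteq> 0" using assms(1) by (metis complex_cnj_cnj complex_cnj_diff complex_cnj_mult complex_cnj_one complex_cnj_zero_iff)
  then show ?thesis using assms by (simp add: disc_aut_def divide_simps) (simp add: algebra_simps)
qed

lemma one_minus_cnj_mult_self:
  assumes "cmod a < 1"
  shows "sqrt (1 - (cmod a)\<^sup>2) > 0"
    and "1 - cnj a * a = of_real (sqrt (1 - (cmod a)\<^sup>2)) * of_real (sqrt (1 - (cmod a)\<^sup>2))"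
proof -
  have lt: "(cmod a)\<^sup>2 < 1" using assms by (simp add: abs_square_less_1)
  then show "sqrt (1 - (cmod a)\<^sup>2) > 0" by simp
  have "sqrt (1 - (cmod a)\<^sup>2) * sqrt (1 - (cmod a)\<^sup>2) = 1 - (cmod a)\<^sup>2" using lt by simp
  then have "complex_of_real (sqrt (1 - (cmod a)\<^sup>2)) * of_real (sqrt (1 - (cmod a)\<^sup>2)) = of_real (1 - (cmod a)\<^sup>2)"
    by (metis of_real_mult)
  then show "1 - cnj a * a = of_real (sqrt (1 - (cmod a)\<^sup>2)) * of_real (sqrt (1 - (cmod a)\<^sup>2))"
    using complex_norm_square[of a] by (simp add: mult.commute)
qed

text \<open>\<open>1 - cnj (f 0) * f\<close> has nonnegative real part and vanishes at 0, so
  Harnack's inequality makes it vanish identically.\<close>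

lemma const_of_boundary_value:
  assumes "f holomorphic_on ball 0 1" "\<And>z. cmod z < 1 \<Longrightarrow> cmod (f z) \<le> 1" "cmod (f 0) = 1" "cmod z < 1"
  shows "f z = f 0"
proof -
  define g where "g z = 1 - cnj (f 0) * f z" for z
  have ff: "cnj (f 0) * f 0 = 1" using complex_norm_square[of "f 0"] assms(3) by (simp add: mult.commute)
  have "g holomorphic_on ball 0 1" unfolding g_def by (intro holomorphic_intros assms)
  moreover have "Re (g w) \<ge> 0" if "cmod w < 1" for w
    using complex_Re_le_cmod[of "cnj (f 0) * f w"] assms(2)[OF that] assms(3) by (simp add: g_def norm_mult)
  ultimately have "cmod (g z - g 0) \<le> 2 * cmod z / (1 - cmod z) * Re (g 0)"
    using positive_real_part_oscillation[of g 1 "cmod z" z] assms(4) by simp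
  moreover have "g 0 = 0" by (simp add: g_def ff)
  ultimately have "cnj (f 0) * f z = cnj (f 0) * f 0" by (simp add: g_def ff)
  moreover have "cnj (f 0) \<noteq> 0" using assms(3) by auto
  ultimately show ?thesis by simp
qed

text \<open>Schur's induction on the nodes. Automorphisms move the node \<open>a\<close> and its
  value to 0; the Schwarz quotients \<open>w'\<close> of the remaining values then have as Pick
  matrix, up to diagonal congruence, the Schur complement of the entry at \<open>a\<close>.\<close>

theorem nevanlinna_pick:
  assumes "finite A" "A \<subseteq> ball 0 1" "\<And>c. 0 \<le> Re (pick_form A (pick_kernel w) c)"
  obtains G where "G holomorphic_on ball 0 1" "\<And>z. cmod z < 1 \<Longrightarrow> cmod (G z) \<le> 1" "\<And>z. z \<in> A \<Longrightarrow> G z = w z"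
proof -
  have "\<exists>G. G holomorphic_on ball 0 1 \<and> (\<forall>z. cmod z < 1 \<longrightarrow> cmod (G z) \<le> 1) \<and> (\<forall>z\<in>A. G z = w z)"
    using assms
  proof (induction A arbitrary: w rule: finite_induct)
    case empty
    then show ?case by (intro exI[of _ "\<lambda>_. 0"]) auto
  next
    case (insert a A)
    note fin = \<open>finite A\<close> and aA = \<open>a \<notin> A\<close>
    have A: "A \<subseteq> ball 0 1" "cmod a < 1" "\<And>i. i \<in> A \<Longrightarrow> cmod i < 1" using insert.prems(1) by auto
    note pos = insert.prems(2)
    have wle: "cmod (w i) \<le> 1" if i: "i \<in> insert a A" for i
    proof -
      have ci: "cmod i < 1" using i A by auto
      have "pick_form (insert a A) (pick_kernel w) (\<lambda>j. if j = i then 1 else 0)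
          = pick_form {i} (pick_kernel w) (\<lambda>j. if j = i then 1 else 0)"
        using i fin by (intro pick_form_subset) auto
      also have "\<dots> = of_real ((1 - (cmod (w i))\<^sup>2) / (1 - (cmod i)\<^sup>2))"
        using complex_norm_square[of i] complex_norm_square[of "w i"]
        by (simp add: pick_form_def mult.commute)
      finally have eq: "pick_form (insert a A) (pick_kernel w) (\<lambda>j. if j = i then 1 else 0)
          = of_real ((1 - (cmod (w i))\<^sup>2) / (1 - (cmod i)\<^sup>2))" .
      have "0 \<le> (1 - (cmod (w i))\<^sup>2) / (1 - (cmod i)\<^sup>2)"
        using pos[of "\<lambda>j. if j = i then 1 else 0"] unfolding eq Re_complex_of_real .
      moreover have "(cmod i)\<^sup>2 < 1" using ci by (simp add: abs_square_less_1)
      ultimately have "(cmod (w i))\<^sup>2 \<le> 1" by (simp add: zero_le_divide_iff)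
      then show ?thesis by (simp add: abs_square_le_1)
    qed
    show ?case
    proof (cases "cmod (w a) = 1")
      \<comment> \<open>A unimodular value at \<open>a\<close>: the diagonal entry there vanishes,
        and positivity on each pair \<open>{a, j}\<close> kills the off-diagonal entry, which says
        \<open>w j = w a\<close>.\<close>
      case True
      have "w j = w a" if j: "j \<in> A" for j
      proof -
        define k where "k = pick_kernel w j a"
        have ww: "w a * cnj (w a) = 1" using complex_norm_square[of "w a"] True by simp
        have ge: "0 \<le> 2 * Re (s * k) + Re (pick_kernel w j j)" for s
        proof -
          define c where "c i = (if i = a then cnj s else if i = j then 1 else 0)" for i
          have "pick_form (insert a A) (pick_kernel w) c = pick_form (insert a {j}) (pick_kernel w) c"
            using j fin aA by (intro pick_form_subset) (auto simp: c_def)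
          also have "\<dots> = s * k + cnj (s * k) + pick_kernel w j j"
            using j aA ww by (subst pick_form_insert) (auto simp: c_def k_def pick_form_def mult_ac)
          finally have "Re (pick_form (insert a A) (pick_kernel w) c) = 2 * Re (s * k) + Re (pick_kernel w j j)" by simp
          then show ?thesis using pos[of c] by simp
        qed
        define m where "m = Re (pick_kernel w j j)"
        have "k = 0 \<or> \<not> (0 \<le> 2 * Re (s * k) + m)" if "s = - of_real (\<bar>m\<bar> / (cmod k)\<^sup>2 + 1 / (cmod k)\<^sup>2) * cnj k" for s
        proof (cases "k = 0")
          case False
          have "s * k = - of_real (\<bar>m\<bar> / (cmod k)\<^sup>2 + 1 / (cmod k)\<^sup>2) * of_real ((cmod k)\<^sup>2)"
            unfolding that complex_norm_square by (simp only: mult.assoc mult.commute[of "cnj k"])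
          also have "\<dots> = of_real (- (\<bar>m\<bar> + 1))"
            using False unfolding of_real_mult[symmetric] of_real_minus[symmetric]
            by (simp add: field_simps)
          finally have "Re (s * k) = - (\<bar>m\<bar> + 1)" by (metis Re_complex_of_real)
          then have "\<not> 0 \<le> 2 * Re (s * k) + m" by linarith
          then show ?thesis ..
        qed simp
        then have "k = 0" using ge unfolding m_def by blast
        moreover have "1 - cnj j * a \<noteq> 0" using one_minus_cnj_mult_nonzero[of j a] A j by auto
        ultimately have "cnj (w j) * w a = 1" unfolding k_def by simp
        then have "cnj (w j) * (w a * cnj (w a)) = cnj (w a)" by (simp add: mult.assoc[symmetric])
        then show ?thesis using ww by simp
      qed
      then show ?thesis using True by (intro exI[of _ "\<lambda>_. w a"]) auto
    next
      case False
      then have wa: "cmod (w a) < 1" using wle[of a] by simp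
      define \<phi> where "\<phi> = disc_aut a"
      define u where "u i = disc_aut (w a) (w i)" for i
      define w' where "w' i = u i / \<phi> i" for i
      have nz1: "1 - cnj a * i \<noteq> 0" "1 - a * cnj i \<noteq> 0" if "i \<in> insert a A" for i
      proof -
        have ci: "cmod i < 1" using that A by auto
        show "1 - cnj a * i \<noteq> 0" using one_minus_cnj_mult_nonzero[of a i] A(2) ci by simp
        show "1 - a * cnj i \<noteq> 0" using one_minus_cnj_mult_nonzero[of i a] A(2) ci by (simp add: mult.commute)
      qed
      have nz2: "1 - cnj (w a) * w i \<noteq> 0" "1 - w a * cnj (w i) \<noteq> 0" if "i \<in> insert a A" for i
      proof -
        show 1: "1 - cnj (w a) * w i \<noteq> 0" using one_minus_cnj_mult_nonzero[of "w a" "w i"] wle[OF that] wa by auto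
        have "cnj (1 - cnj (w a) * w i) = 1 - w a * cnj (w i)" by simp
        then show "1 - w a * cnj (w i) \<noteq> 0" using 1 by (metis complex_cnj_zero_iff)
      qed
      have nz3: "1 - cnj i * j \<noteq> 0" if "i \<in> insert a A" "j \<in> insert a A" for i j
      proof -
        have "cmod i < 1" "cmod j < 1" using that A by auto
        then show ?thesis using one_minus_cnj_mult_nonzero[of i j] by simp
      qed
      define sa where "sa = sqrt (1 - (cmod a)\<^sup>2)"
      define sw where "sw = sqrt (1 - (cmod (w a))\<^sup>2)"
      have sa: "sa > 0" "1 - cnj a * a = of_real sa * of_real sa"
        using one_minus_cnj_mult_self[OF A(2)] by (auto simp: sa_def)
      have sw: "sw > 0" "1 - cnj (w a) * w a = of_real sw * of_real sw"
        using one_minus_cnj_mult_self[OF wa] by (auto simp: sw_def)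
      have sanz: "complex_of_real sa \<noteq> 0" "complex_of_real sw \<noteq> 0" using sa sw by auto
      define K where "K i j = (1 - cnj (u i) * u j) / (1 - cnj (\<phi> i) * \<phi> j)" for i j
      define s where "s i = of_real (sw / sa) * (1 - a * cnj i) / (1 - w a * cnj (w i))" for i
      have Keq: "K i j = s i * cnj (s j) * pick_kernel w i j"
        if "i \<in> insert a A" "j \<in> insert a A" for i j
      proof -
        have n: "1 - cnj (u i) * u j = of_real sw * of_real sw * (1 - cnj (w i) * w j) / ((1 - w a * cnj (w i)) * (1 - cnj (w a) * w j))"
          unfolding u_def sw(2)[symmetric] using nz2 that by (intro disc_aut_kernel) auto
        have d: "1 - cnj (\<phi> i) * \<phi> j = of_real sa * of_real sa * (1 - cnj i * j) / ((1 - a * cnj i) * (1 - cnj a * j))"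
          unfolding \<phi>_def sa(2)[symmetric] using nz1 that by (intro disc_aut_kernel) auto
        show ?thesis
          unfolding K_def n d s_def using nz1[OF that(1)] nz1[OF that(2)] nz2[OF that(1)] nz2[OF that(2)] nz3[OF that] sanz
          by (simp add: field_simps)
      qed
      have Kpos: "0 \<le> Re (pick_form (insert a A) K c)" for c
        using pos[of "\<lambda>i. c i * s i"] pick_form_scale[of "insert a A" K s "pick_kernel w" c] Keq by simp
      have \<phi>0: "\<phi> a = 0" "u a = 0" by (auto simp: \<phi>_def u_def)
      have \<phi>nz: "\<phi> i \<noteq> 0" if "i \<in> A" for i
        using disc_aut_eq_0_iff[of a i] that A(2) A(3)[OF that] aA by (auto simp: \<phi>_def)
      have Kpos': "0 \<le> Re (pick_form A (\<lambda>i j. K i j - 1) c)" for c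
      proof -
        \<comment> \<open>Row and column \<open>a\<close> of \<open>K\<close> consist of ones, so
          the coefficient \<open>- S\<close> at \<open>a\<close> reduces the form of
          \<open>K\<close> on \<open>insert a A\<close> to that of \<open>K - 1\<close> on
          \<open>A\<close>.\<close>
        define c' where "c' i = (if i = a then - (\<Sum>i\<in>A. c i) else c i)" for i
        have c'A: "c' i = c i" if "i \<in> A" for i using that aA by (auto simp: c'_def)
        have K1: "K i a = 1" "K a i = 1" for i by (simp_all add: K_def \<phi>0)
        define S where "S = (\<Sum>i\<in>A. c i)"
        have ca: "c' a = - S" by (simp add: c'_def S_def)
        have s1: "(\<Sum>i\<in>A. c' i * cnj (c' a) * K i a) = S * cnj (- S)"
          unfolding K1 ca S_def sum_distrib_right mult_1_right by (intro sum.cong refl) (simp add: c'A)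
        have s2: "(\<Sum>j\<in>A. c' a * cnj (c' j) * K a j) = - S * cnj S"
          unfolding K1 ca cnj_sum S_def sum_distrib_left mult_1_right by (intro sum.cong refl) (simp add: c'A)
        have s3: "pick_form A K c' = pick_form A K c"
          unfolding pick_form_def by (intro sum.cong refl) (simp add: c'A)
        have "pick_form (insert a A) K c' = pick_form A K c - S * cnj S"
          using pick_form_insert[OF fin aA, of K c'] unfolding s1 s2 s3 unfolding K1 ca by simp
        also have "S * cnj S = (\<Sum>j\<in>A. \<Sum>i\<in>A. c i * cnj (c j))"
          unfolding S_def cnj_sum sum_distrib_left sum_distrib_right ..
        also have "pick_form A K c - \<dots> = pick_form A (\<lambda>i j. K i j - 1) c"
          unfolding pick_form_def sum_subtractf[symmetric] by (intro sum.cong refl) (simp add: algebra_simps)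
        finally show ?thesis using Kpos[of c'] by simp
      qed
      define t where "t i = of_real sa / (cnj (\<phi> i) * (1 - a * cnj i))" for i
      have w'eq: "pick_kernel w' i j = t i * cnj (t j) * (K i j - 1)" if "i \<in> A" "j \<in> A" for i j
      proof -
        have ij: "i \<in> insert a A" "j \<in> insert a A" using that by auto
        have d: "1 - cnj (\<phi> i) * \<phi> j = of_real sa * of_real sa * (1 - cnj i * j) / ((1 - a * cnj i) * (1 - cnj a * j))"
          unfolding \<phi>_def sa(2)[symmetric] using nz1 ij by (intro disc_aut_kernel) auto
        then have dnz: "1 - cnj (\<phi> i) * \<phi> j \<noteq> 0" using nz1[OF ij(1)] nz1[OF ij(2)] nz3[OF ij] sanz by simp
        have "K i j - 1 = (cnj (\<phi> i) * \<phi> j - cnj (u i) * u j) / (1 - cnj (\<phi> i) * \<phi> j)"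
          unfolding K_def using dnz by (simp add: field_simps)
        also have "cnj (\<phi> i) * \<phi> j - cnj (u i) * u j = cnj (\<phi> i) * \<phi> j * (1 - cnj (w' i) * w' j)"
          using \<phi>nz[OF that(1)] \<phi>nz[OF that(2)] by (simp add: w'_def field_simps)
        finally have e: "K i j - 1 = cnj (\<phi> i) * \<phi> j * (1 - cnj (w' i) * w' j) / (1 - cnj (\<phi> i) * \<phi> j)" .
        have ct: "cnj (t j) = of_real sa / (\<phi> j * (1 - cnj a * j))" by (simp add: t_def)
        have alg: "k / D = S / (p * X) * (S / (q * Y)) * (p * q * k / (S * S * D / (X * Y)))"
          if "p \<noteq> 0" "q \<noteq> 0" "S \<noteq> 0" "X \<noteq> 0" "Y \<noteq> 0" "D \<noteq> 0" for k p q S X Y D :: complex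
          using that by (simp add: field_simps)
        show ?thesis
          unfolding e d ct unfolding t_def
          by (rule alg) (use \<phi>nz[OF that(1)] \<phi>nz[OF that(2)] nz1[OF ij(1)] nz1[OF ij(2)] nz3[OF ij] sanz in simp_all)
      qed
      have "0 \<le> Re (pick_form A (pick_kernel w') c)" for c
        using Kpos'[of "\<lambda>i. c i * t i"] pick_form_scale[of A "pick_kernel w'" t "\<lambda>i j. K i j - 1" c] w'eq by simp
      from insert.IH[OF A(1) this]
      obtain G where G: "G holomorphic_on ball 0 1" "\<And>z. cmod z < 1 \<Longrightarrow> cmod (G z) \<le> 1" "\<And>z. z \<in> A \<Longrightarrow> G z = w' z"
        by blast
      define F where "F z = disc_aut (w a) (\<phi> z * G z)" for z
      have b: "cmod (\<phi> z * G z) \<le> 1" if "cmod z < 1" for z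
        unfolding norm_mult \<phi>_def using cmod_disc_aut_le_1[OF A(2), of z] G(2)[OF that] that
        by (intro mult_le_one) auto
      have hF: "F holomorphic_on ball 0 1"
        unfolding F_def \<phi>_def using b wa
        by (intro disc_aut_holomorphic_ball holomorphic_on_mult disc_aut_holomorphic_on_ball[OF A(2)] G) (auto simp: \<phi>_def)
      moreover have "cmod (F z) \<le> 1" if "cmod z < 1" for z
        unfolding F_def by (rule cmod_disc_aut_le_1[OF wa b[OF that]])
      moreover have "F z = w z" if z: "z \<in> insert a A" for z
      proof (cases "z = a")
        case True then show ?thesis by (simp add: F_def \<phi>0)
      next
        case False
        then have zA: "z \<in> A" using z by simp
        then have "\<phi> z * G z = disc_aut (w a) (w z)"
          using G(3)[OF zA] \<phi>nz[OF zA] by (simp add: w'_def u_def)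
        then show ?thesis unfolding F_def using disc_aut_disc_aut[OF wa wle[OF z]] by simp
      qed
      ultimately show ?thesis by blast
    qed
  qed
  then show thesis using that by blast
qed

section \<open>Approximation by finite Blaschke products\<close>

lemma smooth_inner_disc_aut:
  assumes b: "smooth_inner b" and a: "cmod a < 1"
  shows "smooth_inner (\<lambda>z. disc_aut a (- z * b z))"
proof -
  obtain U where U: "open U" "cball 0 1 \<subseteq> U" "b holomorphic_on U" "\<And>z. cmod z = 1 \<Longrightarrow> cmod (b z) = 1"
    using smooth_innerE[OF b] by blast
  define V where "V = U \<inter> (\<lambda>z. 1 - cnj a * (- z * b z)) -` (- {0})"
  have cb: "continuous_on U b" by (rule holomorphic_on_imp_continuous_on[OF U(3)])
  have oV: "open V" unfolding V_def
    by (rule continuous_open_preimage) (auto intro!: continuous_intros cb U)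
  have le: "cmod (- z * b z) \<le> 1" if "cmod z \<le> 1" for z
    using smooth_inner_le_1[OF b that] that by (auto simp: norm_mult intro: mult_le_one)
  have "z \<in> V" if "z \<in> cball 0 1" for z
    using one_minus_cnj_mult_nonzero[OF a le[of z]] U(2) that by (auto simp: V_def)
  moreover have "(\<lambda>z. disc_aut a (- z * b z)) holomorphic_on V"
    by (intro disc_aut_holomorphic holomorphic_intros holomorphic_on_subset[OF U(3)]) (auto simp: V_def)
  moreover have "cmod (disc_aut a (- z * b z)) = 1" if "cmod z = 1" for z
    using that U(4) by (intro cmod_disc_aut_eq_1 a) (simp add: norm_mult)
  ultimately show ?thesis using oV unfolding smooth_inner_def by blast
qed

lemma disc_aut_diff:
  assumes "1 - cnj a * p \<noteq> 0" "1 - cnj a * q \<noteq> 0"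
  shows "disc_aut a p - disc_aut a q = (q - p) * (1 - cnj a * a) / ((1 - cnj a * p) * (1 - cnj a * q))"
  using assms by (simp add: disc_aut_def divide_simps) (simp add: algebra_simps)

text \<open>Each step replaces \<open>f\<close> by the Schwarz quotient of
  \<open>disc_aut (f 0) o f\<close>. Undoing the steps from a unimodular constant yields a finite
  Blaschke product, and every step gains a factor \<open>z\<close> in the error. The minus signs
  stem from \<open>disc_aut 0 z = - z\<close>.\<close>

lemma schur_algorithm:
  assumes "f holomorphic_on ball 0 1" "\<And>z. cmod z < 1 \<Longrightarrow> cmod (f z) \<le> 1"
  shows "\<exists>b h. smooth_inner b \<and> h holomorphic_on ball 0 1 \<and> (\<forall>z. cmod z < 1 \<longrightarrow> f z - b z = z ^ n * h z)"
  using assms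
proof (induction n arbitrary: f)
  case 0
  have "smooth_inner (\<lambda>_. 1)" unfolding smooth_inner_def by (auto intro!: exI[of _ UNIV])
  then show ?case using 0 by (intro exI[of _ "\<lambda>_. 1"] exI[of _ "\<lambda>z. f z - 1"]) (auto intro!: holomorphic_intros)
next
  case (Suc n)
  define a where "a = f 0"
  show ?case
  proof (cases "cmod a = 1")
    case True
    have "smooth_inner (\<lambda>_. a)" unfolding smooth_inner_def using True by (auto intro!: exI[of _ UNIV])
    moreover have "f z = a" if "cmod z < 1" for z
      using const_of_boundary_value[OF Suc.prems _ that] True by (simp add: a_def)
    ultimately show ?thesis by (intro exI[of _ "\<lambda>_. a"] exI[of _ "\<lambda>z. 0"]) auto
  next
    case False
    then have a: "cmod a < 1" using Suc.prems(2)[of 0] by (simp add: a_def)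
    have fb: "cmod (f z) \<le> 1" if "cmod z < 1" for z using Suc.prems(2) that .
    have "(\<lambda>z. disc_aut a (f z)) holomorphic_on ball 0 1"
      using Suc.prems a by (intro disc_aut_holomorphic_ball) auto
    from schwarz_division[OF this, of 1 0]
    obtain f1 where f1: "f1 holomorphic_on ball 0 1" "\<And>z. cmod z < 1 \<Longrightarrow> disc_aut a (f z) = disc_aut 0 z * f1 z"
      "\<And>z. cmod z < 1 \<Longrightarrow> cmod (f1 z) \<le> 1"
      using cmod_disc_aut_le_1[OF a] fb by (auto simp: a_def)
    obtain b h where b: "smooth_inner b" and h: "h holomorphic_on ball 0 1" "\<And>z. cmod z < 1 \<Longrightarrow> f1 z - b z = z ^ n * h z"
      using Suc.IH[OF f1(1,3)] by blast
    obtain U where U: "open U" "cball 0 1 \<subseteq> U" "b holomorphic_on U" using smooth_innerE[OF b] by metis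
    have hb: "b holomorphic_on ball 0 1" using U(2) by (intro holomorphic_on_subset[OF U(3)]) auto
    have p1: "1 - cnj a * (- z * f1 z) \<noteq> 0" and p2: "1 - cnj a * (- z * b z) \<noteq> 0" if "cmod z < 1" for z
      using one_minus_cnj_mult_nonzero[OF a] f1(3)[OF that] smooth_inner_le_1[OF b, of z] that
      by (metis less_imp_le mult_le_one norm_ge_zero norm_minus_cancel norm_mult)+
    define h' where "h' z = h z * (1 - cnj a * a) / ((1 - cnj a * (- z * f1 z)) * (1 - cnj a * (- z * b z)))" for z
    have "h' holomorphic_on ball 0 1"
      unfolding h'_def using p1 p2 by (intro holomorphic_intros h f1 hb) auto
    moreover have "f z - disc_aut a (- z * b z) = z ^ Suc n * h' z" if z: "cmod z < 1" for z
    proof -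
      have "f z = disc_aut a (- z * f1 z)"
        using f1(2)[OF z] disc_aut_disc_aut[OF a fb[OF z]] by simp
      then have "f z - disc_aut a (- z * b z) = (- z * b z - - z * f1 z) * (1 - cnj a * a) / ((1 - cnj a * (- z * f1 z)) * (1 - cnj a * (- z * b z)))"
        using disc_aut_diff[OF p1[OF z] p2[OF z]] by simp
      also have "- z * b z - - z * f1 z = z * (z ^ n * h z)" unfolding h(2)[OF z, symmetric] by (simp add: algebra_simps)
      finally show ?thesis by (simp add: h'_def mult_ac)
    qed
    ultimately show ?thesis using smooth_inner_disc_aut[OF b a] by blast
  qed
qed

text \<open>\<open>f - b\<close> is at most 2 in modulus and divisible by \<open>z^n\<close>, so the
  maximum principle bounds the quotient by 2. As \<open>n\<close> grows the approximation is locally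
  uniform in the disc, not uniform up to the circle.\<close>

lemma smooth_inner_approx:
  assumes f: "f holomorphic_on ball 0 1" "\<And>z. cmod z < 1 \<Longrightarrow> cmod (f z) \<le> 1"
  obtains b where "smooth_inner b" "\<And>z. cmod z < 1 \<Longrightarrow> cmod (f z - b z) \<le> 2 * cmod z ^ n"
proof -
  obtain b h where b: "smooth_inner b" and h: "h holomorphic_on ball 0 1" "\<And>z. cmod z < 1 \<Longrightarrow> f z - b z = z ^ n * h z"
    using schur_algorithm[OF f] by blast
  have "cmod (h z) \<le> 2" if z: "cmod z < 1" for z
  proof (rule max_modulus_limit[OF h(1) _ z])
    fix e :: real assume e: "e > 0"
    have "((\<lambda>x::real. 2 / x ^ n) \<longlongrightarrow> 2 / 1 ^ n) (at_left 1)"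
      by (intro tendsto_intros) auto
    then have "eventually (\<lambda>x. 2 / x ^ n < 2 + e) (at_left 1)"
      using e by (intro order_tendstoD(2)) auto
    then obtain x0 where x0: "x0 < 1" "\<And>x. x0 < x \<Longrightarrow> x < 1 \<Longrightarrow> 2 / x ^ n < 2 + e"
      unfolding eventually_at_left_field by blast
    define x1 where "x1 = max ((1 + x0) / 2) (1 / 2)"
    have x1: "x0 < x1" "x1 < 1" "x1 \<ge> 1 / 2" using x0(1) by (auto simp: x1_def less_max_iff_disj)
    have "cmod (h w) \<le> 2 + e" if w: "x1 \<le> cmod w" "cmod w < 1" for w
    proof -
      have w0: "cmod w > 0" using w x1 by linarith
      have "cmod (f w - b w) \<le> 1 + 1"
        using f(2)[OF w(2)] smooth_inner_le_1[OF b, of w] w by (intro norm_triangle_le_diff) auto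
      then have "cmod w ^ n * cmod (h w) \<le> 2" using h(2)[OF w(2)] by (simp add: norm_mult norm_power)
      then have "cmod (h w) \<le> 2 / cmod w ^ n" using w0 by (simp add: field_simps)
      also have "\<dots> < 2 + e" using x0(2)[of "cmod w"] w x1 by simp
      finally show ?thesis by simp
    qed
    then show "\<exists>r0<1. \<forall>w. r0 \<le> cmod w \<and> cmod w < 1 \<longrightarrow> cmod (h w) \<le> 2 + e" using x1 by blast
  qed
  then have "cmod (f z - b z) \<le> 2 * cmod z ^ n" if "cmod z < 1" for z
    unfolding h(2)[OF that] norm_mult norm_power using that
    by (subst mult.commute) (intro mult_right_mono, auto)
  then show thesis using that b by blast
qed

text \<open>The zeros form a set and are therefore simple: a function vanishing on \<open>A\<close>
  is divisible by the product, and prescribing values on \<open>A\<close> is an interpolation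
  problem without derivatives.\<close>

definition blaschke_fin :: "complex \<Rightarrow> complex set \<Rightarrow> complex \<Rightarrow> complex" where
  "blaschke_fin c A z = c * (\<Prod>a\<in>A. disc_aut a z)"

lemma smooth_inner_blaschke_fin:
  assumes "finite A" "A \<subseteq> ball 0 1" "cmod c = 1"
  shows "smooth_inner (blaschke_fin c A)"
proof -
  define U where "U = (\<Inter>a\<in>A. {z. 1 - cnj a * z \<noteq> 0})"
  have "open {z. 1 - cnj i * z \<noteq> 0}" for i
    by (intro open_Collect_neq continuous_intros)
  then have "open U" unfolding U_def using assms(1) by (intro open_INT) auto
  moreover have "cball 0 1 \<subseteq> U" unfolding U_def using assms(2) one_minus_cnj_mult_nonzero by auto
  moreover have "blaschke_fin c A holomorphic_on U"
    unfolding blaschke_fin_def[abs_def]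
    by (intro holomorphic_on_mult holomorphic_on_const holomorphic_on_prod disc_aut_holomorphic holomorphic_on_ident) (auto simp: U_def)
  moreover have "cmod (blaschke_fin c A z) = 1" if "cmod z = 1" for z
    unfolding blaschke_fin_def norm_mult assms(3) prod_norm[symmetric]
    using cmod_disc_aut_eq_1[OF _ that] assms(2) by (auto intro!: prod.neutral)
  ultimately show ?thesis unfolding smooth_inner_def by blast
qed

lemma blaschke_fin_division:
  assumes "finite A" "A \<subseteq> ball 0 1" "cmod c = 1" and f: "f holomorphic_on ball 0 1"
    "\<And>z. cmod z < 1 \<Longrightarrow> cmod (f z) \<le> M" "\<And>z. z \<in> A \<Longrightarrow> f z = 0"
  obtains h where "h holomorphic_on ball 0 1" "\<And>z. cmod z < 1 \<Longrightarrow> cmod (h z) \<le> M"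
    "\<And>z. cmod z < 1 \<Longrightarrow> f z = h z * blaschke_fin c A z"
proof -
  have "\<exists>h. h holomorphic_on ball 0 1 \<and> (\<forall>z. cmod z < 1 \<longrightarrow> cmod (h z) \<le> M) \<and>
      (\<forall>z. cmod z < 1 \<longrightarrow> f z = h z * blaschke_fin c A z)"
    using assms(1,2) f(3)
  proof (induction A rule: finite_induct)
    case empty
    have c: "c \<noteq> 0" using assms(3) by auto
    show ?case
      by (rule exI[of _ "\<lambda>z. f z / c"]) (use f c assms(3) in \<open>auto intro!: holomorphic_intros simp: blaschke_fin_def norm_divide\<close>)
  next
    case (insert a A)
    then obtain h where h: "h holomorphic_on ball 0 1" "\<And>z. cmod z < 1 \<Longrightarrow> cmod (h z) \<le> M"
      "\<And>z. cmod z < 1 \<Longrightarrow> f z = h z * blaschke_fin c A z" by auto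
    have a: "cmod a < 1" "f a = 0" using insert.prems by auto
    have "blaschke_fin c A a \<noteq> 0"
      using insert.hyps insert.prems assms(3) a disc_aut_eq_0_iff[of _ a]
      unfolding blaschke_fin_def by (auto simp: prod_zero_iff)
    then have "h a = 0" using h(3)[OF a(1)] a(2) by simp
    then obtain g where "g holomorphic_on ball 0 1" "\<And>z. cmod z < 1 \<Longrightarrow> h z = disc_aut a z * g z"
      "\<And>z. cmod z < 1 \<Longrightarrow> cmod (g z) \<le> M"
      using schwarz_division[OF h(1,2) a(1)] by blast
    then show ?case
      using h(3) insert.hyps by (intro exI[of _ g]) (auto simp: blaschke_fin_def)
  qed
  then show thesis using that by blast
qed

text \<open>\<open>G\<close> has to equal \<open>1 / b\<close> at the zeros of the Blaschke product.
  It is obtained by interpolating \<open>s / b\<close>, with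
  \<open>s = 1 / (1 + \<epsilon>)\<close>, by a function bounded by 1 and rescaling. What matters
  for later limits is that \<open>r\<close> depends on \<open>\<epsilon>\<close> alone.\<close>

theorem bezout_finite:
  assumes "\<epsilon> > 0"
  obtains r where "0 < r" "r < 1"
    "\<And>c A b. cmod c = 1 \<Longrightarrow> finite A \<Longrightarrow> A \<subseteq> ball 0 1 \<Longrightarrow> smooth_inner b \<Longrightarrow>
      (\<And>z. cmod z \<le> 1 \<Longrightarrow> cmod (b z) \<ge> r \<or> cmod (blaschke_fin c A z) \<ge> r) \<Longrightarrow>
      \<exists>G h. G holomorphic_on ball 0 1 \<and> h holomorphic_on ball 0 1 \<and>
        (\<forall>z. cmod z < 1 \<longrightarrow> cmod (G z) \<le> 1 + \<epsilon> \<and> cmod (h z) \<le> 2 + \<epsilon> \<and> b z * G z = 1 + h z * blaschke_fin c A z)"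
proof -
  define s where "s = 1 / (1 + \<epsilon>)"
  have s: "0 < s" "s < 1" using assms by (auto simp: s_def)
  define k where "k = min 1 (1 - s\<^sup>2)"
  have k: "k > 0" "k \<le> 1" "k \<le> 1 - s\<^sup>2" using s by (auto simp: k_def abs_square_less_1)
  obtain r where r: "0 < r" "r < 1" "log_level r \<ge> 2" "4 * sqrt (energy_bound r / log_level r) \<le> k"
    using energy_ratio_small[OF k(1)] by blast
  show thesis
  proof (rule that[of r])
    fix c A b
    assume c: "cmod c = 1" and A: "finite A" "A \<subseteq> ball 0 1" and b: "smooth_inner b"
      and max: "\<And>z. cmod z \<le> 1 \<Longrightarrow> cmod (b z) \<ge> r \<or> cmod (blaschke_fin c A z) \<ge> r"
    define T where "T = blaschke_fin c A"
    have T: "smooth_inner T" unfolding T_def by (rule smooth_inner_blaschke_fin[OF A c])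
    have T0: "T z = 0" if "z \<in> A" for z
      using that A(1) disc_aut_self[of z] unfolding T_def blaschke_fin_def by (metis mult_zero_right prod_zero)
    have bnz: "b z \<noteq> 0" if "z \<in> A" for z
      using max[of z] T0[OF that] that A(2) r(1) by (auto simp: T_def)
    define w where "w z = of_real s / b z" for z
    have N: "Re (\<Sum>j\<in>A. \<Sum>i\<in>A. d i * cnj (d j) / (1 - cnj i * j)) \<ge> 0" for d
    proof -
      have "complex_of_real (cmean 1 (\<lambda>z. (cmod (model_vec A d T z))\<^sup>2)) = (\<Sum>j\<in>A. \<Sum>i\<in>A. d i * cnj (d j) / (1 - cnj i * j))"
        unfolding model_vec_mean(2)[OF T A(2,1)] unfolding model_vec_def sum_distrib_left
        by (intro sum.cong) (auto simp: T0)
      moreover have "cmean 1 (\<lambda>z. (cmod (model_vec A d T z))\<^sup>2) \<ge> 0"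
      proof -
        obtain U where "open U" "cball 0 1 \<subseteq> U" "model_vec A d T holomorphic_on U"
          by (rule model_vec_domain[OF T A(2,1) r(1,2), of d]) (rule that; simp)
        from deriv_cont_cball(1)[OF this(3,1,2)] show ?thesis
          by (auto intro!: cmean_nonneg continuous_intros elim: continuous_on_subset)
      qed
      ultimately show ?thesis by (metis Re_complex_of_real)
    qed
    have "0 \<le> Re (pick_form A (pick_kernel w) e)" for e
    proof -
      \<comment> \<open>With these coefficients the numerator of the Pick kernel becomes
        \<open>cnj (b i) * b j - s^2 = (1 - s^2) - (1 - cnj (b i) * b j)\<close>, the difference of
        the two forms that \<open>pick_form_estimate\<close> compares.\<close>
      define d where "d i = e i / cnj (b i)" for i
      define Q where "Q = (\<Sum>j\<in>A. \<Sum>i\<in>A. d i * cnj (d j) * ((1 - cnj (b i) * b j) / (1 - cnj i * j)))"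
      define N' where "N' = (\<Sum>j\<in>A. \<Sum>i\<in>A. d i * cnj (d j) / (1 - cnj i * j))"
      have "pick_form A (pick_kernel w) e = of_real (1 - s\<^sup>2) * N' - Q"
        unfolding pick_form_def N'_def Q_def sum_distrib_left sum_subtractf[symmetric]
      proof (intro sum.cong refl)
        fix i j assume ij: "i \<in> A" "j \<in> A"
        define D where "D = 1 - cnj i * j"
        have "cmod i < 1" "cmod j < 1" using ij A(2) by auto
        then have D: "D \<noteq> 0" using one_minus_cnj_mult_nonzero[of i j] by (simp add: D_def)
        have bi: "cnj (b i) \<noteq> 0" "b j \<noteq> 0" using bnz ij by auto
        show "e i * cnj (e j) * ((1 - cnj (w i) * w j) / (1 - cnj i * j)) =
          of_real (1 - s\<^sup>2) * (d i * cnj (d j) / (1 - cnj i * j)) - d i * cnj (d j) * ((1 - cnj (b i) * b j) / (1 - cnj i * j))"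
          unfolding D_def[symmetric] d_def w_def using D bi
          by (simp add: field_simps power2_eq_square)
      qed
      moreover have "Re Q \<le> k * Re N'"
      proof -
        have "Re Q \<le> 4 * sqrt (energy_bound r / log_level r) * Re N'"
          unfolding Q_def N'_def
          by (rule pick_form_estimate[OF b T A(2,1) T0]) (use max r k in \<open>auto simp: T_def\<close>)
        also have "\<dots> \<le> k * Re N'" using N[of d] r(4) unfolding N'_def by (intro mult_right_mono) auto
        finally show ?thesis .
      qed
      moreover have "k * Re N' \<le> (1 - s\<^sup>2) * Re N'" using N[of d] k unfolding N'_def by (intro mult_right_mono) auto
      ultimately show ?thesis by (simp del: of_real_diff)
    qed
    from nevanlinna_pick[OF A this]
    obtain G where G: "G holomorphic_on ball 0 1" "\<And>z. cmod z < 1 \<Longrightarrow> cmod (G z) \<le> 1" "\<And>z. z \<in> A \<Longrightarrow> G z = w z"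
      by blast
    define H where "H z = of_real (1 + \<epsilon>) * G z" for z
    have hH: "H holomorphic_on ball 0 1" unfolding H_def by (intro holomorphic_intros G)
    have Hb: "cmod (H z) \<le> 1 + \<epsilon>" if "cmod z < 1" for z
      using G(2)[OF that] assms mult_left_mono[of "cmod (G z)" 1 "1 + \<epsilon>"] unfolding H_def norm_mult norm_of_real by simp
    obtain U where U: "open U" "cball 0 1 \<subseteq> U" "b holomorphic_on U" using smooth_innerE[OF b] by metis
    have hb: "b holomorphic_on ball 0 1" using U(2) by (intro holomorphic_on_subset[OF U(3)]) auto
    have "cmod (b z * H z - 1) \<le> 2 + \<epsilon>" if z: "cmod z < 1" for z
    proof -
      have "cmod (b z * H z) \<le> 1 * (1 + \<epsilon>)"
        unfolding norm_mult using smooth_inner_le_1[OF b, of z] Hb[OF z] z by (intro mult_mono) auto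
      then show ?thesis using norm_triangle_ineq4[of "b z * H z" 1] by simp
    qed
    moreover have "b z * H z - 1 = 0" if "z \<in> A" for z
    proof -
      have "complex_of_real (1 + \<epsilon>) * of_real s = 1" unfolding s_def of_real_mult[symmetric] using assms by simp
      then show ?thesis using G(3)[OF that] bnz[OF that] by (simp add: H_def w_def)
    qed
    moreover have "(\<lambda>z. b z * H z - 1) holomorphic_on ball 0 1" by (intro holomorphic_intros hb hH)
    ultimately obtain h where h: "h holomorphic_on ball 0 1" "\<And>z. cmod z < 1 \<Longrightarrow> cmod (h z) \<le> 2 + \<epsilon>"
      "\<And>z. cmod z < 1 \<Longrightarrow> b z * H z - 1 = h z * blaschke_fin c A z"
      using blaschke_fin_division[OF A c, of "\<lambda>z. b z * H z - 1" "2 + \<epsilon>"] by blast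
    show "\<exists>G h. G holomorphic_on ball 0 1 \<and> h holomorphic_on ball 0 1 \<and>
        (\<forall>z. cmod z < 1 \<longrightarrow> cmod (G z) \<le> 1 + \<epsilon> \<and> cmod (h z) \<le> 2 + \<epsilon> \<and> b z * G z = 1 + h z * blaschke_fin c A z)"
      using hH Hb h by (intro exI[of _ H] exI[of _ h]) (auto simp: algebra_simps)
  qed (use r in auto)
qed

section \<open>Blaschke products and Carleson measures\<close>

definition blaschke_part :: "nat set \<Rightarrow> (nat \<Rightarrow> complex) \<Rightarrow> nat \<Rightarrow> complex \<Rightarrow> complex" where
  "blaschke_part J a n z = (\<Prod>j<n. if j \<in> J then blaschke_factor (a j) z else 1)"

text \<open>The conformally invariant form of the Carleson condition, stated on finite subsets so
  that no convergence is presupposed. For Blaschke sequences it is equivalent to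
  \<open>carleson_measure\<close> (\<open>prox_bounded_imp_carleson\<close> and
  \<open>carleson_imp_prox_bounded\<close>).\<close>

definition prox_bounded :: "nat set \<Rightarrow> (nat \<Rightarrow> complex) \<Rightarrow> real \<Rightarrow> bool" where
  "prox_bounded J a K \<longleftrightarrow> (\<forall>z F. cmod z < 1 \<longrightarrow> finite F \<longrightarrow> F \<subseteq> J \<longrightarrow> (\<Sum>j\<in>F. prox z (a j)) \<le> K)"

lemma cmod_blaschke_factor: "cmod (blaschke_factor a z) = cmod (disc_aut a z)"
  by (auto simp: blaschke_factor_def norm_mult norm_divide)

lemma blaschke_factor_eq: "\<exists>c. cmod c = 1 \<and> (\<forall>z. blaschke_factor a z = c * disc_aut a z)"
proof (cases "a = 0")
  case True then show ?thesis by (intro exI[of _ "-1"]) (auto simp: blaschke_factor_def)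
next
  case False then show ?thesis
    by (intro exI[of _ "of_real (cmod a) / a"]) (auto simp: blaschke_factor_def norm_divide)
qed

lemma blaschke_factor_holomorphic:
  assumes "cmod a < 1" shows "blaschke_factor a holomorphic_on ball 0 1"
proof -
  obtain c where "\<And>z. blaschke_factor a z = c * disc_aut a z" using blaschke_factor_eq by blast
  then have "blaschke_factor a = (\<lambda>z. c * disc_aut a z)" by auto
  then show ?thesis using disc_aut_holomorphic_on_ball[OF assms] by (auto intro!: holomorphic_intros)
qed

text \<open>For \<open>a \<noteq> 0\<close> the numerator over the common denominator factors as
  \<open>(1 - |a|) * (a + |a| * z)\<close>. Each factor thus deviates from 1 by O(1 - |a|), and the
  Blaschke condition gives absolute convergence of the product.\<close>

lemma blaschke_factor_deviation:
  assumes a: "cmod a < 1" and z: "cmod z < 1"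
  shows "cmod (1 - blaschke_factor a z) \<le> 2 / (1 - cmod z) * (1 - cmod a)"
proof (cases "a = 0")
  case True
  have "cmod (1 - z) \<le> 2" using norm_triangle_ineq4[of 1 z] z by simp
  also have "2 \<le> 2 / (1 - cmod z)" using z by (simp add: field_simps)
  finally show ?thesis using True by (simp add: blaschke_factor_def)
next
  case False
  define D where "D = 1 - cnj a * z"
  have D: "D \<noteq> 0" using one_minus_cnj_mult_nonzero[of a z] a z by (simp add: D_def)
  have D': "cmod D \<ge> 1 - cmod z"
    using cmod_one_minus_cnj_mult_ge[of a z] a cmod_one_minus_cnj_commute[of a z] by (simp add: D_def)
  have aa: "a * cnj a = of_real (cmod a) * of_real (cmod a)"
    using complex_norm_square[of a] by (simp add: power2_eq_square)
  have "a * D - of_real (cmod a) * (a - z) = a - (a * cnj a) * z - of_real (cmod a) * a + of_real (cmod a) * z"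
    by (simp add: D_def algebra_simps)
  also have "\<dots> = of_real (1 - cmod a) * (a + of_real (cmod a) * z)"
    unfolding aa by (simp add: algebra_simps)
  finally have num: "a * D - of_real (cmod a) * (a - z) = of_real (1 - cmod a) * (a + of_real (cmod a) * z)" .
  have "1 - blaschke_factor a z = (a * D - of_real (cmod a) * (a - z)) / (a * D)"
  proof -
    have "blaschke_factor a z = of_real (cmod a) * (a - z) / (a * D)"
      using False by (simp add: blaschke_factor_def disc_aut_def D_def[symmetric])
    moreover have "a * D / (a * D) = 1" using False D by simp
    ultimately show ?thesis by (simp only: diff_divide_distrib)
  qed
  then have "cmod (1 - blaschke_factor a z) = (1 - cmod a) * cmod (a + of_real (cmod a) * z) / (cmod a * cmod D)"
    unfolding num using a by (simp add: norm_mult norm_divide del: of_real_diff)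
  also have "cmod (a + of_real (cmod a) * z) \<le> cmod a + cmod a * cmod z"
    by (rule norm_triangle_le) (simp add: norm_mult)
  also have "\<dots> \<le> cmod a * 2" using z mult_left_mono[of "cmod z" 1 "cmod a"] by simp
  finally have "cmod (1 - blaschke_factor a z) \<le> (1 - cmod a) * (cmod a * 2) / (cmod a * cmod D)"
    using a D False by (simp add: divide_right_mono mult_left_mono)
  also have "\<dots> = (1 - cmod a) * 2 / cmod D" using False by simp
  also have "\<dots> \<le> (1 - cmod a) * 2 / (1 - cmod z)" using a z D' by (intro divide_left_mono mult_pos_pos) auto
  finally show ?thesis by (simp add: mult.commute)
qed

lemma blaschke_part_holomorphic:
  assumes "a ` J \<subseteq> ball 0 1" shows "blaschke_part J a n holomorphic_on ball 0 1"
proof -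
  have "(\<lambda>z. if j \<in> J then blaschke_factor (a j) z else 1) holomorphic_on ball 0 1" for j
    using assms blaschke_factor_holomorphic[of "a j"] by (cases "j \<in> J") auto
  then show ?thesis unfolding blaschke_part_def[abs_def] by (intro holomorphic_on_prod)
qed

lemma cmod_blaschke_part: "cmod (blaschke_part J a n z) = (\<Prod>j\<in>J \<inter> {..<n}. cmod (disc_aut (a j) z))"
proof -
  have "cmod (blaschke_part J a n z) = (\<Prod>j<n. if j \<in> J then cmod (disc_aut (a j) z) else 1)"
    unfolding blaschke_part_def prod_norm[symmetric] by (intro prod.cong) (auto simp: cmod_blaschke_factor)
  also have "\<dots> = (\<Prod>j\<in>{..<n} \<inter> J. cmod (disc_aut (a j) z))" by (rule prod.inter_restrict[symmetric]) simp
  finally show ?thesis by (simp add: Int_commute)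
qed

lemma cmod_blaschke_part_le_1:
  assumes "a ` J \<subseteq> ball 0 1" "cmod z \<le> 1" shows "cmod (blaschke_part J a n z) \<le> 1"
  unfolding cmod_blaschke_part using assms cmod_disc_aut_le_1 by (intro prod_le_1) auto

lemma blaschke_part_decseq:
  assumes "a ` J \<subseteq> ball 0 1" "cmod z \<le> 1" "m \<le> n"
  shows "cmod (blaschke_part J a n z) \<le> cmod (blaschke_part J a m z)"
proof -
  have "cmod (blaschke_part J a n z) = (\<Prod>j\<in>J \<inter> {..<n} - J \<inter> {..<m}. cmod (disc_aut (a j) z)) * cmod (blaschke_part J a m z)"
    unfolding cmod_blaschke_part using assms(3) by (intro prod.subset_diff) auto
  also have "\<dots> \<le> 1 * cmod (blaschke_part J a m z)"
    using assms cmod_disc_aut_le_1 by (intro mult_right_mono prod_le_1) auto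
  finally show ?thesis by simp
qed

lemma blaschke_has_prod:
  assumes "blaschke_sequence J a" and z: "cmod z < 1"
  shows "(\<lambda>j. if j \<in> J then blaschke_factor (a j) z else 1) has_prod
    (\<Prod>j. if j \<in> J then blaschke_factor (a j) z else 1)"
proof -
  have a: "cmod (a j) < 1" if "j \<in> J" for j using assms(1) that unfolding blaschke_sequence_def by auto
  have "(\<lambda>j. if j \<in> J then 1 - cmod (a j) else 0) summable_on UNIV"
  proof -
    have "(\<lambda>j. 1 - cmod (a j)) summable_on J" using assms(1) unfolding blaschke_sequence_def by blast
    moreover have "(\<lambda>j. if j \<in> J then 1 - cmod (a j) else 0) summable_on UNIV \<longleftrightarrow> (\<lambda>j. 1 - cmod (a j)) summable_on J"
      by (rule summable_on_cong_neutral) auto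
    ultimately show ?thesis by simp
  qed
  then have "summable (\<lambda>j. if j \<in> J then 1 - cmod (a j) else 0)"
    by (rule summable_on_imp_summable)
  then have "summable (\<lambda>j. 2 / (1 - cmod z) * (if j \<in> J then 1 - cmod (a j) else 0))" by (rule summable_mult)
  then have "summable (\<lambda>j. norm ((if j \<in> J then blaschke_factor (a j) z else 1) - 1))"
    by (rule summable_comparison_test[rotated])
      (use blaschke_factor_deviation[OF a z] in \<open>auto simp: norm_minus_commute\<close>)
  then have "abs_convergent_prod (\<lambda>j. if j \<in> J then blaschke_factor (a j) z else 1)"
    by (simp add: abs_convergent_prod_conv_summable)
  then show ?thesis
    by (intro convergent_prod_has_prod abs_convergent_prod_imp_convergent_prod)
qed

lemma blaschke_productE:
  assumes "blaschke_product J a B"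
  obtains c where "cmod c = 1" "\<And>z. cmod z < 1 \<Longrightarrow> (\<lambda>n. c * blaschke_part J a n z) \<longlonglongrightarrow> B z"
    "\<And>z. cmod z < 1 \<Longrightarrow> B z = 0 \<longleftrightarrow> (\<exists>j\<in>J. z = a j)" "a ` J \<subseteq> ball 0 1"
proof -
  obtain c where c: "cmod c = 1" "\<And>z. cmod z < 1 \<Longrightarrow> \<exists>p. (\<lambda>j. if j \<in> J then blaschke_factor (a j) z else 1) has_prod p \<and> B z = c * p"
    and seq: "blaschke_sequence J a"
    using assms unfolding blaschke_product_def by auto
  have aJ: "a ` J \<subseteq> ball 0 1" using seq unfolding blaschke_sequence_def by blast
  have c0: "c \<noteq> 0" using c(1) by auto
  have lim: "(\<lambda>n. c * blaschke_part J a n z) \<longlonglongrightarrow> B z" if "cmod z < 1" for z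
    using c(2)[OF that] has_prod_imp_tendsto' unfolding blaschke_part_def by (auto intro!: tendsto_intros)
  have zero: "B z = 0 \<longleftrightarrow> (\<exists>j\<in>J. z = a j)" if z: "cmod z < 1" for z
  proof -
    obtain p where p: "(\<lambda>j. if j \<in> J then blaschke_factor (a j) z else 1) has_prod p" "B z = c * p"
      using c(2)[OF z] by blast
    have bz: "blaschke_factor (a j) z = 0 \<longleftrightarrow> z = a j" if "j \<in> J" for j
    proof -
      have "blaschke_factor (a j) z = 0 \<longleftrightarrow> disc_aut (a j) z = 0"
        using cmod_blaschke_factor[of "a j" z] by (metis norm_eq_zero)
      then show ?thesis using disc_aut_eq_0_iff[of "a j" z] aJ that z by auto
    qed
    have "B z = 0 \<longleftrightarrow> p = 0" using p(2) c0 by simp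
    also have "\<dots> \<longleftrightarrow> (\<exists>j. (if j \<in> J then blaschke_factor (a j) z else 1) = 0)"
      using has_prod_eq_0_iff[OF p(1)] by auto
    also have "\<dots> \<longleftrightarrow> (\<exists>j\<in>J. z = a j)" using bz by (auto split: if_splits)
    finally show ?thesis .
  qed
  show thesis using that[OF c(1) lim zero aJ] .
qed

lemma blaschke_product_le_part:
  assumes "blaschke_product J a B" "cmod z < 1"
  shows "cmod (B z) \<le> cmod (blaschke_part J a n z)" "cmod (B z) \<le> 1"
proof -
  obtain c where c: "cmod c = 1" "\<And>z. cmod z < 1 \<Longrightarrow> (\<lambda>n. c * blaschke_part J a n z) \<longlonglongrightarrow> B z" "a ` J \<subseteq> ball 0 1"
    using blaschke_productE[OF assms(1)] by metis
  have "(\<lambda>n. cmod (c * blaschke_part J a n z)) \<longlonglongrightarrow> cmod (B z)" using c(2)[OF assms(2)] by (rule tendsto_norm)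
  then have lim: "(\<lambda>n. cmod (blaschke_part J a n z)) \<longlonglongrightarrow> cmod (B z)" using c(1) by (simp add: norm_mult)
  show le: "cmod (B z) \<le> cmod (blaschke_part J a n z)" for n
    by (rule LIMSEQ_le_const2[OF lim]) (use blaschke_part_decseq[OF c(3), of z n] assms(2) in auto)
  show "cmod (B z) \<le> 1"
    using order_trans[OF le cmod_blaschke_part_le_1[OF c(3)]] assms(2) by simp
qed

text \<open>Convergence of the partial products is known only pointwise; Montel's theorem supplies a
  subsequence with holomorphic limit, and this limit must be \<open>B\<close>.\<close>

lemma blaschke_product_holomorphic:
  assumes "blaschke_product J a B" shows "B holomorphic_on ball 0 1"
proof -
  obtain c where c: "cmod c = 1" "\<And>z. cmod z < 1 \<Longrightarrow> (\<lambda>n. c * blaschke_part J a n z) \<longlonglongrightarrow> B z" "a ` J \<subseteq> ball 0 1"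
    using blaschke_productE[OF assms(1)] by metis
  define F where "F n z = c * blaschke_part J a n z" for n z
  have b: "cmod (F n z) \<le> 1" if "cmod z < 1" for n z
    using cmod_blaschke_part_le_1[OF c(3), of z n] c(1) that by (simp add: F_def norm_mult)
  obtain g r where g: "g holomorphic_on ball 0 1" "strict_mono (r :: nat \<Rightarrow> nat)"
    "\<And>x. x \<in> ball 0 1 \<Longrightarrow> ((\<lambda>n. F (r n) x) \<longlongrightarrow> g x) sequentially"
  proof (rule Montel[of "ball 0 1" "range F" F])
    show "h holomorphic_on ball 0 1" if "h \<in> range F" for h
      using that blaschke_part_holomorphic[OF c(3)] by (auto simp: F_def[abs_def] intro!: holomorphic_intros)
    show "\<exists>B. \<forall>h\<in>range F. \<forall>z\<in>K. cmod (h z) \<le> B" if "K \<subseteq> ball 0 1" for K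
      using b that by (intro exI[of _ 1]) auto
  qed auto
  have "g z = B z" if "z \<in> ball 0 1" for z
    using LIMSEQ_unique[OF g(3)[OF that] LIMSEQ_subseq_LIMSEQ[OF _ g(2), unfolded o_def], of "B z"] c(2)[of z] that
    by (auto simp: F_def)
  then show ?thesis using g(1) holomorphic_transform by blast
qed

text \<open>With \<open>x = |disc_aut (a j) z|^2 \<ge> t^2\<close> one has
  \<open>- ln x \<le> (1 - x) / x \<le> prox z (a j) / t^2\<close>, and the sum over the zeros is at
  most \<open>K / t^2\<close>. The 2 in the exponent accounts for the square.\<close>

lemma blaschke_product_lower_bound:
  assumes B: "blaschke_product J a B" and K: "prox_bounded J a K"
    and z: "cmod z < 1" and t: "t > 0" "\<And>j. j \<in> J \<Longrightarrow> cmod (disc_aut (a j) z) \<ge> t"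
  shows "cmod (B z) \<ge> exp (- K / (2 * t\<^sup>2))"
proof -
  obtain c where c: "cmod c = 1" "\<And>z. cmod z < 1 \<Longrightarrow> (\<lambda>n. c * blaschke_part J a n z) \<longlonglongrightarrow> B z" "a ` J \<subseteq> ball 0 1"
    using blaschke_productE[OF B] by metis
  have "cmod (c * blaschke_part J a n z) \<ge> exp (- K / (2 * t\<^sup>2))" for n
  proof -
    let ?F = "J \<inter> {..<n}"
    have each: "(cmod (disc_aut (a j) z))\<^sup>2 \<ge> exp (- prox z (a j) / t\<^sup>2)" if j: "j \<in> J" for j
    proof -
      define x where "x = (cmod (disc_aut (a j) z))\<^sup>2"
      have aj: "cmod (a j) < 1" using c(3) j by auto
      have x: "x \<ge> t\<^sup>2" using t(2)[OF j] t(1) unfolding x_def by (intro power_mono) auto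
      have xp: "prox z (a j) = 1 - x"
        unfolding x_def using cmod_disc_aut_sq[OF one_minus_cnj_mult_nonzero, of "a j" z] aj z
        by (simp add: prox_commute)
      have p0: "1 - x \<ge> 0" using prox_pos[OF z aj] xp by simp
      have t2: "t\<^sup>2 > 0" using t(1) by simp
      then have x0: "x > 0" using x by linarith
      have "ln (1 / x) \<le> 1 / x - 1" using x0 by (intro ln_le_minus_one) auto
      also have "\<dots> = (1 - x) / x" using x0 by (simp add: field_simps)
      also have "\<dots> \<le> (1 - x) / t\<^sup>2" using x t2 x0 p0 by (intro divide_left_mono mult_pos_pos) auto
      also have "ln (1 / x) = - ln x" using x0 by (simp add: ln_div)
      finally have "- (1 - x) / t\<^sup>2 \<le> ln x" unfolding minus_divide_left[symmetric] by linarith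
      then show ?thesis unfolding x_def[symmetric] xp using x0 by (metis exp_le_cancel_iff exp_ln)
    qed
    have "exp (- K / t\<^sup>2) \<le> exp (\<Sum>j\<in>?F. - prox z (a j) / t\<^sup>2)"
    proof -
      have "(\<Sum>j\<in>?F. prox z (a j)) \<le> K" using K z unfolding prox_bounded_def by blast
      then show ?thesis using t(1) by (simp add: sum_divide_distrib[symmetric] sum_negf divide_right_mono)
    qed
    also have "\<dots> = (\<Prod>j\<in>?F. exp (- prox z (a j) / t\<^sup>2))" by (rule exp_sum) simp
    also have "\<dots> \<le> (\<Prod>j\<in>?F. (cmod (disc_aut (a j) z))\<^sup>2)" using each by (intro prod_mono) auto
    also have "\<dots> = (cmod (c * blaschke_part J a n z))\<^sup>2"
      using c(1) by (simp add: norm_mult cmod_blaschke_part prod_power_distrib)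
    finally have "(exp (- K / (2 * t\<^sup>2)))\<^sup>2 \<le> (cmod (c * blaschke_part J a n z))\<^sup>2"
      by (simp add: exp_double[symmetric] power2_eq_square exp_add[symmetric])
    then show ?thesis by (rule power2_le_imp_le) simp
  qed
  moreover have "(\<lambda>n. cmod (c * blaschke_part J a n z)) \<longlonglongrightarrow> cmod (B z)" using c(2)[OF z] by (rule tendsto_norm)
  ultimately show ?thesis by (intro LIMSEQ_le_const) auto
qed

text \<open>Boundedly many zeros lie in a pseudohyperbolic disc, so they leave room for a point that is
  well separated from all of them.\<close>

lemma blaschke_product_large_nearby:
  assumes B: "blaschke_product J a B" and K: "prox_bounded J a K"
  obtains c where "c > 0" "\<And>z. cmod z < 1 \<Longrightarrow> \<exists>w. cmod w < 1 \<and> cmod (disc_aut z w) \<le> 1 / 2 \<and> cmod (B w) \<ge> c"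
proof -
  have aJ: "cmod (a j) < 1" if "j \<in> J" for j
    using B that unfolding blaschke_product_def blaschke_sequence_def by auto
  have K0: "K \<ge> 0" using K[unfolded prox_bounded_def, rule_format, of 0 "{}"] by simp
  define n where "n = nat \<lceil>4 * K\<rceil>"
  have n: "real n \<ge> 4 * K" using K0 by (simp add: n_def)
  define t where "t = 1 / (8 * (real n + 1))"
  have t: "t > 0" "t \<le> 1 / 8" by (auto simp: t_def field_simps)
  have "\<exists>w. cmod w < 1 \<and> cmod (disc_aut z w) \<le> 1 / 2 \<and> cmod (B w) \<ge> exp (- K / (2 * t\<^sup>2))" if z: "cmod z < 1" for z
  proof -
    \<comment> \<open>\<open>n + 1\<close> candidates on a real segment, consecutive ones
      \<open>4 * t\<close> apart, in coordinates centred at \<open>z\<close>. If each were within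
      \<open>t\<close> of some zero, these zeros would have distinct indices and contribute at least
      1/4 each, more than \<open>K\<close> in total.\<close>
    define v where "v k = complex_of_real (real k / (2 * (real n + 1)))" for k :: nat
    have v: "cmod (v k) \<le> 1 / 2" if "k \<le> n" for k
      using that unfolding v_def norm_of_real by (simp add: field_simps)
    have "\<exists>k\<le>n. \<forall>j\<in>J. cmod (disc_aut (disc_aut z (a j)) (v k)) \<ge> t"
    proof (rule ccontr)
      assume "\<not> ?thesis"
      then have "\<forall>k. \<exists>j. k \<le> n \<longrightarrow> j \<in> J \<and> cmod (disc_aut (disc_aut z (a j)) (v k)) < t" by (meson not_le)
      then obtain jj where jj: "\<And>k. k \<le> n \<Longrightarrow> jj k \<in> J \<and> cmod (disc_aut (disc_aut z (a (jj k))) (v k)) < t" by metis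
      define b where "b k = disc_aut z (a (jj k))" for k
      have b: "cmod (b k) < 1" if "k \<le> n" for k
        unfolding b_def using jj[OF that] aJ z by (intro cmod_disc_aut_less_1) auto
      have close: "cmod (b k - v k) < 2 * t" if k: "k \<le> n" for k
      proof -
        have nz: "1 - cnj (b k) * v k \<noteq> 0" using one_minus_cnj_mult_nonzero[of "b k" "v k"] b[OF k] v[OF k] by simp
        have "cmod (b k - v k) = cmod (disc_aut (b k) (v k)) * cmod (1 - cnj (b k) * v k)"
          using nz by (simp add: disc_aut_def norm_divide)
        also have "cmod (1 - cnj (b k) * v k) \<le> 1 + cmod (b k) * cmod (v k)"
          by (rule order_trans[OF norm_triangle_ineq4]) (simp add: norm_mult)
        also have "cmod (b k) * cmod (v k) \<le> 1 * 1" using b[OF k] v[OF k] by (intro mult_mono) auto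
        finally have "cmod (b k - v k) \<le> cmod (disc_aut (b k) (v k)) * 2"
          by (simp add: mult_left_mono)
        then show ?thesis using jj[OF k] unfolding b_def by simp
      qed
      have inj: "inj_on jj {..n}"
      proof (rule inj_onI, rule ccontr)
        fix k l assume kl: "k \<in> {..n}" "l \<in> {..n}" "jj k = jj l" "k \<noteq> l"
        have "cmod (v k - v l) = \<bar>real k - real l\<bar> / (2 * (real n + 1))"
          unfolding v_def of_real_diff[symmetric] norm_of_real diff_divide_distrib[symmetric] by simp
        also have "\<dots> \<ge> 1 / (2 * (real n + 1))" using kl(4) by (intro divide_right_mono) auto
        finally have "cmod (v k - v l) \<ge> 4 * t" by (simp add: t_def field_simps)
        moreover have "cmod (v k - v l) \<le> cmod (b k - v k) + cmod (b l - v l)"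
          using norm_triangle_ineq4[of "b l - v l" "b k - v k"] kl(3) by (simp add: b_def)
        ultimately show False using close[of k] close[of l] kl by auto
      qed
      have px: "prox z (a (jj k)) \<ge> 1 / 4" if k: "k \<le> n" for k
      proof -
        have "cmod (b k) \<le> cmod (v k) + cmod (b k - v k)" using norm_triangle_ineq[of "v k" "b k - v k"] by simp
        then have "cmod (b k) \<le> 3 / 4" using v[OF k] close[OF k] t(2) by linarith
        then have "(cmod (b k))\<^sup>2 \<le> (3 / 4)\<^sup>2" by (intro power_mono) auto
        moreover have "(cmod (b k))\<^sup>2 = 1 - prox z (a (jj k))"
          unfolding b_def using jj[OF k] aJ[of "jj k"] z
          by (intro cmod_disc_aut_sq one_minus_cnj_mult_nonzero) auto
        ultimately show ?thesis by (simp add: power2_eq_square)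
      qed
      have "(real n + 1) * (1 / 4) = (\<Sum>k\<le>n. 1 / 4)" by simp
      also have "\<dots> \<le> (\<Sum>k\<le>n. prox z (a (jj k)))" using px by (intro sum_mono) auto
      also have "\<dots> = (\<Sum>j\<in>jj ` {..n}. prox z (a j))" by (simp add: sum.reindex[OF inj])
      also have "\<dots> \<le> K" using jj by (intro K[unfolded prox_bounded_def, rule_format] z) auto
      finally show False using n by simp
    qed
    then obtain k where k: "k \<le> n" "\<And>j. j \<in> J \<Longrightarrow> cmod (disc_aut (disc_aut z (a j)) (v k)) \<ge> t" by blast
    define w where "w = disc_aut z (v k)"
    have vk: "cmod (v k) < 1" using v[OF k(1)] by simp
    have w: "cmod w < 1" "disc_aut z w = v k"
      unfolding w_def using cmod_disc_aut_less_1[OF z vk] disc_aut_disc_aut[OF z, of "v k"] vk by auto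
    have "cmod (disc_aut (a j) w) \<ge> t" if j: "j \<in> J" for j
      using cmod_disc_aut_invariant[OF z aJ[OF j] w(1)] k(2)[OF j] w(2) by simp
    then have "cmod (B w) \<ge> exp (- K / (2 * t\<^sup>2))"
      using blaschke_product_lower_bound[OF B K w(1) t(1)] by blast
    then show ?thesis using w v[OF k(1)] by auto
  qed
  then show thesis using that[of "exp (- K / (2 * t\<^sup>2))"] by simp
qed

text \<open>The bridge from the measure of a box to finite sums over the zeros, the form in which
  \<open>prox_bounded\<close> is stated.\<close>

lemma zeros_measure_box_le_iff:
  assumes X: "X \<ge> 0" and a: "a ` J \<subseteq> ball 0 1"
  shows "emeasure (zeros_measure J a) (carleson_box \<alpha> \<beta>) \<le> ennreal X \<longleftrightarrow>
    (\<forall>F. finite F \<longrightarrow> F \<subseteq> {j \<in> J. a j \<in> carleson_box \<alpha> \<beta>} \<longrightarrow> (\<Sum>j\<in>F. 1 - cmod (a j)) \<le> X)"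
proof -
  let ?G = "{j \<in> J. a j \<in> carleson_box \<alpha> \<beta>}"
  define f where "f j = (if j \<in> ?G then ennreal (1 - cmod (a j)) else 0)" for j
  have nn: "1 - cmod (a j) \<ge> 0" if "j \<in> J" for j using a that by (auto simp: less_imp_le)
  have "emeasure (zeros_measure J a) (carleson_box \<alpha> \<beta>) = (\<integral>\<^sup>+ j. ennreal (1 - cmod (a j)) \<partial>count_space ?G)"
    by (rule emeasure_zeros_measure[OF carleson_box_borel])
  also have "\<dots> = (\<integral>\<^sup>+ j. ennreal (1 - cmod (a j)) * indicator ?G j \<partial>count_space UNIV)"
    by (rule nn_integral_count_space_indicator) simp
  also have "\<dots> = (\<integral>\<^sup>+ j. f j \<partial>count_space UNIV)"
    by (intro nn_integral_cong) (auto simp: f_def)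
  also have "\<dots> = (\<Sum>j. f j)" by (rule nn_integral_count_space_nat)
  finally have eq: "emeasure (zeros_measure J a) (carleson_box \<alpha> \<beta>) = (\<Sum>j. f j)" .
  have fs: "sum f F = ennreal (\<Sum>j\<in>F. 1 - cmod (a j))" if "F \<subseteq> ?G" for F
  proof -
    have "sum f F = (\<Sum>j\<in>F. ennreal (1 - cmod (a j)))" using that by (intro sum.cong) (auto simp: f_def)
    then show ?thesis using that nn by (subst sum_ennreal[symmetric]) auto
  qed
  show ?thesis
  proof (intro iffI allI impI)
    fix F assume le: "emeasure (zeros_measure J a) (carleson_box \<alpha> \<beta>) \<le> ennreal X" and F: "finite F" "F \<subseteq> ?G"
    have "sum f F \<le> (\<Sum>j. f j)" using F by (intro sum_le_suminf) auto
    then have "ennreal (\<Sum>j\<in>F. 1 - cmod (a j)) \<le> ennreal X" using le unfolding eq fs[OF F(2)] by (rule order_trans)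
    then show "(\<Sum>j\<in>F. 1 - cmod (a j)) \<le> X" using X by (simp add: ennreal_le_iff)
  next
    assume H: "\<forall>F. finite F \<longrightarrow> F \<subseteq> ?G \<longrightarrow> (\<Sum>j\<in>F. 1 - cmod (a j)) \<le> X"
    have "(\<Sum>j<n. f j) \<le> ennreal X" for n
    proof -
      have "(\<Sum>j<n. f j) = sum f (?G \<inter> {..<n})" by (rule sum.mono_neutral_right) (auto simp: f_def)
      also have "\<dots> \<le> ennreal X" using H[rule_format, of "?G \<inter> {..<n}"] by (subst fs) (auto intro: ennreal_leI)
      finally show ?thesis .
    qed
    then show "emeasure (zeros_measure J a) (carleson_box \<alpha> \<beta>) \<le> ennreal X"
      unfolding eq by (intro suminf_le_const) auto
  qed
qed

section \<open>Elementary estimates in polar coordinates\<close>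

lemma cmod_one_minus_cis: "cmod (1 - cis x) = 2 * \<bar>sin (x / 2)\<bar>"
proof -
  have "(cmod (1 - cis x))\<^sup>2 = (2 * \<bar>sin (x / 2)\<bar>)\<^sup>2"
  proof -
    have "(cmod (1 - cis x))\<^sup>2 = 2 - 2 * cos x"
      using sin_cos_squared_add[of x] unfolding cmod_power2 by (simp add: power2_eq_square algebra_simps)
    also have "cos x = 1 - 2 * (sin (x / 2))\<^sup>2" using cos_double_sin[of "x / 2"] by simp
    finally show ?thesis by (simp add: power_mult_distrib)
  qed
  then show ?thesis by (rule power2_eq_imp_eq) auto
qed

lemma sin_ge_half:
  assumes "0 \<le> x" "x \<le> pi / 2" shows "sin x \<ge> x / 2"
proof (cases "x \<le> pi / 3")
  case True
  have "0 / 2 \<le> x / 2" using assms by simp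
  have "sin 0 - 0 / 2 \<le> sin x - x / 2"
  proof (rule DERIV_nonneg_imp_nondecreasing[OF assms(1)])
    fix y assume y: "0 \<le> y" "y \<le> x"
    have "cos (pi / 3) \<le> cos y" using y True pi_gt_zero by (intro cos_monotone_0_pi_le) auto
    then have "cos y - 1 / 2 \<ge> 0" by (simp add: cos_60)
    moreover have "((\<lambda>x. sin x - x / 2) has_real_derivative (cos y - 1 / 2)) (at y)" by (auto intro!: derivative_eq_intros)
    ultimately show "\<exists>d. ((\<lambda>x. sin x - x / 2) has_real_derivative d) (at y) \<and> d \<ge> 0" by blast
  qed
  then show ?thesis by simp
next
  case False
  have "sin (pi / 3) \<le> sin x" using False assms by (intro sin_monotone_2pi_le) auto
  moreover have "sqrt 3 \<ge> 1.7" by (rule real_le_rsqrt) (simp add: power2_eq_square)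
  moreover have "pi < 3.2" using pi_approx by simp
  ultimately show ?thesis using assms by (simp add: sin_60)
qed

lemma cmod_one_minus_cis_bounds:
  assumes "\<bar>x\<bar> \<le> pi" shows "\<bar>x\<bar> / 2 \<le> cmod (1 - cis x)" "cmod (1 - cis x) \<le> \<bar>x\<bar>"
proof -
  have s: "\<bar>sin (x / 2)\<bar> = sin (\<bar>x\<bar> / 2)"
    using assms sin_ge_zero[of "\<bar>x\<bar> / 2"] by (cases "x \<ge> 0") (auto simp: abs_if)
  show "\<bar>x\<bar> / 2 \<le> cmod (1 - cis x)" unfolding cmod_one_minus_cis s using sin_ge_half[of "\<bar>x\<bar> / 2"] assms by simp
  show "cmod (1 - cis x) \<le> \<bar>x\<bar>" unfolding cmod_one_minus_cis s using sin_x_le_x[of "\<bar>x\<bar> / 2"] by simp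
qed

lemma polar_near:
  obtains s where "a = of_real (cmod a) * cis s" "\<bar>s - \<tau>\<bar> \<le> pi"
proof -
  have "a * cis (- \<tau>) = of_real (cmod (a * cis (- \<tau>))) * cis (Arg (a * cis (- \<tau>)))"
    by (metis rcis_cmod_Arg rcis_def)
  then have "a * cis (- \<tau>) * cis \<tau> = of_real (cmod a) * cis (Arg (a * cis (- \<tau>)) + \<tau>)"
    by (simp add: norm_mult cis_mult[symmetric] mult_ac)
  then have "a = of_real (cmod a) * cis (Arg (a * cis (- \<tau>)) + \<tau>)" by (simp add: mult.assoc cis_mult)
  moreover have "\<bar>Arg (a * cis (- \<tau>)) + \<tau> - \<tau>\<bar> \<le> pi" using Arg_bounded[of "a * cis (- \<tau>)"] by (simp add: abs_le_iff)
  ultimately show thesis using that by blast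
qed

lemma one_minus_cnj_polar:
  "1 - cnj (of_real p * cis s) * (of_real q * cis t) = 1 - of_real (p * q) * cis (t - s)"
  by (simp add: cis_cnj cis_mult[symmetric] diff_conv_add_uminus del: add_uminus_conv_diff)

lemma one_minus_polar_lower:
  assumes "0 \<le> p" "p \<le> 1" "\<bar>x\<bar> \<le> pi"
  shows "cmod (1 - of_real p * cis x) \<ge> 1 - p" "cmod (1 - of_real p * cis x) \<ge> \<bar>x\<bar> / 4"
proof -
  show 1: "cmod (1 - of_real p * cis x) \<ge> 1 - p"
    using norm_triangle_ineq2[of 1 "of_real p * cis x"] assms by (simp add: norm_mult)
  have "1 - cis x = (1 - of_real p * cis x) - of_real (1 - p) * cis x" by (simp add: algebra_simps)
  then have "cmod (1 - cis x) \<le> cmod (1 - of_real p * cis x) + cmod (of_real (1 - p) * cis x)"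
    by (metis norm_triangle_ineq4)
  moreover have "cmod (of_real (1 - p) * cis x) = 1 - p" using assms unfolding norm_mult norm_of_real by simp
  ultimately show "cmod (1 - of_real p * cis x) \<ge> \<bar>x\<bar> / 4"
    using 1 cmod_one_minus_cis_bounds(1)[OF assms(3)] by linarith
qed

text \<open>For an arc of length \<open>l < 1\<close> with midpoint \<open>cis m\<close> the test
  point is \<open>z = (1 - l) * cis m\<close>: on the box
  \<open>|1 - cnj z * a| \<le> 3 * l\<close>, whence \<open>1 - |a| \<le> 9 * l * prox z a\<close>.
  Longer arcs are tested at 0. The summand 1 in the constant keeps it positive when
  \<open>K = 0\<close>.\<close>

theorem prox_bounded_imp_carleson:
  assumes a: "a ` J \<subseteq> ball 0 1" and K: "prox_bounded J a K"
  shows "carleson_measure (zeros_measure J a)"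
proof -
  have aJ: "cmod (a j) < 1" if "j \<in> J" for j using a that by auto
  have K0: "K \<ge> 0" using K[unfolded prox_bounded_def, rule_format, of 0 "{}"] by simp
  have sq: "1 - x \<le> 1 - x\<^sup>2" if "0 \<le> x" "x \<le> 1" for x :: real
    using that by (simp add: power2_eq_square mult_left_le)
  have "emeasure (zeros_measure J a) (carleson_box \<alpha> \<beta>) \<le> ennreal ((9 * K + 1) * (\<beta> - \<alpha>))"
    if ab: "\<alpha> < \<beta>" "\<beta> \<le> \<alpha> + 2 * pi" for \<alpha> \<beta>
  proof (subst zeros_measure_box_le_iff[OF _ a], goal_cases)
    case 1
    then show ?case using ab K0 by simp
  next
    case 2
    show ?case
    proof (intro allI impI)
      fix F assume F: "finite F" "F \<subseteq> {j \<in> J. a j \<in> carleson_box \<alpha> \<beta>}"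
      define l where "l = \<beta> - \<alpha>"
      have l: "l > 0" using ab by (simp add: l_def)
      have "(\<Sum>j\<in>F. 1 - cmod (a j)) \<le> 9 * K * l"
      proof (cases "l \<ge> 1")
        case True
        have "(\<Sum>j\<in>F. 1 - cmod (a j)) \<le> (\<Sum>j\<in>F. prox 0 (a j))"
        proof (rule sum_mono)
          fix j assume "j \<in> F"
          then have "cmod (a j) < 1" using F aJ by auto
          then show "1 - cmod (a j) \<le> prox 0 (a j)" using sq[of "cmod (a j)"] by (simp add: prox_def)
        qed
        also have "\<dots> \<le> K" using F by (intro K[unfolded prox_bounded_def, rule_format]) auto
        also have "\<dots> \<le> 9 * K * l" using K0 True mult_mono[of K "9 * K" 1 l] by simp
        finally show ?thesis .
      next
        case False
        define m where "m = (\<alpha> + \<beta>) / 2"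
        define z where "z = complex_of_real (1 - l) * cis m"
        have z: "cmod z = 1 - l" using False unfolding z_def norm_mult norm_of_real by simp
        have each: "1 - cmod (a j) \<le> 9 * l * prox z (a j)" if j: "j \<in> F" for j
        proof -
          have jb: "j \<in> J" "a j \<in> carleson_box \<alpha> \<beta>" using F j by auto
          then obtain s where s: "a j / of_real (cmod (a j)) = cis s" "\<alpha> \<le> s" "s \<le> \<beta>" and d: "1 - cmod (a j) \<le> l"
            unfolding carleson_box_def l_def by auto
          have anz: "a j \<noteq> 0" using s(1) by auto
          then have aj: "a j = of_real (cmod (a j)) * cis s" using s(1) by (simp add: field_simps)
          define p where "p = (1 - l) * cmod (a j)"
          have p: "0 \<le> p" "p \<le> 1" "1 - p \<le> 2 * l"
          proof -
            show "0 \<le> p" using False by (simp add: p_def)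
            show "p \<le> 1" unfolding p_def using False l aJ[OF jb(1)] by (intro mult_le_one) auto
            have "l * cmod (a j) \<le> l * 1" using l aJ[OF jb(1)] by (intro mult_left_mono) auto
            then show "1 - p \<le> 2 * l" using d by (simp add: p_def algebra_simps)
          qed
          have sm: "\<bar>s - m\<bar> \<le> l / 2" using s by (simp add: m_def l_def abs_le_iff field_simps)
          have smp: "\<bar>s - m\<bar> \<le> pi" using sm False pi_gt3 by linarith
          have "1 - cnj z * a j = 1 - of_real p * cis (s - m)"
            unfolding z_def p_def by (subst aj, subst one_minus_cnj_polar) simp
          also have "\<dots> = of_real (1 - p) + of_real p * (1 - cis (s - m))" by (simp add: algebra_simps)
          finally have "cmod (1 - cnj z * a j) \<le> cmod (of_real (1 - p)) + cmod (of_real p * (1 - cis (s - m)))"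
            by (metis norm_triangle_ineq)
          also have "\<dots> \<le> 2 * l + 1 * (l / 2)"
          proof (rule add_mono)
            show "cmod (of_real (1 - p)) \<le> 2 * l" unfolding norm_of_real using p by simp
            show "cmod (of_real p * (1 - cis (s - m))) \<le> 1 * (l / 2)"
              unfolding norm_mult norm_of_real using p sm cmod_one_minus_cis_bounds(2)[OF smp] by (intro mult_mono) auto
          qed
          finally have D: "cmod (1 - cnj z * a j) \<le> 3 * l" using l by simp
          have D0: "cmod (1 - cnj z * a j) > 0"
            using one_minus_cnj_mult_nonzero[of z "a j"] z l aJ[OF jb(1)] by simp
          have "l * (1 - cmod (a j)) \<le> (1 - (cmod z)\<^sup>2) * (1 - (cmod (a j))\<^sup>2)"
            using sq[of "cmod z"] sq[of "cmod (a j)"] z l False aJ[OF jb(1)] by (intro mult_mono) auto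
          also have "\<dots> = prox z (a j) * (cmod (1 - cnj z * a j))\<^sup>2" using D0 by (simp add: prox_def)
          also have "\<dots> \<le> prox z (a j) * (3 * l)\<^sup>2"
            using D prox_pos[of z "a j"] z l False aJ[OF jb(1)] by (intro mult_left_mono power_mono) auto
          also have "\<dots> = l * (9 * l * prox z (a j))" by (simp add: power2_eq_square)
          finally show ?thesis using l by simp
        qed
        have "(\<Sum>j\<in>F. 1 - cmod (a j)) \<le> 9 * l * (\<Sum>j\<in>F. prox z (a j))"
          unfolding sum_distrib_left using each by (intro sum_mono)
        also have "\<dots> \<le> 9 * l * K" using F z l by (intro mult_left_mono K[unfolded prox_bounded_def, rule_format]) auto
        finally show ?thesis by (simp add: mult_ac)
      qed
      also have "\<dots> \<le> (9 * K + 1) * (\<beta> - \<alpha>)" using l by (simp add: l_def algebra_simps)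
      finally show "(\<Sum>j\<in>F. 1 - cmod (a j)) \<le> (9 * K + 1) * (\<beta> - \<alpha>)" .
    qed
  qed
  then show ?thesis unfolding carleson_measure_def using K0 by (intro exI[of _ "9 * K + 1"]) auto
qed

text \<open>The zeros are sorted by the dyadic size \<open>2^k * l\<close> of
  \<open>|1 - cnj z * a|\<close>, where \<open>l = 1 - |z|\<close>. The k-th group lies in a box
  over an arc of length at most \<open>8 * 2^k * l\<close>, which bounds its mass, while
  \<open>prox z a\<close> is at most \<open>16 * (1 - |a|) / (4^k * l)\<close> on it. The
  contributions form a geometric series.\<close>

theorem carleson_imp_prox_bounded:
  assumes seq: "blaschke_sequence J a" and car: "carleson_measure (zeros_measure J a)"
  obtains K where "prox_bounded J a K"
proof -
  have a: "a ` J \<subseteq> ball 0 1" using seq unfolding blaschke_sequence_def by blast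
  have aJ: "cmod (a j) < 1" if "j \<in> J" for j using a that by auto
  \<comment> \<open>The origin lies in no \<open>carleson_box\<close>, since
    \<open>0 / 0 = 0\<close> is not on the unit circle. Zeros at the origin are therefore counted by
    the Blaschke sum \<open>M\<close>.\<close>
  define M where "M = (\<Sum>\<^sub>\<infinity>j\<in>J. 1 - cmod (a j))"
  have M: "(\<Sum>j\<in>F. 1 - cmod (a j)) \<le> M" if "finite F" "F \<subseteq> J" for F
    unfolding M_def using seq that aJ unfolding blaschke_sequence_def by (intro finite_sum_le_infsum) (auto simp: less_imp_le)
  obtain C where C: "C > 0" "\<And>\<alpha> \<beta>. \<alpha> < \<beta> \<Longrightarrow> \<beta> \<le> \<alpha> + 2 * pi \<Longrightarrow>
      emeasure (zeros_measure J a) (carleson_box \<alpha> \<beta>) \<le> ennreal (C * (\<beta> - \<alpha>))"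
    using car unfolding carleson_measure_def by blast
  have "(\<Sum>j\<in>F. prox z (a j)) \<le> M + 256 * C" if z: "cmod z < 1" and F: "finite F" "F \<subseteq> J" for z F
  proof -
    define l where "l = 1 - cmod z"
    have l: "0 < l" "l \<le> 1" using z by (auto simp: l_def)
    obtain \<tau> where \<tau>: "z = of_real (cmod z) * cis \<tau>" using polar_near by blast
    define w where "w k = min (4 * 2 ^ k * l) pi" for k :: nat
    have w: "w k > 0" "w k \<le> pi" "w k \<le> 4 * 2 ^ k * l" for k using l by (auto simp: w_def)
    define Q where "Q k = carleson_box (\<tau> - w k) (\<tau> + w k)" for k
    have each: "\<exists>k. a j \<in> Q k \<and> prox z (a j) \<le> 16 * (1 - cmod (a j)) / (4 ^ k * l)" if j: "j \<in> F" "a j \<noteq> 0" for j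
    proof -
      have aj: "cmod (a j) < 1" using F j aJ by auto
      obtain s where s: "a j = of_real (cmod (a j)) * cis s" "\<bar>s - \<tau>\<bar> \<le> pi" using polar_near by blast
      define p where "p = cmod z * cmod (a j)"
      have p: "0 \<le> p" "p \<le> cmod z" "p \<le> cmod (a j)"
        using z aj mult_left_mono[of "cmod (a j)" 1 "cmod z"] mult_right_mono[of "cmod z" 1 "cmod (a j)"] by (auto simp: p_def)
      define d where "d = cmod (1 - cnj z * a j)"
      have "1 - cnj z * a j = 1 - of_real p * cis (s - \<tau>)"
        unfolding p_def by (subst \<tau>, subst s(1), subst one_minus_cnj_polar) simp
      then have d_eq: "d = cmod (1 - of_real p * cis (s - \<tau>))" by (simp add: d_def)
      have d: "d \<ge> l" "d \<ge> 1 - cmod (a j)" "d \<ge> \<bar>s - \<tau>\<bar> / 4"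
        using one_minus_polar_lower[of p "s - \<tau>"] p s(2) z unfolding d_eq l_def by auto
      have ex: "\<exists>k. d \<le> 2 ^ k * l"
      proof -
        obtain k where "d / l < 2 ^ k" using real_arch_pow[of 2 "d / l"] by auto
        then show ?thesis using l by (auto simp: field_simps intro: less_imp_le)
      qed
      \<comment> \<open>Minimality gives \<open>2 ^ k * l \<le> 2 * d\<close>; for
        \<open>k = 0\<close> this comes from \<open>d \<ge> l\<close>.\<close>
      define k where "k = (LEAST k. d \<le> 2 ^ k * l)"
      have k1: "d \<le> 2 ^ k * l" unfolding k_def using ex by (rule LeastI_ex)
      have k2: "2 ^ k * l \<le> 2 * d"
      proof (cases k)
        case 0 then show ?thesis using d(1) l by simp
      next
        case (Suc m)
        then have "\<not> d \<le> 2 ^ m * l" using not_less_Least[of m "\<lambda>k. d \<le> 2 ^ k * l"] unfolding k_def by simp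
        then show ?thesis using Suc by simp
      qed
      have "a j \<in> Q k"
      proof -
        have "\<bar>s - \<tau>\<bar> \<le> w k" unfolding w_def using d(3) k1 s(2) by simp
        moreover have "1 - cmod (a j) \<le> 2 * w k"
        proof -
          have "0 \<le> 2 ^ k * l" using l by simp
          then have "1 - cmod (a j) \<le> 2 * (4 * 2 ^ k * l)" using d(2) k1 by linarith
          moreover have "1 - cmod (a j) \<le> 2 * pi" using pi_gt3 norm_ge_zero[of "a j"] by linarith
          ultimately show ?thesis unfolding w_def by (simp add: min_def)
        qed
        moreover have "a j / of_real (cmod (a j)) = cis s" using s(1) j(2) by (metis nonzero_mult_div_cancel_left norm_eq_zero of_real_eq_0_iff)
        ultimately show ?thesis unfolding Q_def carleson_box_def using aj by (auto simp: abs_le_iff)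
      qed
      moreover have "prox z (a j) \<le> 16 * (1 - cmod (a j)) / (4 ^ k * l)"
      proof -
        have "1 - x\<^sup>2 \<le> 2 * (1 - x)" for x :: real
          using zero_le_power2[of "x - 1"] by (simp add: power2_eq_square algebra_simps)
        then have n: "(1 - (cmod z)\<^sup>2) * (1 - (cmod (a j))\<^sup>2) \<le> (2 * l) * (2 * (1 - cmod (a j)))"
          using z aj unfolding l_def by (intro mult_mono) (auto simp: power_le_one)
        have "(2 ^ k * l / 2)\<^sup>2 \<le> d\<^sup>2" using k2 l by (intro power_mono) auto
        then have dd: "4 ^ k * l\<^sup>2 / 4 \<le> d\<^sup>2"
          by (simp add: power_divide power_mult_distrib power_mult[symmetric] mult.commute[of k] power_mult[of 2 2 k, simplified])
        have pos: "4 ^ k * l\<^sup>2 / 4 > 0" using l by simp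
        have "prox z (a j) \<le> (2 * l) * (2 * (1 - cmod (a j))) / (4 ^ k * l\<^sup>2 / 4)"
          unfolding prox_def d_def[symmetric] using n dd pos l aj by (intro frac_le) auto
        also have "\<dots> = 16 * (1 - cmod (a j)) / (4 ^ k * l)" using l by (simp add: field_simps power2_eq_square)
        finally show ?thesis .
      qed
      ultimately show ?thesis by blast
    qed
    then obtain kk where kk: "\<And>j. j \<in> F \<Longrightarrow> a j \<noteq> 0 \<Longrightarrow> a j \<in> Q (kk j) \<and> prox z (a j) \<le> 16 * (1 - cmod (a j)) / (4 ^ kk j * l)"
      by metis
    define F0 where "F0 = {j \<in> F. a j = 0}"
    define F1 where "F1 = {j \<in> F. a j \<noteq> 0}"
    have FF: "F = F0 \<union> F1" "F0 \<inter> F1 = {}" "finite F0" "finite F1" "F0 \<subseteq> J" "F1 \<subseteq> J"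
      using F by (auto simp: F0_def F1_def)
    have "(\<Sum>j\<in>F0. prox z (a j)) \<le> (\<Sum>j\<in>F0. 1 - cmod (a j))"
      by (rule sum_mono) (auto simp: F0_def prox_def)
    also have "\<dots> \<le> M" using M FF by blast
    finally have s0: "(\<Sum>j\<in>F0. prox z (a j)) \<le> M" .
    have "(\<Sum>j\<in>F1. prox z (a j)) = (\<Sum>k\<in>kk ` F1. \<Sum>j\<in>{j \<in> F1. kk j = k}. prox z (a j))"
      by (rule sum.image_gen[OF FF(4)])
    also have "\<dots> \<le> (\<Sum>k\<in>kk ` F1. 128 * C * (1 / 2) ^ k)"
    proof (rule sum_mono)
      fix k
      let ?G = "{j \<in> F1. kk j = k}"
      have "(\<Sum>j\<in>?G. prox z (a j)) \<le> (\<Sum>j\<in>?G. 16 / (4 ^ k * l) * (1 - cmod (a j)))"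
        using kk by (intro sum_mono) (auto simp: F1_def)
      also have "\<dots> = 16 / (4 ^ k * l) * (\<Sum>j\<in>?G. 1 - cmod (a j))" by (rule sum_distrib_left[symmetric])
      also have "\<dots> \<le> 16 / (4 ^ k * l) * (C * (2 * (4 * 2 ^ k * l)))"
      proof (rule mult_left_mono)
        have "emeasure (zeros_measure J a) (carleson_box (\<tau> - w k) (\<tau> + w k)) \<le> ennreal (C * ((\<tau> + w k) - (\<tau> - w k)))"
          using w[of k] by (intro C) auto
        moreover have nn: "C * ((\<tau> + w k) - (\<tau> - w k)) \<ge> 0" using C(1) w[of k] by (intro mult_nonneg_nonneg) auto
        moreover have "finite ?G" using FF(4) by simp
        moreover have "?G \<subseteq> {j \<in> J. a j \<in> carleson_box (\<tau> - w k) (\<tau> + w k)}"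
          using FF(6) kk unfolding F1_def Q_def by auto
        ultimately have "(\<Sum>j\<in>?G. 1 - cmod (a j)) \<le> C * ((\<tau> + w k) - (\<tau> - w k))"
          using zeros_measure_box_le_iff[OF nn a] by blast
        also have "\<dots> \<le> C * (2 * (4 * 2 ^ k * l))" using w[of k] C(1) by (intro mult_left_mono) (auto simp: mult_ac)
        finally show "(\<Sum>j\<in>?G. 1 - cmod (a j)) \<le> C * (2 * (4 * 2 ^ k * l))" .
      qed (use l in simp)
      also have "\<dots> = 128 * C * (2 ^ k / 4 ^ k)" using l by (simp add: field_simps)
      also have "(2 ^ k / 4 ^ k :: real) = (1 / 2) ^ k" by (simp add: power_divide[symmetric])
      finally show "(\<Sum>j\<in>?G. prox z (a j)) \<le> 128 * C * (1 / 2) ^ k" .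
    qed
    also have "\<dots> = 128 * C * (\<Sum>k\<in>kk ` F1. (1 / 2) ^ k)" by (rule sum_distrib_left[symmetric])
    also have "\<dots> \<le> 128 * C * 2"
    proof (rule mult_left_mono)
      have "(\<Sum>k\<in>kk ` F1. (1 / 2 :: real) ^ k) \<le> (\<Sum>k. (1 / 2) ^ k)"
        using FF by (intro sum_le_suminf summable_geometric) auto
      then show "(\<Sum>k\<in>kk ` F1. (1 / 2 :: real) ^ k) \<le> 2" by (simp add: suminf_geometric)
    qed (use C in simp)
    finally have "(\<Sum>j\<in>F1. prox z (a j)) \<le> 256 * C" by simp
    then show ?thesis unfolding FF(1) using s0 FF by (subst sum.union_disjoint) auto
  qed
  then show thesis using that[of "M + 256 * C"] unfolding prox_bounded_def by blast
qed

section \<open>Inner functions that are not small on large discs\<close>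

text \<open>The only consequence of having unimodular radial limits that matters below.\<close>

definition inner_mean :: "(complex \<Rightarrow> complex) \<Rightarrow> bool" where
  "inner_mean B \<longleftrightarrow> B holomorphic_on ball 0 1 \<and> (\<forall>z. cmod z < 1 \<longrightarrow> cmod (B z) \<le> 1) \<and>
     (\<exists>\<rho>. (\<forall>n::nat. 0 < \<rho> n \<and> \<rho> n < 1) \<and> \<rho> \<longlonglongrightarrow> 1 \<and> (\<lambda>n. cmean (\<rho> n) (\<lambda>z. 1 - (cmod (B z))\<^sup>2)) \<longlonglongrightarrow> 0)"

section \<open>The zeros of a bounded analytic function, listed with multiplicity\<close>

lemma holomorphic_zero_extend:
  assumes "H holomorphic_on ball 0 1" "cmod w < 1" "\<And>z. cmod z < 1 \<Longrightarrow> z \<noteq> w \<Longrightarrow> H z = 0"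
  shows "H w = 0"
proof -
  have "isCont H w"
    using holomorphic_on_imp_continuous_on[OF assms(1)] assms(2) by (simp add: continuous_on_eq_continuous_at)
  then have "(H \<longlongrightarrow> H w) (at w)" by (simp add: isCont_def)
  moreover have "(H \<longlongrightarrow> 0) (at w)"
  proof (rule tendsto_eventually)
    have "eventually (\<lambda>z. z \<in> ball 0 1) (at w)" using assms(2) by (intro eventually_at_in_open') auto
    then show "eventually (\<lambda>z. H z = 0) (at w)"
      unfolding eventually_at_filter by eventually_elim (use assms(3) in auto)
  qed
  ultimately show ?thesis using tendsto_unique[OF at_neq_bot] by blast
qed

text \<open>The order is measured by division with a cofactor that is again bounded by 1. This fits
  \<open>schwarz_division\<close> and makes orders finite (\<open>order_bounded\<close>) without
  power series.\<close>

definition zero_of_order_ge :: "(complex \<Rightarrow> complex) \<Rightarrow> complex \<Rightarrow> nat \<Rightarrow> bool" where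
  "zero_of_order_ge B w k \<longleftrightarrow> (\<exists>g. g holomorphic_on ball 0 1 \<and> (\<forall>z. cmod z < 1 \<longrightarrow> cmod (g z) \<le> 1) \<and>
     (\<forall>z. cmod z < 1 \<longrightarrow> B z = disc_aut w z ^ k * g z))"

locale bounded_zeros =
  fixes B :: "complex \<Rightarrow> complex"
  assumes hol: "B holomorphic_on ball 0 1" and bd: "\<And>z. cmod z < 1 \<Longrightarrow> cmod (B z) \<le> 1"
    and nz: "\<exists>z. cmod z < 1 \<and> B z \<noteq> 0"
begin

definition "Z = {z \<in> ball 0 1. B z = 0}"
definition "zmult w = (GREATEST k. zero_of_order_ge B w k)"
text \<open>An index encodes a zero, by its number in an enumeration of \<open>Z\<close>, together
  with a copy \<open>k < zmult w\<close>, so that each zero occurs exactly as often as its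
  multiplicity (\<open>fibre_card\<close>).\<close>

definition "J = {prod_encode (to_nat_on Z w, k) | w k. w \<in> Z \<and> k < zmult w}"
definition "a j = from_nat_into Z (fst (prod_decode j))"

lemma countable_Z: "countable Z"
proof (cases "B constant_on ball 0 1")
  case True
  then have "Z = {}" using nz unfolding constant_on_def Z_def by auto
  then show ?thesis by simp
next
  case False
  have "Z \<subseteq> (\<Union>n::nat. {z \<in> cball 0 (1 - 1 / (real n + 1)). B z = 0})"
  proof
    fix z assume z: "z \<in> Z"
    then obtain n :: nat where "1 / (real n + 1) < 1 - cmod z"
      using reals_Archimedean[of "1 - cmod z"] by (auto simp: Z_def inverse_eq_divide add.commute)
    then have "cmod z \<le> 1 - 1 / (real n + 1)" by simp
    then show "z \<in> (\<Union>n::nat. {z \<in> cball 0 (1 - 1 / (real n + 1)). B z = 0})" using z by (auto simp: Z_def)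
  qed
  moreover have "finite {z \<in> cball 0 (1 - 1 / (real n + 1)). B z = 0}" for n
  proof (rule holomorphic_compact_finite_zeros[OF hol _ _ _ _ False])
    show "cball 0 (1 - 1 / (real n + 1)) \<subseteq> ball (0::complex) 1" by (simp add: cball_subset_ball_iff)
  qed auto
  ultimately show ?thesis
    by (meson countable_UN countable_finite countable_subset countableI_type)
qed

text \<open>At a point \<open>z\<close> where \<open>B\<close> does not vanish, a zero of order
  \<open>k\<close> at \<open>w\<close> forces \<open>|B z| \<le> q^k\<close> with
  \<open>q < 1\<close>.\<close>

lemma order_bounded:
  assumes "cmod w < 1" shows "\<exists>N. \<forall>k. zero_of_order_ge B w k \<longrightarrow> k \<le> N"
proof -
  obtain z where z: "cmod z < 1" "B z \<noteq> 0" using nz by blast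
  define q where "q = cmod (disc_aut w z)"
  have q: "0 \<le> q" "q < 1" using cmod_disc_aut_less_1[OF assms z(1)] by (auto simp: q_def)
  obtain N where N: "q ^ N < cmod (B z)" using real_arch_pow_inv[of "cmod (B z)" q] z q by auto
  have "k \<le> N" if ko: "zero_of_order_ge B w k" for k
  proof (rule ccontr)
    assume "\<not> k \<le> N"
    obtain g where g: "\<And>z. cmod z < 1 \<Longrightarrow> cmod (g z) \<le> 1" "\<And>z. cmod z < 1 \<Longrightarrow> B z = disc_aut w z ^ k * g z"
      using ko unfolding zero_of_order_ge_def by blast
    have "cmod (B z) \<le> q ^ k * 1"
      unfolding g(2)[OF z(1)] norm_mult norm_power q_def using g(1)[OF z(1)] by (intro mult_left_mono) auto
    also have "\<dots> \<le> q ^ N" using q \<open>\<not> k \<le> N\<close> by (simp add: power_decreasing)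
    finally show False using N by simp
  qed
  then show ?thesis by blast
qed

lemma zmult_ge: "cmod w < 1 \<Longrightarrow> zero_of_order_ge B w k \<Longrightarrow> k \<le> zmult w"
  unfolding zmult_def using order_bounded[of w] by (metis Greatest_le_nat)

lemma zmult_order: "cmod w < 1 \<Longrightarrow> zero_of_order_ge B w (zmult w)"
proof -
  assume w: "cmod w < 1"
  have "zero_of_order_ge B w 0" unfolding zero_of_order_ge_def using hol bd by (intro exI[of _ B]) auto
  then show ?thesis unfolding zmult_def using order_bounded[OF w] by (metis GreatestI_nat)
qed

lemma a_encode: "w \<in> Z \<Longrightarrow> a (prod_encode (to_nat_on Z w, k)) = w"
  unfolding a_def using countable_Z by simp

lemma a_in_Z: "j \<in> J \<Longrightarrow> a j \<in> Z"
  unfolding J_def using a_encode by auto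

lemma a_disc: "j \<in> J \<Longrightarrow> cmod (a j) < 1"
  using a_in_Z by (auto simp: Z_def)

lemma fibre: "{j \<in> J. a j = w} \<subseteq> (\<lambda>k. prod_encode (to_nat_on Z w, k)) ` {..<zmult w}"
  unfolding J_def using a_encode by auto

lemma fibre_finite: "finite {j \<in> J. a j = w}"
  using finite_subset[OF fibre] by blast

lemma fibre_card: assumes "w \<in> Z" shows "card {j \<in> J. a j = w} = zmult w"
proof -
  have "{j \<in> J. a j = w} = (\<lambda>k. prod_encode (to_nat_on Z w, k)) ` {..<zmult w}"
    using fibre assms a_encode by (auto simp: J_def)
  moreover have "inj_on (\<lambda>k. prod_encode (to_nat_on Z w, k)) {..<zmult w}" by (auto simp: inj_on_def)
  ultimately show ?thesis by (simp add: card_image)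
qed

text \<open>If fewer than \<open>zmult w\<close> of the factors vanish at \<open>w\<close>, then so does the cofactor.\<close>

lemma cofactor_zero:
  assumes F: "finite F" "F \<subseteq> J" and Q: "Q holomorphic_on ball 0 1"
    and BQ: "\<And>z. cmod z < 1 \<Longrightarrow> B z = (\<Prod>j\<in>F. blaschke_factor (a j) z) * Q z"
    and w: "w \<in> Z" and less: "card {j \<in> F. a j = w} < zmult w"
  shows "Q w = 0"
proof -
  have wd: "cmod w < 1" using w by (simp add: Z_def)
  define m where "m = card {j \<in> F. a j = w}"
  define M where "M = zmult w"
  obtain g where g: "g holomorphic_on ball 0 1" "\<And>z. cmod z < 1 \<Longrightarrow> B z = disc_aut w z ^ M * g z"
    using zmult_order[OF wd] unfolding zero_of_order_ge_def M_def by blast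
  obtain c where c: "cmod c = 1" "\<And>z. blaschke_factor w z = c * disc_aut w z" using blaschke_factor_eq by blast
  have c0: "c \<noteq> 0" using c(1) by auto
  define U where "U z = c ^ m * (\<Prod>j\<in>{j \<in> F. a j \<noteq> w}. blaschke_factor (a j) z)" for z
  define H where "H z = U z * Q z - disc_aut w z ^ (M - m) * g z" for z
  have hU: "U holomorphic_on ball 0 1"
    unfolding U_def using F a_disc by (intro holomorphic_intros blaschke_factor_holomorphic) auto
  have hH: "H holomorphic_on ball 0 1"
    unfolding H_def by (intro holomorphic_intros hU Q g disc_aut_holomorphic_on_ball wd)
  have prod: "(\<Prod>j\<in>F. blaschke_factor (a j) z) = disc_aut w z ^ m * U z" for z
  proof -
    have "F = {j \<in> F. a j = w} \<union> {j \<in> F. a j \<noteq> w}" by auto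
    then have "(\<Prod>j\<in>F. blaschke_factor (a j) z) =
        (\<Prod>j\<in>{j \<in> F. a j = w}. blaschke_factor (a j) z) * (\<Prod>j\<in>{j \<in> F. a j \<noteq> w}. blaschke_factor (a j) z)"
      using F(1) by (metis (no_types, lifting) Collect_disj_eq finite_Un prod.union_disjoint disjoint_iff mem_Collect_eq)
    also have "(\<Prod>j\<in>{j \<in> F. a j = w}. blaschke_factor (a j) z) = (c * disc_aut w z) ^ m"
      unfolding m_def by (simp add: c(2))
    finally show ?thesis by (simp add: U_def power_mult_distrib mult_ac)
  qed
  have "H w = 0"
  proof (rule holomorphic_zero_extend[OF hH wd])
    fix z assume z: "cmod z < 1" "z \<noteq> w"
    have d: "disc_aut w z ^ m \<noteq> 0" using disc_aut_eq_0_iff[OF wd, of z] z by simp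
    have "disc_aut w z ^ m * (U z * Q z) = disc_aut w z ^ M * g z"
      using BQ[OF z(1)] g(2)[OF z(1)] unfolding prod by (simp add: mult.assoc)
    also have "\<dots> = disc_aut w z ^ m * (disc_aut w z ^ (M - m) * g z)"
      using less by (simp add: m_def M_def mult.assoc[symmetric] power_add[symmetric])
    finally have "U z * Q z = disc_aut w z ^ (M - m) * g z" unfolding mult_left_cancel[OF d] .
    then show "H z = 0" by (simp add: H_def)
  qed
  moreover have "disc_aut w w ^ (M - m) = 0" using less by (simp add: m_def M_def)
  ultimately have "U w * Q w = 0" by (simp add: H_def)
  moreover have "U w \<noteq> 0"
  proof -
    have "blaschke_factor (a j) w \<noteq> 0" if "j \<in> F" "a j \<noteq> w" for j
      using that F a_disc[of j] wd disc_aut_eq_0_iff[of "a j" w] cmod_blaschke_factor[of "a j" w]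
      by (metis less_imp_le norm_eq_zero subsetD)
    then show ?thesis using c0 F(1) by (simp add: U_def)
  qed
  ultimately show ?thesis by simp
qed

text \<open>One index is divided out at a time: the copies of the new zero used so far are fewer
  than its multiplicity, so the current cofactor still vanishes there.\<close>

lemma blaschke_division:
  assumes "finite F" "F \<subseteq> J"
  shows "\<exists>Q. Q holomorphic_on ball 0 1 \<and> (\<forall>z. cmod z < 1 \<longrightarrow> cmod (Q z) \<le> 1) \<and>
    (\<forall>z. cmod z < 1 \<longrightarrow> B z = (\<Prod>j\<in>F. blaschke_factor (a j) z) * Q z)"
  using assms
proof (induction F rule: finite_induct)
  case empty
  then show ?case using hol bd by (intro exI[of _ B]) auto
next
  case (insert i F)
  then obtain Q where Q: "Q holomorphic_on ball 0 1" "\<And>z. cmod z < 1 \<Longrightarrow> cmod (Q z) \<le> 1"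
    "\<And>z. cmod z < 1 \<Longrightarrow> B z = (\<Prod>j\<in>F. blaschke_factor (a j) z) * Q z" by auto
  define w where "w = a i"
  have iJ: "i \<in> J" and FJ: "F \<subseteq> J" using insert.prems by auto
  have w: "w \<in> Z" unfolding w_def by (rule a_in_Z[OF iJ])
  have "{j \<in> F. a j = w} \<subset> {j \<in> J. a j = w}" using iJ FJ insert.hyps by (auto simp: w_def)
  then have "card {j \<in> F. a j = w} < zmult w"
    using psubset_card_mono[OF fibre_finite] fibre_card[OF w] by metis
  then have Qw: "Q w = 0" using cofactor_zero[OF insert.hyps(1) FJ Q(1,3) w] by blast
  have wd: "cmod w < 1" using w by (simp add: Z_def)
  obtain g where g: "g holomorphic_on ball 0 1" "\<And>z. cmod z < 1 \<Longrightarrow> Q z = disc_aut w z * g z"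
    "\<And>z. cmod z < 1 \<Longrightarrow> cmod (g z) \<le> 1"
    using schwarz_division[OF Q(1,2) wd Qw] by blast
  obtain c where c: "cmod c = 1" "\<And>z. blaschke_factor w z = c * disc_aut w z" using blaschke_factor_eq by blast
  have c0: "c \<noteq> 0" using c(1) by auto
  show ?case
    by (rule exI[of _ "\<lambda>z. g z / c"])
      (use g Q(3) c c0 insert.hyps in \<open>auto intro!: holomorphic_intros simp: norm_divide w_def[symmetric]\<close>)
qed

text \<open>The counterpart of \<open>blaschke_product_lower_bound\<close>: each squared factor is
  \<open>1 - prox w (a j) \<le> exp (- prox w (a j))\<close>, and the cofactor is at most 1.\<close>

lemma prox_sum_le:
  assumes F: "finite F" "F \<subseteq> J" and w: "cmod w < 1" "B w \<noteq> 0"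
  shows "(\<Sum>j\<in>F. prox w (a j)) \<le> - 2 * ln (cmod (B w))"
proof -
  obtain Q where Q: "\<And>z. cmod z < 1 \<Longrightarrow> cmod (Q z) \<le> 1"
    "\<And>z. cmod z < 1 \<Longrightarrow> B z = (\<Prod>j\<in>F. blaschke_factor (a j) z) * Q z" using blaschke_division[OF F] by blast
  have "(cmod (B w))\<^sup>2 = (\<Prod>j\<in>F. (cmod (disc_aut (a j) w))\<^sup>2) * (cmod (Q w))\<^sup>2"
    unfolding Q(2)[OF w(1)] norm_mult prod_norm[symmetric] cmod_blaschke_factor power_mult_distrib prod_power_distrib ..
  also have "\<dots> \<le> (\<Prod>j\<in>F. (cmod (disc_aut (a j) w))\<^sup>2) * 1"
    using Q(1)[OF w(1)] by (intro mult_left_mono prod_nonneg) (auto simp: power_le_one)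
  also have "(\<Prod>j\<in>F. (cmod (disc_aut (a j) w))\<^sup>2) \<le> (\<Prod>j\<in>F. exp (- prox w (a j)))"
  proof (rule prod_mono)
    fix j assume "j \<in> F"
    then have "cmod (a j) < 1" using F a_disc by blast
    then have "(cmod (disc_aut (a j) w))\<^sup>2 = 1 + - prox w (a j)"
      using cmod_disc_aut_sq[OF one_minus_cnj_mult_nonzero, of "a j" w] w by (simp add: prox_commute)
    then have "(cmod (disc_aut (a j) w))\<^sup>2 \<le> exp (- prox w (a j))"
      using exp_ge_add_one_self[of "- prox w (a j)"] by simp
    moreover have "0 \<le> (cmod (disc_aut (a j) w))\<^sup>2" by simp
    ultimately show "0 \<le> (cmod (disc_aut (a j) w))\<^sup>2 \<and> (cmod (disc_aut (a j) w))\<^sup>2 \<le> exp (- prox w (a j))" by blast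
  qed
  also have "\<dots> = exp (- (\<Sum>j\<in>F. prox w (a j)))" using F(1) by (simp add: exp_sum sum_negf[symmetric])
  finally have "(cmod (B w))\<^sup>2 \<le> exp (- (\<Sum>j\<in>F. prox w (a j)))" by simp
  then have "ln ((cmod (B w))\<^sup>2) \<le> ln (exp (- (\<Sum>j\<in>F. prox w (a j))))" using w(2) by (subst ln_le_cancel_iff) auto
  then show ?thesis using w(2) by (simp add: ln_realpow)
qed

text \<open>Once all copies of \<open>w\<close> have been divided out, a further zero of the
  cofactor at \<open>w\<close> would exceed the maximal order. This is the input for Hurwitz's
  theorem.\<close>

lemma quotient_nonzero:
  assumes F: "finite F" "F \<subseteq> J" "{j \<in> J. a j = w} \<subseteq> F" and w: "cmod w < 1"
    and Q: "Q holomorphic_on ball 0 1" "\<And>z. cmod z < 1 \<Longrightarrow> cmod (Q z) \<le> 1"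
      "\<And>z. cmod z < 1 \<Longrightarrow> B z = (\<Prod>j\<in>F. blaschke_factor (a j) z) * Q z"
  shows "Q w \<noteq> 0"
proof
  assume "Q w = 0"
  then obtain g where g: "g holomorphic_on ball 0 1" "\<And>z. cmod z < 1 \<Longrightarrow> Q z = disc_aut w z * g z"
    "\<And>z. cmod z < 1 \<Longrightarrow> cmod (g z) \<le> 1"
    using schwarz_division[OF Q(1,2) w] by blast
  have wZ: "w \<in> Z" using Q(3)[OF w] \<open>Q w = 0\<close> w by (simp add: Z_def)
  obtain c where c: "cmod c = 1" "\<And>z. blaschke_factor w z = c * disc_aut w z" using blaschke_factor_eq by blast
  define h where "h z = c ^ zmult w * (\<Prod>j\<in>F - {j \<in> J. a j = w}. blaschke_factor (a j) z) * g z" for z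
  have ad: "cmod (a j) < 1" if "j \<in> F" for j using that F a_disc by blast
  have "zero_of_order_ge B w (Suc (zmult w))"
    unfolding zero_of_order_ge_def
  proof (intro exI[of _ h] conjI allI impI)
    show "h holomorphic_on ball 0 1"
      unfolding h_def using ad by (intro holomorphic_intros g blaschke_factor_holomorphic) auto
    fix z assume z: "cmod z < 1"
    have "cmod (\<Prod>j\<in>F - {j \<in> J. a j = w}. blaschke_factor (a j) z) \<le> 1"
      unfolding prod_norm[symmetric] cmod_blaschke_factor using ad z cmod_disc_aut_le_1 by (intro prod_le_1) auto
    then show "cmod (h z) \<le> 1"
      unfolding h_def norm_mult norm_power c(1) using g(3)[OF z] by (simp add: mult_le_one)
    have "(\<Prod>j\<in>F. blaschke_factor (a j) z) = (\<Prod>j\<in>F - {j \<in> J. a j = w}. blaschke_factor (a j) z) * (\<Prod>j\<in>{j \<in> J. a j = w}. blaschke_factor (a j) z)"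
      by (rule prod.subset_diff[OF F(3,1)])
    also have "(\<Prod>j\<in>{j \<in> J. a j = w}. blaschke_factor (a j) z) = (c * disc_aut w z) ^ zmult w"
      unfolding fibre_card[OF wZ, symmetric] by (simp add: c(2))
    finally show "B z = disc_aut w z ^ Suc (zmult w) * h z"
      unfolding Q(3)[OF z] g(2)[OF z] h_def by (simp add: power_mult_distrib mult_ac)
  qed
  from zmult_ge[OF w this] show False by simp
qed

end

text \<open>The Carleson bound follows from \<open>prox_sum_le\<close> at the nearby point where
  \<open>|B| \<ge> c\<close>. It remains to make the zero-free cofactor \<open>s\<close> constant:
  near every point there is one with \<open>|s| \<ge> |B| \<ge> c\<close>, so Harnack's inequality
  bounds the nonnegative harmonic function \<open>- ln |s|\<close> on the whole disc. It is then O(1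
  - |B|^2), its circle means tend to 0, and \<open>|s 0| = 1\<close>.\<close>

theorem inner_mean_imp_CN:
  assumes B: "inner_mean B" and c: "c > 0" "R < 1"
    and large: "\<And>z. cmod z < 1 \<Longrightarrow> \<exists>w. cmod w < 1 \<and> cmod (disc_aut z w) \<le> R \<and> cmod (B w) \<ge> c"
  shows "B \<in> CN"
proof -
  have hol: "B holomorphic_on ball 0 1" and bd: "\<And>z. cmod z < 1 \<Longrightarrow> cmod (B z) \<le> 1"
    using B unfolding inner_mean_def by auto
  have R0: "R \<ge> 0" using large[of 0] by (auto intro: order_trans[OF norm_ge_zero])
  interpret bounded_zeros B
  proof
    obtain w where "cmod w < 1" "cmod (B w) \<ge> c" using large[of 0] by auto
    then show "\<exists>z. cmod z < 1 \<and> B z \<noteq> 0" using c(1) by (intro exI[of _ w]) auto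
  qed (use hol bd in auto)
  define K where "K = - 2 * ln c / (1 - R)\<^sup>2"
  have pb: "prox_bounded J a K"
    unfolding prox_bounded_def
  proof (intro allI impI)
    fix z F assume z: "cmod z < 1" and F: "finite F" "F \<subseteq> J"
    obtain w where w: "cmod w < 1" "cmod (disc_aut z w) \<le> R" "cmod (B w) \<ge> c" using large[OF z] by blast
    have "(\<Sum>j\<in>F. prox z (a j)) \<le> (\<Sum>j\<in>F. prox w (a j) / (1 - R)\<^sup>2)"
      using F a_disc by (intro sum_mono prox_quasi_invariant[OF z w(1) _ w(2) c(2)]) auto
    also have "\<dots> = (\<Sum>j\<in>F. prox w (a j)) / (1 - R)\<^sup>2" by (rule sum_divide_distrib[symmetric])
    also have "\<dots> \<le> (- 2 * ln (cmod (B w))) / (1 - R)\<^sup>2"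
      using w c(1) by (intro divide_right_mono prox_sum_le F) auto
    also have "\<dots> \<le> K"
    proof -
      have "ln c \<le> ln (cmod (B w))" using w(3) c(1) by (subst ln_le_cancel_iff) auto
      then show ?thesis unfolding K_def by (intro divide_right_mono) auto
    qed
    finally show "(\<Sum>j\<in>F. prox z (a j)) \<le> K" .
  qed
  have aJ: "a ` J \<subseteq> ball 0 1" using a_disc by auto
  have seq: "blaschke_sequence J a"
    unfolding blaschke_sequence_def
  proof
    show "(\<lambda>j. 1 - cmod (a j)) summable_on J"
    proof (rule nonneg_bdd_above_summable_on)
      show "bdd_above (sum (\<lambda>j. 1 - cmod (a j)) ` {F. F \<subseteq> J \<and> finite F})"
      proof (intro bdd_aboveI2[where M = K])
        fix F assume F: "F \<in> {F. F \<subseteq> J \<and> finite F}"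
        have "(\<Sum>j\<in>F. 1 - cmod (a j)) \<le> (\<Sum>j\<in>F. prox 0 (a j))"
        proof (rule sum_mono)
          fix j assume "j \<in> F"
          then have "cmod (a j) < 1" using F a_disc by auto
          then show "1 - cmod (a j) \<le> prox 0 (a j)" by (simp add: prox_def power2_eq_square mult_left_le)
        qed
        also have "\<dots> \<le> K" using F by (intro pb[unfolded prox_bounded_def, rule_format]) auto
        finally show "(\<Sum>j\<in>F. 1 - cmod (a j)) \<le> K" .
      qed
    qed (use a_disc in \<open>auto simp: less_imp_le\<close>)
  qed (rule aJ)
  define P where "P z = (\<Prod>j. if j \<in> J then blaschke_factor (a j) z else 1)" for z
  have hp: "(\<lambda>j. if j \<in> J then blaschke_factor (a j) z else 1) has_prod P z" if "cmod z < 1" for z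
    unfolding P_def by (rule blaschke_has_prod[OF seq that])
  have limP: "(\<lambda>n. blaschke_part J a n z) \<longlonglongrightarrow> P z" if "cmod z < 1" for z
    unfolding blaschke_part_def by (rule has_prod_imp_tendsto'[OF hp[OF that]])
  have part: "blaschke_part J a n z = (\<Prod>j\<in>J \<inter> {..<n}. blaschke_factor (a j) z)" for n z
    unfolding blaschke_part_def by (subst Int_commute) (rule prod.inter_restrict[symmetric], simp)
  have "\<forall>n. \<exists>Q. Q holomorphic_on ball 0 1 \<and> (\<forall>z. cmod z < 1 \<longrightarrow> cmod (Q z) \<le> 1) \<and>
    (\<forall>z. cmod z < 1 \<longrightarrow> B z = blaschke_part J a n z * Q z)"
    unfolding part by (intro allI blaschke_division) auto
  then obtain S where S: "\<And>n. S n holomorphic_on ball 0 1" "\<And>n z. cmod z < 1 \<Longrightarrow> cmod (S n z) \<le> 1"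
    "\<And>n z. cmod z < 1 \<Longrightarrow> B z = blaschke_part J a n z * S n z" by metis
  obtain s r where s: "s holomorphic_on ball 0 1" and r: "strict_mono (r :: nat \<Rightarrow> nat)"
    and lim: "\<And>z. z \<in> ball 0 1 \<Longrightarrow> ((\<lambda>n. S (r n) z) \<longlongrightarrow> s z) sequentially"
    and ul: "\<And>K. compact K \<Longrightarrow> K \<subseteq> ball 0 1 \<Longrightarrow> uniform_limit K (S \<circ> r) s sequentially"
  proof (rule Montel[of "ball 0 1" "range S" S])
    show "\<exists>B. \<forall>h\<in>range S. \<forall>z\<in>K. cmod (h z) \<le> B" if "K \<subseteq> ball 0 1" for K
      using S(2) that by (intro exI[of _ 1]) auto
  qed (use S(1) in auto)
  have BPs: "B z = P z * s z" if z: "cmod z < 1" for z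
  proof -
    have "(\<lambda>n. blaschke_part J a (r n) z * S (r n) z) \<longlonglongrightarrow> P z * s z"
      using LIMSEQ_subseq_LIMSEQ[OF limP[OF z] r] lim[of z] z by (auto intro!: tendsto_mult simp: o_def)
    then show ?thesis using S(3)[OF z, symmetric] LIMSEQ_unique[of "\<lambda>_. B z"] by auto
  qed
  have s1: "cmod (s z) \<le> 1" if z: "cmod z < 1" for z
    using tendsto_norm[OF lim[of z]] S(2)[OF z] z by (intro LIMSEQ_le_const2[of _ "cmod (s z)"]) auto
  have P1: "cmod (P z) \<le> 1" if z: "cmod z < 1" for z
    using tendsto_norm[OF limP[OF z]] cmod_blaschke_part_le_1[OF aJ] z by (intro LIMSEQ_le_const2[of _ "cmod (P z)"]) auto
  have Bs: "cmod (B z) \<le> cmod (s z)" if z: "cmod z < 1" for z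
    unfolding BPs[OF z] norm_mult using P1[OF z] mult_right_mono[of "cmod (P z)" 1 "cmod (s z)"] by simp
  have snz: "s w \<noteq> 0" if w: "cmod w < 1" for w
  proof
    assume sw: "s w = 0"
    then have Bw: "B w = 0" using BPs[OF w] by simp
    obtain z1 where z1: "cmod z1 < 1" "B z1 \<noteq> 0" using nz by blast
    obtain e where e: "0 < e" "ball w e \<subseteq> ball 0 1" "\<And>z. z \<in> ball w e - {w} \<Longrightarrow> B z \<noteq> 0"
      using isolated_zeros[OF hol, of w z1] w Bw z1 by auto
    \<comment> \<open>From \<open>N\<close> on all copies of \<open>w\<close> have been divided out,
      so the shifted sequence has no zeros near \<open>w\<close> and Hurwitz's theorem applies to
      its limit.\<close>
    obtain N where N: "{j \<in> J. a j = w} \<subseteq> {..<N}"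
      using fibre_finite[of w] finite_nat_bounded by blast
    have no0: "S (r (n + N)) z \<noteq> 0" if z: "z \<in> ball w e" for n z
    proof (cases "z = w")
      case True
      have "N \<le> r (n + N)" using seq_suble[OF r, of "n + N"] by simp
      then have "{j \<in> J. a j = w} \<subseteq> J \<inter> {..<r (n + N)}" using N by auto
      then show ?thesis
        unfolding True using quotient_nonzero[OF _ _ _ w S(1,2), of "J \<inter> {..<r (n + N)}" "r (n + N)"] S(3) unfolding part by auto
    next
      case False
      then have "B z \<noteq> 0" using e(3) z by blast
      then show ?thesis using S(3)[of z "r (n + N)"] e(2) z by auto
    qed
    have "s w \<noteq> 0"
    proof (rule Hurwitz_no_zeros[of "ball w e" "\<lambda>n. S (r (n + N))" s])
      show "S (r (n + N)) holomorphic_on ball w e" for n using S(1) e(2) by (rule holomorphic_on_subset)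
      show "s holomorphic_on ball w e" using s e(2) by (rule holomorphic_on_subset)
      show "uniform_limit K (\<lambda>n. S (r (n + N))) s sequentially" if "compact K" "K \<subseteq> ball w e" for K
      proof -
        have "uniform_limit K (S \<circ> r) s sequentially" using ul that e(2) by blast
        then show ?thesis
          unfolding uniform_limit_iff o_def
          by (auto elim!: all_forward imp_forward intro: sequentially_offset[where k = N])
      qed
      show "\<not> s constant_on ball w e"
      proof
        assume "s constant_on ball w e"
        then have "s z = 0" if "z \<in> ball w e" for z
          using sw e(1) that unfolding constant_on_def by (metis centre_in_ball)
        then have B0: "B z = 0" if "z \<in> ball w e" for z using BPs[of z] e(2) that by auto
        have "w + of_real (e / 2) \<in> ball w e - {w}" using e(1) by (auto simp: dist_norm)
        then show False using e(3) B0 by blast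
      qed
    qed (use no0 e(1) in auto)
    then show False using sw by simp
  qed
  obtain g where g: "g holomorphic_on ball 0 1" "\<And>z. z \<in> ball 0 1 \<Longrightarrow> exp (g z) = s z"
    using holomorphic_logarithm_exists[of "ball 0 1" s 0] s snz by auto
  have Reg: "Re (- g z) = - ln (cmod (s z))" if "cmod z < 1" for z
  proof -
    have "cmod (s z) = exp (Re (g z))" using g(2)[of z, symmetric] that by simp
    then show ?thesis by simp
  qed
  have Reg0: "Re (- g z) \<ge> 0" if "cmod z < 1" for z
    unfolding Reg[OF that] using s1[OF that] snz[OF that] by simp
  \<comment> \<open>\<open>- ln |s|\<close> is at most \<open>- ln c\<close> at the nearby point,
    and Harnack's inequality multiplies it by at most \<open>1 + 2 * R / (1 - R)\<close>.\<close>
  define c' where "c' = exp (- ((1 + 2 * R / (1 - R)) * (- ln c)))"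
  have c': "c' > 0" by (simp add: c'_def)
  have s_ge: "cmod (s z) \<ge> c'" if z: "cmod z < 1" for z
  proof -
    obtain w where w: "cmod w < 1" "cmod (disc_aut z w) \<le> R" "cmod (B w) \<ge> c" using large[OF z] by blast
    have cw: "c \<le> cmod (s w)" using w(3) Bs[OF w(1)] by simp
    have "cmod (- g z - - g w) \<le> 2 * R / (1 - R) * Re (- g w)"
      using w cmod_disc_aut_commute[of z w] z c(2) Reg0
      by (intro positive_real_part_oscillation_disc) (auto intro!: holomorphic_intros g)
    then have "Re (- g z) \<le> (1 + 2 * R / (1 - R)) * Re (- g w)"
      using complex_Re_le_cmod[of "- g z - - g w"] by (simp add: algebra_simps)
    also have "\<dots> \<le> (1 + 2 * R / (1 - R)) * (- ln c)"
    proof (rule mult_left_mono)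
      have "ln c \<le> ln (cmod (s w))" using cw c(1) by (subst ln_le_cancel_iff) auto
      then show "Re (- g w) \<le> - ln c" unfolding Reg[OF w(1)] by simp
    qed (use c R0 in auto)
    finally have "- ((1 + 2 * R / (1 - R)) * (- ln c)) \<le> ln (cmod (s z))" unfolding Reg[OF z] by linarith
    then show ?thesis unfolding c'_def using snz[OF z] by (metis exp_le_cancel_iff exp_ln zero_less_norm_iff)
  qed
  obtain \<rho> where \<rho>: "\<And>n::nat. 0 < \<rho> n \<and> \<rho> n < 1" "(\<lambda>n. cmean (\<rho> n) (\<lambda>z. 1 - (cmod (B z))\<^sup>2)) \<longlonglongrightarrow> 0"
    using B unfolding inner_mean_def by blast
  have "Re (- g 0) \<le> (1 / (2 * c'\<^sup>2)) * cmean (\<rho> n) (\<lambda>z. 1 - (cmod (B z))\<^sup>2)" for n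
  proof -
    have rr: "cball 0 (\<rho> n) \<subseteq> ball (0::complex) 1" "ball 0 (\<rho> n) \<subseteq> ball (0::complex) 1" "sphere 0 (\<rho> n) \<subseteq> ball (0::complex) 1"
      using \<rho>(1)[of n] by auto
    have cg: "continuous_on T g" "continuous_on T B" if "T \<subseteq> ball 0 1" for T
      using g(1) hol that holomorphic_on_imp_continuous_on continuous_on_subset by blast+
    have "Re (- g 0) = Re (cmean (\<rho> n) (\<lambda>z. - g z))"
      using \<rho>(1)[of n] rr by (subst cmean_holomorphic) (auto intro!: continuous_intros cg holomorphic_intros holomorphic_on_subset[OF g(1)])
    also have "\<dots> = cmean (\<rho> n) (\<lambda>z. Re (- g z))"
      using \<rho>(1)[of n] rr by (intro cmean_Re[symmetric] continuous_intros cg) auto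
    also have "\<dots> \<le> cmean (\<rho> n) (\<lambda>z. (1 / (2 * c'\<^sup>2)) * (1 - (cmod (B z))\<^sup>2))"
    proof (rule cmean_mono)
      fix z :: complex assume z': "cmod z = \<rho> n"
      then have z: "cmod z < 1" using \<rho>(1) by simp
      define x where "x = (cmod (s z))\<^sup>2"
      have x: "x \<ge> c'\<^sup>2" "x \<le> 1" "x > 0"
        using s_ge[OF z] c' s1[OF z] snz[OF z] unfolding x_def by (auto intro!: power_mono simp: power_le_one)
      have "Re (- g z) = (1 / 2) * ln (1 / x)"
        unfolding Reg[OF z] x_def using snz[OF z] by (simp add: ln_div ln_realpow)
      also have "ln (1 / x) \<le> 1 / x - 1" using x by (intro ln_le_minus_one) auto
      also have "\<dots> = (1 - x) / x" using x by (simp add: field_simps)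
      also have "\<dots> \<le> (1 - x) / c'\<^sup>2" using x c' by (intro divide_left_mono) auto
      also have "1 - x \<le> 1 - (cmod (B z))\<^sup>2" unfolding x_def using Bs[OF z] by (simp add: power_mono)
      finally show "Re (- g z) \<le> (1 / (2 * c'\<^sup>2)) * (1 - (cmod (B z))\<^sup>2)"
        by (simp add: divide_right_mono)
    qed (use \<rho>(1)[of n] rr c' in \<open>auto intro!: continuous_intros cg\<close>)
    finally show ?thesis unfolding cmean_mult_right .
  qed
  then have "Re (- g 0) \<le> (1 / (2 * c'\<^sup>2)) * 0"
    by (intro LIMSEQ_le_const[OF tendsto_mult[OF tendsto_const \<rho>(2)]]) auto
  then have "cmod (s 0) = 1" using Reg[of 0] Reg0[of 0] snz[of 0] by simp
  then have sc: "s z = s 0" if "cmod z < 1" for z using const_of_boundary_value[OF s s1 _ that] by simp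
  have "\<forall>z\<in>ball 0 1. \<exists>p. (\<lambda>j. if j \<in> J then blaschke_factor (a j) z else 1) has_prod p \<and> B z = s 0 * p"
  proof
    fix z :: complex assume "z \<in> ball 0 1"
    then have z: "cmod z < 1" by simp
    show "\<exists>p. (\<lambda>j. if j \<in> J then blaschke_factor (a j) z else 1) has_prod p \<and> B z = s 0 * p"
      using hp[OF z] BPs[OF z] sc[OF z] by (intro exI[of _ "P z"]) (auto simp: mult.commute)
  qed
  then have "blaschke_product J a B"
    unfolding blaschke_product_def using seq \<open>cmod (s 0) = 1\<close> by blast
  then show ?thesis using prox_bounded_imp_carleson[OF aJ pb] unfolding CN_def by blast
qed

section \<open>From the sharp invertibility property to the class M\<close>

definition inner_radius :: "nat \<Rightarrow> real" where "inner_radius n = 1 - 1 / (real n + 2)"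

lemma inner_radius: "0 < inner_radius n" "inner_radius n < 1"
  by (auto simp: inner_radius_def field_simps)

lemma inner_radius_tendsto: "inner_radius \<longlonglongrightarrow> 1"
  unfolding inner_radius_def[abs_def] by real_asymp

lemma circle_in_ball:
  assumes "continuous_on (ball 0 1) F" "0 < r" "r < 1"
  shows "continuous_on (sphere 0 r) F" "continuous_on (cball 0 r) F"
  using assms by (auto elim!: continuous_on_subset)

lemma Hinf_bound: "f \<in> Hinf \<Longrightarrow> \<exists>M>0. \<forall>z. cmod z < 1 \<longrightarrow> cmod (f z) \<le> M"
  unfolding Hinf_def bounded_pos by auto

lemma HinfI: "f holomorphic_on ball 0 1 \<Longrightarrow> (\<And>z. cmod z < 1 \<Longrightarrow> cmod (f z) \<le> M) \<Longrightarrow> f \<in> Hinf"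
  unfolding Hinf_def bounded_iff by (auto intro!: exI[of _ M])

text \<open>Dominated convergence along the radii. The absolute value is kept because at this stage
  an inner function is only known to be bounded, not to be bounded by 1.\<close>

lemma inner_function_mean_deviation:
  assumes "inner_function \<Theta>"
  shows "(\<lambda>n. cmean (inner_radius n) (\<lambda>z. \<bar>1 - (cmod (\<Theta> z))\<^sup>2\<bar>)) \<longlonglongrightarrow> 0"
proof -
  have hol: "\<Theta> holomorphic_on ball 0 1" using assms unfolding inner_function_def Hinf_def by auto
  then have cont: "continuous_on (ball 0 1) \<Theta>" by (rule holomorphic_on_imp_continuous_on)
  obtain M where M: "M > 0" "\<And>z. cmod z < 1 \<Longrightarrow> cmod (\<Theta> z) \<le> M"
    using Hinf_bound assms unfolding inner_function_def by blast
  define d where "d n t = \<bar>1 - (cmod (\<Theta> (of_real (inner_radius n) * cis t)))\<^sup>2\<bar>" for n t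
  have in_ball: "cmod (of_real (inner_radius n) * cis t) < 1" for n t
    using inner_radius[of n] by (simp add: norm_mult)
  have cd: "continuous_on A (d n)" for A n
    unfolding d_def using in_ball
    by (intro continuous_intros continuous_on_compose2[OF cont]) auto
  have lim: "(\<lambda>n. integral\<^sup>L (lebesgue_on {0..2 * pi}) (d n)) \<longlonglongrightarrow> integral\<^sup>L (lebesgue_on {0..2 * pi}) (\<lambda>t. 0)"
  proof (rule integral_dominated_convergence[where w = "\<lambda>_. 1 + M\<^sup>2"])
    show "d n \<in> borel_measurable (lebesgue_on {0..2 * pi})" for n
      by (intro continuous_imp_measurable_on_sets_lebesgue cd) auto
    show "integrable (lebesgue_on {0..2 * pi}) (\<lambda>_. 1 + M\<^sup>2)"
      by (intro finite_measure.integrable_const finite_measure_lebesgue_on) auto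
    show "AE t in lebesgue_on {0..2 * pi}. (\<lambda>n. d n t) \<longlonglongrightarrow> 0"
    proof -
      have "AE t in lebesgue_on {0..2 * pi}. \<exists>L. cmod L = 1 \<and> ((\<lambda>r. \<Theta> (complex_of_real r * cis t)) \<longlongrightarrow> L) (at_left 1)"
        using assms unfolding inner_function_def by blast
      then show ?thesis
      proof (rule AE_mp, intro AE_I2 impI)
        fix t assume "\<exists>L. cmod L = 1 \<and> ((\<lambda>r. \<Theta> (complex_of_real r * cis t)) \<longlongrightarrow> L) (at_left 1)"
        then obtain L where L: "cmod L = 1" "((\<lambda>r. \<Theta> (complex_of_real r * cis t)) \<longlongrightarrow> L) (at_left 1)" by blast
        have "filterlim inner_radius (at_left 1) sequentially"
          using inner_radius inner_radius_tendsto by (intro tendsto_imp_filterlim_at_left) auto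
        from filterlim_compose[OF L(2) this]
        have "(\<lambda>n. d n t) \<longlonglongrightarrow> \<bar>1 - (cmod L)\<^sup>2\<bar>" unfolding d_def by (intro tendsto_intros)
        then show "(\<lambda>n. d n t) \<longlonglongrightarrow> 0" using L(1) by simp
      qed
    qed
    show "AE t in lebesgue_on {0..2 * pi}. norm (d n t) \<le> 1 + M\<^sup>2" for n
    proof (intro AE_I2)
      fix t
      have "(cmod (\<Theta> (of_real (inner_radius n) * cis t)))\<^sup>2 \<le> M\<^sup>2" using M in_ball by (intro power_mono) auto
      then show "norm (d n t) \<le> 1 + M\<^sup>2" unfolding d_def by (auto simp: abs_le_iff intro: order_trans[of _ "1"])
    qed
  qed simp
  have "integral\<^sup>L (lebesgue_on {0..2 * pi}) (d n) = integral {0..2 * pi} (d n)" for n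
    by (rule lebesgue_integral_eq_integral)
      (auto intro!: absolutely_integrable_imp_integrable absolutely_integrable_continuous_real cd)
  then have "(\<lambda>n. integral {0..2 * pi} (d n)) \<longlonglongrightarrow> 0" using lim by simp
  from tendsto_mult_left[OF this, of "1 / (2 * pi)"] show ?thesis
    unfolding cmean_def d_def by simp
qed

lemma poisson_le:
  assumes "cmod z < 1" "(1 + cmod z) / 2 \<le> r" "r < 1" "cmod w = r"
  shows "cmod z < r" "0 < poisson r z w" "poisson r z w \<le> 4 / (1 - cmod z)"
proof -
  show zr: "cmod z < r" using assms by (simp add: field_simps)
  show "0 < poisson r z w" using poisson_bounds[OF zr assms(4)] by simp
  have "poisson r z w \<le> (r + cmod z) / (r - cmod z)" using poisson_bounds[OF zr assms(4)] by simp
  also have "\<dots> \<le> 2 / ((1 - cmod z) / 2)" using assms zr by (intro frac_le) (auto simp: field_simps)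
  finally show "poisson r z w \<le> 4 / (1 - cmod z)" by simp
qed

lemma eventually_inner_radius:
  assumes "cmod z < 1" shows "eventually (\<lambda>n. (1 + cmod z) / 2 \<le> inner_radius n) sequentially"
proof -
  have "eventually (\<lambda>n. (1 + cmod z) / 2 < inner_radius n) sequentially"
    by (rule order_tendstoD(1)[OF inner_radius_tendsto]) (use assms in simp)
  then show ?thesis by eventually_elim simp
qed

text \<open>The bound by 1 comes from the Poisson formula for \<open>\<Theta>^2\<close>: the mean of
  \<open>||\<Theta>|^2 - 1|\<close> over large circles tends to 0, and for fixed \<open>z\<close>
  the kernel is bounded and has mean 1.\<close>

lemma inner_function_imp_inner_mean:
  assumes "inner_function \<Theta>" shows "inner_mean \<Theta>"
proof -
  have hol: "\<Theta> holomorphic_on ball 0 1" using assms unfolding inner_function_def Hinf_def by auto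
  then have cont: "continuous_on (ball 0 1) \<Theta>" by (rule holomorphic_on_imp_continuous_on)
  define D where "D n = cmean (inner_radius n) (\<lambda>z. \<bar>1 - (cmod (\<Theta> z))\<^sup>2\<bar>)" for n
  have D: "D \<longlonglongrightarrow> 0" unfolding D_def by (rule inner_function_mean_deviation[OF assms])
  have le1: "cmod (\<Theta> z) \<le> 1" if z: "cmod z < 1" for z
  proof -
    have "eventually (\<lambda>n. (cmod (\<Theta> z))\<^sup>2 \<le> 1 + 4 / (1 - cmod z) * D n) sequentially"
      using eventually_inner_radius[OF z]
    proof eventually_elim
      case (elim n)
      define r where "r = inner_radius n"
      have r: "0 < r" "r < 1" "(1 + cmod z) / 2 \<le> r" using inner_radius[of n] elim by (auto simp: r_def)
      note p = poisson_le[OF z r(3,2)]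
      have zr: "cmod z < r" using r z by (simp add: field_simps)
      note c = circle_in_ball[OF cont r(1,2)]
      note cp = poisson_continuous[OF zr]
      have "(\<Theta> z)\<^sup>2 = cmean r (\<lambda>w. of_real (poisson r z w) * (\<Theta> w)\<^sup>2)"
        using r zr by (intro poisson_formula[symmetric]) (auto intro!: holomorphic_intros continuous_intros c holomorphic_on_subset[OF hol])
      then have "(cmod (\<Theta> z))\<^sup>2 \<le> cmean r (\<lambda>w. cmod (of_real (poisson r z w) * (\<Theta> w)\<^sup>2))"
        unfolding norm_power[symmetric] using r by (simp only:) (intro norm_cmean_le continuous_intros c cp, simp)
      also have "\<dots> \<le> cmean r (\<lambda>w. poisson r z w + 4 / (1 - cmod z) * \<bar>1 - (cmod (\<Theta> w))\<^sup>2\<bar>)"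
      proof (rule cmean_mono)
        fix w assume w: "cmod w = r"
        have "cmod (of_real (poisson r z w) * (\<Theta> w)\<^sup>2) = poisson r z w * (cmod (\<Theta> w))\<^sup>2"
          using p(2)[OF w] by (simp add: norm_mult norm_power)
        also have "\<dots> \<le> poisson r z w * (1 + \<bar>1 - (cmod (\<Theta> w))\<^sup>2\<bar>)"
          using p(2)[OF w] by (intro mult_left_mono) auto
        also have "\<dots> \<le> poisson r z w + 4 / (1 - cmod z) * \<bar>1 - (cmod (\<Theta> w))\<^sup>2\<bar>"
          using mult_right_mono[OF p(3)[OF w], of "\<bar>1 - (cmod (\<Theta> w))\<^sup>2\<bar>"] by (simp add: distrib_left)
        finally show "cmod (of_real (poisson r z w) * (\<Theta> w)\<^sup>2) \<le> poisson r z w + 4 / (1 - cmod z) * \<bar>1 - (cmod (\<Theta> w))\<^sup>2\<bar>" .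
      qed (use r in \<open>auto intro!: continuous_intros c cp\<close>)
      also have "\<dots> = cmean r (poisson r z) + cmean r (\<lambda>w. 4 / (1 - cmod z) * \<bar>1 - (cmod (\<Theta> w))\<^sup>2\<bar>)"
        by (rule cmean_add) (use r in \<open>auto intro!: continuous_intros c cp\<close>)
      also have "\<dots> = 1 + 4 / (1 - cmod z) * D n"
        unfolding cmean_mult_right D_def r_def[symmetric] poisson_mean_1[OF zr] ..
      finally show ?case .
    qed
    moreover have "(\<lambda>n. 1 + 4 / (1 - cmod z) * D n) \<longlonglongrightarrow> 1 + 4 / (1 - cmod z) * 0"
      by (intro tendsto_intros D)
    ultimately have "(cmod (\<Theta> z))\<^sup>2 \<le> 1 + 4 / (1 - cmod z) * 0"
      by (intro tendsto_lowerbound[of _ _ sequentially]) auto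
    then show ?thesis by (simp add: abs_square_le_1)
  qed
  have "(\<lambda>n. cmean (inner_radius n) (\<lambda>z. 1 - (cmod (\<Theta> z))\<^sup>2)) = D"
  proof
    fix n
    show "cmean (inner_radius n) (\<lambda>z. 1 - (cmod (\<Theta> z))\<^sup>2) = D n"
      unfolding D_def using inner_radius[of n] le1 by (intro cmean_cong) (auto simp: abs_if power_le_one not_less)
  qed
  then show ?thesis unfolding inner_mean_def using hol le1 D inner_radius inner_radius_tendsto by auto
qed

text \<open>A lower bound for the inverse of \<open>disc_aut z\<close> modulo \<open>\<Theta>\<close>: the identity is tested against
  \<open>(1 - cnj (\<Theta> z) * \<Theta>)\<^sup>2 * cnj \<Theta>\<close>, integrated over circles with the Poisson weight at \<open>z\<close>.\<close>

lemma quot_inverse_disc_aut_bound: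
  assumes inner: "inner_mean \<Theta>" and z: "cmod z < 1" and nz: "\<Theta> z \<noteq> 0"
    and G: "G holomorphic_on ball 0 1" "\<And>w. cmod w < 1 \<Longrightarrow> cmod (G w) \<le> M"
    and H: "H holomorphic_on ball 0 1" "\<And>w. cmod w < 1 \<Longrightarrow> cmod (H w) \<le> N"
    and eq: "\<And>w. cmod w < 1 \<Longrightarrow> disc_aut z w * G w = 1 + H w * \<Theta> w"
  shows "cmod (\<Theta> z) = 1 \<or> 1 \<le> M * cmod (\<Theta> z)"
proof (rule disjCI)
  assume not1: "\<not> 1 \<le> M * cmod (\<Theta> z)"
  show "cmod (\<Theta> z) = 1"
  proof (rule ccontr)
    assume ne: "cmod (\<Theta> z) \<noteq> 1"
    obtain \<rho> where \<rho>: "\<And>n::nat. 0 < \<rho> n \<and> \<rho> n < 1" "\<rho> \<longlonglongrightarrow> 1"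
      "(\<lambda>n. cmean (\<rho> n) (\<lambda>z. 1 - (cmod (\<Theta> z))\<^sup>2)) \<longlonglongrightarrow> 0"
      using inner unfolding inner_mean_def by blast
    have hol: "\<Theta> holomorphic_on ball 0 1" and le1: "\<And>w. cmod w < 1 \<Longrightarrow> cmod (\<Theta> w) \<le> 1"
      using inner unfolding inner_mean_def by auto
    define a where "a = \<Theta> z"
    have a: "a \<noteq> 0" "cmod a < 1" using nz ne le1[OF z] by (auto simp: a_def)
    have N0: "N \<ge> 0" using H(2)[OF z] norm_ge_zero order_trans by blast
    have M0: "M \<ge> 0" using G(2)[OF z] norm_ge_zero order_trans by blast
    \<comment> \<open>The square makes \<open>|f| = |1 - cnj a * \<Theta>|^2\<close>, whose Poisson
      mean at \<open>z\<close> is at most \<open>1 - |a|^2\<close>. This is matched against the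
      modulus \<open>(1 - |a|^2) / |a|\<close> of the quantity found in \<open>val\<close>.\<close>
    define f where "f w = (1 - cnj a * \<Theta> w)\<^sup>2" for w
    \<comment> \<open>If \<open>|\<Theta>|^2\<close> is replaced by 1, then
      \<open>(1 + H * \<Theta>) * f * cnj \<Theta>\<close> becomes \<open>cnj \<Theta> + E\<close>.
      The discrepancy is exactly \<open>(1 - |\<Theta>|^2) * E\<close>, the source of
      \<open>W\<close> below, whose mean tends to 0.\<close>
    define E where "E w = - 2 * cnj a + (cnj a)\<^sup>2 * \<Theta> w + H w * f w" for w
    define \<delta> where "\<delta> n = cmean (\<rho> n) (\<lambda>z. 1 - (cmod (\<Theta> z))\<^sup>2)" for n
    have hE: "E holomorphic_on ball 0 1" unfolding E_def f_def by (intro holomorphic_intros hol H)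
    have af: "cmod (1 - cnj a * \<Theta> w) \<le> 2" if "cmod w < 1" for w
    proof -
      have "cmod (1 - cnj a * \<Theta> w) \<le> 1 + cmod a * cmod (\<Theta> w)"
        using norm_triangle_ineq4[of 1 "cnj a * \<Theta> w"] by (simp add: norm_mult)
      also have "cmod a * cmod (\<Theta> w) \<le> 1 * 1" using a le1[OF that] by (intro mult_mono) auto
      finally show ?thesis by simp
    qed
    have Eb: "cmod (E w) \<le> 3 + 4 * N" if w: "cmod w < 1" for w
    proof -
      have "cmod (E w) \<le> cmod (- 2 * cnj a) + cmod ((cnj a)\<^sup>2 * \<Theta> w) + cmod (H w * f w)"
        unfolding E_def by (intro order_trans[OF norm_triangle_ineq] add_mono norm_triangle_ineq order_refl)
      also have "cmod (- 2 * cnj a) \<le> 2" using a by (simp add: norm_mult)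
      also have "cmod ((cnj a)\<^sup>2 * \<Theta> w) \<le> 1 * 1"
        unfolding norm_mult norm_power using a le1[OF w] by (intro mult_mono) (auto simp: power_le_one)
      also have "cmod (H w * f w) \<le> N * 2\<^sup>2"
        unfolding norm_mult f_def norm_power using H(2)[OF w] af[OF w] N0 by (intro mult_mono power_mono) auto
      finally show ?thesis by simp
    qed
    have aa: "cnj a * a = of_real ((cmod a)\<^sup>2)" using complex_norm_square[of a] by (simp add: mult.commute)
    have val: "cnj a + E z = - of_real (1 - (cmod a)\<^sup>2) / a"
    proof -
      have "H z * a = - 1" using eq[OF z] by (simp add: a_def add_eq_0_iff)
      then have Hz: "H z = - 1 / a" using a by (simp add: field_simps)
      have "a * (cnj a + E z) = - (1 - cnj a * a)"
        unfolding E_def f_def Hz a_def[symmetric] using a(1) by (simp add: field_simps power2_eq_square)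
      then show ?thesis unfolding aa using a(1) by (simp add: field_simps)
    qed
    define C where "C = 4 / (1 - cmod z) * (3 + 4 * N)"
    have "eventually (\<lambda>n. (1 + cmod z) / 2 < \<rho> n) sequentially"
      by (rule order_tendstoD(1)[OF \<rho>(2)]) (use z in simp)
    then have "eventually (\<lambda>n. (1 - (cmod a)\<^sup>2) / cmod a \<le> M * (1 - (cmod a)\<^sup>2) + C * \<delta> n) sequentially"
    proof eventually_elim
      case (elim n)
      define r where "r = \<rho> n"
      have r: "0 < r" "r < 1" "(1 + cmod z) / 2 \<le> r" using \<rho>(1)[of n] elim by (auto simp: r_def)
      note p = poisson_le[OF z r(3,2)]
      have zr: "cmod z < r" using r z by (simp add: field_simps)
      note c = circle_in_ball[OF holomorphic_on_imp_continuous_on[OF hol] r(1,2)]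
        circle_in_ball[OF holomorphic_on_imp_continuous_on[OF hE] r(1,2)]
        circle_in_ball[OF holomorphic_on_imp_continuous_on[OF G(1)] r(1,2)]
        circle_in_ball[OF holomorphic_on_imp_continuous_on[OF disc_aut_holomorphic_on_ball[OF z]] r(1,2)]
      note cp = poisson_continuous[OF zr]
      define P where "P w = complex_of_real (poisson r z w)" for w
      have cP: "continuous_on (sphere 0 r) P" unfolding P_def by (intro continuous_intros cp)
      have sub: "ball 0 r \<subseteq> ball (0::complex) 1" using r by auto
      have r0: "r \<ge> 0" using r by simp
      have m1: "cmean r (\<lambda>w. P w * cnj (\<Theta> w)) = cnj a"
      proof -
        have "cmean r (\<lambda>w. cnj (P w * \<Theta> w)) = cnj (cmean r (\<lambda>w. P w * \<Theta> w))"
          by (rule cmean_cnj) (intro continuous_intros cP c r0)+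
        also have "cmean r (\<lambda>w. P w * \<Theta> w) = \<Theta> z"
          unfolding P_def using sub zr by (intro poisson_formula c holomorphic_on_subset[OF hol]) auto
        finally show ?thesis by (simp add: P_def a_def)
      qed
      have m2: "cmean r (\<lambda>w. P w * E w) = E z"
        unfolding P_def using sub zr by (intro poisson_formula c holomorphic_on_subset[OF hE]) auto
      define W where "W w = P w * (of_real (1 - (cmod (\<Theta> w))\<^sup>2) * E w)" for w
      define V where "V w = P w * (disc_aut z w * G w * f w * cnj (\<Theta> w))" for w
      have cW: "continuous_on (sphere 0 r) W" unfolding W_def by (intro continuous_intros cP c)
      have cV: "continuous_on (sphere 0 r) V" unfolding V_def f_def by (intro continuous_intros cP c)
      have VW: "V w + W w = P w * cnj (\<Theta> w) + P w * E w" if w: "cmod w = r" for w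
      proof -
        have w1: "cmod w < 1" using w r by simp
        have tt: "of_real ((cmod (\<Theta> w))\<^sup>2) = \<Theta> w * cnj (\<Theta> w)" by (rule complex_norm_square)
        show ?thesis unfolding V_def W_def eq[OF w1] of_real_diff tt E_def f_def
          by (simp add: algebra_simps power2_eq_square)
      qed
      have "cmean r (\<lambda>w. V w + W w) = cmean r (\<lambda>w. P w * cnj (\<Theta> w) + P w * E w)"
        by (rule cmean_cong) (use VW r in auto)
      also have "\<dots> = cnj a + E z"
        unfolding m1[symmetric] m2[symmetric] by (rule cmean_add) (intro continuous_intros cP c r0)+
      finally have "cmod (cnj a + E z) \<le> cmean r (\<lambda>w. cmod (V w + W w))"
        using norm_cmean_le[of r "\<lambda>w. V w + W w"] cV cW r0 by (auto intro!: continuous_intros)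
      also have "\<dots> \<le> cmean r (\<lambda>w. M * (poisson r z w * (cmod (1 - cnj a * \<Theta> w))\<^sup>2) + C * (1 - (cmod (\<Theta> w))\<^sup>2))"
      proof (rule cmean_mono)
        fix w assume w: "cmod w = r"
        have w1: "cmod w < 1" using w r by simp
        have q: "0 \<le> 1 - (cmod (\<Theta> w))\<^sup>2" using le1[OF w1] by (simp add: power_le_one)
        have "cmod (V w) = poisson r z w * ((cmod (disc_aut z w) * cmod (\<Theta> w)) * cmod (G w) * (cmod (1 - cnj a * \<Theta> w))\<^sup>2)"
          unfolding V_def P_def f_def using p(2)[OF w] by (simp add: norm_mult norm_power)
        also have "\<dots> \<le> poisson r z w * ((1 * 1) * M * (cmod (1 - cnj a * \<Theta> w))\<^sup>2)"
          using p(2)[OF w] G(2)[OF w1] le1[OF w1] cmod_disc_aut_le_1[OF z, of w] w1 M0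
          by (intro mult_left_mono mult_right_mono mult_mono) auto
        finally have V: "cmod (V w) \<le> M * (poisson r z w * (cmod (1 - cnj a * \<Theta> w))\<^sup>2)" by (simp add: mult_ac)
        have "cmod (W w) = poisson r z w * ((1 - (cmod (\<Theta> w))\<^sup>2) * cmod (E w))"
          unfolding W_def P_def norm_mult norm_of_real using p(2)[OF w] q by simp
        also have "\<dots> \<le> 4 / (1 - cmod z) * ((1 - (cmod (\<Theta> w))\<^sup>2) * (3 + 4 * N))"
          using p[OF w] q Eb[OF w1] z by (intro mult_mono mult_left_mono) auto
        finally have "cmod (W w) \<le> C * (1 - (cmod (\<Theta> w))\<^sup>2)" by (simp add: C_def mult_ac)
        with V show "cmod (V w + W w) \<le> M * (poisson r z w * (cmod (1 - cnj a * \<Theta> w))\<^sup>2) + C * (1 - (cmod (\<Theta> w))\<^sup>2)"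
          by (intro order_trans[OF norm_triangle_ineq] add_mono)
      qed (intro continuous_intros cV cW c cp r0)+
      also have "\<dots> = M * cmean r (\<lambda>w. poisson r z w * (cmod (1 - cnj a * \<Theta> w))\<^sup>2) + C * \<delta> n"
        unfolding \<delta>_def r_def[symmetric] cmean_mult_right[symmetric]
        by (rule cmean_add) (intro continuous_intros c cp r0)+
      also have "cmean r (\<lambda>w. poisson r z w * (cmod (1 - cnj a * \<Theta> w))\<^sup>2)
          \<le> cmean r (\<lambda>w. (1 + (cmod a)\<^sup>2) * poisson r z w - 2 * Re (cnj a * (P w * \<Theta> w)))"
      proof (rule cmean_mono)
        fix w assume w: "cmod w = r"
        have w1: "cmod w < 1" using w r by simp
        have "(cmod (1 - cnj a * \<Theta> w))\<^sup>2 = 1 - 2 * Re (cnj a * \<Theta> w) + (cmod a)\<^sup>2 * (cmod (\<Theta> w))\<^sup>2"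
          unfolding cmod_power2 by (simp add: algebra_simps power2_eq_square)
        also have "\<dots> \<le> 1 - 2 * Re (cnj a * \<Theta> w) + (cmod a)\<^sup>2 * 1"
          using le1[OF w1] by (intro add_left_mono mult_left_mono) (auto simp: power_le_one)
        finally have "poisson r z w * (cmod (1 - cnj a * \<Theta> w))\<^sup>2 \<le> poisson r z w * (1 - 2 * Re (cnj a * \<Theta> w) + (cmod a)\<^sup>2)"
          using p(2)[OF w] by (intro mult_left_mono) auto
        also have "\<dots> = (1 + (cmod a)\<^sup>2) * poisson r z w - 2 * Re (cnj a * (P w * \<Theta> w))"
          unfolding P_def by (simp add: algebra_simps)
        finally show "poisson r z w * (cmod (1 - cnj a * \<Theta> w))\<^sup>2 \<le> \<dots>" .
      qed (intro continuous_intros c cp cP r0)+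
      also have "\<dots> = (1 + (cmod a)\<^sup>2) * cmean r (poisson r z) - 2 * Re (cnj a * cmean r (\<lambda>w. P w * \<Theta> w))"
        unfolding cmean_mult_right[symmetric]
        by (subst cmean_Re[symmetric], (intro continuous_intros c cP r0)+, subst cmean_mult_right[symmetric], rule cmean_diff)
          (intro continuous_intros c cp cP r0)+
      also have "\<dots> = 1 - (cmod a)\<^sup>2"
      proof -
        have "cmean r (\<lambda>w. P w * \<Theta> w) = a"
          unfolding P_def a_def using sub zr by (intro poisson_formula c holomorphic_on_subset[OF hol]) auto
        then show ?thesis using poisson_mean_1[OF zr] aa by simp
      qed
      finally have "cmod (cnj a + E z) \<le> M * (1 - (cmod a)\<^sup>2) + C * \<delta> n" using M0 by (simp add: mult_left_mono)
      moreover have "cmod (cnj a + E z) = (1 - (cmod a)\<^sup>2) / cmod a"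
        unfolding val norm_divide norm_minus_cancel norm_of_real using a(2) by (simp add: power_le_one)
      ultimately show ?case by simp
    qed
    moreover have "(\<lambda>n. M * (1 - (cmod a)\<^sup>2) + C * \<delta> n) \<longlonglongrightarrow> M * (1 - (cmod a)\<^sup>2) + C * 0"
      using \<rho>(3) unfolding \<delta>_def by (intro tendsto_intros)
    ultimately have "(1 - (cmod a)\<^sup>2) / cmod a \<le> M * (1 - (cmod a)\<^sup>2) + C * 0"
      by (intro tendsto_lowerbound[of _ _ sequentially]) auto
    moreover have "1 - (cmod a)\<^sup>2 > 0" using a(2) by (simp add: abs_square_less_1)
    moreover from calculation have "(1 - (cmod a)\<^sup>2) * 1 \<le> (1 - (cmod a)\<^sup>2) * (M * cmod a)"
      using a(1) by (simp add: divide_le_eq mult_ac)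
    ultimately have "1 \<le> M * cmod a" using mult_le_cancel_left_pos by blast
    then show False using not1 by (simp add: a_def)
  qed
qed

section \<open>Points far from the zeros, and quotient norms\<close>

definition far_from_zeros :: "(complex \<Rightarrow> complex) \<Rightarrow> real \<Rightarrow> complex \<Rightarrow> bool" where
  "far_from_zeros \<Theta> t z \<longleftrightarrow> cmod z < 1 \<and> (\<forall>w\<in>zero_set \<Theta>. cmod (disc_aut w z) \<ge> t)"

text \<open>If \<open>\<Theta>\<close> has no zeros in the disc, every point counts as far, and the
  condition demands \<open>|\<Theta>| \<ge> 1 - \<eta>\<close> everywhere for all
  \<open>\<eta> > 0\<close>. Nonconstant singular inner functions are thereby excluded.\<close>

definition unimodular_far :: "(complex \<Rightarrow> complex) \<Rightarrow> bool" where
  "unimodular_far \<Theta> \<longleftrightarrow> (\<forall>\<eta>>0. \<exists>t<1. \<forall>z. far_from_zeros \<Theta> t z \<longrightarrow> cmod (\<Theta> z) \<ge> 1 - \<eta>)"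

lemma sup_norm_bounds:
  assumes "f \<in> Hinf"
  shows "cmod z < 1 \<Longrightarrow> cmod (f z) \<le> sup_norm f" "(\<And>z. cmod z < 1 \<Longrightarrow> cmod (f z) \<le> M) \<Longrightarrow> sup_norm f \<le> M"
proof -
  have "bdd_above ((\<lambda>z. cmod (f z)) ` ball 0 1)" 
  proof -
    obtain M where "\<And>z. cmod z < 1 \<Longrightarrow> cmod (f z) \<le> M" using Hinf_bound[OF assms] by blast
    then show ?thesis by (intro bdd_aboveI2[where M = M]) auto
  qed
  then show "cmod z < 1 \<Longrightarrow> cmod (f z) \<le> sup_norm f" unfolding sup_norm_def by (intro cSUP_upper) auto
  show "(\<And>z. cmod z < 1 \<Longrightarrow> cmod (f z) \<le> M) \<Longrightarrow> sup_norm f \<le> M"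
    unfolding sup_norm_def by (intro cSUP_least) auto
qed

lemma Hinf_add: "f \<in> Hinf \<Longrightarrow> g \<in> Hinf \<Longrightarrow> (\<lambda>z. f z + g z) \<in> Hinf"
  and Hinf_mult: "f \<in> Hinf \<Longrightarrow> g \<in> Hinf \<Longrightarrow> (\<lambda>z. f z * g z) \<in> Hinf"
proof -
  assume f: "f \<in> Hinf" and g: "g \<in> Hinf"
  obtain M N where M: "M > 0" "\<And>z. cmod z < 1 \<Longrightarrow> cmod (f z) \<le> M" and N: "N > 0" "\<And>z. cmod z < 1 \<Longrightarrow> cmod (g z) \<le> N"
    using Hinf_bound[OF f] Hinf_bound[OF g] by blast
  have h: "f holomorphic_on ball 0 1" "g holomorphic_on ball 0 1" using f g unfolding Hinf_def by auto
  show "(\<lambda>z. f z + g z) \<in> Hinf"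
    by (rule HinfI[where M = "M + N"]) (auto intro!: holomorphic_intros h order_trans[OF norm_triangle_ineq] add_mono M N)
  show "(\<lambda>z. f z * g z) \<in> Hinf"
    using M N by (intro HinfI[where M = "M * N"]) (auto intro!: holomorphic_intros h simp: norm_mult intro: mult_mono)
qed

lemma Hinf_const: "(\<lambda>_. c) \<in> Hinf"
  by (rule HinfI[where M = "cmod c"]) auto

lemma quot_norm_lessE:
  assumes "f \<in> Hinf" "\<Theta> \<in> Hinf" "quot_norm \<Theta> f < X"
  obtains k where "k \<in> Hinf" "\<And>z. cmod z < 1 \<Longrightarrow> cmod (f z + k z * \<Theta> z) \<le> X"
proof -
  have "(INF g\<in>Hinf. sup_norm (\<lambda>z. f z + g z * \<Theta> z)) < X" using assms(3) unfolding quot_norm_def .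
  moreover have "(\<lambda>g. sup_norm (\<lambda>z. f z + g z * \<Theta> z)) ` Hinf \<noteq> {}" using Hinf_const by auto
  ultimately obtain k where k: "k \<in> Hinf" "sup_norm (\<lambda>z. f z + k z * \<Theta> z) < X"
    using cInf_lessD by (metis (no_types, lifting) imageE)
  have "(\<lambda>z. f z + k z * \<Theta> z) \<in> Hinf" using assms k by (intro Hinf_add Hinf_mult)
  from sup_norm_bounds(1)[OF this] k show thesis using that[of k] by force
qed

lemma quot_norm_le:
  assumes "f \<in> Hinf" "\<Theta> \<in> Hinf" "\<And>z. cmod z < 1 \<Longrightarrow> cmod (f z) \<le> X"
  shows "quot_norm \<Theta> f \<le> X"
proof -
  have "quot_norm \<Theta> f \<le> sup_norm (\<lambda>z. f z + 0 * \<Theta> z)"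
    unfolding quot_norm_def
  proof (rule cINF_lower)
    show "bdd_below ((\<lambda>g. sup_norm (\<lambda>z. f z + g z * \<Theta> z)) ` Hinf)"
    proof (rule bdd_belowI2[where m = 0])
      fix g assume "g \<in> Hinf"
      then have "(\<lambda>z. f z + g z * \<Theta> z) \<in> Hinf" using assms by (intro Hinf_add Hinf_mult)
      from sup_norm_bounds(1)[OF this, of 0] show "0 \<le> sup_norm (\<lambda>z. f z + g z * \<Theta> z)"
        using norm_ge_zero order_trans by (metis norm_zero zero_less_one)
    qed
  qed (rule Hinf_const)
  also have "\<dots> \<le> X" using sup_norm_bounds(2)[OF assms(1,3)] by simp
  finally show ?thesis .
qed

lemma disc_aut_Hinf: "cmod a < 1 \<Longrightarrow> disc_aut a \<in> Hinf"
  by (rule HinfI[where M = 1]) (auto intro!: disc_aut_holomorphic_on_ball cmod_disc_aut_le_1)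

lemma SIP_imp_unimodular_far:
  assumes inner: "inner_function \<Theta>" and sip: "SIP \<Theta>"
  shows "unimodular_far \<Theta>"
  unfolding unimodular_far_def
proof (intro allI impI)
  fix \<eta> :: real assume \<eta>: "\<eta> > 0"
  have TH: "\<Theta> \<in> Hinf" using inner unfolding inner_function_def by blast
  \<comment> \<open>SIP is invoked with \<open>\<eta> / 2\<close>, since the quotient norm is an
    infimum and a representative bounded by \<open>1 + \<eta>\<close> has to be extracted.\<close>
  obtain \<delta> where \<delta>: "\<delta> > 0" "\<And>f. f \<in> Hinf \<Longrightarrow> quot_norm \<Theta> f \<le> 1 \<Longrightarrow>
      (INF z\<in>zero_set \<Theta>. ereal (cmod (f z))) \<ge> ereal (1 - \<delta>) \<Longrightarrow>
      \<exists>g. quot_inverse \<Theta> f g \<and> quot_norm \<Theta> g \<le> 1 + \<eta> / 2"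
    using sip[unfolded SIP_def, rule_format, of "\<eta> / 2"] \<eta> by auto
  show "\<exists>t<1. \<forall>z. far_from_zeros \<Theta> t z \<longrightarrow> cmod (\<Theta> z) \<ge> 1 - \<eta>"
  \<comment> \<open>\<open>1 - \<delta>\<close> is what SIP asks of \<open>disc_aut z\<close> on the
    zero set; the floor 1/2 makes sure that \<open>z\<close> itself is no zero of
    \<open>\<Theta>\<close>.\<close>
  proof (intro exI[of _ "max (1 - \<delta>) (1 / 2)"] conjI allI impI)
    fix z assume far: "far_from_zeros \<Theta> (max (1 - \<delta>) (1 / 2)) z"
    then have z: "cmod z < 1" by (simp add: far_from_zeros_def)
    have fz: "cmod (disc_aut z w) \<ge> 1 - \<delta>" "cmod (disc_aut z w) \<ge> 1 / 2" if "w \<in> zero_set \<Theta>" for w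
      using far that cmod_disc_aut_commute[of z w] unfolding far_from_zeros_def by auto
    have nz: "\<Theta> z \<noteq> 0" using fz(2)[of z] z by (auto simp: zero_set_def)
    have "quot_norm \<Theta> (disc_aut z) \<le> 1"
      using cmod_disc_aut_le_1[OF z] by (intro quot_norm_le disc_aut_Hinf z TH) auto
    moreover have "(INF w\<in>zero_set \<Theta>. ereal (cmod (disc_aut z w))) \<ge> ereal (1 - \<delta>)"
      using fz(1) by (intro INF_greatest) auto
    ultimately obtain g where g: "quot_inverse \<Theta> (disc_aut z) g" "quot_norm \<Theta> g \<le> 1 + \<eta> / 2"
      using \<delta>(2)[OF disc_aut_Hinf[OF z]] by blast
    have gH: "g \<in> Hinf" using g(1) unfolding quot_inverse_def by blast
    obtain h where h: "h \<in> Hinf" "\<And>w. cmod w < 1 \<Longrightarrow> disc_aut z w * g w - 1 = h w * \<Theta> w"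
      using g(1) unfolding quot_inverse_def quot_eq_def by auto
    obtain k where k: "k \<in> Hinf" "\<And>w. cmod w < 1 \<Longrightarrow> cmod (g w + k w * \<Theta> w) \<le> 1 + \<eta>"
      by (rule quot_norm_lessE[OF gH TH, of "1 + \<eta>"]) (use g(2) \<eta> in auto)
    define H where "H w = h w + disc_aut z w * k w" for w
    have HH: "H \<in> Hinf" unfolding H_def by (intro Hinf_add Hinf_mult h k disc_aut_Hinf z)
    then obtain N where N: "\<And>w. cmod w < 1 \<Longrightarrow> cmod (H w) \<le> N" using Hinf_bound by blast
    have GH: "(\<lambda>w. g w + k w * \<Theta> w) \<in> Hinf" by (intro Hinf_add Hinf_mult gH k TH)
    have "cmod (\<Theta> z) = 1 \<or> 1 \<le> (1 + \<eta>) * cmod (\<Theta> z)"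
    proof (rule quot_inverse_disc_aut_bound[OF inner_function_imp_inner_mean[OF inner] z nz _ k(2) _ N])
      show "(\<lambda>w. g w + k w * \<Theta> w) holomorphic_on ball 0 1" "H holomorphic_on ball 0 1"
        using GH HH unfolding Hinf_def by auto
      show "disc_aut z w * (g w + k w * \<Theta> w) = 1 + H w * \<Theta> w" if "cmod w < 1" for w
        using h(2)[OF that] unfolding H_def by (simp add: algebra_simps)
    qed
    then show "cmod (\<Theta> z) \<ge> 1 - \<eta>"
    proof
      assume "1 \<le> (1 + \<eta>) * cmod (\<Theta> z)"
      moreover have "(1 - \<eta>) * (1 + \<eta>) \<le> 1" by (simp add: algebra_simps)
      ultimately have "(1 + \<eta>) * (1 - \<eta>) \<le> (1 + \<eta>) * cmod (\<Theta> z)" by (simp add: mult.commute)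
      then show ?thesis using \<eta> by simp
    qed (use \<eta> in simp)
  qed (use \<delta> in auto)
qed

lemma disc_aut_comp_inner_mean:
  assumes "inner_mean \<Theta>" "cmod a < 1"
  shows "inner_mean (disc_aut a \<circ> \<Theta>)"
proof -
  obtain \<rho> where \<rho>: "\<And>n::nat. 0 < \<rho> n \<and> \<rho> n < 1" "\<rho> \<longlonglongrightarrow> 1"
    "(\<lambda>n. cmean (\<rho> n) (\<lambda>z. 1 - (cmod (\<Theta> z))\<^sup>2)) \<longlonglongrightarrow> 0"
    using assms unfolding inner_mean_def by blast
  have hol: "\<Theta> holomorphic_on ball 0 1" and le1: "\<And>w. cmod w < 1 \<Longrightarrow> cmod (\<Theta> w) \<le> 1"
    using assms unfolding inner_mean_def by auto
  have hc: "(disc_aut a \<circ> \<Theta>) holomorphic_on ball 0 1"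
    unfolding o_def using le1 assms by (intro disc_aut_holomorphic_ball hol) auto
  define K where "K = 1 / (1 - cmod a)\<^sup>2"
  have K: "K \<ge> 0" by (simp add: K_def)
  have pt: "0 \<le> 1 - (cmod ((disc_aut a \<circ> \<Theta>) z))\<^sup>2 \<and> 1 - (cmod ((disc_aut a \<circ> \<Theta>) z))\<^sup>2 \<le> K * (1 - (cmod (\<Theta> z))\<^sup>2)"
    if z: "cmod z < 1" for z
  proof
    show "0 \<le> 1 - (cmod ((disc_aut a \<circ> \<Theta>) z))\<^sup>2"
      using cmod_disc_aut_le_1[OF assms(2) le1[OF z]] by (simp add: power_le_one)
    have nz: "1 - cnj a * \<Theta> z \<noteq> 0" by (rule one_minus_cnj_mult_nonzero[OF assms(2) le1[OF z]])
    have "(1 - cmod a)\<^sup>2 \<le> (cmod (1 - cnj a * \<Theta> z))\<^sup>2"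
      using cmod_one_minus_cnj_mult_ge[OF le1[OF z], of a] assms(2) by (intro power_mono) auto
    moreover have "(1 - (cmod a)\<^sup>2) * (1 - (cmod (\<Theta> z))\<^sup>2) \<le> 1 * (1 - (cmod (\<Theta> z))\<^sup>2)"
      using le1[OF z] by (intro mult_right_mono) (auto simp: power_le_one)
    ultimately have "prox a (\<Theta> z) \<le> 1 * (1 - (cmod (\<Theta> z))\<^sup>2) / (1 - cmod a)\<^sup>2"
      unfolding prox_def using assms(2) le1[OF z] by (intro frac_le) (auto simp: power_le_one)
    then show "1 - (cmod ((disc_aut a \<circ> \<Theta>) z))\<^sup>2 \<le> K * (1 - (cmod (\<Theta> z))\<^sup>2)"
      using cmod_disc_aut_sq[OF nz] by (simp add: K_def)
  qed
  have "(\<lambda>n. cmean (\<rho> n) (\<lambda>z. 1 - (cmod ((disc_aut a \<circ> \<Theta>) z))\<^sup>2)) \<longlonglongrightarrow> 0"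
  proof (rule tendsto_sandwich[OF _ _ tendsto_const])
    have c: "continuous_on (sphere 0 (\<rho> n)) \<Theta>" "continuous_on (sphere 0 (\<rho> n)) (disc_aut a \<circ> \<Theta>)" for n
      using circle_in_ball[OF holomorphic_on_imp_continuous_on[OF hol], of "\<rho> n"]
        circle_in_ball[OF holomorphic_on_imp_continuous_on[OF hc], of "\<rho> n"] \<rho>(1)[of n] by auto
    show "eventually (\<lambda>n. 0 \<le> cmean (\<rho> n) (\<lambda>z. 1 - (cmod ((disc_aut a \<circ> \<Theta>) z))\<^sup>2)) sequentially"
      using pt \<rho>(1) by (intro always_eventually allI cmean_nonneg continuous_intros c) (auto simp: less_imp_le)
    show "eventually (\<lambda>n. cmean (\<rho> n) (\<lambda>z. 1 - (cmod ((disc_aut a \<circ> \<Theta>) z))\<^sup>2) \<le> K * cmean (\<rho> n) (\<lambda>z. 1 - (cmod (\<Theta> z))\<^sup>2)) sequentially"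
      unfolding cmean_mult_right[symmetric]
      using pt \<rho>(1) by (intro always_eventually allI cmean_mono continuous_intros c) (auto simp: less_imp_le)
    show "(\<lambda>n. K * cmean (\<rho> n) (\<lambda>z. 1 - (cmod (\<Theta> z))\<^sup>2)) \<longlonglongrightarrow> 0"
      using tendsto_mult_left[OF \<rho>(3), of K] by simp
  qed
  moreover have "cmod ((disc_aut a \<circ> \<Theta>) z) \<le> 1" if "cmod z < 1" for z
    using cmod_disc_aut_le_1[OF assms(2) le1[OF that]] by simp
  ultimately show ?thesis unfolding inner_mean_def using hc \<rho> by blast
qed

text \<open>At a far point \<open>|\<Theta>|\<close> is at least the midpoint of \<open>|a|\<close>
  and 1, so \<open>disc_aut a o \<Theta>\<close> is bounded below there. Any other point is close to
  a zero of \<open>\<Theta>\<close>, where \<open>disc_aut a o \<Theta>\<close> takes the value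
  \<open>a\<close>, and this is where \<open>a \<noteq> 0\<close> enters.\<close>

theorem unimodular_far_imp_M:
  assumes inner: "inner_mean \<Theta>" and far: "unimodular_far \<Theta>" and a: "cmod a < 1" "a \<noteq> 0"
  shows "disc_aut a \<circ> \<Theta> \<in> CN"
proof -
  have le1: "\<And>w. cmod w < 1 \<Longrightarrow> cmod (\<Theta> w) \<le> 1"
    using inner unfolding inner_mean_def by auto
  obtain t where t: "t < 1" "\<And>z. far_from_zeros \<Theta> t z \<Longrightarrow> cmod (\<Theta> z) \<ge> 1 - (1 - cmod a) / 2"
    using far[unfolded unimodular_far_def, rule_format, of "(1 - cmod a) / 2"] a by auto
  show ?thesis
  proof (rule inner_mean_imp_CN[OF disc_aut_comp_inner_mean[OF inner a(1)], of "min (cmod a) ((1 - cmod a) / 4)" "max t 0"])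
    fix z assume z: "cmod z < 1"
    show "\<exists>w. cmod w < 1 \<and> cmod (disc_aut z w) \<le> max t 0 \<and> min (cmod a) ((1 - cmod a) / 4) \<le> cmod ((disc_aut a \<circ> \<Theta>) w)"
    proof (cases "far_from_zeros \<Theta> t z")
      case True
      have "cmod (\<Theta> z) - cmod a \<ge> (1 - cmod a) / 2" using t(2)[OF True] by (simp add: field_simps)
      then have n: "cmod (a - \<Theta> z) \<ge> (1 - cmod a) / 2"
        using norm_triangle_ineq2[of "\<Theta> z" a] by (simp add: norm_minus_commute)
      have "cmod (1 - cnj a * \<Theta> z) \<le> 1 + cmod a * cmod (\<Theta> z)"
        using norm_triangle_ineq4[of 1 "cnj a * \<Theta> z"] by (simp add: norm_mult)
      also have "cmod a * cmod (\<Theta> z) \<le> 1 * 1" using a le1[OF z] by (intro mult_mono) auto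
      finally have d: "cmod (1 - cnj a * \<Theta> z) \<le> 2" by simp
      have d0: "cmod (1 - cnj a * \<Theta> z) > 0" using one_minus_cnj_mult_nonzero[OF a(1) le1[OF z]] by simp
      have "(1 - cmod a) / 4 = ((1 - cmod a) / 2) / 2" by simp
      also have "\<dots> \<le> cmod (a - \<Theta> z) / cmod (1 - cnj a * \<Theta> z)" using n d d0 a by (intro frac_le) auto
      finally have "(1 - cmod a) / 4 \<le> cmod ((disc_aut a \<circ> \<Theta>) z)" by (simp add: disc_aut_def norm_divide)
      then show ?thesis using z by (intro exI[of _ z]) (auto simp: min_le_iff_disj)
    next
      case False
      then obtain w where w: "w \<in> zero_set \<Theta>" "cmod (disc_aut w z) < t" using z unfolding far_from_zeros_def by auto
      then show ?thesis using cmod_disc_aut_commute[of z w] by (intro exI[of _ w]) (auto simp: zero_set_def)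
    qed
  qed (use a t in auto)
qed

section \<open>From the class M to the sharp invertibility property\<close>

text \<open>The factor 16 is the loss \<open>1 / (1 - 3/4)^2\<close> in
  \<open>prox_quasi_invariant\<close>.\<close>

lemma far_from_zeros_nearby:
  assumes far: "far_from_zeros \<Theta> s z" and s: "0 \<le> s" "1 - s\<^sup>2 \<le> (1 - t\<^sup>2) / 16"
    and w: "cmod w < 1" "cmod (disc_aut z w) \<le> 3 / 4"
  shows "far_from_zeros \<Theta> t w"
  unfolding far_from_zeros_def
proof (intro conjI ballI w(1))
  fix x assume x: "x \<in> zero_set \<Theta>"
  have z: "cmod z < 1" and x1: "cmod x < 1" using far x by (auto simp: far_from_zeros_def zero_set_def)
  have "s\<^sup>2 \<le> (cmod (disc_aut x z))\<^sup>2" using far x s by (intro power_mono) (auto simp: far_from_zeros_def)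
  then have "prox z x \<le> 1 - s\<^sup>2"
    using cmod_disc_aut_sq[OF one_minus_cnj_mult_nonzero, of x z] x1 z by (simp add: prox_commute)
  moreover have "prox w x \<le> prox z x / (1 - 3 / 4)\<^sup>2"
    using w z x1 cmod_disc_aut_commute[of z w] by (intro prox_quasi_invariant) auto
  ultimately have "prox w x \<le> 1 - t\<^sup>2" using s by (simp add: power2_eq_square)
  then have "t\<^sup>2 \<le> (cmod (disc_aut x w))\<^sup>2"
    using cmod_disc_aut_sq[OF one_minus_cnj_mult_nonzero, of x w] x1 w by (simp add: prox_commute)
  then show "t \<le> cmod (disc_aut x w)" by (rule power2_le_imp_le) simp
qed

text \<open>If the infimum \<open>m\<close> of \<open>\<bar>\<Theta>\<bar>\<close> far from the zeros stayed in \<open>(0, 1)\<close>, then by Harnack \<open>\<Theta>\<close> would be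
  almost a constant of modulus \<open>m\<close> on discs of fixed hyperbolic size around almost minimising points.\<close>

theorem M_imp_unimodular_far:
  assumes hol: "\<Theta> holomorphic_on ball 0 1" and le1: "\<And>z. cmod z < 1 \<Longrightarrow> cmod (\<Theta> z) \<le> 1"
    and M: "\<And>a. cmod a < 1 \<Longrightarrow> a \<noteq> 0 \<Longrightarrow> disc_aut a \<circ> \<Theta> \<in> CN"
    and low: "t0 < 1" "c > 0" "\<And>z. far_from_zeros \<Theta> t0 z \<Longrightarrow> cmod (\<Theta> z) \<ge> c"
  shows "unimodular_far \<Theta>"
proof (rule ccontr)
  assume "\<not> ?thesis"
  then obtain \<eta> where \<eta>: "\<eta> > 0" "\<And>t. t < 1 \<Longrightarrow> \<exists>z. far_from_zeros \<Theta> t z \<and> cmod (\<Theta> z) < 1 - \<eta>"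
    unfolding unimodular_far_def by (meson not_le)
  \<comment> \<open>\<open>I\<close> increases with \<open>t\<close>, and \<open>m\<close> is its
    limit as \<open>t\<close> tends to 1: points with \<open>|\<Theta>|\<close> close to
    \<open>m\<close> exist arbitrarily far from the zeros, while sufficiently far from the zeros
    nothing is essentially smaller than \<open>m\<close>.\<close>
  define I where "I t = (INF z\<in>{z. far_from_zeros \<Theta> t z}. cmod (\<Theta> z))" for t
  define T where "T = {max t0 0..<1}"
  have Tne: "T \<noteq> {}" using low(1) by (auto simp: T_def)
  have bb: "bdd_below ((\<lambda>z. cmod (\<Theta> z)) ` {z. far_from_zeros \<Theta> t z})" for t by (rule bdd_belowI2[where m = 0]) auto
  have I_le: "I t \<le> cmod (\<Theta> z)" if "far_from_zeros \<Theta> t z" for t z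
    unfolding I_def using that by (intro cINF_lower bb) auto
  have I_lt: "I t < 1 - \<eta>" if "t < 1" for t
    using \<eta>(2)[OF that] I_le by (meson le_less_trans)
  have I_ge: "I t \<ge> c" if "t \<in> T" for t
    unfolding I_def
  proof (rule cINF_greatest)
    show "{z. far_from_zeros \<Theta> t z} \<noteq> {}" using \<eta>(2)[of t] that by (auto simp: T_def)
    show "c \<le> cmod (\<Theta> z)" if "z \<in> {z. far_from_zeros \<Theta> t z}" for z
      using that \<open>t \<in> T\<close> by (intro low(3)) (force simp: far_from_zeros_def T_def)
  qed
  define m where "m = (SUP t\<in>T. I t)"
  have ba: "bdd_above (I ` T)" using I_lt by (intro bdd_aboveI2[where M = "1 - \<eta>"]) (auto simp: T_def less_imp_le)
  have m: "c \<le> m" "m \<le> 1 - \<eta>"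
  proof -
    obtain t where "t \<in> T" using Tne by blast
    then show "c \<le> m" unfolding m_def using I_ge[of t] cSUP_upper[OF _ ba, of t] by simp
    show "m \<le> 1 - \<eta>" unfolding m_def using I_lt Tne by (intro cSUP_least) (auto simp: T_def less_imp_le)
  qed
  have "\<exists>z. cmod z < 1 \<and> cmod (\<Theta> z) < m + e \<and> (\<forall>w. cmod w < 1 \<longrightarrow> cmod (disc_aut z w) \<le> 3 / 4 \<longrightarrow> m - e < cmod (\<Theta> w))"
    if e: "e > 0" for e
  proof -
    obtain t where t: "t \<in> T" "m - e < I t"
      using less_cSUP_iff[OF Tne ba, of "m - e"] e unfolding m_def by auto
    have t01: "0 \<le> t" "t < 1" using t by (auto simp: T_def)
    \<comment> \<open>The level at which the whole disc of pseudohyperbolic radius 3/4 about an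
      s-far point consists of t-far points.\<close>
    define s where "s = sqrt (1 - (1 - t\<^sup>2) / 16)"
    have t2: "t\<^sup>2 < 1" "0 \<le> t\<^sup>2" using t01 by (auto simp: abs_square_less_1)
    then have s2: "s\<^sup>2 = 1 - (1 - t\<^sup>2) / 16" unfolding s_def by (simp add: field_simps)
    have s: "0 \<le> s" "1 - s\<^sup>2 \<le> (1 - t\<^sup>2) / 16" using s2 t2 by (auto simp: s_def field_simps)
    have s1: "s < 1" unfolding s_def using t2 by simp
    have ts: "t \<le> s"
    proof (rule power2_le_imp_le[OF _ s(1)])
      show "t\<^sup>2 \<le> s\<^sup>2" unfolding s2 using t2 by (simp add: field_simps)
    qed
    then have sT: "s \<in> T" using t s1 by (auto simp: T_def)
    have "I s < m + e" using cSUP_upper[OF sT ba] e unfolding m_def by simp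
    then obtain z where z: "far_from_zeros \<Theta> s z" "cmod (\<Theta> z) < m + e"
      unfolding I_def using cINF_less_iff[OF _ bb, of s "m + e"] \<eta>(2)[OF s1] by auto
    have "m - e < cmod (\<Theta> w)" if "cmod w < 1" "cmod (disc_aut z w) \<le> 3 / 4" for w
      using far_from_zeros_nearby[OF z(1) s that] I_le t(2) by fastforce
    then show ?thesis using z by (auto simp: far_from_zeros_def)
  qed
  then obtain zz where zz: "\<And>e. e > 0 \<Longrightarrow> cmod (zz e) < 1 \<and> cmod (\<Theta> (zz e)) < m + e \<and>
      (\<forall>w. cmod w < 1 \<longrightarrow> cmod (disc_aut (zz e) w) \<le> 3 / 4 \<longrightarrow> m - e < cmod (\<Theta> w))" by metis
  have m0: "m > 0" using m low(2) by simp
  define e where "e n = m / (real n + 2)" for n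
  have e: "0 < e n" "e n < m" for n
  proof -
    show "0 < e n" using m0 by (simp add: e_def)
    have "m * 1 < m * (real n + 2)" using m0 by (intro mult_strict_left_mono) auto
    then show "e n < m" by (simp add: e_def divide_less_eq)
  qed
  have elim: "e \<longlonglongrightarrow> 0" unfolding e_def by real_asymp
  define z where "z n = zz (e n)" for n
  have z: "cmod (z n) < 1" "cmod (\<Theta> (z n)) < m + e n"
    "\<And>w. cmod w < 1 \<Longrightarrow> cmod (disc_aut (z n) w) \<le> 3 / 4 \<Longrightarrow> m - e n < cmod (\<Theta> w)" for n
    using zz[OF e(1)[of n]] unfolding z_def by auto
  define \<tau> where "\<tau> n = ln ((m + e n) / (m - e n))" for n
  have osc: "\<exists>d. cmod d \<le> 4 * \<tau> n \<and> \<Theta> w = \<Theta> (z n) * exp d" if w: "cmod w < 1" "cmod (disc_aut (z n) w) \<le> 1 / 2" for n w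
  proof -
    \<comment> \<open>Dividing by \<open>m - e n\<close> makes \<open>|F| > 1\<close> on the disc of
      radius 3/4, so a branch of the logarithm of \<open>F\<close> has positive real part; at the
      centre this part is at most \<open>\<tau> n\<close>, which tends to 0. Harnack's inequality is
      used with ratio 2/3, as 1/2 = 2/3 * 3/4.\<close>
    define F where "F x = \<Theta> (disc_aut (z n) x) / of_real (m - e n)" for x
    have hF: "F holomorphic_on ball 0 (3 / 4)"
      unfolding F_def using e(2)[of n] z(1)[of n] cmod_disc_aut_less_1[OF z(1)]
      by (intro holomorphic_intros holomorphic_on_compose_gen[OF _ hol, unfolded o_def] holomorphic_on_subset[OF disc_aut_holomorphic_on_ball[OF z(1)]]) auto
    have F1: "cmod (F x) > 1" if x: "cmod x < 3 / 4" for x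
    proof -
      have x1: "cmod x < 1" using x by simp
      have "m - e n < cmod (\<Theta> (disc_aut (z n) x))"
        using x x1 cmod_disc_aut_less_1[OF z(1) x1] disc_aut_disc_aut[OF z(1), of x n] by (intro z(3)) auto
      then show ?thesis unfolding F_def norm_divide norm_of_real using e(2)[of n] by simp
    qed
    then have "F x \<noteq> 0" if "x \<in> ball 0 (3 / 4)" for x using that by force
    then obtain g where g: "g holomorphic_on ball 0 (3 / 4)" "\<And>x. x \<in> ball 0 (3 / 4) \<Longrightarrow> exp (g x) = F x"
      using holomorphic_logarithm_exists[of "ball 0 (3 / 4)" F 0] hF by auto
    have Re: "Re (g x) = ln (cmod (F x))" if "cmod x < 3 / 4" for x
      using g(2)[of x, symmetric] that by simp
    define x where "x = disc_aut (z n) w"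
    have x: "cmod x \<le> 1 / 2" "disc_aut (z n) x = w"
      using w disc_aut_disc_aut[OF z(1)] unfolding x_def by auto
    have "cmod (g x - g 0) \<le> 2 * (2 / 3) / (1 - 2 / 3) * Re (g 0)"
      using F1 Re x by (intro positive_real_part_oscillation[OF g(1)]) (auto simp: less_imp_le)
    also have "\<dots> = 4 * Re (g 0)" by simp
    also have "Re (g 0) \<le> \<tau> n"
    proof -
      have "cmod (F 0) = cmod (\<Theta> (z n)) / (m - e n)"
        unfolding F_def norm_divide norm_of_real using e(2)[of n] by simp
      also have "\<dots> \<le> (m + e n) / (m - e n)" using z(2)[of n] e(2)[of n] by (intro divide_right_mono) auto
      finally have le: "cmod (F 0) \<le> (m + e n) / (m - e n)" .
      have "cmod (F 0) > 1" using F1[of 0] by simp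
      then have "ln (cmod (F 0)) \<le> ln ((m + e n) / (m - e n))" using le by (subst ln_le_cancel_iff) auto
      then show ?thesis using Re[of 0] unfolding \<tau>_def by simp
    qed
    finally have d: "cmod (g x - g 0) \<le> 4 * \<tau> n" by simp
    have "exp (g x) = exp (g 0) * exp (g x - g 0)" by (simp add: exp_add[symmetric])
    then have "F x = F 0 * exp (g x - g 0)" using g(2) x(1) by simp
    then have "\<Theta> w = \<Theta> (z n) * exp (g x - g 0)"
      unfolding F_def x(2) using e(2)[of n] by (simp add: field_simps)
    then show ?thesis using d by blast
  qed
  have "compact (cball (0::complex) 1)" by simp
  \<comment> \<open>The constant to which \<open>\<Theta>\<close> becomes nearly equal on the discs.
    Its modulus \<open>m\<close> lies strictly between 0 and 1, so hypothesis \<open>M\<close>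
    applies to it.\<close>
  then obtain a r where a: "a \<in> cball 0 1" and r: "strict_mono (r :: nat \<Rightarrow> nat)" and lima: "((\<lambda>n. \<Theta> (z n)) \<circ> r) \<longlonglongrightarrow> a"
    unfolding compact_def using le1 z(1) by (metis (no_types, lifting) mem_cball_0)
  have am: "cmod a = m"
  proof -
    have "(\<lambda>n. cmod (\<Theta> (z n))) \<longlonglongrightarrow> m"
    proof (rule tendsto_sandwich)
      show "(\<lambda>n. m - e n) \<longlonglongrightarrow> m" "(\<lambda>n. m + e n) \<longlonglongrightarrow> m"
        using tendsto_diff[OF tendsto_const elim, of m] tendsto_add[OF tendsto_const elim, of m] by auto
      show "eventually (\<lambda>n. m - e n \<le> cmod (\<Theta> (z n))) sequentially"
        using z(3)[OF z(1)] by (intro always_eventually allI) (simp add: less_imp_le)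
      show "eventually (\<lambda>n. cmod (\<Theta> (z n)) \<le> m + e n) sequentially"
        using z(2) by (intro always_eventually allI) (simp add: less_imp_le)
    qed
    from LIMSEQ_subseq_LIMSEQ[OF this r] tendsto_norm[OF lima] show ?thesis
      by (intro LIMSEQ_unique[of "\<lambda>n. cmod (\<Theta> (z (r n)))"]) (auto simp: o_def)
  qed
  have a1: "cmod a < 1" "a \<noteq> 0" using am m m0 \<eta>(1) by auto
  obtain J b where B: "blaschke_product J b (disc_aut a \<circ> \<Theta>)" "carleson_measure (zeros_measure J b)"
    using M[OF a1] unfolding CN_def by blast
  have seq: "blaschke_sequence J b" using B(1) unfolding blaschke_product_def by blast
  obtain K where K: "prox_bounded J b K" by (rule carleson_imp_prox_bounded[OF seq B(2)])
  obtain c1 where c1: "c1 > 0" "\<And>z. cmod z < 1 \<Longrightarrow> \<exists>w. cmod w < 1 \<and> cmod (disc_aut z w) \<le> 1 / 2 \<and> cmod ((disc_aut a \<circ> \<Theta>) w) \<ge> c1"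
    by (rule blaschke_product_large_nearby[OF B(1) K]) (rule that; blast)
  then have "\<forall>n. \<exists>w. cmod w < 1 \<and> cmod (disc_aut (z n) w) \<le> 1 / 2 \<and> cmod ((disc_aut a \<circ> \<Theta>) w) \<ge> c1"
    using z(1) by blast
  from choice[OF this] obtain w where "\<forall>n. cmod (w n) < 1 \<and> cmod (disc_aut (z n) (w n)) \<le> 1 / 2 \<and> cmod ((disc_aut a \<circ> \<Theta>) (w n)) \<ge> c1" ..
  then have w: "cmod (w n) < 1 \<and> cmod (disc_aut (z n) (w n)) \<le> 1 / 2 \<and> cmod ((disc_aut a \<circ> \<Theta>) (w n)) \<ge> c1" for n
    by blast
  then have "\<forall>n. \<exists>d. cmod d \<le> 4 * \<tau> n \<and> \<Theta> (w n) = \<Theta> (z n) * exp d" using osc by blast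
  from choice[OF this] obtain d where "\<forall>n. cmod (d n) \<le> 4 * \<tau> n \<and> \<Theta> (w n) = \<Theta> (z n) * exp (d n)" ..
  then have d: "cmod (d n) \<le> 4 * \<tau> n \<and> \<Theta> (w n) = \<Theta> (z n) * exp (d n)" for n by blast
  have "\<tau> \<longlonglongrightarrow> ln ((m + 0) / (m - 0))" unfolding \<tau>_def using m0 by (intro tendsto_intros elim) auto
  then have "(\<lambda>n. 4 * \<tau> n) \<longlonglongrightarrow> 0" using m0 tendsto_mult_left[of \<tau> 0 sequentially 4] by simp
  then have "d \<longlonglongrightarrow> 0" by (rule Lim_null_comparison[rotated]) (use d in auto)
  then have "(\<lambda>n. d (r n)) \<longlonglongrightarrow> 0" using LIMSEQ_subseq_LIMSEQ[OF _ r] by (auto simp: o_def)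
  then have "(\<lambda>n. \<Theta> (z (r n)) * exp (d (r n))) \<longlonglongrightarrow> a * exp 0" using lima by (intro tendsto_intros) (auto simp: o_def)
  then have lw: "(\<lambda>n. \<Theta> (w (r n))) \<longlonglongrightarrow> a" using d by simp
  have "1 - cnj a * a \<noteq> 0" using one_minus_cnj_mult_nonzero[of a a] a1 by simp
  then have "(\<lambda>n. disc_aut a (\<Theta> (w (r n)))) \<longlonglongrightarrow> disc_aut a a"
    unfolding disc_aut_def by (intro tendsto_intros lw)
  then have "(\<lambda>n. cmod (disc_aut a (\<Theta> (w (r n))))) \<longlonglongrightarrow> 0" using tendsto_norm by fastforce
  then have "c1 \<le> 0" using w by (intro LIMSEQ_le_const) auto
  then show False using c1(1) by simp
qed

section \<open>Sparse Blaschke products and the lower bound under WEP\<close>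

lemma dyadic_min_sum:
  fixes u :: "nat \<Rightarrow> real"
  assumes "\<And>n. u n > 0" "\<And>n. u (Suc n) \<le> u n / 2" "y > 0"
  shows "(\<Sum>n<N. min (y / u n) (u n / y)) \<le> 4"
proof -
  have A: "(\<Sum>n<N. u n) \<le> 2 * u 0" if "\<And>n. u n > 0" "\<And>n. u (Suc n) \<le> u n / 2" for u :: "nat \<Rightarrow> real" and N
    using that
  proof (induction N arbitrary: u)
    case (Suc N)
    have "(\<Sum>n<N. u (Suc n)) \<le> 2 * u (Suc 0)" using Suc.prems by (intro Suc.IH) auto
    then show ?case using Suc.prems(2)[of 0] by (simp add: sum.lessThan_Suc_shift del: sum.lessThan_Suc)
  qed (use less_imp_le in auto)
  have le: "(\<Sum>n<N. min (y / u n) (u n / y)) \<le> 2 * u 0 / y" if "\<And>n. u n > 0" "\<And>n. u (Suc n) \<le> u n / 2" for u :: "nat \<Rightarrow> real" and N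
  proof -
    have "(\<Sum>n<N. min (y / u n) (u n / y)) \<le> (\<Sum>n<N. u n / y)" by (intro sum_mono) auto
    also have "\<dots> \<le> 2 * u 0 / y" unfolding sum_divide_distrib[symmetric] using A[of u N, OF that] assms(3) by (intro divide_right_mono) auto
    finally show ?thesis .
  qed
  \<comment> \<open>The subtracted \<open>y / u 0\<close> is a reserve that pays for the new first
    term in the induction: it at least doubles with each index as long as \<open>u\<close> exceeds
    \<open>y\<close>. Once \<open>u\<close> has dropped to \<open>y\<close>, the remaining terms sum
    to at most 2.\<close>
  have gt: "(\<Sum>n<N. min (y / u n) (u n / y)) \<le> 4 - y / u 0" if "\<And>n. u n > 0" "\<And>n. u (Suc n) \<le> u n / 2" "u 0 > y" for u :: "nat \<Rightarrow> real" and N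
    using that
  proof (induction N arbitrary: u)
    case 0
    then have "y / u 0 < 1" using assms(3) by simp
    then show ?case by simp
  next
    case (Suc N)
    define v where "v n = u (Suc n)" for n
    have v: "v n > 0" "v (Suc n) \<le> v n / 2" for n using Suc.prems by (auto simp: v_def)
    have u0: "y / u 0 < 1" using Suc.prems(3) assms(3) by simp
    have "(\<Sum>n<Suc N. min (y / u n) (u n / y)) = min (y / u 0) (u 0 / y) + (\<Sum>n<N. min (y / v n) (v n / y))"
      by (simp add: sum.lessThan_Suc_shift v_def del: sum.lessThan_Suc)
    also have "\<dots> \<le> y / u 0 + (\<Sum>n<N. min (y / v n) (v n / y))" by simp
    also have "\<dots> \<le> 4 - y / u 0"
    proof (cases "v 0 > y")
      case True
      have "2 * (y / u 0) = y / (u 0 / 2)" by simp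
      also have "\<dots> \<le> y / v 0" using Suc.prems(2)[of 0] v(1)[of 0] assms(3) Suc.prems(1)[of 0] by (intro divide_left_mono) (auto simp: v_def)
      finally show ?thesis using Suc.IH[of v, OF v True] by linarith
    next
      case False
      then have "2 * v 0 / y \<le> 2" using assms(3) by (simp add: field_simps)
      then show ?thesis using le[of v N, OF v] u0 by linarith
    qed
    finally show ?case .
  qed
  show ?thesis
  proof (cases "u 0 > y")
    case True
    then show ?thesis using gt[of u N] assms by (smt (verit) divide_pos_pos)
  next
    case False
    then have "2 * u 0 / y \<le> 2" using assms(3) by (simp add: field_simps)
    moreover have "(\<Sum>n<N. min (y / u n) (u n / y)) \<le> 2 * u 0 / y" by (rule le) (rule assms)+
    ultimately show ?thesis by linarith
  qed
qed

text \<open>\<open>|1 - cnj z * x n|\<close> dominates both \<open>1 - |z|\<close> and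
  \<open>1 - |x n|\<close>, so \<open>prox z (x n)\<close> is at most 4 times the smaller of the two
  quotients of these numbers, and by \<open>dyadic_min_sum\<close> such minima sum to at most
  4.\<close>

lemma sparse_prox_bounded:
  fixes x :: "nat \<Rightarrow> complex"
  assumes x: "\<And>n. cmod (x n) < 1" "\<And>n. 1 - cmod (x (Suc n)) \<le> (1 - cmod (x n)) / 2"
  shows "prox_bounded UNIV x 16" "blaschke_sequence UNIV x"
proof -
  define u where "u n = 1 - cmod (x n)" for n
  have u: "u n > 0" "u (Suc n) \<le> u n / 2" for n using x by (auto simp: u_def)
  have sq: "1 - s\<^sup>2 \<le> 2 * (1 - s)" for s :: real
    using zero_le_power2[of "s - 1"] by (simp add: power2_eq_square algebra_simps)
  show pb: "prox_bounded UNIV x 16"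
    unfolding prox_bounded_def
  proof (intro allI impI)
    fix z F assume z: "cmod z < 1" and F: "finite (F :: nat set)"
    define y where "y = 1 - cmod z"
    have y: "y > 0" using z by (simp add: y_def)
    have each: "prox z (x n) \<le> 4 * min (y / u n) (u n / y)" for n
    proof -
      define d where "d = cmod (1 - cnj z * x n)"
      have d: "d \<ge> y" "d \<ge> u n"
        using cmod_one_minus_cnj_mult_ge[of "x n" z] cmod_one_minus_cnj_mult_ge[of z "x n"] x(1)[of n] z
          cmod_one_minus_cnj_commute[of z "x n"] unfolding d_def y_def u_def by auto
      have num: "(1 - (cmod z)\<^sup>2) * (1 - (cmod (x n))\<^sup>2) \<le> (2 * y) * (2 * u n)"
        unfolding y_def u_def using z x(1)[of n] by (intro mult_mono sq) (auto simp: power_le_one)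
      have "prox z (x n) \<le> (2 * y) * (2 * u n) / s\<^sup>2" if "0 < s" "s \<le> d" for s
        unfolding prox_def d_def[symmetric] using num that y u(1)[of n] by (intro frac_le power_mono) auto
      from this[OF y d(1)] this[OF u(1) d(2)]
      have "prox z (x n) \<le> 4 * (u n / y)" "prox z (x n) \<le> 4 * (y / u n)"
        using y u(1)[of n] by (auto simp: power2_eq_square)
      then show ?thesis by (simp add: min_def)
    qed
    obtain N where N: "F \<subseteq> {..<N}" using finite_nat_bounded[OF F] by blast
    have "(\<Sum>j\<in>F. prox z (x j)) \<le> (\<Sum>j<N. prox z (x j))"
      using N prox_pos[OF z x(1)] by (intro sum_mono2) (auto simp: less_imp_le)
    also have "\<dots> \<le> (\<Sum>j<N. 4 * min (y / u j) (u j / y))" by (intro sum_mono each)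
    also have "\<dots> = 4 * (\<Sum>j<N. min (y / u j) (u j / y))" by (rule sum_distrib_left[symmetric])
    also have "\<dots> \<le> 4 * 4" using dyadic_min_sum[of u y N] u y by (intro mult_left_mono) auto
    finally show "(\<Sum>j\<in>F. prox z (x j)) \<le> 16" by simp
  qed
  have ub: "u n \<le> (1 / 2) ^ n" for n
  proof (induction n)
    case 0 then show ?case by (simp add: u_def)
  next
    case (Suc n) then show ?case using u(2)[of n] by simp
  qed
  have "summable u"
    by (rule summable_comparison_test[of _ "\<lambda>n. (1 / 2) ^ n"]) (use ub u in \<open>auto intro!: exI[of _ 0] summable_geometric simp: less_imp_le\<close>)
  then have "u summable_on UNIV"
    using u by (subst summable_on_UNIV_nonneg_real_iff) (auto simp: less_imp_le)
  then show "blaschke_sequence UNIV x"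
    unfolding blaschke_sequence_def u_def using x by auto
qed

text \<open>Otherwise a Blaschke product with sparse zeros at points where \<open>\<Theta>\<close> is tiny violates the property.\<close>

theorem WEP_imp_lower_bound:
  assumes TH: "\<Theta> \<in> Hinf" and wep: "WEP \<Theta>"
  shows "\<exists>c>0. \<forall>z. far_from_zeros \<Theta> (1 / 2) z \<longrightarrow> cmod (\<Theta> z) \<ge> c"
proof (rule ccontr)
  assume neg: "\<not> ?thesis"
  have cont: "continuous_on (ball 0 1) \<Theta>" using TH unfolding Hinf_def by (auto intro: holomorphic_on_imp_continuous_on)
  \<comment> \<open>The far points with \<open>1 - |z| \<ge> \<delta>\<close> form a compact set
    without zeros of \<open>\<Theta>\<close>. Hence far points at which \<open>\<Theta>\<close> is
    arbitrarily small can be found arbitrarily close to the circle, which allows a sparse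
    choice.\<close>
  have ex: "\<exists>z. far_from_zeros \<Theta> (1 / 2) z \<and> cmod (\<Theta> z) < \<delta> \<and> 1 - cmod z < \<delta>" if \<delta>: "\<delta> > 0" for \<delta>
  proof (rule ccontr)
    assume no: "\<not> ?thesis"
    define S where "S = cball (0::complex) (1 - \<delta>) \<inter> {z. far_from_zeros \<Theta> (1 / 2) z}"
    have "S = cball 0 (1 - \<delta>) \<inter> (\<Inter>w\<in>zero_set \<Theta>. {z \<in> cball 0 (1 - \<delta>). cmod (disc_aut w z) \<ge> 1 / 2})"
      using \<delta> by (auto simp: S_def far_from_zeros_def)
    moreover have "closed {z \<in> cball 0 (1 - \<delta>). cmod (disc_aut w z) \<ge> 1 / 2}" if "w \<in> zero_set \<Theta>" for w
    proof -
      have "cmod w < 1" using that by (simp add: zero_set_def)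
      then have "continuous_on (cball 0 (1 - \<delta>)) (disc_aut w)"
        by (rule continuous_on_subset[OF disc_aut_continuous_on_cball]) (use \<delta> in auto)
      then show ?thesis by (intro continuous_on_closed_Collect_le continuous_intros) auto
    qed
    ultimately have S: "compact S" by (metis (no_types, lifting) closed_INT compact_Int_closed compact_cball)
    have Sb: "S \<subseteq> ball 0 1" by (auto simp: S_def far_from_zeros_def)
    have Snz: "\<Theta> z \<noteq> 0" if "z \<in> S" for z
    proof
      assume "\<Theta> z = 0"
      then have "z \<in> zero_set \<Theta>" "far_from_zeros \<Theta> (1 / 2) z" using that Sb by (auto simp: zero_set_def S_def)
      then show False by (auto simp: far_from_zeros_def)
    qed
    have cS: "continuous_on S (\<lambda>z. cmod (\<Theta> z))" using Sb by (intro continuous_intros continuous_on_subset[OF cont])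
    have "\<exists>\<mu>>0. \<forall>z\<in>S. cmod (\<Theta> z) \<ge> \<mu>"
    proof (cases "S = {}")
      case True then show ?thesis by (intro exI[of _ 1]) auto
    next
      case False
      then obtain z0 where "z0 \<in> S" "\<And>z. z \<in> S \<Longrightarrow> cmod (\<Theta> z0) \<le> cmod (\<Theta> z)"
        using continuous_attains_inf[OF S _ cS] by blast
      then show ?thesis using Snz by (intro exI[of _ "cmod (\<Theta> z0)"]) auto
    qed
    then obtain \<mu> where \<mu>: "\<mu> > 0" "\<And>z. z \<in> S \<Longrightarrow> cmod (\<Theta> z) \<ge> \<mu>" by blast
    have "cmod (\<Theta> z) \<ge> min \<delta> \<mu>" if z: "far_from_zeros \<Theta> (1 / 2) z" for z
    proof (cases "z \<in> S")
      case True then show ?thesis using \<mu>(2)[of z] by simp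
    next
      case False
      then have "1 - cmod z < \<delta>" using z by (auto simp: S_def not_le)
      then show ?thesis using no z by (auto simp: not_less intro: min.coboundedI1)
    qed
    then show False using neg \<delta> \<mu>(1) by (metis min_less_iff_conj)
  qed
  have "\<exists>f. \<forall>n. (far_from_zeros \<Theta> (1 / 2) (f n) \<and> cmod (\<Theta> (f n)) < 1 / (real n + 1)) \<and>
      1 - cmod (f (Suc n)) \<le> (1 - cmod (f n)) / 2"
  proof (rule dependent_nat_choice)
    show "\<exists>x. far_from_zeros \<Theta> (1 / 2) x \<and> cmod (\<Theta> x) < 1 / (real 0 + 1)" using ex[of 1] by auto
    fix x and n :: nat assume x: "far_from_zeros \<Theta> (1 / 2) x \<and> cmod (\<Theta> x) < 1 / (real n + 1)"
    then have "min ((1 - cmod x) / 2) (1 / (real (Suc n) + 1)) > 0" by (auto simp: far_from_zeros_def)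
    from ex[OF this] show "\<exists>y. (far_from_zeros \<Theta> (1 / 2) y \<and> cmod (\<Theta> y) < 1 / (real (Suc n) + 1)) \<and> 1 - cmod y \<le> (1 - cmod x) / 2"
      by (auto intro: less_imp_le)
  qed
  then obtain x where x: "\<And>n. far_from_zeros \<Theta> (1 / 2) (x n)" "\<And>n. cmod (\<Theta> (x n)) < 1 / (real n + 1)"
    "\<And>n. 1 - cmod (x (Suc n)) \<le> (1 - cmod (x n)) / 2" by blast
  have x1: "cmod (x n) < 1" for n using x(1) by (auto simp: far_from_zeros_def)
  note sp = sparse_prox_bounded[of x, OF x1 x(3)]
  define f where "f z = (\<Prod>j. if j \<in> UNIV then blaschke_factor (x j) z else 1)" for z
  have bf: "blaschke_product UNIV x f"
    unfolding blaschke_product_def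
  proof (intro conjI sp(2) exI[of _ 1])
    show "\<forall>z\<in>ball 0 1. \<exists>p. (\<lambda>j. if j \<in> UNIV then blaschke_factor (x j) z else 1) has_prod p \<and> f z = 1 * p"
      using blaschke_has_prod[OF sp(2)] unfolding f_def by auto
  qed simp
  have fH: "f \<in> Hinf"
    by (rule HinfI[where M = 1]) (use blaschke_product_holomorphic[OF bf] blaschke_product_le_part(2)[OF bf] in auto)
  have f0: "f (x n) = 0" for n using blaschke_productE[OF bf] x1 by (metis UNIV_I)
  define c where "c = exp (- 16 / (2 * (1 / 2)\<^sup>2) :: real)"
  have "cmod (f w) \<ge> c" if w: "w \<in> zero_set \<Theta>" for w
    unfolding c_def
  proof (rule blaschke_product_lower_bound[OF bf sp(1)])
    show "cmod w < 1" using w by (simp add: zero_set_def)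
    show "cmod (disc_aut (x j) w) \<ge> 1 / 2" for j
      using x(1)[of j] w cmod_disc_aut_commute[of w "x j"] by (auto simp: far_from_zeros_def)
  qed simp
  then have "(INF z\<in>zero_set \<Theta>. ereal (cmod (f z))) \<ge> ereal c" by (intro INF_greatest) auto
  moreover have "ereal c > 0" by (simp add: c_def)
  ultimately have "(INF z\<in>zero_set \<Theta>. ereal (cmod (f z))) > 0" by (rule less_le_trans[rotated])
  then obtain g where "quot_inverse \<Theta> f g" using wep fH unfolding WEP_def by blast
  then obtain h where h: "h \<in> Hinf" "\<And>z. cmod z < 1 \<Longrightarrow> f z * g z - 1 = h z * \<Theta> z"
    unfolding quot_inverse_def quot_eq_def by auto
  obtain C where C: "C > 0" "\<And>z. cmod z < 1 \<Longrightarrow> cmod (h z) \<le> C" using Hinf_bound[OF h(1)] by blast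
  have "1 \<le> C * (1 / (real n + 1))" for n
  proof -
    have "h (x n) * \<Theta> (x n) = - 1" using h(2)[OF x1[of n]] f0[of n] by simp
    then have "1 = cmod (h (x n)) * cmod (\<Theta> (x n))" by (metis norm_minus_cancel norm_mult norm_one)
    also have "\<dots> \<le> C * (1 / (real n + 1))" using C x1 x(2)[of n] by (intro mult_mono) (auto simp: less_imp_le)
    finally show ?thesis .
  qed
  moreover have "(\<lambda>n. C * (1 / (real n + 1))) \<longlonglongrightarrow> 0" by real_asymp
  ultimately have "(1::real) \<le> 0" by (intro LIMSEQ_le_const) auto
  then show False by simp
qed

section \<open>Bezout equations with bounds, and their limits\<close>

definition bezout_bound :: "(complex \<Rightarrow> complex) \<Rightarrow> (complex \<Rightarrow> complex) \<Rightarrow> real \<Rightarrow> bool" where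
  "bezout_bound F B C \<longleftrightarrow> (\<exists>G h. G holomorphic_on ball 0 1 \<and> h holomorphic_on ball 0 1 \<and>
     (\<forall>z. cmod z < 1 \<longrightarrow> cmod (G z) \<le> C \<and> cmod (h z) \<le> 1 + C \<and> F z * G z = 1 + h z * B z))"

text \<open>The bound on \<open>h\<close> belongs to the predicate so that Montel's theorem applies
  to both solution sequences; the data have to converge only pointwise.\<close>

lemma bezout_bound_limit:
  assumes b: "\<And>k. bezout_bound (F k) (B k) C"
    and F: "\<And>z. cmod z < 1 \<Longrightarrow> (\<lambda>k. F k z) \<longlonglongrightarrow> F' z" and B: "\<And>z. cmod z < 1 \<Longrightarrow> (\<lambda>k. B k z) \<longlonglongrightarrow> B' z"
  shows "bezout_bound F' B' C"
proof -
  obtain G h where G: "\<And>k. G k holomorphic_on ball 0 1" "\<And>k z. cmod z < 1 \<Longrightarrow> cmod (G k z) \<le> C"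
    and h: "\<And>k. h k holomorphic_on ball 0 1" "\<And>k z. cmod z < 1 \<Longrightarrow> cmod (h k z) \<le> 1 + C"
    and eq: "\<And>k z. cmod z < 1 \<Longrightarrow> F k z * G k z = 1 + h k z * B k z"
    using b unfolding bezout_bound_def by metis
  obtain g r where g: "g holomorphic_on ball 0 1" and r: "strict_mono (r :: nat \<Rightarrow> nat)"
    and lg: "\<And>z. z \<in> ball 0 1 \<Longrightarrow> ((\<lambda>n. G (r n) z) \<longlongrightarrow> g z) sequentially"
  proof (rule Montel[of "ball 0 1" "range G" G])
    show "\<exists>B. \<forall>h\<in>range G. \<forall>z\<in>K. cmod (h z) \<le> B" if "K \<subseteq> ball 0 1" for K
      using G(2) that by (intro exI[of _ C]) auto
  qed (use G(1) in auto)
  obtain h' s where h': "h' holomorphic_on ball 0 1" and s: "strict_mono (s :: nat \<Rightarrow> nat)"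
    and lh: "\<And>z. z \<in> ball 0 1 \<Longrightarrow> ((\<lambda>n. h (r (s n)) z) \<longlongrightarrow> h' z) sequentially"
  proof (rule Montel[of "ball 0 1" "range (\<lambda>n. h (r n))" "\<lambda>n. h (r n)"])
    show "\<exists>B. \<forall>h\<in>range (\<lambda>n. h (r n)). \<forall>z\<in>K. cmod (h z) \<le> B" if "K \<subseteq> ball 0 1" for K
      using h(2) that by (intro exI[of _ "1 + C"]) auto
  qed (use h(1) in auto)
  have rs: "strict_mono (r \<circ> s)" using r s by (simp add: strict_mono_o)
  show ?thesis
    unfolding bezout_bound_def
  proof (rule exI[of _ g], rule exI[of _ h'], intro conjI g h' allI impI)
    fix z :: complex assume z: "cmod z < 1"
    have lg': "(\<lambda>n. G (r (s n)) z) \<longlonglongrightarrow> g z" using LIMSEQ_subseq_LIMSEQ[OF lg[of z] s] z by (simp add: o_def)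
    have lh': "(\<lambda>n. h (r (s n)) z) \<longlonglongrightarrow> h' z" using lh[of z] z by simp
    show "cmod (g z) \<le> C" by (rule LIMSEQ_le_const2[OF tendsto_norm[OF lg']]) (use G(2)[OF z] in auto)
    show "cmod (h' z) \<le> 1 + C" by (rule LIMSEQ_le_const2[OF tendsto_norm[OF lh']]) (use h(2)[OF z] in auto)
    have F': "(\<lambda>n. F (r (s n)) z) \<longlonglongrightarrow> F' z" and B': "(\<lambda>n. B (r (s n)) z) \<longlonglongrightarrow> B' z"
      using LIMSEQ_subseq_LIMSEQ[OF F[OF z] rs] LIMSEQ_subseq_LIMSEQ[OF B[OF z] rs] by (auto simp: o_def)
    have "(\<lambda>n. F (r (s n)) z * G (r (s n)) z) \<longlonglongrightarrow> F' z * g z" by (intro tendsto_intros F' lg')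
    moreover have "(\<lambda>n. F (r (s n)) z * G (r (s n)) z) \<longlonglongrightarrow> 1 + h' z * B' z"
      unfolding eq[OF z] by (intro tendsto_intros lh' B')
    ultimately show "F' z * g z = 1 + h' z * B' z" by (rule LIMSEQ_unique)
  qed
qed

lemma disc_aut_perturb:
  assumes a: "cmod a < 1" and e: "e > 0"
  obtains d where "d > 0" "\<And>b z. cmod (b - a) < d \<Longrightarrow> cmod z \<le> 1 \<Longrightarrow> cmod b < 1 \<and> cmod (disc_aut a z - disc_aut b z) < e"
proof -
  define q where "q = (1 - cmod a) / 2"
  have q: "q > 0" "q \<le> 1" using a norm_ge_zero[of a] by (simp add: q_def, simp add: q_def del: norm_ge_zero)
  define d where "d = min q (e * q\<^sup>2 / 8)"
  have d: "d > 0" using q e by (simp add: d_def)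
  have "cmod b < 1 \<and> cmod (disc_aut a z - disc_aut b z) < e" if b: "cmod (b - a) < d" and z: "cmod z \<le> 1" for b z
  proof -
    have "cmod b \<le> cmod a + cmod (b - a)" using norm_triangle_ineq[of a "b - a"] by simp
    then have b1: "cmod b \<le> 1 - q" using b by (simp add: d_def q_def field_simps)
    have a1: "cmod a \<le> 1 - q" using q(1) by (simp add: q_def field_simps)
    define A where "A = 1 - cnj a * z"
    define B where "B = 1 - cnj b * z"
    have AB: "cmod A \<ge> q" "cmod B \<ge> q"
      using cmod_one_minus_cnj_mult_ge[OF z, of a] cmod_one_minus_cnj_mult_ge[OF z, of b] a1 b1 by (auto simp: A_def B_def)
    then have nz: "A \<noteq> 0" "B \<noteq> 0" using q by auto
    have "disc_aut a z - disc_aut b z = ((a - z) * B - (b - z) * A) / (A * B)"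
      using nz by (simp add: disc_aut_def A_def B_def field_simps)
    also have "(a - z) * B - (b - z) * A = (a - b) * B + (b - z) * (cnj a - cnj b) * z"
      by (simp add: A_def B_def algebra_simps)
    finally have "cmod (disc_aut a z - disc_aut b z) = cmod ((a - b) * B + (b - z) * (cnj a - cnj b) * z) / (cmod A * cmod B)"
      by (simp add: norm_divide norm_mult)
    also have "\<dots> \<le> (4 * cmod (b - a)) / (q * q)"
    proof (rule frac_le)
      have "cmod B \<le> 1 + cmod b * cmod z" using norm_triangle_ineq4[of 1 "cnj b * z"] by (simp add: B_def norm_mult)
      also have "cmod b * cmod z \<le> 1 * 1" using b1 q z by (intro mult_mono) auto
      finally have B2: "cmod B \<le> 2" by simp
      have bz: "cmod (b - z) \<le> 2" using norm_triangle_ineq4[of b z] b1 q z by simp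
      have cc: "cmod (cnj a - cnj b) = cmod (b - a)" by (metis complex_cnj_diff complex_mod_cnj norm_minus_commute)
      have "cmod (a - b) * cmod B \<le> cmod (b - a) * 2" using B2 by (intro mult_mono) (auto simp: norm_minus_commute)
      moreover have "cmod (b - z) * cmod (b - a) * cmod z \<le> 2 * cmod (b - a) * 1"
        using bz z by (intro mult_mono) auto
      moreover have "cmod ((a - b) * B + (b - z) * (cnj a - cnj b) * z) \<le> cmod (a - b) * cmod B + cmod (b - z) * cmod (b - a) * cmod z"
        using norm_triangle_ineq[of "(a - b) * B" "(b - z) * (cnj a - cnj b) * z"] by (simp only: norm_mult cc)
      ultimately have "cmod ((a - b) * B + (b - z) * (cnj a - cnj b) * z) \<le> cmod (b - a) * 2 + 2 * cmod (b - a) * 1" by linarith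
      then show "cmod ((a - b) * B + (b - z) * (cnj a - cnj b) * z) \<le> 4 * cmod (b - a)" by simp
      show "q * q \<le> cmod A * cmod B" using AB q by (intro mult_mono) auto
    qed (use q in auto)
    also have "\<dots> < e"
    proof -
      have "8 * cmod (b - a) < e * q\<^sup>2" using b by (simp add: d_def)
      then have "4 * cmod (b - a) < e * (q * q)" unfolding power2_eq_square using norm_ge_zero[of "b - a"] by linarith
      then show ?thesis using q by (simp add: divide_less_eq)
    qed
    finally show ?thesis using b1 q by simp
  qed
  then show thesis using that d by blast
qed

text \<open>A partial Blaschke product may have multiple zeros, whereas \<open>blaschke_fin\<close>
  has simple ones. The zeros are moved one at a time to a nearby point that is not yet
  taken.\<close>

lemma distinct_zeros_approx:
  assumes "finite F" "a ` F \<subseteq> ball 0 1" "e > 0"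
  shows "\<exists>A. finite A \<and> A \<subseteq> ball 0 1 \<and> (\<forall>z. cmod z \<le> 1 \<longrightarrow> cmod ((\<Prod>j\<in>F. disc_aut (a j) z) - (\<Prod>b\<in>A. disc_aut b z)) < e)"
  using assms
proof (induction F arbitrary: e rule: finite_induct)
  case empty
  then show ?case by (intro exI[of _ "{}"]) auto
next
  case (insert j F)
  obtain A where A: "finite A" "A \<subseteq> ball 0 1" "\<And>z. cmod z \<le> 1 \<Longrightarrow> cmod ((\<Prod>j\<in>F. disc_aut (a j) z) - (\<Prod>b\<in>A. disc_aut b z)) < e / 2"
    using insert.IH[of "e / 2"] insert.prems by auto
  have aj: "cmod (a j) < 1" using insert.prems by auto
  obtain d where d: "d > 0" "\<And>b z. cmod (b - a j) < d \<Longrightarrow> cmod z \<le> 1 \<Longrightarrow> cmod b < 1 \<and> cmod (disc_aut (a j) z - disc_aut b z) < e / 2"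
    by (rule disc_aut_perturb[OF aj, of "e / 2"]) (use insert.prems in auto)
  have "infinite (ball (a j) d)" using uncountable_ball[OF d(1)] countable_finite by blast
  then obtain b where b: "b \<in> ball (a j) d" "b \<notin> A" using A(1) by (meson finite_subset subsetI)
  then have bd: "cmod (b - a j) < d" by (simp add: dist_norm norm_minus_commute)
  have b1: "cmod b < 1" using d(2)[OF bd, of 0] by simp
  show ?case
  proof (intro exI[of _ "insert b A"] conjI allI impI)
    fix z :: complex assume z: "cmod z \<le> 1"
    define P where "P = (\<Prod>j\<in>F. disc_aut (a j) z)"
    define Q where "Q = (\<Prod>b\<in>A. disc_aut b z)"
    have P1: "cmod P \<le> 1" unfolding P_def prod_norm[symmetric] using insert.prems z cmod_disc_aut_le_1 by (intro prod_le_1) auto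
    have "disc_aut (a j) z * P - disc_aut b z * Q = (disc_aut (a j) z - disc_aut b z) * P + disc_aut b z * (P - Q)"
      by (simp add: algebra_simps)
    also have "cmod \<dots> \<le> cmod (disc_aut (a j) z - disc_aut b z) * cmod P + cmod (disc_aut b z) * cmod (P - Q)"
      using norm_triangle_ineq[of "(disc_aut (a j) z - disc_aut b z) * P" "disc_aut b z * (P - Q)"] by (simp add: norm_mult)
    also have "\<dots> \<le> cmod (disc_aut (a j) z - disc_aut b z) * 1 + 1 * cmod (P - Q)"
      using P1 cmod_disc_aut_le_1[OF b1 z] by (intro add_mono mult_left_mono mult_right_mono) auto
    also have "\<dots> < e / 2 + e / 2" using d(2)[OF bd z] A(3)[OF z] unfolding P_def Q_def by (intro add_strict_mono) auto
    finally show "cmod ((\<Prod>j\<in>insert j F. disc_aut (a j) z) - (\<Prod>b\<in>insert b A. disc_aut b z)) < e"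
      using insert.hyps A(1) b(2) by (simp add: P_def Q_def)
  qed (use A b1 in auto)
qed

text \<open>The smooth approximants of \<open>F\<close> are close to it only on compact subsets of
  the disc. That suffices: their size matters only on the set \<open>S\<close> where the Blaschke
  product is at most \<open>r\<close>, and since that product has modulus 1 on the circle,
  \<open>S\<close> is compact in the open disc.\<close>

lemma bezout_blaschke_fin:
  assumes bez: "\<And>b. smooth_inner b \<Longrightarrow> (\<And>z. cmod z \<le> 1 \<Longrightarrow> cmod (b z) \<ge> r \<or> cmod (blaschke_fin c A z) \<ge> r) \<Longrightarrow> bezout_bound b (blaschke_fin c A) C"
    and c: "cmod c = 1" and A: "finite A" "A \<subseteq> ball 0 1" and r: "0 < r" "r < r1"
    and r1: "r1 < 1" and F: "F holomorphic_on ball 0 1" "\<And>z. cmod z < 1 \<Longrightarrow> cmod (F z) \<le> 1"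
    and max: "\<And>z. cmod z < 1 \<Longrightarrow> cmod (F z) \<ge> r1 \<or> cmod (blaschke_fin c A z) \<ge> r1"
  shows "bezout_bound F (blaschke_fin c A) C"
proof -
  define B where "B = blaschke_fin c A"
  have si: "smooth_inner B" unfolding B_def by (rule smooth_inner_blaschke_fin[OF A c])
  then obtain U where U: "open U" "cball 0 1 \<subseteq> U" "B holomorphic_on U" "\<And>z. cmod z = 1 \<Longrightarrow> cmod (B z) = 1"
    using smooth_innerE by blast
  have cB: "continuous_on (cball 0 1) B" using deriv_cont_cball(1)[OF U(3,1,2)] .
  define S where "S = {z \<in> cball 0 1. cmod (B z) \<le> r}"
  have "closed S" unfolding S_def by (intro continuous_on_closed_Collect_le continuous_intros cB) auto
  moreover have "bounded S" by (rule bounded_subset[OF bounded_cball[of 0 1]]) (auto simp: S_def)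
  ultimately have cS: "compact S" by (simp add: compact_eq_bounded_closed)
  have S1: "cmod z < 1" if "z \<in> S" for z
    using that U(4)[of z] r r1 by (cases "cmod z = 1") (auto simp: S_def)
  obtain q where q: "0 \<le> q" "q < 1" "\<And>z. z \<in> S \<Longrightarrow> cmod z \<le> q"
  proof (cases "S = {}")
    case True then show thesis using that[of 0] by auto
  next
    case False
    have "continuous_on S (\<lambda>z. cmod z)" by (intro continuous_intros)
    then obtain z0 where "z0 \<in> S" "\<And>z. z \<in> S \<Longrightarrow> cmod z \<le> cmod z0" using continuous_attains_sup[OF cS False] by blast
    then show thesis using that[of "cmod z0"] S1 by auto
  qed
  have "\<exists>b. smooth_inner b \<and> (\<forall>z. cmod z < 1 \<longrightarrow> cmod (F z - b z) \<le> 2 * cmod z ^ n)" for n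
    by (rule smooth_inner_approx[OF F]) auto
  then obtain b where b: "\<And>n. smooth_inner (b n)" "\<And>n z. cmod z < 1 \<Longrightarrow> cmod (F z - b n z) \<le> 2 * cmod z ^ n"
    by metis
  obtain k where k: "q ^ k < (r1 - r) / 2" using real_arch_pow_inv[of "(r1 - r) / 2" q] q r by auto
  have "bezout_bound (b (n + k)) B C" for n
    unfolding B_def
  proof (rule bez[OF b(1)])
    fix z :: complex assume z: "cmod z \<le> 1"
    show "cmod (b (n + k) z) \<ge> r \<or> cmod (blaschke_fin c A z) \<ge> r"
    proof (cases "z \<in> S")
      case False
      then show ?thesis using z by (auto simp: S_def B_def)
    next
      case True
      then have z1: "cmod z < 1" "cmod z \<le> q" and Bz: "cmod (B z) \<le> r" using S1 q by (auto simp: S_def)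
      have "cmod (F z) \<ge> r1" using max[OF z1(1)] Bz r unfolding B_def by auto
      have "cmod z ^ (n + k) \<le> q ^ (n + k)" using z1 by (intro power_mono) auto
      also have "\<dots> \<le> q ^ k" using q by (intro power_decreasing) auto
      also have "\<dots> \<le> (r1 - r) / 2" using k by simp
      finally have "2 * cmod z ^ (n + k) \<le> r1 - r" by simp
      with b(2)[OF z1(1), of "n + k"] have "cmod (F z - b (n + k) z) \<le> r1 - r" by (rule order_trans)
      then have "cmod (b (n + k) z) \<ge> r"
        using \<open>cmod (F z) \<ge> r1\<close> norm_triangle_ineq2[of "F z" "F z - b (n + k) z"] by simp
      then show ?thesis ..
    qed
  qed
  then show ?thesis
    unfolding B_def[symmetric]
  proof (rule bezout_bound_limit)
    fix z :: complex assume z: "cmod z < 1"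
    have "(\<lambda>n. 2 * cmod z ^ n) \<longlonglongrightarrow> 2 * 0" using z by (intro tendsto_intros LIMSEQ_realpow_zero) auto
    then have "(\<lambda>n. 2 * cmod z ^ n) \<longlonglongrightarrow> 0" by simp
    then have "(\<lambda>n. F z - b n z) \<longlonglongrightarrow> 0"
      by (rule Lim_null_comparison[rotated]) (use b(2)[OF z] in auto)
    then have "(\<lambda>n. F z - (F z - b n z)) \<longlonglongrightarrow> F z - 0" by (intro tendsto_intros)
    then have "(\<lambda>n. b n z) \<longlonglongrightarrow> F z" by simp
    then show "(\<lambda>n. b (n + k) z) \<longlonglongrightarrow> F z" by (rule LIMSEQ_ignore_initial_segment)
  qed auto
qed

text \<open>Partial products dominate \<open>B\<close> in modulus, so hypothesis \<open>max\<close>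
  passes to them; the gap \<open>r2 - r1\<close> pays for making their zeros distinct.\<close>

lemma bezout_blaschke_product:
  assumes bez: "\<And>c A. cmod c = 1 \<Longrightarrow> finite A \<Longrightarrow> A \<subseteq> ball 0 1 \<Longrightarrow>
      (\<And>z. cmod z < 1 \<Longrightarrow> cmod (F z) \<ge> r1 \<or> cmod (blaschke_fin c A z) \<ge> r1) \<Longrightarrow> bezout_bound F (blaschke_fin c A) C"
    and r: "r1 < r2" and B: "blaschke_product J a B"
    and max: "\<And>z. cmod z < 1 \<Longrightarrow> cmod (F z) \<ge> r2 \<or> cmod (B z) \<ge> r2"
  shows "bezout_bound F B C"
proof -
  obtain c where c: "cmod c = 1" "\<And>z. cmod z < 1 \<Longrightarrow> (\<lambda>n. c * blaschke_part J a n z) \<longlonglongrightarrow> B z" "a ` J \<subseteq> ball 0 1"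
    using blaschke_productE[OF B] by metis
  have "\<exists>c' A. cmod c' = 1 \<and> finite A \<and> A \<subseteq> ball 0 1 \<and>
      (\<forall>z. cmod z < 1 \<longrightarrow> cmod (c * blaschke_part J a n z - blaschke_fin c' A z) < min (r2 - r1) (1 / (real n + 1)))" for n
  proof -
    have "\<forall>j. \<exists>s. cmod s = 1 \<and> (\<forall>z. blaschke_factor (a j) z = s * disc_aut (a j) z)" using blaschke_factor_eq by blast
    then obtain s where s: "\<And>j. cmod (s j) = 1 \<and> (\<forall>z. blaschke_factor (a j) z = s j * disc_aut (a j) z)"
      by metis
    define c' where "c' = c * (\<Prod>j\<in>J \<inter> {..<n}. s j)"
    have c': "cmod c' = 1" unfolding c'_def norm_mult c(1) prod_norm[symmetric] using s by (auto intro!: prod.neutral)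
    have part: "c * blaschke_part J a n z = c' * (\<Prod>j\<in>J \<inter> {..<n}. disc_aut (a j) z)" for z
    proof -
      have "blaschke_part J a n z = (\<Prod>j\<in>{..<n} \<inter> J. blaschke_factor (a j) z)"
        unfolding blaschke_part_def by (rule prod.inter_restrict[symmetric]) simp
      then show ?thesis using s by (simp add: c'_def prod.distrib[symmetric] Int_commute mult.assoc)
    qed
    have "min (r2 - r1) (1 / (real n + 1)) > 0" using r by simp
    moreover have "finite (J \<inter> {..<n})" "a ` (J \<inter> {..<n}) \<subseteq> ball 0 1" using c(3) by auto
    ultimately have "\<exists>A. finite A \<and> A \<subseteq> ball 0 1 \<and> (\<forall>z. cmod z \<le> 1 \<longrightarrow>
        cmod ((\<Prod>j\<in>J \<inter> {..<n}. disc_aut (a j) z) - (\<Prod>b\<in>A. disc_aut b z)) < min (r2 - r1) (1 / (real n + 1)))"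
      by (intro distinct_zeros_approx)
    then obtain A where A: "finite A" "A \<subseteq> ball 0 1" "\<And>z. cmod z \<le> 1 \<Longrightarrow>
        cmod ((\<Prod>j\<in>J \<inter> {..<n}. disc_aut (a j) z) - (\<Prod>b\<in>A. disc_aut b z)) < min (r2 - r1) (1 / (real n + 1))"
      by (elim exE conjE) (rule that; blast)
    have "cmod (c * blaschke_part J a n z - blaschke_fin c' A z) < min (r2 - r1) (1 / (real n + 1))" if "cmod z < 1" for z
      using A(3)[of z] that c' unfolding part blaschke_fin_def right_diff_distrib[symmetric] norm_mult by simp
    then show ?thesis using A c' by blast
  qed
  then obtain c' A where A: "\<And>n. cmod (c' n) = 1" "\<And>n. finite (A n)" "\<And>n. A n \<subseteq> ball 0 1"
    "\<And>n z. cmod z < 1 \<Longrightarrow> cmod (c * blaschke_part J a n z - blaschke_fin (c' n) (A n) z) < min (r2 - r1) (1 / (real n + 1))"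
    by metis
  have "bezout_bound F (blaschke_fin (c' n) (A n)) C" for n
  proof (rule bez[OF A(1-3)])
    fix z :: complex assume z: "cmod z < 1"
    have "cmod (blaschke_fin (c' n) (A n) z) \<ge> cmod (c * blaschke_part J a n z) - (r2 - r1)"
      using A(4)[OF z, of n] norm_triangle_ineq2[of "c * blaschke_part J a n z" "blaschke_fin (c' n) (A n) z"] by simp
    moreover have "cmod (B z) \<le> cmod (c * blaschke_part J a n z)"
      using blaschke_product_le_part(1)[OF B z, of n] c(1) by (simp add: norm_mult)
    ultimately show "cmod (F z) \<ge> r1 \<or> cmod (blaschke_fin (c' n) (A n) z) \<ge> r1" using max[OF z] r by linarith
  qed
  then show ?thesis
  proof (rule bezout_bound_limit)
    fix z :: complex assume z: "cmod z < 1"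
    have "(\<lambda>n. 1 / (real n + 1)) \<longlonglongrightarrow> 0" by real_asymp
    then have "(\<lambda>n. c * blaschke_part J a n z - blaschke_fin (c' n) (A n) z) \<longlonglongrightarrow> 0"
      by (rule Lim_null_comparison[rotated]) (use A(4)[OF z] in \<open>auto simp: less_imp_le\<close>)
    from tendsto_diff[OF c(2)[OF z] this] show "(\<lambda>n. blaschke_fin (c' n) (A n) z) \<longlonglongrightarrow> B z" by simp
  qed auto
qed

text \<open>\<open>\<Theta>\<close> itself may fail to be a Blaschke product. By hypothesis
  \<open>M\<close> the functions \<open>disc_aut (a n) o \<Theta>\<close> with small
  \<open>a n \<noteq> 0\<close> are Blaschke products, and they tend to \<open>- \<Theta>\<close>;
  the sign is absorbed into \<open>h\<close>.\<close>

theorem unimodular_far_imp_SIP: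
  assumes TH: "\<Theta> holomorphic_on ball 0 1" and le1: "\<And>z. cmod z < 1 \<Longrightarrow> cmod (\<Theta> z) \<le> 1"
    and M: "\<And>a. cmod a < 1 \<Longrightarrow> a \<noteq> 0 \<Longrightarrow> disc_aut a \<circ> \<Theta> \<in> CN" and far: "unimodular_far \<Theta>"
  shows "SIP \<Theta>"
  unfolding SIP_def
proof (intro allI impI)
  fix \<epsilon> :: real assume \<epsilon>: "\<epsilon> > 0"
  have THH: "\<Theta> \<in> Hinf" by (rule HinfI[OF TH le1])
  obtain r where r: "0 < r" "r < 1" and bez: "\<And>c A b. cmod c = 1 \<Longrightarrow> finite A \<Longrightarrow> A \<subseteq> ball 0 1 \<Longrightarrow> smooth_inner b \<Longrightarrow>
      (\<And>z. cmod z \<le> 1 \<Longrightarrow> cmod (b z) \<ge> r \<or> cmod (blaschke_fin c A z) \<ge> r) \<Longrightarrow> bezout_bound b (blaschke_fin c A) (1 + \<epsilon>)"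
  proof (rule bezout_finite[OF \<epsilon>], goal_cases)
    case (1 r)
    have "1 + (1 + \<epsilon>) = 2 + \<epsilon>" by simp
    then show ?case
      using 1(1)[OF 1(2,3)] 1(4) unfolding bezout_bound_def by metis
  qed
  \<comment> \<open>Four equal steps lead from \<open>r\<close> to 1: one each for approximating
    \<open>F\<close>, for perturbing zeros and for shifting \<open>\<Theta>\<close>, and a last one
    that is the permitted distance of the larger of \<open>|F|\<close> and \<open>|\<Theta>|\<close>
    from 1.\<close>
  define q where "q = (1 - r) / 4"
  have q: "q > 0" "r + 4 * q = 1" using r by (simp add: q_def, simp add: q_def field_simps)
  have bez3: "bezout_bound F \<Theta> (1 + \<epsilon>)"
    if F: "F holomorphic_on ball 0 1" "\<And>z. cmod z < 1 \<Longrightarrow> cmod (F z) \<le> 1"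
      and max: "\<And>z. cmod z < 1 \<Longrightarrow> cmod (F z) \<ge> r + 3 * q \<or> cmod (\<Theta> z) \<ge> r + 3 * q" for F
  proof -
    define a where "a n = complex_of_real (min (q / 4) (1 / 2) / (real n + 1))" for n :: nat
    have a: "cmod (a n) \<le> q / 4" "cmod (a n) \<le> 1 / 2" "a n \<noteq> 0" for n
    proof -
      have m: "min (q / 4) (1 / 2) > 0" using q by simp
      have "min (q / 4) (1 / 2) / (real n + 1) \<le> min (q / 4) (1 / 2)"
        using m divide_left_mono[of 1 "real n + 1" "min (q / 4) (1 / 2)"] by simp
      then show "cmod (a n) \<le> q / 4" "cmod (a n) \<le> 1 / 2" unfolding a_def norm_of_real using m by auto
      show "a n \<noteq> 0" unfolding a_def of_real_eq_0_iff using m by (simp del: min_less_iff_conj)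
    qed
    have a1: "cmod (a n) < 1" for n using a(2)[of n] by linarith
    have diff: "cmod (disc_aut (a n) (\<Theta> z) + \<Theta> z) \<le> 4 * cmod (a n)" if z: "cmod z < 1" for n z
    proof -
      define D where "D = 1 - cnj (a n) * \<Theta> z"
      have D: "D \<noteq> 0" unfolding D_def by (rule one_minus_cnj_mult_nonzero[OF a1 le1[OF z]])
      have Dg: "cmod D \<ge> 1 / 2" using cmod_one_minus_cnj_mult_ge[OF le1[OF z], of "a n"] a(2)[of n] by (simp add: D_def)
      have "disc_aut (a n) (\<Theta> z) + \<Theta> z = (a n - cnj (a n) * (\<Theta> z)\<^sup>2) / D"
        using D by (simp add: disc_aut_def D_def field_simps power2_eq_square)
      then have "cmod (disc_aut (a n) (\<Theta> z) + \<Theta> z) = cmod (a n - cnj (a n) * (\<Theta> z)\<^sup>2) / cmod D" by (simp add: norm_divide)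
      also have "\<dots> \<le> (2 * cmod (a n)) / (1 / 2)"
      proof (rule frac_le)
        have "cmod (a n - cnj (a n) * (\<Theta> z)\<^sup>2) \<le> cmod (a n) + cmod (a n) * (cmod (\<Theta> z))\<^sup>2"
          using norm_triangle_ineq4[of "a n" "cnj (a n) * (\<Theta> z)\<^sup>2"] by (simp add: norm_mult norm_power)
        also have "\<dots> \<le> cmod (a n) + cmod (a n) * 1" using le1[OF z] by (intro add_left_mono mult_left_mono) (auto simp: power_le_one)
        finally show "cmod (a n - cnj (a n) * (\<Theta> z)\<^sup>2) \<le> 2 * cmod (a n)" by simp
      qed (use Dg in auto)
      finally show ?thesis by simp
    qed
    have bn: "bezout_bound F (disc_aut (a n) \<circ> \<Theta>) (1 + \<epsilon>)" for n
    proof -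
      obtain J b where B: "blaschke_product J b (disc_aut (a n) \<circ> \<Theta>)"
        using M[OF a1 a(3)] unfolding CN_def by blast
      show ?thesis
      proof (rule bezout_blaschke_product[OF _ _ B, where ?r1.0 = "r + q" and ?r2.0 = "r + 2 * q"])
        fix c A assume cA: "cmod c = 1" "finite A" "A \<subseteq> ball 0 1"
          and mx: "\<And>z. cmod z < 1 \<Longrightarrow> cmod (F z) \<ge> r + q \<or> cmod (blaschke_fin c A z) \<ge> r + q"
        show "bezout_bound F (blaschke_fin c A) (1 + \<epsilon>)"
          by (rule bezout_blaschke_fin[OF bez[OF cA] cA r(1) _ _ F mx]) (use q in auto)
      next
        fix z :: complex assume z: "cmod z < 1"
        have "cmod (\<Theta> z) \<le> cmod (disc_aut (a n) (\<Theta> z)) + q"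
          using diff[OF z, of n] a(1)[of n] norm_triangle_ineq4[of "disc_aut (a n) (\<Theta> z) + \<Theta> z" "disc_aut (a n) (\<Theta> z)"] by simp
        then show "cmod (F z) \<ge> r + 2 * q \<or> cmod ((disc_aut (a n) \<circ> \<Theta>) z) \<ge> r + 2 * q"
          using max[OF z] q by auto
      qed (use q in auto)
    qed
    have lim: "(\<lambda>n. (disc_aut (a n) \<circ> \<Theta>) z) \<longlonglongrightarrow> - \<Theta> z" if z: "cmod z < 1" for z
    proof -
      have "(\<lambda>n. min (q / 4) (1 / 2) / (real n + 1)) \<longlonglongrightarrow> 0" by real_asymp
      from tendsto_of_real[OF this] have a0: "a \<longlonglongrightarrow> 0" unfolding a_def[abs_def] by (simp only: of_real_0)
      have "(\<lambda>n. disc_aut (a n) (\<Theta> z)) \<longlonglongrightarrow> (0 - \<Theta> z) / (1 - cnj 0 * \<Theta> z)"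
        unfolding disc_aut_def by (intro tendsto_intros a0) auto
      then show ?thesis by (simp add: o_def)
    qed
    have "bezout_bound F (\<lambda>z. - \<Theta> z) (1 + \<epsilon>)"
      by (rule bezout_bound_limit[OF bn _ lim]) auto
    then obtain G h where Gh: "G holomorphic_on ball 0 1" "h holomorphic_on ball 0 1"
      "\<And>z. cmod z < 1 \<Longrightarrow> cmod (G z) \<le> 1 + \<epsilon> \<and> cmod (h z) \<le> 1 + (1 + \<epsilon>) \<and> F z * G z = 1 + h z * - \<Theta> z"
      unfolding bezout_bound_def by blast
    then show ?thesis unfolding bezout_bound_def
      by (rule_tac exI[of _ G], rule_tac exI[of _ "\<lambda>z. - h z"]) (auto intro!: holomorphic_intros)
  qed
  obtain t0 where t0: "t0 < 1" "\<And>z. far_from_zeros \<Theta> t0 z \<Longrightarrow> cmod (\<Theta> z) \<ge> 1 - q"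
    using far[unfolded unimodular_far_def, rule_format, OF q(1)] by blast
  define t where "t = max t0 0"
  have t: "0 \<le> t" "t < 1" "\<And>z. far_from_zeros \<Theta> t z \<Longrightarrow> cmod (\<Theta> z) \<ge> 1 - q"
    using t0 by (auto simp: t_def far_from_zeros_def)
  \<comment> \<open>Harnack's factor: from a zero \<open>w\<close> of \<open>\<Theta>\<close> to a
    point within distance \<open>t\<close> of it, \<open>1 - |F|\<close> grows at most
    \<open>D\<close>-fold. \<open>\<delta>\<close> is chosen so that the result is at most
    \<open>q\<close>.\<close>
  define D where "D = 1 + 2 * t / (1 - t)"
  have D: "D \<ge> 1" using t by (simp add: D_def)
  define \<delta> where "\<delta> = min (1 / 4) (q / (2 * D))"
  have \<delta>: "\<delta> > 0" "\<delta> \<le> 1 / 4" "D * (2 * \<delta>) \<le> q"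
  proof -
    show "\<delta> > 0" "\<delta> \<le> 1 / 4" using q D by (auto simp: \<delta>_def)
    have "\<delta> \<le> q / (2 * D)" by (simp add: \<delta>_def)
    then show "D * (2 * \<delta>) \<le> q" using D by (simp add: field_simps)
  qed
  show "\<exists>\<delta>>0. \<forall>f\<in>Hinf. quot_norm \<Theta> f \<le> 1 \<longrightarrow> (INF z\<in>zero_set \<Theta>. ereal (cmod (f z))) \<ge> ereal (1 - \<delta>) \<longrightarrow>
     (\<exists>g. quot_inverse \<Theta> f g \<and> quot_norm \<Theta> g \<le> 1 + \<epsilon>)"
  proof (intro exI[of _ \<delta>] conjI \<delta>(1) ballI impI)
    fix f assume f: "f \<in> Hinf" "quot_norm \<Theta> f \<le> 1" and inf: "(INF z\<in>zero_set \<Theta>. ereal (cmod (f z))) \<ge> ereal (1 - \<delta>)"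
    have fZ: "cmod (f w) \<ge> 1 - \<delta>" if "w \<in> zero_set \<Theta>" for w
    proof -
      have "ereal (1 - \<delta>) \<le> ereal (cmod (f w))" using inf INF_lower[OF that] by (rule order_trans)
      then show ?thesis by simp
    qed
    obtain k where k: "k \<in> Hinf" "\<And>z. cmod z < 1 \<Longrightarrow> cmod (f z + k z * \<Theta> z) \<le> 1 + \<delta>"
      by (rule quot_norm_lessE[OF f(1) THH, of "1 + \<delta>"]) (use f(2) \<delta> in auto)
    define F where "F z = (f z + k z * \<Theta> z) / of_real (1 + \<delta>)" for z
    have h: "f holomorphic_on ball 0 1" "k holomorphic_on ball 0 1" using f k unfolding Hinf_def by auto
    have d0: "complex_of_real (1 + \<delta>) \<noteq> 0" unfolding of_real_eq_0_iff using \<delta>(1) by linarith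
    have F: "F holomorphic_on ball 0 1" unfolding F_def using d0 by (intro holomorphic_intros h TH) auto
    have F1: "cmod (F z) \<le> 1" if "cmod z < 1" for z
      unfolding F_def norm_divide norm_of_real using k(2)[OF that] \<delta>(1) by simp
    have FZ: "1 - cmod (F w) \<le> 2 * \<delta>" if w: "w \<in> zero_set \<Theta>" for w
    proof -
      have "cmod (F w) = cmod (f w) / (1 + \<delta>)"
        using w \<delta>(1) unfolding F_def norm_divide norm_of_real by (simp add: zero_set_def)
      moreover have "(1 - 2 * \<delta>) * (1 + \<delta>) \<le> 1 - \<delta>" by (simp add: algebra_simps)
      then have "1 - 2 * \<delta> \<le> (1 - \<delta>) / (1 + \<delta>)" using \<delta>(1) by (simp add: pos_le_divide_eq)
      moreover have "(1 - \<delta>) / (1 + \<delta>) \<le> cmod (f w) / (1 + \<delta>)" using fZ[OF w] \<delta>(1) by (intro divide_right_mono) auto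
      ultimately show ?thesis by linarith
    qed
    have "bezout_bound F \<Theta> (1 + \<epsilon>)"
    proof (rule bez3[OF F F1])
      fix z :: complex assume z: "cmod z < 1"
      show "cmod (F z) \<ge> r + 3 * q \<or> cmod (\<Theta> z) \<ge> r + 3 * q"
      proof (cases "far_from_zeros \<Theta> t z")
        case True then show ?thesis using t(3)[OF True] q by auto
      next
        case False
        then obtain w where w: "w \<in> zero_set \<Theta>" "cmod (disc_aut w z) < t" using z unfolding far_from_zeros_def by auto
        have w1: "cmod w < 1" using w by (simp add: zero_set_def)
        have Fw: "cmod (F w) > 0" using FZ[OF w(1)] \<delta>(2) by linarith
        \<comment> \<open>Rotating by \<open>cnj u\<close> makes the value of \<open>F\<close> at
          \<open>w\<close> positive, so that the real part of \<open>1 - cnj u * F\<close> at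
          \<open>w\<close> is exactly \<open>1 - |F w|\<close>.\<close>
        define u where "u = F w / of_real (cmod (F w))"
        have u: "cmod u = 1" using Fw by (simp add: u_def norm_divide)
        have uF: "cnj u * F w = of_real (cmod (F w))"
          using Fw complex_norm_square[of "F w"] by (simp add: u_def power2_eq_square field_simps)
        define g where "g x = 1 - cnj u * F x" for x
        have "cmod (g z - g w) \<le> 2 * t / (1 - t) * Re (g w)"
        proof (rule positive_real_part_oscillation_disc[OF _ _ w1 z _ t(2)])
          show "g holomorphic_on ball 0 1" unfolding g_def by (intro holomorphic_intros F)
          show "Re (g x) \<ge> 0" if "cmod x < 1" for x
            using complex_Re_le_cmod[of "cnj u * F x"] F1[OF that] u by (simp add: g_def norm_mult)
        qed (use w in simp)
        moreover have "cmod (g z - g w) = cmod (F w - F z)"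
        proof -
          have "g z - g w = cnj u * (F w - F z)" by (simp add: g_def algebra_simps)
          then show ?thesis using u by (simp add: norm_mult)
        qed
        moreover have "Re (g w) = 1 - cmod (F w)" unfolding g_def uF by simp
        ultimately have "cmod (F w - F z) \<le> (D - 1) * (1 - cmod (F w))" by (simp add: D_def)
        then have "1 - cmod (F z) \<le> D * (1 - cmod (F w))"
          using norm_triangle_ineq2[of "F w" "F z"] by (simp add: algebra_simps)
        also have "\<dots> \<le> D * (2 * \<delta>)" using FZ[OF w(1)] D by (intro mult_left_mono) auto
        also have "\<dots> \<le> q" by (rule \<delta>(3))
        finally show ?thesis using q by linarith
      qed
    qed
    then obtain G h' where G: "G holomorphic_on ball 0 1" "\<And>z. cmod z < 1 \<Longrightarrow> cmod (G z) \<le> 1 + \<epsilon>"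
      and h': "h' holomorphic_on ball 0 1" "\<And>z. cmod z < 1 \<Longrightarrow> cmod (h' z) \<le> 1 + (1 + \<epsilon>)"
      and eq: "\<And>z. cmod z < 1 \<Longrightarrow> F z * G z = 1 + h' z * \<Theta> z"
      unfolding bezout_bound_def by blast
    define g where "g z = (1 / of_real (1 + \<delta>)) * G z" for z
    have GH: "G \<in> Hinf" and hH: "h' \<in> Hinf" using HinfI[OF G] HinfI[OF h'] by auto
    have gH: "g \<in> Hinf" unfolding g_def by (intro Hinf_mult Hinf_const GH)
    have "quot_inverse \<Theta> f g"
      unfolding quot_inverse_def quot_eq_def
    proof (intro conjI gH bexI[of _ "\<lambda>z. h' z + (- 1) * (k z * g z)"] ballI)
      show "(\<lambda>z. h' z + (- 1) * (k z * g z)) \<in> Hinf" by (intro Hinf_add Hinf_mult Hinf_const hH k gH)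
      fix z :: complex assume "z \<in> ball 0 1"
      then have "(f z + k z * \<Theta> z) * g z = 1 + h' z * \<Theta> z" using eq[of z] by (simp add: F_def g_def)
      then show "f z * g z - 1 = (h' z + (- 1) * (k z * g z)) * \<Theta> z" by (simp add: algebra_simps)
    qed
    moreover have "quot_norm \<Theta> g \<le> 1 + \<epsilon>"
    proof (rule quot_norm_le[OF gH THH])
      fix z :: complex assume z: "cmod z < 1"
      have "cmod (g z) = (1 / (1 + \<delta>)) * cmod (G z)" unfolding g_def norm_mult norm_divide norm_of_real using \<delta>(1) by simp
      also have "\<dots> \<le> 1 * cmod (G z)" using \<delta>(1) by (intro mult_right_mono) auto
      finally show "cmod (g z) \<le> 1 + \<epsilon>" using G(2)[OF z] by simp
    qed
    ultimately show "\<exists>g. quot_inverse \<Theta> f g \<and> quot_norm \<Theta> g \<le> 1 + \<epsilon>" by blast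
  qed
qed

section \<open>Radial limits of Blaschke products\<close>

text \<open>A weak-type bound for the maximal function by Vitali's covering lemma: the selected
  balls are disjoint, and their fivefold enlargements, of length \<open>10 * s\<close>, cover
  \<open>E\<close>.\<close>

lemma emeasure_le_of_dense_balls:
  fixes \<nu> :: "real measure"
  assumes sets: "sets \<nu> = sets borel" and fin: "emeasure \<nu> UNIV \<le> ennreal M" and M: "M \<ge> 0" and m: "m > 0"
    and E: "E \<in> sets borel" "\<And>t. t \<in> E \<Longrightarrow> \<exists>s>0. emeasure \<nu> (ball t s) > ennreal (m * s)"
  shows "emeasure lborel E \<le> ennreal (10 * M / m)"
proof -
  have sp: "space \<nu> = UNIV" using sets_eq_imp_space_eq[OF sets] by simp
  have "\<forall>t\<in>E. \<exists>s>0. emeasure \<nu> (ball t s) > ennreal (m * s)" using E(2) by blast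
  from bchoice[OF this] obtain s where s: "\<forall>t\<in>E. s t > 0 \<and> emeasure \<nu> (ball t (s t)) > ennreal (m * s t)" by blast
  have sM: "s t \<le> M / m" if t: "t \<in> E" for t
  proof -
    have "ennreal (m * s t) \<le> emeasure \<nu> (ball t (s t))" using s t by (simp add: less_imp_le)
    also have "\<dots> \<le> emeasure \<nu> UNIV" by (rule emeasure_mono) (auto simp: sets)
    also have "\<dots> \<le> ennreal M" by (rule fin)
    finally have "m * s t \<le> M" using M by (simp add: ennreal_le_iff)
    then show ?thesis using m by (simp add: field_simps)
  qed
  obtain C where C: "countable C" "C \<subseteq> E"
    "pairwise (\<lambda>i j. disjnt (ball i (s i)) (ball j (s j))) C" "E \<subseteq> (\<Union>i\<in>C. ball i (5 * s i))"
  proof (rule Vitali_covering_lemma_balls[where S = E and K = E and a = "\<lambda>t. t" and r = s and B = "M / m"])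
    show "E \<subseteq> (\<Union>i\<in>E. ball i (s i))" using s by force
    show "0 < s i \<and> s i \<le> M / m" if "i \<in> E" for i using s sM that by blast
  qed (rule that; assumption)
  define I where "I = to_nat_on C ` C"
  define F where "F c n = (if n \<in> I then ball (from_nat_into C n) (c * s (from_nat_into C n)) else {})" for c :: real and n
  have inC: "from_nat_into C n \<in> C" "to_nat_on C (from_nat_into C n) = n" if "n \<in> I" for n
    using that C(1) unfolding I_def by (auto simp: from_nat_into_to_nat_on)
  have sub: "E \<subseteq> (\<Union>n. F 5 n)"
  proof
    fix t assume "t \<in> E"
    then obtain i where i: "i \<in> C" "t \<in> ball i (5 * s i)" using C(4) by blast
    then have "t \<in> F 5 (to_nat_on C i)" using C(1) unfolding F_def I_def by simp
    then show "t \<in> (\<Union>n. F 5 n)" by blast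
  qed
  have disj: "disjoint_family (F 1)"
    unfolding disjoint_family_on_def
  proof (intro ballI impI)
    fix i j :: nat assume "i \<noteq> j"
    show "F 1 i \<inter> F 1 j = {}"
    proof (cases "i \<in> I \<and> j \<in> I")
      case True
      then have "from_nat_into C i \<noteq> from_nat_into C j" using inC(2) \<open>i \<noteq> j\<close> by metis
      then show ?thesis using pairwiseD[OF C(3)] inC(1) True by (simp add: F_def disjnt_def)
    qed (auto simp: F_def)
  qed
  have le_n: "emeasure lborel (F 5 n) \<le> ennreal (10 / m) * emeasure \<nu> (F 1 n)" for n
  proof (cases "n \<in> I")
    case True
    define x where "x = from_nat_into C n"
    have x: "s x > 0" "emeasure \<nu> (ball x (s x)) > ennreal (m * s x)" using inC(1)[OF True] C(2) s unfolding x_def by auto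
    have "emeasure lborel (F 5 n) = ennreal (10 * s x)"
      using True x by (simp add: F_def x_def[symmetric] ball_eq_greaterThanLessThan)
    also have "\<dots> = ennreal (10 / m * (m * s x))" using m by simp
    also have "\<dots> = ennreal (10 / m) * ennreal (m * s x)" using m x by (intro ennreal_mult) auto
    also have "\<dots> \<le> ennreal (10 / m) * emeasure \<nu> (F 1 n)"
      using True x(2) by (intro mult_left_mono) (auto simp: F_def x_def[symmetric])
    finally show ?thesis .
  qed (simp add: F_def)
  have Fb: "F c n \<in> sets borel" for c n by (auto simp: F_def)
  have "emeasure lborel E \<le> emeasure lborel (\<Union>n. F 5 n)" using Fb by (intro emeasure_mono sub) auto
  also have "\<dots> \<le> (\<Sum>n. emeasure lborel (F 5 n))" using Fb by (intro emeasure_subadditive_countably) auto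
  also have "\<dots> \<le> (\<Sum>n. ennreal (10 / m) * emeasure \<nu> (F 1 n))" by (intro suminf_le le_n summableI)
  also have "\<dots> = ennreal (10 / m) * (\<Sum>n. emeasure \<nu> (F 1 n))" by simp
  also have "(\<Sum>n. emeasure \<nu> (F 1 n)) = emeasure \<nu> (\<Union>n. F 1 n)"
    using Fb disj by (intro suminf_emeasure) (auto simp: sets)
  also have "emeasure \<nu> (\<Union>n. F 1 n) \<le> emeasure \<nu> UNIV" by (rule emeasure_mono) (auto simp: sets)
  also have "emeasure \<nu> UNIV \<le> ennreal M" by (rule fin)
  also have "ennreal (10 / m) * ennreal M = ennreal (10 * M / m)" using m M by (simp add: ennreal_mult[symmetric])
  finally show ?thesis by (simp add: mult_left_mono)
qed

text \<open>The kernel is dominated by the sum of the constants \<open>4 / (4^k * h)\<close> on the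
  balls of radius \<open>2^k * h\<close>, each of which contributes at most
  \<open>4 * m / 2^k\<close>.\<close>

lemma nn_integral_poisson_kernel_le:
  fixes \<nu> :: "real measure"
  assumes sets: "sets \<nu> = sets borel" and h: "h > 0" and m: "m \<ge> 0"
    and ball: "\<And>s. s > 0 \<Longrightarrow> emeasure \<nu> (ball t s) \<le> ennreal (m * s)"
  shows "(\<integral>\<^sup>+x. ennreal (h / (h\<^sup>2 + (x - t)\<^sup>2)) \<partial>\<nu>) \<le> ennreal (8 * m)"
proof -
  define f where "f k x = ennreal (4 / (4 ^ k * h)) * indicator (ball t (2 ^ k * h)) x" for k :: nat and x
  have pw: "ennreal (h / (h\<^sup>2 + (x - t)\<^sup>2)) \<le> (\<Sum>k. f k x)" for x
  proof -
    define k where "k = (LEAST k. \<bar>x - t\<bar> / h < 2 ^ k)"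
    have k1: "\<bar>x - t\<bar> / h < 2 ^ k" unfolding k_def by (rule LeastI_ex) (rule real_arch_pow; simp)
    have "4 / (4 ^ k * h) \<ge> h / (h\<^sup>2 + (x - t)\<^sup>2)"
    proof (cases k)
      case 0
      have "h / (h\<^sup>2 + (x - t)\<^sup>2) \<le> h / h\<^sup>2" using h by (intro divide_left_mono mult_pos_pos add_pos_nonneg) auto
      also have "\<dots> = 1 / h" using h by (simp add: power2_eq_square)
      also have "\<dots> \<le> 4 / h" using h by (intro divide_right_mono) auto
      finally show ?thesis using 0 by simp
    next
      case (Suc j)
      have "\<not> \<bar>x - t\<bar> / h < 2 ^ j" using not_less_Least[of j] Suc unfolding k_def by (metis lessI)
      then have "2 ^ j * h \<le> \<bar>x - t\<bar>" using h by (simp add: field_simps)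
      then have "(2 ^ j * h)\<^sup>2 \<le> \<bar>x - t\<bar>\<^sup>2" using h by (intro power_mono) auto
      moreover have "(2 ^ j)\<^sup>2 = (4::real) ^ j" by (simp add: power2_eq_square power_mult_distrib[symmetric])
      ultimately have "4 ^ j * h\<^sup>2 \<le> (x - t)\<^sup>2" by (simp add: power_mult_distrib)
      then have "h / (h\<^sup>2 + (x - t)\<^sup>2) \<le> h / (4 ^ j * h\<^sup>2)"
        using h by (intro divide_left_mono mult_pos_pos add_pos_nonneg) (auto intro: order_trans[OF _ le_add_same_cancel2[THEN iffD2]])
      also have "\<dots> = 4 / (4 ^ k * h)" using h Suc by (simp add: power2_eq_square)
      finally show ?thesis .
    qed
    moreover have "x \<in> ball t (2 ^ k * h)" using k1 h by (simp add: dist_real_def field_simps abs_minus_commute)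
    ultimately have "ennreal (h / (h\<^sup>2 + (x - t)\<^sup>2)) \<le> f k x" by (simp add: f_def ennreal_leI)
    also have "f k x \<le> (\<Sum>k. f k x)" using sum_le_suminf[of "\<lambda>k. f k x" "{k}"] by (simp add: summableI)
    finally show ?thesis .
  qed
  have sb: "ball t s \<in> sets \<nu>" for s by (simp add: sets)
  have fm: "f k \<in> borel_measurable \<nu>" for k unfolding f_def[abs_def] using sb by (intro borel_measurable_times_ennreal borel_measurable_indicator) auto
  have "(\<integral>\<^sup>+x. ennreal (h / (h\<^sup>2 + (x - t)\<^sup>2)) \<partial>\<nu>) \<le> (\<integral>\<^sup>+x. (\<Sum>k. f k x) \<partial>\<nu>)" by (intro nn_integral_mono pw)
  also have "\<dots> = (\<Sum>k. \<integral>\<^sup>+x. f k x \<partial>\<nu>)" using fm by (rule nn_integral_suminf)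
  also have "\<dots> \<le> (\<Sum>k. ennreal (4 * m * (1 / 2) ^ k))"
  proof (intro suminf_le summableI)
    fix k :: nat
    have "(\<integral>\<^sup>+x. f k x \<partial>\<nu>) = ennreal (4 / (4 ^ k * h)) * emeasure \<nu> (ball t (2 ^ k * h))"
      unfolding f_def by (rule nn_integral_cmult_indicator[OF sb])
    also have "\<dots> \<le> ennreal (4 / (4 ^ k * h)) * ennreal (m * (2 ^ k * h))" using h by (intro mult_left_mono ball) auto
    also have "\<dots> = ennreal (4 / (4 ^ k * h) * (m * (2 ^ k * h)))" using h m by (intro ennreal_mult[symmetric]) auto
    also have "4 / (4 ^ k * h) * (m * (2 ^ k * h)) = 4 * m * (1 / 2) ^ k"
    proof -
      have "(4::real) ^ k = 2 ^ k * 2 ^ k" by (simp add: power_mult_distrib[symmetric])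
      then show ?thesis using h by (simp add: field_simps)
    qed
    finally show "(\<integral>\<^sup>+x. f k x \<partial>\<nu>) \<le> ennreal (4 * m * (1 / 2) ^ k)" .
  qed
  also have "\<dots> = ennreal (4 * m * 2)"
  proof (rule suminf_ennreal_eq)
    show "(\<lambda>k. 4 * m * (1 / 2) ^ k) sums (4 * m * 2)" using geometric_sums[of "1 / 2 :: real"] by (intro sums_mult) auto
  qed (use m in auto)
  finally show ?thesis by simp
qed

text \<open>Comparison with the kernel of the half plane:
  \<open>|R * cis x - r|^2 = (R - r)^2 + R * r * |1 - cis x|^2\<close>, where
  \<open>R * r \<ge> 1/4\<close> and \<open>|1 - cis x| \<ge> |x| / 2\<close>.\<close>

lemma poisson_kernel_le:
  assumes r: "1 / 2 \<le> r" "r < R" "3 / 4 \<le> R" "R \<le> 1" and x: "\<bar>x\<bar> \<le> pi"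
  shows "(R\<^sup>2 - r\<^sup>2) / (cmod (of_real R * cis x - of_real r))\<^sup>2 \<le> 32 * ((R - r) / ((R - r)\<^sup>2 + x\<^sup>2))"
proof -
  define h where "h = R - r"
  have h: "h > 0" using r by (simp add: h_def)
  have expand: "(R * c - r)\<^sup>2 + (R * s)\<^sup>2 = R\<^sup>2 * (s\<^sup>2 + c\<^sup>2) - 2 * (R * r * c) + r\<^sup>2" for c s :: real
    by (simp add: power2_eq_square algebra_simps)
  have "(cmod (of_real R * cis x - of_real r))\<^sup>2 = (R * cos x - r)\<^sup>2 + (R * sin x)\<^sup>2"
    unfolding cmod_power2 by simp
  also have "\<dots> = R\<^sup>2 * ((sin x)\<^sup>2 + (cos x)\<^sup>2) - 2 * (R * r * cos x) + r\<^sup>2"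
    by (rule expand)
  also have "\<dots> = h\<^sup>2 + R * r * (2 - 2 * cos x)"
    unfolding h_def sin_cos_squared_add by (simp add: power2_eq_square algebra_simps)
  also have "2 - 2 * cos x = (cmod (1 - cis x))\<^sup>2"
    unfolding cmod_power2 using sin_cos_squared_add[of x] by (simp add: power2_eq_square algebra_simps)
  finally have eq: "(cmod (of_real R * cis x - of_real r))\<^sup>2 = h\<^sup>2 + R * r * (cmod (1 - cis x))\<^sup>2" .
  have Rr: "R * r \<ge> 1 / 4"
  proof -
    have "R * r \<ge> (3 / 4) * (1 / 2)" using r by (intro mult_mono) auto
    then show ?thesis by simp
  qed
  have "(\<bar>x\<bar> / 2)\<^sup>2 \<le> (cmod (1 - cis x))\<^sup>2" using cmod_one_minus_cis_bounds(1)[OF x] by (intro power_mono) auto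
  then have x2: "x\<^sup>2 / 4 \<le> (cmod (1 - cis x))\<^sup>2" by (simp add: power_divide)
  have "(1 / 4) * (x\<^sup>2 / 4) \<le> R * r * (cmod (1 - cis x))\<^sup>2" using Rr x2 by (intro mult_mono) auto
  have "(p + q) / 16 \<le> p + w" if "0 \<le> p" "(1 / 4) * (q / 4) \<le> w" for p q w :: real using that by simp
  from this[OF zero_le_power2 \<open>(1 / 4) * (x\<^sup>2 / 4) \<le> R * r * (cmod (1 - cis x))\<^sup>2\<close>]
  have low: "(h\<^sup>2 + x\<^sup>2) / 16 \<le> h\<^sup>2 + R * r * (cmod (1 - cis x))\<^sup>2" .
  have pos: "h\<^sup>2 + x\<^sup>2 > 0" using h by (intro add_pos_nonneg) auto
  have "R\<^sup>2 - r\<^sup>2 = h * (R + r)" by (simp add: h_def power2_eq_square algebra_simps)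
  also have "\<dots> \<le> h * 2" using r h by (intro mult_left_mono) auto
  finally have "(R\<^sup>2 - r\<^sup>2) / (h\<^sup>2 + R * r * (cmod (1 - cis x))\<^sup>2) \<le> (h * 2) / ((h\<^sup>2 + x\<^sup>2) / 16)"
    using h pos low by (intro frac_le) auto
  also have "\<dots> = 32 * (h / (h\<^sup>2 + x\<^sup>2))" by simp
  finally show ?thesis unfolding eq by (simp add: h_def)
qed

text \<open>Three periods are taken so that intervals of half-length \<open>pi\<close> about points
  of \<open>{0..2 * pi}\<close> stay inside the range of integration.\<close>

lemma integral_periods:
  fixes G :: "real \<Rightarrow> real"
  assumes "continuous_on UNIV G" "\<And>u. G (u + 2 * pi) = G u"
  shows "(G has_integral (3 * integral {0..2 * pi} G)) {- 2 * pi..4 * pi}"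
proof -
  define I where "I = integral {0..2 * pi} G"
  have 0: "(G has_integral I) {0..2 * pi}"
    unfolding I_def by (intro integrable_integral integrable_continuous_real continuous_on_subset[OF assms(1)]) auto
  have 1: "(G has_integral I) {- 2 * pi..0}"
    using has_integral_shift_real_ivl[OF 0, of "2 * pi"] assms(2) by simp
  have "G (u - 2 * pi) = G u" for u using assms(2)[of "u - 2 * pi"] by simp
  then have 2: "(G has_integral I) {2 * pi..4 * pi}"
    using has_integral_shift_real_ivl[OF 0, of "- 2 * pi"] by simp
  have "(G has_integral (I + I)) {- 2 * pi..2 * pi}" by (rule has_integral_combine[OF _ _ 1 0]) auto
  from has_integral_combine[OF _ _ this 2] show ?thesis by (simp add: I_def)
qed

text \<open>The radii are restricted to \<open>r \<le> \<rho>\<close> so that one circle of radius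
  \<open>R > \<rho>\<close> carries the data for all \<open>t\<close>. The values of
  \<open>|g|^2\<close> on it are the density of \<open>\<nu>\<close>; if no ball about
  \<open>t\<close> were dense for \<open>\<nu>\<close>, the Poisson integral, and with it
  \<open>|g|^2\<close> at the given point of the radius, would be at most \<open>l\<close>.\<close>

lemma radial_maximal_bound_aux:
  assumes hol: "g holomorphic_on ball 0 1" and mean: "\<And>r. 0 < r \<Longrightarrow> r < 1 \<Longrightarrow> cmean r (\<lambda>z. (cmod (g z))\<^sup>2) \<le> \<epsilon>"
    and l: "l > 0" and \<rho>: "\<rho> < 1" and \<epsilon>: "\<epsilon> \<ge> 0"
    and E: "E \<in> sets borel" "E \<subseteq> {0..2 * pi}" "\<And>t. t \<in> E \<Longrightarrow> \<exists>r. 1 / 2 \<le> r \<and> r \<le> \<rho> \<and> l < (cmod (g (of_real r * cis t)))\<^sup>2"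
  shows "emeasure lborel E \<le> ennreal (7680 * \<epsilon> / l)"
proof -
  define R where "R = max (3 / 4) ((1 + \<rho>) / 2)"
  have R: "3 / 4 \<le> R" "\<rho> < R" "R < 1" using \<rho> by (auto simp: R_def less_max_iff_disj)
  define G where "G u = (cmod (g (of_real R * cis u)))\<^sup>2" for u
  have cont: "continuous_on (ball 0 1) g" using hol by (rule holomorphic_on_imp_continuous_on)
  have cG: "continuous_on A G" for A
    unfolding G_def using R by (intro continuous_intros continuous_on_compose2[OF cont]) (auto simp: norm_mult)
  have per: "G (u + 2 * pi) = G u" for u by (simp add: G_def cis_mult[symmetric])
  have Gb [measurable]: "G \<in> borel_measurable borel" using cG by (rule borel_measurable_continuous_onI)
  have G0: "G u \<ge> 0" for u by (simp add: G_def)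
  define \<nu> where "\<nu> = density lborel (\<lambda>x. indicator {- 2 * pi..4 * pi} x * ennreal (G x))"
  have sets: "sets \<nu> = sets borel" by (simp add: \<nu>_def)
  have "integral {0..2 * pi} G \<le> 2 * pi * \<epsilon>"
    using mean[of R] R unfolding cmean_def real_scaleR_def G_def by (simp add: field_simps)
  then have I3: "3 * integral {0..2 * pi} G \<le> 6 * pi * \<epsilon>" by simp
  have "emeasure \<nu> UNIV = (\<integral>\<^sup>+x. indicator {- 2 * pi..4 * pi} x * ennreal (G x) \<partial>lborel)"
    unfolding \<nu>_def by (subst emeasure_density) auto
  also have "\<dots> = (\<integral>\<^sup>+x. ennreal (indicator {- 2 * pi..4 * pi} x * G x) \<partial>lborel)"
    by (intro nn_integral_cong) (simp split: split_indicator)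
  also have "\<dots> = ennreal (3 * integral {0..2 * pi} G)"
    by (rule nn_integral_has_integral_lebesgue) (use G0 integral_periods[OF cG per] in auto)
  also have "\<dots> \<le> ennreal (6 * pi * \<epsilon>)" using I3 by (rule ennreal_leI)
  finally have tot: "emeasure \<nu> UNIV \<le> ennreal (6 * pi * \<epsilon>)" .
  \<comment> \<open>The threshold \<open>pi * l / 128\<close> is such that the kernel bound 8 and
    the factor \<open>16 / pi\<close> in front of the integral give exactly \<open>l\<close>. The
    final constant is 10 * 6 * 128 = 7680.\<close>
  have "emeasure lborel E \<le> ennreal (10 * (6 * pi * \<epsilon>) / (pi * l / 128))"
  proof (rule emeasure_le_of_dense_balls[OF sets tot _ _ E(1)])
    fix t assume t: "t \<in> E"
    then have t2: "0 \<le> t" "t \<le> 2 * pi" using E(2) by auto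
    obtain r where r: "1 / 2 \<le> r" "r \<le> \<rho>" "l < (cmod (g (of_real r * cis t)))\<^sup>2" using E(3)[OF t] by blast
    define K where "K x = (R - r) / ((R - r)\<^sup>2 + x\<^sup>2)" for x :: real
    have h: "R - r > 0" using r R by simp
    have dpos: "(R - r)\<^sup>2 + x\<^sup>2 > 0" for x using h by (intro add_pos_nonneg) auto
    have cK: "continuous_on A K" for A unfolding K_def using dpos by (intro continuous_intros) (auto simp: less_le)
    have K0: "K x \<ge> 0" for x unfolding K_def using h dpos[of x] by simp
    \<comment> \<open>The rotation puts the point at \<open>- r\<close>, so the peak of the Poisson
      kernel sits at the angle \<open>pi\<close>, in the middle of
      \<open>{0..2 * pi}\<close>.\<close>
    define f where "f w = (g (w * cis (t - pi)))\<^sup>2" for w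
    have fh: "f holomorphic_on ball 0 1"
      unfolding f_def by (intro holomorphic_intros holomorphic_on_compose_gen[OF _ hol, unfolded o_def]) (auto simp: norm_mult)
    have fc: "continuous_on (cball 0 R) f"
      by (rule continuous_on_subset[OF holomorphic_on_imp_continuous_on[OF fh]]) (use R in auto)
    have fh': "f holomorphic_on ball 0 R" by (rule holomorphic_on_subset[OF fh]) (use R in auto)
    have zR: "cmod (- of_real r) < R" using r R by simp
    have fz: "cmod (f (- of_real r)) = (cmod (g (of_real r * cis t)))\<^sup>2"
    proof -
      have "- of_real r * cis (t - pi) = of_real r * cis t" by (simp add: cis.code sin_diff cos_diff complex_eq_iff)
      then show ?thesis by (simp add: f_def norm_power)
    qed
    have c1: "continuous_on (sphere 0 R) (\<lambda>w. of_real (poisson R (- of_real r) w) * f w)"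
      by (intro continuous_intros poisson_continuous[OF zR] continuous_on_subset[OF fc]) auto
    have "cmod (f (- of_real r)) \<le> cmean R (\<lambda>w. cmod (of_real (poisson R (- of_real r) w) * f w))"
      using norm_cmean_le[OF c1] poisson_formula[OF fh' fc zR] R by simp
    also have "\<dots> = cmean R (\<lambda>w. poisson R (- of_real r) w * cmod (f w))"
      using poisson_bounds(1)[OF zR] R by (intro cmean_cong) (auto simp: norm_mult less_imp_le)
    also have "\<dots> = (1 / (2 * pi)) * integral {0..2 * pi} (\<lambda>u. poisson R (- of_real r) (of_real R * cis u) * G (u + (t - pi)))"
      unfolding cmean_def f_def G_def by (simp add: norm_power cis_mult mult.assoc)
    also have "integral {0..2 * pi} (\<lambda>u. poisson R (- of_real r) (of_real R * cis u) * G (u + (t - pi)))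
       \<le> integral {0..2 * pi} (\<lambda>u. 32 * K (u - pi) * G (u + (t - pi)))"
    proof (rule integral_le)
      show "(\<lambda>u. poisson R (- of_real r) (of_real R * cis u) * G (u + (t - pi))) integrable_on {0..2 * pi}"
        using R by (intro integrable_continuous_real continuous_intros continuous_on_circle poisson_continuous[OF zR]
            continuous_on_compose2[OF cG[of UNIV]]) auto
      show "(\<lambda>u. 32 * K (u - pi) * G (u + (t - pi))) integrable_on {0..2 * pi}"
        by (intro integrable_continuous_real continuous_intros continuous_on_compose2[OF cG[of UNIV]] continuous_on_compose2[OF cK[of UNIV]]) auto
      fix u assume u: "u \<in> {0..2 * pi}"
      have "cmod (of_real R * cis u - - of_real r) = cmod (of_real R * cis (u - pi) - of_real r)"
      proof -
        have "of_real R * cis u - - of_real r = - (of_real R * cis (u - pi) - of_real r)"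
          by (simp add: complex_eq_iff sin_diff cos_diff)
        then show ?thesis by (simp only: norm_minus_cancel)
      qed
      then have "poisson R (- of_real r) (of_real R * cis u) \<le> 32 * K (u - pi)"
        using poisson_kernel_le[of r R "u - pi"] r R u unfolding poisson_def K_def by (simp add: abs_le_iff)
      then show "poisson R (- of_real r) (of_real R * cis u) * G (u + (t - pi)) \<le> 32 * K (u - pi) * G (u + (t - pi))"
        by (rule mult_right_mono[OF _ G0])
    qed
    also have "integral {0..2 * pi} (\<lambda>u. 32 * K (u - pi) * G (u + (t - pi))) = 32 * integral {t - pi..t + pi} (\<lambda>x. K (x - t) * G x)"
    proof -
      define H where "H x = K (x - t) * G x" for x
      have "(H has_integral integral {t - pi..t + pi} H) {t - pi..t + pi}"
        unfolding H_def by (intro integrable_integral integrable_continuous_real continuous_intros cG continuous_on_compose2[OF cK[of UNIV]]) auto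
      from has_integral_shift_real_ivl[OF this, of "t - pi"]
      have "((\<lambda>u. H (u + (t - pi))) has_integral integral {t - pi..t + pi} H) {0..2 * pi}" by simp
      from has_integral_mult_right[OF this, of 32] show ?thesis unfolding H_def by (intro integral_unique) (simp add: mult.assoc)
    qed
    finally have key: "l < (16 / pi) * integral {t - pi..t + pi} (\<lambda>x. K (x - t) * G x)"
      using r(3) unfolding fz by (simp add: divide_right_mono)
    show "\<exists>s>0. emeasure \<nu> (ball t s) > ennreal (pi * l / 128 * s)"
    proof (rule ccontr)
      assume "\<not> ?thesis"
      then have "\<And>s. s > 0 \<Longrightarrow> emeasure \<nu> (ball t s) \<le> ennreal (pi * l / 128 * s)" using not_less by blast
      from nn_integral_poisson_kernel_le[OF sets h _ this]
      have up: "(\<integral>\<^sup>+x. ennreal (K (x - t)) \<partial>\<nu>) \<le> ennreal (pi * l / 16)" using l by (simp add: K_def)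
      have Kb [measurable]: "(\<lambda>x. K (x - t)) \<in> borel_measurable borel" unfolding K_def by measurable
      have "ennreal (integral {t - pi..t + pi} (\<lambda>x. K (x - t) * G x)) = (\<integral>\<^sup>+x. ennreal (indicator {t - pi..t + pi} x * (K (x - t) * G x)) \<partial>lborel)"
      proof (rule nn_integral_has_integral_lebesgue[symmetric])
        show "((\<lambda>x. K (x - t) * G x) has_integral integral {t - pi..t + pi} (\<lambda>x. K (x - t) * G x)) {t - pi..t + pi}"
          by (intro integrable_integral integrable_continuous_real continuous_intros cG continuous_on_compose2[OF cK[of UNIV]]) auto
      qed (use K0 G0 in auto)
      also have "\<dots> \<le> (\<integral>\<^sup>+x. indicator {- 2 * pi..4 * pi} x * ennreal (G x) * ennreal (K (x - t)) \<partial>lborel)"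
        using t2 K0 G0 by (intro nn_integral_mono) (auto simp: ennreal_mult[symmetric] mult.commute split: split_indicator)
      also have "\<dots> = (\<integral>\<^sup>+x. ennreal (K (x - t)) \<partial>\<nu>)" unfolding \<nu>_def by (subst nn_integral_density) auto
      also note up
      finally have "integral {t - pi..t + pi} (\<lambda>x. K (x - t) * G x) \<le> pi * l / 16" using l by (simp add: ennreal_le_iff)
      then have "(16 / pi) * integral {t - pi..t + pi} (\<lambda>x. K (x - t) * G x) \<le> (16 / pi) * (pi * l / 16)" by (intro mult_left_mono) auto
      then show False using key by simp
    qed
  qed (use l \<epsilon> in auto)
  then show ?thesis by simp
qed

text \<open>The set is a union of open sets over all radii, hence open and measurable although the
  union is uncountable; it is the increasing limit of the sets belonging to
  \<open>\<rho> < 1\<close>.\<close>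

lemma radial_maximal_bound:
  fixes g :: "complex \<Rightarrow> complex"
  assumes hol: "g holomorphic_on ball 0 1" and mean: "\<And>r. 0 < r \<Longrightarrow> r < 1 \<Longrightarrow> cmean r (\<lambda>z. (cmod (g z))\<^sup>2) \<le> \<epsilon>"
    and l: "l > 0" and \<epsilon>: "\<epsilon> \<ge> 0"
  defines "E \<equiv> {t \<in> {0<..<2 * pi}. \<exists>r\<in>{1 / 2<..<1}. l < (cmod (g (of_real r * cis t)))\<^sup>2}"
  shows "E \<in> sets lborel" "emeasure lborel E \<le> ennreal (7680 * \<epsilon> / l)"
proof -
  define F where "F \<rho> = {t \<in> {0<..<2 * pi}. \<exists>r\<in>{1 / 2<..<\<rho>}. l < (cmod (g (of_real r * cis t)))\<^sup>2}" for \<rho> :: real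
  have cont: "continuous_on (ball 0 1) g" using hol by (rule holomorphic_on_imp_continuous_on)
  have op: "open (F \<rho>)" if "\<rho> \<le> 1" for \<rho>
  proof -
    have eq: "F \<rho> = {0<..<2 * pi} \<inter> (\<Union>r\<in>{1 / 2<..<\<rho>}. {t. l < (cmod (g (of_real r * cis t)))\<^sup>2})" unfolding F_def by blast
    have "open {t. l < (cmod (g (of_real r * cis t)))\<^sup>2}" if "r \<in> {1 / 2<..<\<rho>}" for r
      using that \<open>\<rho> \<le> 1\<close> by (intro open_Collect_less continuous_intros continuous_on_compose2[OF cont]) (auto simp: norm_mult)
    then show ?thesis unfolding eq by (intro open_Int open_UN) auto
  qed
  have EF: "E = F 1" by (simp add: E_def F_def)
  show "E \<in> sets lborel" using op[of 1] by (simp add: EF)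
  define \<rho> where "\<rho> n = 1 - 1 / (real n + 1)" for n :: nat
  have \<rho>: "\<rho> n < 1" "\<rho> n \<le> \<rho> (Suc n)" for n by (auto simp: \<rho>_def field_simps)
  have inc: "incseq (\<lambda>n. F (\<rho> n))"
  proof (rule incseq_SucI)
    fix n show "F (\<rho> n) \<subseteq> F (\<rho> (Suc n))" using \<rho>(2)[of n] unfolding F_def by fastforce
  qed
  have un: "F 1 = (\<Union>n. F (\<rho> n))"
  proof
    have "F (\<rho> n) \<subseteq> F 1" for n using \<rho>(1)[of n] unfolding F_def by fastforce
    then show "(\<Union>n. F (\<rho> n)) \<subseteq> F 1" by blast
    show "F 1 \<subseteq> (\<Union>n. F (\<rho> n))"
    proof
      fix t assume "t \<in> F 1"
      then obtain r where r: "1 / 2 < r" "r < 1" "l < (cmod (g (of_real r * cis t)))\<^sup>2" and t: "t \<in> {0<..<2 * pi}" unfolding F_def by auto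
      have "\<rho> \<longlonglongrightarrow> 1" unfolding \<rho>_def by real_asymp
      from order_tendstoD(1)[OF this r(2)] obtain n where "r < \<rho> n" unfolding eventually_sequentially by blast
      then have "t \<in> F (\<rho> n)" unfolding F_def using r t by auto
      then show "t \<in> (\<Union>n. F (\<rho> n))" by blast
    qed
  qed
  have rng: "range (\<lambda>n. F (\<rho> n)) \<subseteq> sets lborel" using op \<rho>(1) by (auto simp: less_imp_le)
  have "emeasure lborel E = (SUP n. emeasure lborel (F (\<rho> n)))"
    unfolding EF un by (rule SUP_emeasure_incseq[OF rng inc, symmetric])
  also have "\<dots> \<le> ennreal (7680 * \<epsilon> / l)"
  proof (rule SUP_least)
    fix n
    have o: "open (F (\<rho> n))" using op \<rho>(1)[of n] by simp
    show "emeasure lborel (F (\<rho> n)) \<le> ennreal (7680 * \<epsilon> / l)"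
    proof (rule radial_maximal_bound_aux[OF hol mean l \<rho>(1)[of n] \<epsilon>])
      show "F (\<rho> n) \<in> sets borel" using o by simp
      show "F (\<rho> n) \<subseteq> {0..2 * pi}" by (auto simp: F_def)
      fix t assume "t \<in> F (\<rho> n)"
      then obtain r where "1 / 2 < r" "r < \<rho> n" "l < (cmod (g (of_real r * cis t)))\<^sup>2" unfolding F_def by auto
      then show "\<exists>r. 1 / 2 \<le> r \<and> r \<le> \<rho> n \<and> l < (cmod (g (of_real r * cis t)))\<^sup>2" by (intro exI[of _ r]) simp
    qed
  qed
  finally show "emeasure lborel E \<le> ennreal (7680 * \<epsilon> / l)" .
qed

text \<open>The limit is a cluster point of the approximating values \<open>p n\<close> on the
  compact circle.\<close>

lemma limit_of_unimodular_approx: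
  fixes f :: "real \<Rightarrow> complex"
  assumes "\<And>e. e > 0 \<Longrightarrow> \<exists>p. cmod p = 1 \<and> eventually (\<lambda>r. cmod (f r - p) \<le> e) F"
  shows "\<exists>L. cmod L = 1 \<and> (f \<longlongrightarrow> L) F"
proof -
  have "\<forall>n::nat. \<exists>p. cmod p = 1 \<and> eventually (\<lambda>r. cmod (f r - p) \<le> 1 / (real n + 1)) F" using assms by simp
  from choice[OF this] obtain p where p: "\<And>n::nat. cmod (p n) = 1" "\<And>n::nat. eventually (\<lambda>r. cmod (f r - p n) \<le> 1 / (real n + 1)) F" by blast
  have "\<forall>n. p n \<in> sphere 0 1" using p(1) by simp
  then obtain L s where L: "L \<in> sphere 0 1" and s: "strict_mono (s :: nat \<Rightarrow> nat)" and lim: "(p \<circ> s) \<longlonglongrightarrow> L"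
    using compact_sphere[of "0::complex" 1] unfolding compact_def by blast
  have "(f \<longlongrightarrow> L) F"
  proof (rule tendstoI)
    fix e :: real assume e: "e > 0"
    have "(\<lambda>n. 1 / (real n + 1)) \<longlonglongrightarrow> 0" by real_asymp
    from LIMSEQ_subseq_LIMSEQ[OF this s] have "eventually (\<lambda>n. 1 / (real (s n) + 1) < e / 2) sequentially"
      unfolding o_def by (rule order_tendstoD) (use e in simp)
    moreover have "eventually (\<lambda>n. dist ((p \<circ> s) n) L < e / 2) sequentially" using tendstoD[OF lim, of "e / 2"] e by linarith
    ultimately have "eventually (\<lambda>n. 1 / (real (s n) + 1) < e / 2 \<and> dist (p (s n)) L < e / 2) sequentially"
      by eventually_elim simp
    then obtain n where n: "1 / (real (s n) + 1) < e / 2" "dist (p (s n)) L < e / 2"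
      unfolding eventually_sequentially by blast
    show "eventually (\<lambda>r. dist (f r) L < e) F"
      using p(2)[of "s n"]
    proof eventually_elim
      case (elim r)
      then have "dist (f r) (p (s n)) < e / 2" using n(1) by (simp add: dist_norm)
      then show ?case using n(2) dist_triangle_half_l[of "f r" "p (s n)" e L] by (simp add: dist_commute)
    qed
  qed
  then show ?thesis using L by auto
qed

text \<open>The factors take the values \<open>|a j|\<close> at 0, so Weierstrass' inequality for
  products and the Blaschke condition give convergence of \<open>T N 0\<close> to 1. This single
  value controls the tail in mean square on every circle.\<close>

lemma blaschke_product_tail:
  assumes "blaschke_product J a B"
  obtains c T where "cmod c = 1" "\<And>N::nat. T N holomorphic_on ball 0 1" "\<And>N z. cmod z < 1 \<Longrightarrow> cmod (T N z) \<le> 1"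
    "\<And>N z. cmod z < 1 \<Longrightarrow> B z = c * blaschke_part J a N z * T N z" "(\<lambda>N. T N 0) \<longlonglongrightarrow> 1"
proof -
  obtain c where c: "cmod c = 1" "\<And>z. cmod z < 1 \<Longrightarrow> (\<lambda>n. c * blaschke_part J a n z) \<longlonglongrightarrow> B z" and aJ: "a ` J \<subseteq> ball 0 1"
    by (rule blaschke_productE[OF assms]) (rule that; blast)
  have seq: "blaschke_sequence J a" using assms unfolding blaschke_product_def by blast
  define T where "T N z = (\<Prod>j. if j \<in> J - {..<N} then blaschke_factor (a j) z else 1)" for N :: nat and z
  have seqN: "blaschke_sequence (J - {..<N}) a" for N
    using seq summable_on_subset_banach[of "\<lambda>j. 1 - cmod (a j)" J "J - {..<N}"] unfolding blaschke_sequence_def by auto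
  have hp: "(\<lambda>j. if j \<in> J - {..<N} then blaschke_factor (a j) z else 1) has_prod T N z" if "cmod z < 1" for N z
    unfolding T_def using blaschke_has_prod[OF seqN that] .
  have prodN: "blaschke_product (J - {..<N}) a (T N)" for N
    unfolding blaschke_product_def
  proof (rule conjI[OF seqN], rule exI[of _ 1], intro conjI ballI)
    fix z :: complex assume "z \<in> ball 0 1"
    then show "\<exists>p. (\<lambda>j. if j \<in> J - {..<N} then blaschke_factor (a j) z else 1) has_prod p \<and> T N z = 1 * p"
      using hp[of z N] by (intro exI[of _ "T N z"]) simp
  qed simp
  have limN: "(\<lambda>n. blaschke_part (J - {..<N}) a n z) \<longlonglongrightarrow> T N z" if "cmod z < 1" for N z
    using has_prod_imp_tendsto'[OF hp[OF that, of N]] unfolding blaschke_part_def .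
  have split: "blaschke_part J a n z = blaschke_part J a N z * blaschke_part (J - {..<N}) a n z" if "n \<ge> N" for n N z
  proof -
    have "blaschke_part J a N z = (\<Prod>j<n. if j < N then (if j \<in> J then blaschke_factor (a j) z else 1) else 1)"
      unfolding blaschke_part_def using that by (intro prod.mono_neutral_cong_left) auto
    then show ?thesis unfolding blaschke_part_def by (simp only: prod.distrib[symmetric]) (auto intro!: prod.cong)
  qed
  have eq: "B z = c * blaschke_part J a N z * T N z" if z: "cmod z < 1" for N z
  proof (rule LIMSEQ_unique[OF c(2)[OF z]])
    have "(\<lambda>n. c * blaschke_part J a N z * blaschke_part (J - {..<N}) a n z) \<longlonglongrightarrow> c * blaschke_part J a N z * T N z"
      by (intro tendsto_intros limN z)
    then show "(\<lambda>n. c * blaschke_part J a n z) \<longlonglongrightarrow> c * blaschke_part J a N z * T N z"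
      by (rule Lim_transform_eventually) (use eventually_ge_at_top[of N] in eventually_elim, simp add: split mult.assoc)
  qed
  define s where "s j = (if j \<in> J then 1 - cmod (a j) else 0)" for j
  have s01: "s j \<in> {0..1}" for j using aJ by (force simp: s_def)
  have "s summable_on UNIV"
    using seq summable_on_cong_neutral[of UNIV J s "\<lambda>j. 1 - cmod (a j)"] unfolding blaschke_sequence_def by (auto simp: s_def)
  then have sums: "summable s" by (rule summable_on_imp_summable)
  have "(\<lambda>N. T N 0) \<longlonglongrightarrow> 1"
  proof (rule LIMSEQ_I)
    fix e :: real assume e: "e > 0"
    then obtain N0 where N0: "\<And>m n. m \<ge> N0 \<Longrightarrow> norm (sum s {m..<n}) < e / 2"
      using sums unfolding summable_Cauchy by (meson half_gt_zero)
    have "norm (T N 0 - 1) < e" if N: "N \<ge> N0" for N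
    proof -
      have b: "cmod (blaschke_part (J - {..<N}) a n 0 - 1) \<le> e / 2" for n
      proof -
        define x where "x = (\<Prod>j\<in>{..<n} - {..<N}. 1 - s j)"
        have "blaschke_part (J - {..<N}) a n 0 = (\<Prod>j\<in>{..<n} - {..<N}. of_real (1 - s j))"
          unfolding blaschke_part_def
          by (rule prod.mono_neutral_cong_right) (auto simp: s_def blaschke_factor_def disc_aut_def)
        then have bx: "blaschke_part (J - {..<N}) a n 0 = of_real x" by (simp add: x_def)
        have "x \<le> 1" unfolding x_def using s01 by (intro prod_le_1) auto
        moreover have "1 - sum s ({..<n} - {..<N}) \<le> x" unfolding x_def using s01 by (intro Weierstrass_prod_ineq) auto
        moreover have "{..<n} - {..<N} = {N..<n}" by auto
        moreover have "sum s {N..<n} < e / 2" using N0[OF N, of n] by simp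
        ultimately have "\<bar>x - 1\<bar> \<le> e / 2" by simp
        then show ?thesis unfolding bx using norm_of_real[of "x - 1", where 'a = complex] by simp
      qed
      have "(\<lambda>n. cmod (blaschke_part (J - {..<N}) a n 0 - 1)) \<longlonglongrightarrow> cmod (T N 0 - 1)"
        by (intro tendsto_intros limN) simp
      then have "cmod (T N 0 - 1) \<le> e / 2" by (rule LIMSEQ_le_const2) (use b in auto)
      then show ?thesis using e by simp
    qed
    then show "\<exists>N0. \<forall>N\<ge>N0. norm (T N 0 - 1) < e" by blast
  qed
  with c(1) blaschke_product_holomorphic[OF prodN] blaschke_product_le_part(2)[OF prodN] eq show thesis by (intro that[of c T]) auto
qed

text \<open>The tails of the product tend to 1 in mean square, hence, by the maximal estimate and along a
  suitable sequence, uniformly on almost every radius.\<close>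

theorem blaschke_product_imp_inner_function:
  assumes B: "blaschke_product J a B"
  shows "inner_function B"
proof -
  obtain c T where c: "cmod c = 1" and T: "\<And>N::nat. T N holomorphic_on ball 0 1" "\<And>N z. cmod z < 1 \<Longrightarrow> cmod (T N z) \<le> 1"
    and fac: "\<And>N z. cmod z < 1 \<Longrightarrow> B z = c * blaschke_part J a N z * T N z" and T0: "(\<lambda>N. T N 0) \<longlonglongrightarrow> 1"
    by (rule blaschke_product_tail[OF B]) (rule that)
  have aJ: "a ` J \<subseteq> ball 0 1" using B unfolding blaschke_product_def blaschke_sequence_def by blast
  \<comment> \<open>\<open>|T - 1|^2 \<le> 2 * (1 - Re T)\<close> since \<open>|T| \<le> 1\<close>,
    and the circle mean of the harmonic right side is its value at 0.\<close>
  define \<epsilon> where "\<epsilon> N = 2 * (1 - Re (T N 0))" for N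
  have \<epsilon>0: "\<epsilon> N \<ge> 0" for N using complex_Re_le_cmod[of "T N 0"] T(2)[of 0 N] by (simp add: \<epsilon>_def)
  have mean: "cmean r (\<lambda>z. (cmod (T N z - 1))\<^sup>2) \<le> \<epsilon> N" if r: "0 < r" "r < 1" for N r
  proof -
    have cT: "continuous_on (cball 0 r) (T N)"
      by (rule continuous_on_subset[OF holomorphic_on_imp_continuous_on[OF T(1)]]) (use r in auto)
    have cT': "continuous_on (sphere 0 r) (T N)" by (rule continuous_on_subset[OF cT]) auto
    have hT: "T N holomorphic_on ball 0 r" by (rule holomorphic_on_subset[OF T(1)]) (use r in auto)
    have "cmean r (\<lambda>z. (cmod (T N z - 1))\<^sup>2) \<le> cmean r (\<lambda>z. 2 * (1 - Re (T N z)))"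
    proof (rule cmean_mono)
      fix z assume z: "cmod z = r"
      have "(cmod (T N z - 1))\<^sup>2 = (cmod (T N z))\<^sup>2 - 2 * Re (T N z) + 1"
        unfolding cmod_power2 by (simp add: power2_eq_square algebra_simps)
      also have "(cmod (T N z))\<^sup>2 \<le> 1" using T(2)[of z N] z r by (simp add: power_le_one)
      finally show "(cmod (T N z - 1))\<^sup>2 \<le> 2 * (1 - Re (T N z))" by simp
    qed (use r cT' in \<open>auto intro!: continuous_intros\<close>)
    also have "\<dots> = 2 * (1 - Re (T N 0))"
    proof -
      have "cmean r (\<lambda>z. 2 * (1 - Re (T N z))) = 2 * (cmean r (\<lambda>z. 1) - cmean r (\<lambda>z. Re (T N z)))"
        unfolding cmean_mult_right using r cT' by (subst cmean_diff) (auto intro!: continuous_intros)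
      then show ?thesis using cmean_Re[OF cT'] cmean_holomorphic[OF cT hT] r by (simp add: cmean_const)
    qed
    finally show ?thesis by (simp add: \<epsilon>_def)
  qed
  define E where "E N k = {t \<in> {0<..<2 * pi}. \<exists>r\<in>{1 / 2<..<1}. (1 / (real k + 1))\<^sup>2 < (cmod (T N (of_real r * cis t) - 1))\<^sup>2}" for N k :: nat
  have E: "E N k \<in> sets lborel" "emeasure lborel (E N k) \<le> ennreal (7680 * \<epsilon> N / (1 / (real k + 1))\<^sup>2)" for N k
    unfolding E_def
    by (rule radial_maximal_bound[of "\<lambda>z. T N z - 1", OF _ mean _ \<epsilon>0]; (intro holomorphic_intros T(1))?; simp)+
  \<comment> \<open>For a given accuracy one good \<open>N\<close> is enough, so the exceptional set
    is an intersection over \<open>N\<close>, and its measure lies below bounds that tend to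
    0.\<close>
  have null: "(\<Inter>N. E N k) \<in> null_sets lborel" for k
  proof (rule null_setsI)
    have m: "(\<Inter>N. E N k) \<in> sets lborel" using E(1) by (intro sets.countable_INT) auto
    then show "(\<Inter>N. E N k) \<in> sets lborel" .
    have le: "emeasure lborel (\<Inter>N. E N k) \<le> ennreal (7680 * \<epsilon> N / (1 / (real k + 1))\<^sup>2)" for N
      by (rule order_trans[OF emeasure_mono E(2)[of N k]]) (use E(1) in auto)
    have "(\<lambda>N. 7680 * \<epsilon> N / (1 / (real k + 1))\<^sup>2) \<longlonglongrightarrow> 7680 * (2 * (1 - Re 1)) / (1 / (real k + 1))\<^sup>2"
      unfolding \<epsilon>_def by (intro tendsto_intros T0) auto
    then have "(\<lambda>N. ennreal (7680 * \<epsilon> N / (1 / (real k + 1))\<^sup>2)) \<longlonglongrightarrow> ennreal 0" by (intro tendsto_ennrealI) simp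
    then have "emeasure lborel (\<Inter>N. E N k) \<le> ennreal 0" by (rule LIMSEQ_le_const) (use le in auto)
    then show "emeasure lborel (\<Inter>N. E N k) = 0" by simp
  qed
  define Z where "Z = (\<Union>k. \<Inter>N. E N k) \<union> {0, 2 * pi}"
  have "(\<Union>k. \<Inter>N. E N k) \<in> null_sets lborel" by (intro null_sets_UN null)
  moreover have "{0, 2 * pi} \<in> null_sets lborel" by (rule countable_imp_null_set_lborel) auto
  ultimately have Z: "Z \<in> null_sets lborel" unfolding Z_def by (rule null_sets.Un)
  have good: "\<exists>L. cmod L = 1 \<and> ((\<lambda>r. B (of_real r * cis t)) \<longlongrightarrow> L) (at_left 1)" if t: "t \<in> {0..2 * pi}" "t \<notin> Z" for t
  proof (rule limit_of_unimodular_approx)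
    fix e :: real assume e: "e > 0"
    obtain k where k: "1 / (real k + 1) < e / 2"
      using reals_Archimedean[of "e / 2"] e by (auto simp: inverse_eq_divide add.commute)
    have "t \<in> {0<..<2 * pi}" using t unfolding Z_def by auto
    obtain N where "t \<notin> E N k" using t(2) unfolding Z_def by blast
    have small: "cmod (T N (of_real r * cis t) - 1) \<le> 1 / (real k + 1)" if "1 / 2 < r" "r < 1" for r
    proof -
      have "\<not> (1 / (real k + 1))\<^sup>2 < (cmod (T N (of_real r * cis t) - 1))\<^sup>2"
        using that \<open>t \<in> {0<..<2 * pi}\<close> \<open>t \<notin> E N k\<close> unfolding E_def by auto
      then have "(cmod (T N (of_real r * cis t) - 1))\<^sup>2 \<le> (1 / (real k + 1))\<^sup>2" by (simp only: not_less)
      then show ?thesis by (rule power2_le_imp_le) simp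
    qed
    define P where "P r = blaschke_part J a N (of_real r * cis t)" for r
    have "(P \<longlongrightarrow> P 1) (at_left 1)"
      unfolding P_def blaschke_part_def
    proof (intro tendsto_prod)
      fix j assume "j \<in> {..<N}"
      have "((\<lambda>r. blaschke_factor (a j) (of_real r * cis t)) \<longlongrightarrow> blaschke_factor (a j) (of_real 1 * cis t)) (at_left 1)" if j: "j \<in> J"
      proof -
        have "1 - cnj (a j) * (of_real 1 * cis t) \<noteq> 0" using one_minus_cnj_mult_nonzero[of "a j" "of_real 1 * cis t"] aJ j by auto
        then show ?thesis unfolding blaschke_factor_def disc_aut_def by (cases "a j = 0") (auto intro!: tendsto_eq_intros)
      qed
      then show "((\<lambda>r. if j \<in> J then blaschke_factor (a j) (of_real r * cis t) else 1) \<longlongrightarrow>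
          (if j \<in> J then blaschke_factor (a j) (of_real 1 * cis t) else 1)) (at_left 1)" by auto
    qed
    then have ev: "eventually (\<lambda>r. dist (P r) (P 1) < e / 2) (at_left 1)" by (rule tendstoD) (use e in simp)
    have P1: "cmod (P 1) = 1"
      unfolding P_def cmod_blaschke_part using aJ by (intro prod.neutral) (auto intro!: cmod_disc_aut_eq_1)
    have "eventually (\<lambda>r. r \<in> {1 / 2<..<1}) (at_left (1::real))" by (rule eventually_at_leftI[of "1 / 2"]) auto
    with ev have "eventually (\<lambda>r. cmod (B (of_real r * cis t) - c * P 1) \<le> e) (at_left 1)"
    proof eventually_elim
      case (elim r)
      then have r: "1 / 2 < r" "r < 1" by auto
      define z where "z = of_real r * cis t"
      have z: "cmod z < 1" using r by (simp add: z_def norm_mult)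
      have "B z - c * P 1 = c * (P r * (T N z - 1) + (P r - P 1))"
        unfolding fac[OF z, of N] P_def z_def[symmetric] by (simp add: algebra_simps)
      then have "cmod (B z - c * P 1) = cmod (P r * (T N z - 1) + (P r - P 1))" using c by (simp add: norm_mult)
      also have "\<dots> \<le> cmod (P r) * cmod (T N z - 1) + cmod (P r - P 1)"
        using norm_triangle_ineq[of "P r * (T N z - 1)" "P r - P 1"] by (simp add: norm_mult)
      also have "\<dots> \<le> 1 * (1 / (real k + 1)) + e / 2"
        using small[OF r] cmod_blaschke_part_le_1[OF aJ, of z N] z elim(1)
        by (intro add_mono mult_mono) (auto simp: P_def z_def dist_norm)
      finally show ?case using k by (simp add: z_def)
    qed
    moreover have "cmod (c * P 1) = 1" using c P1 by (simp add: norm_mult)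
    ultimately show "\<exists>p. cmod p = 1 \<and> eventually (\<lambda>r. cmod (B (of_real r * cis t) - p) \<le> e) (at_left 1)" by blast
  qed
  have "AE t in lborel. t \<in> {0..2 * pi} \<longrightarrow> (\<exists>L. cmod L = 1 \<and> ((\<lambda>r. B (of_real r * cis t)) \<longlongrightarrow> L) (at_left 1))"
    by (rule AE_I'[OF Z]) (use good in auto)
  then have "AE t in lebesgue. t \<in> {0..2 * pi} \<longrightarrow> (\<exists>L. cmod L = 1 \<and> ((\<lambda>r. B (of_real r * cis t)) \<longlongrightarrow> L) (at_left 1))"
    by (rule AE_completion)
  then have "AE t in lebesgue_on {0..2 * pi}. \<exists>L. cmod L = 1 \<and> ((\<lambda>r. B (of_real r * cis t)) \<longlongrightarrow> L) (at_left 1)"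
    by (subst AE_restrict_space_iff) auto
  then show ?thesis unfolding inner_function_def using HinfI[OF blaschke_product_holomorphic[OF B] blaschke_product_le_part(2)[OF B]] by blast
qed

section \<open>The classes M and P\<close>

lemma inner_function_le_1:
  assumes "inner_function \<Theta>"
  shows "\<Theta> holomorphic_on ball 0 1" "cmod z < 1 \<Longrightarrow> cmod (\<Theta> z) \<le> 1"
  using inner_function_imp_inner_mean[OF assms] unfolding inner_mean_def by blast+

lemma class_M_imp_SIP:
  assumes M: "\<Theta> \<in> class_M" and low: "\<exists>c>0. \<forall>z. far_from_zeros \<Theta> (1 / 2) z \<longrightarrow> cmod (\<Theta> z) \<ge> c"
  shows "SIP \<Theta>"
proof -
  have inner: "inner_function \<Theta>" and CN: "\<And>a. cmod a < 1 \<Longrightarrow> a \<noteq> 0 \<Longrightarrow> disc_aut a \<circ> \<Theta> \<in> CN"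
    using M unfolding class_M_def by auto
  obtain c where c: "c > 0" "\<And>z. far_from_zeros \<Theta> (1 / 2) z \<Longrightarrow> cmod (\<Theta> z) \<ge> c" using low by blast
  note le = inner_function_le_1[OF inner]
  have "unimodular_far \<Theta>" by (rule M_imp_unimodular_far[OF le CN _ c]) auto
  then show ?thesis by (intro unimodular_far_imp_SIP le CN)
qed

lemma SIP_imp_class_M:
  assumes "inner_function \<Theta>" "SIP \<Theta>" shows "\<Theta> \<in> class_M"
  using unimodular_far_imp_M[OF inner_function_imp_inner_mean[OF assms(1)] SIP_imp_unimodular_far[OF assms]] assms(1)
  unfolding class_M_def by auto

lemma CN_lower_bound:
  assumes "B \<in> CN"
  shows "\<exists>c>0. \<forall>z. far_from_zeros B (1 / 2) z \<longrightarrow> cmod (B z) \<ge> c"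
proof -
  obtain J a where B: "blaschke_product J a B" and car: "carleson_measure (zeros_measure J a)"
    using assms unfolding CN_def by blast
  have seq: "blaschke_sequence J a" using B unfolding blaschke_product_def by blast
  obtain K where K: "prox_bounded J a K" by (rule carleson_imp_prox_bounded[OF seq car])
  have zero: "a j \<in> zero_set B" if "j \<in> J" for j
  proof (rule blaschke_productE[OF B])
    assume z: "\<And>z. cmod z < 1 \<Longrightarrow> B z = 0 \<longleftrightarrow> (\<exists>j\<in>J. z = a j)" and aJ: "a ` J \<subseteq> ball 0 1"
    have "cmod (a j) < 1" using aJ that by auto
    then show ?thesis using z[of "a j"] that by (auto simp: zero_set_def)
  qed
  have "cmod (B z) \<ge> exp (- K / (2 * (1 / 2)\<^sup>2))" if "far_from_zeros B (1 / 2) z" for z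
    using that zero unfolding far_from_zeros_def by (intro blaschke_product_lower_bound[OF B K]) auto
  then show ?thesis by (intro exI[of _ "exp (- K / (2 * (1 / 2)\<^sup>2))"]) auto
qed

theorem corollary1p6:
  shows "class_P \<subseteq> {\<Theta>. inner_function \<Theta> \<and> SIP \<Theta>}
       \<and> {\<Theta>. inner_function \<Theta> \<and> SIP \<Theta>} \<subseteq> class_M
       \<and> (\<forall>\<Theta>. inner_function \<Theta> \<and> WEP \<Theta> \<longrightarrow> (\<Theta> \<in> class_M \<longleftrightarrow> SIP \<Theta>))
       \<and> class_P = {\<Theta> \<in> CN. SIP \<Theta>}"
proof -
  have P_SIP: "SIP \<Theta>" if "\<Theta> \<in> class_P" for \<Theta>
    using that CN_lower_bound class_M_imp_SIP unfolding class_P_def by blast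
  have M_inner: "inner_function \<Theta>" if "\<Theta> \<in> class_M" for \<Theta>
    using that unfolding class_M_def by blast
  \<comment> \<open>Membership in \<open>CN\<close> does not mention radial limits; this step is
    what places a function of \<open>CN\<close> with SIP in \<open>class_M\<close>.\<close>
  have CN_inner: "inner_function \<Theta>" if "\<Theta> \<in> CN" for \<Theta>
    using that blaschke_product_imp_inner_function unfolding CN_def by blast
  have WEP_SIP: "SIP \<Theta>" if "inner_function \<Theta>" "WEP \<Theta>" "\<Theta> \<in> class_M" for \<Theta>
    using that class_M_imp_SIP WEP_imp_lower_bound unfolding inner_function_def by blast
  show ?thesis
    using P_SIP M_inner CN_inner WEP_SIP SIP_imp_class_M unfolding class_P_def by blast
qed


end
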